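(* There exists no domain in $\mathbb{C}$ whose Bergman metric has constant positive holomorphic sectional curvature. Moreover, there exists no Bergman nondegenerate Riemann surface whose Bergman metric has constant positive holomorphic sectional curvature.
   Context: Complex manifolds (in particular Riemann surfaces) are assumed connected; a domain is a nonempty connected open set. For an $n$-dimensional complex manifold $M$ (here $n=1$), $A^2_{(n,0)}(M)$ is the Hilbert space of holomorphic $(n,0)$-forms $f$ with $|\int_M f\wedge\overline f|<\infty$, with inner product $\langle f,g\rangle=(\sqrt{-1})^{n^2}\int_M f\wedge\overline g$. For an orthonormal basis $\{\phi_k\}$, the Bergman kernel is $K_M=\sum_k\phi_k\wedge\overline{\phi_k}$, written in local coordinates as $\widetilde K_M(z,w)\,dz_1\wedge\cdots\wedge dz_n\wedge d\bar w_1\wedge\cdots\wedge d\bar w_n$. The Bergman space is (i) base point free if for every $\xi\in M$ there is $f\in A^2_{(n,0)}(M)$ with $f(\xi)\ne0$; (ii) separates holomorphic directions if for every $\xi\in M$ and nonzero $Z\in T^{1,0}_\xi M$ there is $f\in A^2_{(n,0)}(M)$ with $f(\xi)=0$ and $Zf(\xi)\neq0$ ($Z$ applied to the coefficient of $f$ in local coordinates); (iii) separates points if for any distinct $\xi_1,\xi_2\in M$ there is $f\in A^2_{(n,0)}(M)$ with $f(\xi_1)=0$, $f(\xi_2)\ne0$. $M$ admits a Bergman metric exactly when (i) and (ii) hold, namely the Kähler metric with form $i\partial\bar\partial\log\widetilde K_M(z,z)$ in local coordinates. $M$ is Bergman nondegenerate if (i), (ii), (iii) all hold. In dimension one, holomorphic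 sectional curvature is, up to a fixed positive normalizing constant, the Gaussian curvature. *)

theory Defs
  imports "HOL-Analysis.Analysis"
begin

section \<open>Riemann surfaces\<close>

text \<open>A chart \<open>(U, \<phi>)\<close> consists of its domain and its coordinate; only the values of \<open>\<phi>\<close> on \<open>U\<close>
  matter.\<close>

type_synonym 'a chart = "'a set \<times> ('a \<Rightarrow> complex)"

definition chart_dom :: "'a chart \<Rightarrow> 'a set" where
  "chart_dom c = fst c"

definition coord :: "'a chart \<Rightarrow> 'a \<Rightarrow> complex" where
  "coord c = snd c"

definition chart_image :: "'a chart \<Rightarrow> complex set" where
  "chart_image c = coord c ` chart_dom c"

definition overlap :: "'a chart \<Rightarrow> 'a chart \<Rightarrow> complex set" where
  "overlap c d = coord c ` (chart_dom c \<inter> chart_dom d)"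

definition transition :: "'a chart \<Rightarrow> 'a chart \<Rightarrow> complex \<Rightarrow> complex" where
  "transition c d = coord d \<circ> inv_into (chart_dom c) (coord c)"

definition chart_on :: "'a topology \<Rightarrow> 'a chart \<Rightarrow> bool" where
  "chart_on X c \<longleftrightarrow>
     openin X (chart_dom c) \<and> open (chart_image c) \<and>
     homeomorphic_map (subtopology X (chart_dom c)) (top_of_set (chart_image c)) (coord c)"

text \<open>The atlas \<open>A\<close> need not be maximal.\<close>

definition riemann_surface :: "'a topology \<Rightarrow> 'a chart set \<Rightarrow> bool" where
  "riemann_surface X A \<longleftrightarrow>
     topspace X \<noteq> {} \<and> connected_space X \<and> Hausdorff_space X \<and> second_countable X \<and>
     (\<forall>c\<in>A. chart_on X c) \<and> (\<Union>c\<in>A. chart_dom c) = topspace X \<and>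
     (\<forall>c\<in>A. \<forall>d\<in>A. transition c d holomorphic_on overlap c d)"

definition plane_atlas :: "complex set \<Rightarrow> complex chart set" where
  "plane_atlas \<Omega> = {(\<Omega>, id)}"

lemma riemann_surface_plane:
  assumes "open \<Omega>" "connected \<Omega>" "\<Omega> \<noteq> {}"
  shows "riemann_surface (top_of_set \<Omega>) (plane_atlas \<Omega>)"
proof -
  have eq: "id holomorphic_on \<Omega> \<longleftrightarrow> transition (\<Omega>, id) (\<Omega>, id) holomorphic_on \<Omega>"
    by (rule holomorphic_cong) (auto simp: transition_def coord_def chart_dom_def)
  obtain \<B> :: "complex set set" where \<B>: "countable \<B>" "\<And>C. C \<in> \<B> \<Longrightarrow> open C"
    "\<And>S. open S \<Longrightarrow> \<exists>U. U \<subseteq> \<B> \<and> S = \<Union>U"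
    using univ_second_countable by blast
  have "second_countable (euclidean :: complex topology)"
    unfolding second_countable_def
  proof (intro exI conjI allI impI ballI)
    fix U :: "complex set" and x assume "openin euclidean U \<and> x \<in> U"
    then show "\<exists>V\<in>\<B>. x \<in> V \<and> V \<subseteq> U" using \<B>(3)[of U] by fastforce
  qed (use \<B> in \<open>simp_all\<close>)
  then have "second_countable (top_of_set \<Omega>)"
    by (rule second_countable_subtopology)
  then show ?thesis
    using assms eq
    by (auto simp: riemann_surface_def plane_atlas_def chart_on_def chart_dom_def coord_def
        chart_image_def overlap_def connected_space_subtopology Hausdorff_space_subtopology
        holomorphic_on_id subtopology_subtopology)
qed

section \<open>Differential forms in local coordinates\<close>

text \<open>A \<open>(1,0)\<close>-form is given by its coefficients \<open>f c\<close>, meaning \<open>f c z dz\<close> on \<open>chart_image c\<close>.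
  Coefficients are set to 0 where they have no meaning, so that equality of forms is equality of
  functions.\<close>

definition holomorphic_forms :: "'a chart set \<Rightarrow> ('a chart \<Rightarrow> complex \<Rightarrow> complex) set" where
  "holomorphic_forms A = {f.
     (\<forall>c\<in>A. f c holomorphic_on chart_image c) \<and>
     (\<forall>c\<in>A. \<forall>d\<in>A. \<forall>z\<in>overlap c d.
        f c z = f d (transition c d z) * deriv (transition c d) z) \<and>
     (\<forall>c z. c \<notin> A \<or> z \<notin> chart_image c \<longrightarrow> f c z = 0)}"

text \<open>Coefficient of \<open>f \<and> cnj g\<close> with respect to \<open>dz \<and> d(cnj z)\<close>.\<close>

definition wedge_cnj ::
  "('a chart \<Rightarrow> complex \<Rightarrow> complex) \<Rightarrow> ('a chart \<Rightarrow> complex \<Rightarrow> complex) \<Rightarrow> 'a chart \<Rightarrow> complex \<Rightarrow> complex"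
  where "wedge_cnj f g c z = f c z * cnj (g c z)"

text \<open>To integrate a \<open>(1,1)\<close>-form, the surface is cut into countably many disjoint Borel pieces, each
  inside the domain of a chart. By the change of variables formula the integral of a form does not
  depend on the chosen countable cover (one exists because the surface is second countable).\<close>

definition chart_cover :: "'a chart set \<Rightarrow> nat \<Rightarrow> 'a chart" where
  "chart_cover A = (SOME c. range c \<subseteq> A \<and> (\<Union>n. chart_dom (c n)) = (\<Union>d\<in>A. chart_dom d))"

definition piece :: "'a chart set \<Rightarrow> nat \<Rightarrow> complex set" where
  "piece A n = coord (chart_cover A n) ` disjointed (\<lambda>k. chart_dom (chart_cover A k)) n"

lemma chart_cover_plane: "chart_cover (plane_atlas \<Omega>) n = (\<Omega>, id)"
proof -
  have "range (chart_cover (plane_atlas \<Omega>)) \<subseteq> plane_atlas \<Omega> \<and>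
      (\<Union>n. chart_dom (chart_cover (plane_atlas \<Omega>) n)) = (\<Union>d\<in>plane_atlas \<Omega>. chart_dom d)"
    unfolding chart_cover_def
    by (rule someI[of _ "\<lambda>_. (\<Omega>, id)"]) (simp add: plane_atlas_def)
  then show ?thesis by (auto simp: plane_atlas_def)
qed

lemma piece_plane: "piece (plane_atlas \<Omega>) n = (if n = 0 then \<Omega> else {})"
  by (auto simp: piece_def chart_cover_plane coord_def chart_dom_def disjointed_def)

text \<open>Here \<open>\<eta> c\<close> is the coefficient with respect to \<open>dz \<and> d(cnj z) = -2\<i> dx \<and> dy\<close>.\<close>

definition form_integrable :: "'a chart set \<Rightarrow> ('a chart \<Rightarrow> complex \<Rightarrow> complex) \<Rightarrow> bool" where
  "form_integrable A \<eta> \<longleftrightarrow>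
     (\<forall>n. set_integrable lborel (piece A n) (\<eta> (chart_cover A n))) \<and>
     summable (\<lambda>n. LINT z:piece A n|lborel. norm (\<eta> (chart_cover A n) z))"

definition form_integral :: "'a chart set \<Rightarrow> ('a chart \<Rightarrow> complex \<Rightarrow> complex) \<Rightarrow> complex" where
  "form_integral A \<eta> = (\<Sum>n. LINT z:piece A n|lborel. \<eta> (chart_cover A n) z * (- 2 * \<i>))"

section \<open>Bergman space and Bergman kernel\<close>

definition bergman_space :: "'a chart set \<Rightarrow> ('a chart \<Rightarrow> complex \<Rightarrow> complex) set" where
  "bergman_space A = {f \<in> holomorphic_forms A. form_integrable A (wedge_cnj f f)}"

definition bergman_inner ::
  "'a chart set \<Rightarrow> ('a chart \<Rightarrow> complex \<Rightarrow> complex) \<Rightarrow> ('a chart \<Rightarrow> complex \<Rightarrow> complex) \<Rightarrow> complex" where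
  "bergman_inner A f g = \<i> * form_integral A (wedge_cnj f g)"

text \<open>Orthonormal basis in the Hilbert space sense: a maximal orthonormal set.\<close>

definition bergman_basis ::
  "'a chart set \<Rightarrow> ('a chart \<Rightarrow> complex \<Rightarrow> complex) set \<Rightarrow> bool" where
  "bergman_basis A B \<longleftrightarrow>
     B \<subseteq> bergman_space A \<and>
     (\<forall>f\<in>B. \<forall>g\<in>B. bergman_inner A f g = (if f = g then 1 else 0)) \<and>
     (\<forall>f\<in>bergman_space A. (\<forall>g\<in>B. bergman_inner A f g = 0) \<longrightarrow> f = (\<lambda>c z. 0))"

text \<open>Coefficient of the kernel form with respect to \<open>dz \<and> d(cnj w)\<close>, both variables in the chart \<open>c\<close>.
  It does not depend on the orthonormal basis.\<close>

definition bergman_kernel :: "'a chart set \<Rightarrow> 'a chart \<Rightarrow> complex \<Rightarrow> complex \<Rightarrow> complex" where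
  "bergman_kernel A c z w =
     (\<Sum>\<^sub>\<infinity>f\<in>(SOME B. bergman_basis A B). f c z * cnj (f c w))"

lemma bergman_space_plane:
  "f \<in> bergman_space (plane_atlas \<Omega>) \<longleftrightarrow>
     f \<in> holomorphic_forms (plane_atlas \<Omega>) \<and>
     set_integrable lborel \<Omega> (\<lambda>z. f (\<Omega>, id) z * cnj (f (\<Omega>, id) z))"
proof -
  have c: "chart_cover (plane_atlas \<Omega>) n = (\<Omega>, id)" for n
    using chart_cover_plane .
  have "summable (\<lambda>n. LINT z:piece (plane_atlas \<Omega>) n|lborel. norm (wedge_cnj f f (\<Omega>, id) z))"
    by (rule summable_finite[of "{0}"]) (auto simp: piece_plane set_lebesgue_integral_def)
  moreover have "set_integrable lborel {} h" for h :: "complex \<Rightarrow> complex"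
    by (simp add: set_integrable_def)
  ultimately show ?thesis
    by (auto simp: bergman_space_def form_integrable_def c piece_plane wedge_cnj_def [abs_def])
qed

lemma bergman_inner_plane:
  "bergman_inner (plane_atlas \<Omega>) f g =
     2 * (LINT z:\<Omega>|lborel. f (\<Omega>, id) z * cnj (g (\<Omega>, id) z))"
proof -
  have "form_integral (plane_atlas \<Omega>) (wedge_cnj f g) =
      (\<Sum>n\<in>{0}. LINT z:piece (plane_atlas \<Omega>) n|lborel. wedge_cnj f g (\<Omega>, id) z * (- 2 * \<i>))"
    unfolding form_integral_def chart_cover_plane
    by (rule suminf_finite) (auto simp: piece_plane set_lebesgue_integral_def)
  also have "\<dots> = (LINT z:\<Omega>|lborel. f (\<Omega>, id) z * cnj (g (\<Omega>, id) z)) * (- 2 * \<i>)"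
    by (simp only: wedge_cnj_def set_integral_mult_left) (simp add: piece_plane)
  finally have "bergman_inner (plane_atlas \<Omega>) f g =
      \<i> * ((LINT z:\<Omega>|lborel. f (\<Omega>, id) z * cnj (g (\<Omega>, id) z)) * (- 2 * \<i>))"
    by (simp only: bergman_inner_def)
  moreover have "\<i> * (x * (- 2 * \<i>)) = 2 * x" for x
    by (simp add: complex_eq_iff)
  ultimately show ?thesis by (simp only:)
qed

definition base_point_free :: "'a chart set \<Rightarrow> bool" where
  "base_point_free A \<longleftrightarrow>
     (\<forall>c\<in>A. \<forall>p\<in>chart_dom c. \<exists>f\<in>bergman_space A. f c (coord c p) \<noteq> 0)"

text \<open>A nonzero \<open>(1,0)\<close>-vector at \<open>p\<close> is \<open>\<zeta> \<partial>/\<partial>z\<close> with \<open>\<zeta> \<noteq> 0\<close>.\<close>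

definition separates_directions :: "'a chart set \<Rightarrow> bool" where
  "separates_directions A \<longleftrightarrow>
     (\<forall>c\<in>A. \<forall>p\<in>chart_dom c. \<forall>\<zeta>. \<zeta> \<noteq> 0 \<longrightarrow>
        (\<exists>f\<in>bergman_space A. f c (coord c p) = 0 \<and> \<zeta> * deriv (f c) (coord c p) \<noteq> 0))"

definition separates_points :: "'a chart set \<Rightarrow> bool" where
  "separates_points A \<longleftrightarrow>
     (\<forall>c\<in>A. \<forall>d\<in>A. \<forall>p\<in>chart_dom c. \<forall>q\<in>chart_dom d. p \<noteq> q \<longrightarrow>
        (\<exists>f\<in>bergman_space A. f c (coord c p) = 0 \<and> f d (coord d q) \<noteq> 0))"

definition admits_bergman_metric :: "'a chart set \<Rightarrow> bool" where
  "admits_bergman_metric A \<longleftrightarrow> base_point_free A \<and> separates_directions A"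

definition bergman_nondegenerate :: "'a chart set \<Rightarrow> bool" where
  "bergman_nondegenerate A \<longleftrightarrow>
     base_point_free A \<and> separates_directions A \<and> separates_points A"

section \<open>Bergman metric and its curvature\<close>

text \<open>The Wirtinger derivatives \<open>\<partial>/\<partial>z\<close> and \<open>\<partial>/\<partial>(cnj z)\<close> of real differentiable functions.\<close>

definition wirtinger :: "(complex \<Rightarrow> complex) \<Rightarrow> complex \<Rightarrow> complex" where
  "wirtinger F z =
     (frechet_derivative F (at z) 1 - \<i> * frechet_derivative F (at z) \<i>) / 2"

definition wirtinger_bar :: "(complex \<Rightarrow> complex) \<Rightarrow> complex \<Rightarrow> complex" where
  "wirtinger_bar F z =
     (frechet_derivative F (at z) 1 + \<i> * frechet_derivative F (at z) \<i>) / 2"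

text \<open>The function \<open>g\<close> such that the Kaehler form of the metric is \<open>\<i> g dz \<and> d(cnj z)\<close>. The kernel is
  positive on the diagonal when the Bergman space is base point free, so \<open>ln\<close> is the real logarithm
  there.\<close>

definition bergman_metric :: "'a chart set \<Rightarrow> 'a chart \<Rightarrow> complex \<Rightarrow> complex" where
  "bergman_metric A c =
     wirtinger (wirtinger_bar (\<lambda>z. ln (bergman_kernel A c z z)))"

text \<open>\<open>R / g\<^sup>2\<close> for the curvature component \<open>R = - \<partial>\<partial>' g + g\<^sup>-\<^sup>1 (\<partial> g) (\<partial>' g)\<close> of a Kaehler metric \<open>g\<close> in
  one variable, where \<open>\<partial>\<close> and \<open>\<partial>'\<close> are the two Wirtinger derivatives; the tangent direction cancels.
  With the normalization \<open>2 g \<bar>dz\<bar>\<^sup>2\<close> of the Riemannian metric this is the Gaussian curvature.\<close>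

definition hol_sectional_curvature :: "(complex \<Rightarrow> complex) \<Rightarrow> complex \<Rightarrow> complex" where
  "hol_sectional_curvature g z =
     (- wirtinger (wirtinger_bar g) z + wirtinger g z * wirtinger_bar g z / g z) / (g z)\<^sup>2"

definition bergman_constant_curvature :: "'a chart set \<Rightarrow> real \<Rightarrow> bool" where
  "bergman_constant_curvature A \<kappa> \<longleftrightarrow>
     (\<forall>c\<in>A. \<forall>z\<in>chart_image c.
        hol_sectional_curvature (bergman_metric A c) z = of_real \<kappa>)"

end

theory Submission
  imports Defs "HOL-Complex_Analysis.Complex_Analysis"
begin

text \<open>
  Suppose that the Bergman metric has constant curvature \<open>\<kappa> > 0\<close>. Near a point where the kernel does not
  vanish, let \<open>k (z, cnj x)\<close> be its polarization. The curvature equation is Liouville's equation for the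
  potential \<open>ln k\<close> and can be integrated: \<open>k (z, cnj x) = h z * cnj (h x) * (1 + c * \<psi> z * cnj (\<psi> x)) powr (2 / \<kappa>)\<close>
  with \<open>h\<close> and \<open>\<psi>\<close> holomorphic (\<open>liouville_potential\<close>). On the other hand the kernel is the sum of
  \<open>f z * cnj (f x)\<close> over an orthonormal basis. Hence the Taylor coefficients of \<open>(1 + c t) powr (2 / \<kappa>)\<close> are sums of
  squares; for a positive exponent this is only possible if \<open>2 / \<kappa>\<close> is a natural number \<open>m\<close>, and then every
  member of the basis is \<open>h\<close> times a polynomial of degree at most \<open>m\<close> in \<open>\<psi>\<close> (\<open>bessel_binomial\<close>,
  \<open>constant_curvature_local_form\<close>). By the identity theorem the Bergman space is finite dimensional, spanned
  by forms \<open>e 0, \<dots>, e m\<close> that are \<open>h \<psi>^j\<close> near the point (\<open>constant_curvature_span\<close>).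

  For a plane domain this is absurd, because a finite dimensional Bergman space of a plane domain is trivial
  (\<open>planar_finite_dim_trivial\<close>). If the complement has positive area, the Cauchy transform of a piece of it is
  bounded and nonconstant, and multiplication with its powers produces infinitely many dimensions. If the complement is a null
  set, a nonzero member of the space either has infinitely many singular points, and Cauchy transforms separate these into
  infinitely many dimensions, or it extends to an entire function in \<open>L\<^sup>2\<close>, which must vanish.

  On a surface the relations \<open>e i * e (j + 1) = e (i + 1) * e j\<close> hold globally. Thus \<open>\<psi> = e 1 / e 0\<close> is a map to
  the Riemann sphere, and it is injective when the Bergman space separates points. If it omits a value, moving that
  value to infinity makes the surface a plane domain with isomorphic Bergman space
  (\<open>no_global_coordinate\<close>). If it is onto, removing the point over infinity leaves a copy of the
  plane, and the forms become entire functions in \<open>L\<^sup>2\<close> (\<open>plane_image_zero\<close>). Either way the Bergman space is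
  trivial, which contradicts base point freeness.
\<close>

unbundle no fps_syntax

section \<open>Area and holomorphic injections\<close>

definition to_plane :: "complex \<Rightarrow> real^2" where "to_plane z = vector [Re z, Im z]"
definition of_plane :: "real^2 \<Rightarrow> complex" where "of_plane v = Complex (v$1) (v$2)"

lemma of_to_plane [simp]: "of_plane (to_plane z) = z" "to_plane (of_plane v) = v"
  by (auto simp: of_plane_def to_plane_def vec_eq_iff forall_2)

lemma linear_to_plane: "linear to_plane" "linear of_plane"
  by (auto intro!: linearI simp: to_plane_def of_plane_def vec_eq_iff forall_2 complex_eq_iff)

lemma bounded_linear_to_plane: "bounded_linear to_plane" "bounded_linear of_plane"
  using linear_to_plane linear_conv_bounded_linear by auto

lemma measurable_to_plane [measurable]: "to_plane \<in> borel_measurable borel" "of_plane \<in> borel_measurable borel"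
  using bounded_linear_to_plane
  by (auto intro!: borel_measurable_continuous_onI linear_continuous_on)

lemma lborel_to_plane: "distr lborel borel to_plane = lborel"
proof (rule lborel_eqI[symmetric])
  fix l u :: "real^2" assume lu: "\<And>b. b \<in> Basis \<Longrightarrow> l \<bullet> b \<le> u \<bullet> b"
  have b: "Basis = {axis 1 1, axis 2 (1::real) :: real^2}" "axis 1 (1::real) \<noteq> (axis 2 1 :: real^2)"
    by (auto simp: Basis_vec_def axis_eq_axis UNIV_2)
  have le: "l$1 \<le> u$1" "l$2 \<le> u$2" using lu[of "axis 1 1"] lu[of "axis 2 1"] by (auto simp: b inner_axis)
  have "to_plane -` box l u = box (of_plane l) (of_plane u)"
    by (auto simp: box_def b inner_axis to_plane_def of_plane_def Basis_complex_def inner_complex_def)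
  then have "emeasure (distr lborel borel to_plane) (box l u) = emeasure lborel (box (of_plane l) (of_plane u))"
    by (subst emeasure_distr) auto
  also have "\<dots> = (\<Prod>b\<in>Basis. (of_plane u - of_plane l) \<bullet> b)"
    using le by (subst emeasure_lborel_box) (auto simp: Basis_complex_def of_plane_def inner_complex_def)
  also have "\<dots> = (\<Prod>b\<in>Basis. (u - l) \<bullet> b)"
    by (simp add: Basis_complex_def of_plane_def b inner_axis)
  finally show "emeasure (distr lborel borel to_plane) (box l u) = ennreal (\<Prod>b\<in>Basis. (u - l) \<bullet> b)" .
qed simp

lemma emeasure_to_plane:
  assumes "A \<in> sets borel"
  shows "emeasure lborel (of_plane -` A) = emeasure lborel A" "of_plane -` A \<in> sets borel"
proof -
  show m: "of_plane -` A \<in> sets borel" using measurable_sets[OF measurable_to_plane(2) assms] by simp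
  have "emeasure lborel (of_plane -` A) = emeasure (distr lborel borel to_plane) (of_plane -` A)"
    by (simp add: lborel_to_plane)
  also have "\<dots> = emeasure lborel A"
    using m by (subst emeasure_distr) (auto simp: vimage_def)
  finally show "emeasure lborel (of_plane -` A) = emeasure lborel A" .
qed

lemma nn_integral_to_plane:
  assumes [measurable]: "\<phi> \<in> borel_measurable borel"
  shows "(\<integral>\<^sup>+v. \<phi> (of_plane v) \<partial>lborel) = (\<integral>\<^sup>+z. \<phi> z \<partial>lborel)"
  by (subst lborel_to_plane[symmetric], subst nn_integral_distr) auto

lemma image_of_plane: "to_plane ` A = of_plane -` A"
  by (auto simp: image_iff) (metis of_to_plane(2))

lemma det_complex_mult:
  "det (matrix (\<lambda>v. to_plane (d * of_plane v))) = (norm d)\<^sup>2"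
proof -
  have "(norm d)\<^sup>2 = Re d * Re d + Im d * Im d" by (simp only: cmod_power2 power2_eq_square[of "Re d"] power2_eq_square[of "Im d"])
  then show ?thesis by (simp add: det_2 matrix_def to_plane_def of_plane_def axis_def algebra_simps)
qed

text \<open>The change of variables formula for maps of \<open>real^2\<close>, applied after identifying \<open>\<complex>\<close> with \<open>real^2\<close>: complex
  multiplication by \<open>T'\<close> has determinant \<open>\<bar>T'\<bar>\<^sup>2\<close>. The formula is stated for finite integrals in the sense of
  Henstock and Kurzweil, which is why the infinite case is separate.\<close>

lemma emeasure_holomorphic_image:
  assumes hol: "T holomorphic_on S" and S: "open S" and inj: "inj_on T S"
    and A: "A \<in> sets borel" "A \<subseteq> S" and TA: "T ` A \<in> sets borel"
  shows "emeasure lborel (T ` A) = (\<integral>\<^sup>+z\<in>A. ennreal ((norm (deriv T z))\<^sup>2) \<partial>lborel)"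
proof -
  define f where "f = to_plane \<circ> T \<circ> of_plane"
  define f' where "f' x v = to_plane (deriv T (of_plane x) * of_plane v)" for x v
  define A' where "A' = of_plane -` A"
  have A'[measurable]: "A' \<in> sets borel" unfolding A'_def using A by (intro emeasure_to_plane)
  have der: "(f has_derivative f' x) (at x within A')" if "x \<in> A'" for x
  proof -
    have "(T has_field_derivative deriv T (of_plane x)) (at (of_plane x))"
      using A that by (intro holomorphic_derivI[OF hol S]) (auto simp: A'_def)
    then have "(T has_derivative (*) (deriv T (of_plane x))) (at (of_plane x))"
      by (simp add: has_field_derivative_def)
    moreover have "(of_plane has_derivative of_plane) (at x)" "(to_plane has_derivative to_plane) (at (T (of_plane x)))"
      using bounded_linear_to_plane by (auto intro: bounded_linear_imp_has_derivative)
    ultimately have "(to_plane \<circ> T \<circ> of_plane has_derivative to_plane \<circ> (*) (deriv T (of_plane x)) \<circ> of_plane) (at x)"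
      by (metis comp_apply diff_chain_at)
    then show ?thesis
      unfolding f_def by (rule has_derivative_at_withinI[OF has_derivative_eq_rhs]) (auto simp: f'_def)
  qed
  have injf: "inj_on f A'"
    using inj A unfolding f_def A'_def inj_on_def by (metis comp_apply of_to_plane vimageE subsetD)
  have im: "f ` A' = of_plane -` (T ` A)"
  proof -
    have "of_plane ` A' = A" unfolding A'_def using of_to_plane by (metis surj_image_vimage_eq surjI)
    then show ?thesis unfolding f_def image_comp[symmetric] by (simp add: image_of_plane)
  qed
  have det: "\<bar>det (matrix (f' x))\<bar> = (norm (deriv T (of_plane x)))\<^sup>2" for x
    unfolding f'_def by (simp add: det_complex_mult)
  have A'l: "A' \<in> sets lebesgue" using A' by simp
  note iff = has_measure_differentiable_image[OF A'l der injf]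
  have derm: "(\<lambda>z. indicator A z *\<^sub>R deriv T z) \<in> borel_measurable borel"
    using holomorphic_deriv[OF hol S] A
    by (metis borel_measurable_continuous_on_indicator holomorphic_on_imp_continuous_on holomorphic_on_subset)
  then have "(\<lambda>z. ennreal ((norm (indicator A z *\<^sub>R deriv T z))\<^sup>2)) \<in> borel_measurable borel"
    by measurable
  then have phim: "(\<lambda>z. ennreal ((norm (deriv T z))\<^sup>2) * indicator A z) \<in> borel_measurable borel"
    by (rule measurable_cong[THEN iffD1, rotated]) (auto simp: indicator_def)
  have nn: "(\<integral>\<^sup>+z\<in>A. ennreal ((norm (deriv T z))\<^sup>2) \<partial>lborel) = (\<integral>\<^sup>+x\<in>A'. ennreal \<bar>det (matrix (f' x))\<bar> \<partial>lborel)"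
    unfolding nn_integral_to_plane[OF phim, symmetric] det A'_def
    by (auto intro!: nn_integral_cong simp: indicator_def)
  define g where "g x = \<bar>det (matrix (f' x))\<bar> * indicator A' x" for x
  have gm: "g \<in> borel_measurable borel"
  proof -
    have "(\<lambda>x. enn2real (ennreal ((norm (deriv T (of_plane x)))\<^sup>2) * indicator A (of_plane x))) \<in> borel_measurable borel"
      using phim by measurable
    moreover have "enn2real (ennreal ((norm (deriv T (of_plane x)))\<^sup>2) * indicator A (of_plane x)) = g x" for x
      by (auto simp: g_def det A'_def indicator_def)
    ultimately show ?thesis by simp
  qed
  have nng: "(\<integral>\<^sup>+x\<in>A'. ennreal \<bar>det (matrix (f' x))\<bar> \<partial>lborel) = (\<integral>\<^sup>+x. ennreal (g x) \<partial>lborel)"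
    by (auto intro!: nn_integral_cong simp: indicator_def g_def)
  have em: "emeasure lborel (T ` A) = emeasure lborel (f ` A')"
    unfolding im using emeasure_to_plane(1)[OF TA] by simp
  have fA: "f ` A' \<in> sets borel" unfolding im by (rule emeasure_to_plane(2)[OF TA])
  show ?thesis
  proof (cases "(\<integral>\<^sup>+x. ennreal (g x) \<partial>lborel) < \<infinity>")
    case True
    have int: "integrable lborel g"
      using True gm by (intro integrableI_bounded) (auto simp: g_def)
    then have hi: "(g has_integral integral\<^sup>L lborel g) UNIV"
      by (rule has_integral_integral_lborel)
    have "((\<lambda>x. if x \<in> A' then \<bar>det (matrix (f' x))\<bar> else 0) has_integral integral\<^sup>L lborel g) UNIV"
      by (rule has_integral_eq[OF _ hi]) (auto simp: g_def)
    then have "((\<lambda>x. \<bar>det (matrix (f' x))\<bar>) has_integral integral\<^sup>L lborel g) A'"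
      by (simp add: has_integral_restrict_UNIV)
    then have "f ` A' \<in> lmeasurable" "measure lebesgue (f ` A') = integral\<^sup>L lborel g" using iff by auto
    then have "emeasure lebesgue (f ` A') = ennreal (integral\<^sup>L lborel g)"
      by (metis emeasure_eq_measure2 )
    also have "\<dots> = (\<integral>\<^sup>+x. ennreal (g x) \<partial>lborel)"
      using int by (subst nn_integral_eq_integral) (auto simp: g_def)
    finally show ?thesis using em fA nn nng by (simp add: emeasure_completion main_part_sets)
  next
    case False
    have "emeasure lborel (f ` A') = \<infinity>"
    proof (rule ccontr)
      assume "emeasure lborel (f ` A') \<noteq> \<infinity>"
      then have "f ` A' \<in> lmeasurable"
        using fA by (auto simp: fmeasurable_def less_top)
      then have hi: "((\<lambda>x. \<bar>det (matrix (f' x))\<bar>) has_integral measure lebesgue (f ` A')) A'" using iff by blast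
      then have "((\<lambda>x. if x \<in> A' then \<bar>det (matrix (f' x))\<bar> else 0) has_integral measure lebesgue (f ` A')) UNIV"
        by (simp add: has_integral_restrict_UNIV)
      then have "(g has_integral measure lebesgue (f ` A')) UNIV"
        by (rule has_integral_eq[rotated]) (auto simp: g_def)
      moreover have "0 \<le> g x" for x by (simp add: g_def)
      ultimately have "(\<integral>\<^sup>+x. ennreal (g x) \<partial>lborel) = ennreal (measure lebesgue (f ` A'))"
        using nn_integral_has_integral_lborel[OF gm] by blast
      then show False using False by simp
    qed
    then show ?thesis using False em nn nng by (metis infinity_ennreal_def top.not_eq_extremum)
  qed
qed

lemma borel_holomorphic_image:
  assumes hol: "T holomorphic_on S" and S: "open S" and inj: "inj_on T S"
    and A: "A \<in> sets borel" "A \<subseteq> S"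
  shows "T ` A \<in> sets borel"
proof -
  obtain g where g: "g holomorphic_on (T ` S)" "\<And>z. z \<in> S \<Longrightarrow> g (T z) = z"
    using holomorphic_has_inverse[OF hol S inj] by metis
  have o: "open (T ` S)" using open_mapping_thm3[OF hol S inj] .
  have "(\<lambda>w. indicator (T ` S) w *\<^sub>R g w) \<in> borel_measurable borel"
    using g(1) o by (intro borel_measurable_continuous_on_indicator holomorphic_on_imp_continuous_on) auto
  from measurable_sets[OF this A(1)]
  have "(\<lambda>w. indicator (T ` S) w *\<^sub>R g w) -` A \<inter> T ` S \<in> sets borel" using o by auto
  also have "(\<lambda>w. indicator (T ` S) w *\<^sub>R g w) -` A \<inter> T ` S = T ` A"
    using g(2) A(2) by (auto simp: subset_iff)
  finally show ?thesis .
qed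

lemma nn_integral_holomorphic_image:
  assumes hol: "T holomorphic_on S" and S: "open S" and inj: "inj_on T S"
    and A: "A \<in> sets borel" "A \<subseteq> S" and phi: "\<phi> \<in> borel_measurable borel"
  shows "(\<integral>\<^sup>+w\<in>T ` A. \<phi> w \<partial>lborel) = (\<integral>\<^sup>+z\<in>A. \<phi> (T z) * ennreal ((norm (deriv T z))\<^sup>2) \<partial>lborel)"
proof -
  note phi[measurable]
  define T0 where "T0 z = indicator A z *\<^sub>R T z" for z
  define d where "d z = indicator A z *\<^sub>R deriv T z" for z
  have T0[measurable]: "T0 \<in> borel_measurable borel" unfolding T0_def
    using hol A by (intro borel_measurable_continuous_on_indicator holomorphic_on_imp_continuous_on) (auto intro: holomorphic_on_subset)
  have d[measurable]: "d \<in> borel_measurable borel" unfolding d_def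
    using holomorphic_deriv[OF hol S] A by (intro borel_measurable_continuous_on_indicator holomorphic_on_imp_continuous_on) (auto intro: holomorphic_on_subset)
  have TA[measurable]: "T ` A \<in> sets borel" by (rule borel_holomorphic_image[OF hol S inj A])
  note A(1)[measurable]
  define M where "M = density lborel (\<lambda>z. ennreal ((norm (d z))\<^sup>2))"
  have "density lborel (indicator (T ` A)) = distr M borel T0"
  proof (rule measure_eqI)
    fix C assume "C \<in> sets (density lborel (indicator (T ` A)))"
    then have C[measurable]: "C \<in> sets borel" by simp
    have [measurable]: "T0 -` C \<in> sets borel" using measurable_sets[OF T0 C] by simp
    have im: "T ` (A \<inter> T0 -` C) = C \<inter> T ` A" by (auto simp: T0_def)
    have "emeasure (density lborel (indicator (T ` A))) C = emeasure lborel (C \<inter> T ` A)"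
      by (subst emeasure_density) (auto simp: indicator_inter_arith[symmetric] Int_commute)
    also have "\<dots> = (\<integral>\<^sup>+z\<in>A \<inter> T0 -` C. ennreal ((norm (deriv T z))\<^sup>2) \<partial>lborel)"
      unfolding im[symmetric] by (rule emeasure_holomorphic_image[OF hol S inj]) (use A im in auto)
    also have "\<dots> = (\<integral>\<^sup>+z. ennreal ((norm (d z))\<^sup>2) * indicator (T0 -` C) z \<partial>lborel)"
      by (auto intro!: nn_integral_cong simp: indicator_def d_def)
    also have "\<dots> = emeasure (distr M borel T0) C"
      by (simp add: M_def emeasure_distr emeasure_density)
    finally show "emeasure (density lborel (indicator (T ` A))) C = emeasure (distr M borel T0) C" .
  qed simp
  then have "(\<integral>\<^sup>+w. \<phi> w \<partial>density lborel (indicator (T ` A))) = (\<integral>\<^sup>+w. \<phi> w \<partial>distr M borel T0)" by simp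
  moreover have "(\<integral>\<^sup>+w. \<phi> w \<partial>density lborel (indicator (T ` A))) = (\<integral>\<^sup>+w\<in>T ` A. \<phi> w \<partial>lborel)"
    by (subst nn_integral_density) (auto simp: mult.commute)
  moreover have "(\<integral>\<^sup>+w. \<phi> w \<partial>distr M borel T0) = (\<integral>\<^sup>+z. ennreal ((norm (d z))\<^sup>2) * \<phi> (T0 z) \<partial>lborel)"
    unfolding M_def by (subst nn_integral_distr; simp?; subst nn_integral_density; simp?)
  moreover have "\<dots> = (\<integral>\<^sup>+z\<in>A. \<phi> (T z) * ennreal ((norm (deriv T z))\<^sup>2) \<partial>lborel)"
    by (auto intro!: nn_integral_cong simp: indicator_def d_def T0_def mult.commute)
  ultimately show ?thesis by simp
qed

section \<open>Area integrals of powers and of the Cauchy kernel\<close>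

lemma lborel_rotate:
  assumes "norm (a::complex) = 1"
  shows "distr lborel borel ((*) a) = lborel"
proof (rule measure_eqI)
  fix C assume "C \<in> sets (distr lborel borel ((*) a))"
  then have C[measurable]: "C \<in> sets borel" by simp
  have a: "a \<noteq> 0" using assms by auto
  define A where "A = (*) a -` C"
  have A: "A \<in> sets borel" unfolding A_def using measurable_sets[of "(*) a" borel borel C] C by simp
  have im: "(*) a ` A = C" unfolding A_def using a by (auto simp: image_iff) (metis nonzero_mult_div_cancel_left times_divide_eq_right)
  have "emeasure (distr lborel borel ((*) a)) C = emeasure lborel A"
    by (subst emeasure_distr) (auto simp: A_def)
  also have "\<dots> = emeasure lborel ((*) a ` A)"
    using emeasure_holomorphic_image[of "(*) a" UNIV A] A C a assms
    by (auto simp: im inj_on_def intro!: holomorphic_intros)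
  finally show "emeasure (distr lborel borel ((*) a)) C = emeasure lborel C" by (simp add: im)
qed simp

text \<open>Rotations preserve area. With \<open>a = exp (\<i> \<pi> / n)\<close> this kills the integrals of all nonzero powers over
  rotation invariant sets, and the area mean value property follows by integrating a power series
  term by term.\<close>

lemma integral_rotate_antisym:
  fixes \<phi> :: "complex \<Rightarrow> complex"
  assumes "norm a = 1" "\<And>w. \<phi> (a * w) = - \<phi> w" and [measurable]: "\<phi> \<in> borel_measurable borel"
  shows "(\<integral>w. \<phi> w \<partial>lborel) = 0"
proof -
  have "(\<integral>w. \<phi> w \<partial>lborel) = (\<integral>w. \<phi> w \<partial>distr lborel borel ((*) a))"
    using lborel_rotate[OF assms(1)] by simp
  also have "\<dots> = (\<integral>w. \<phi> (a * w) \<partial>lborel)" by (subst integral_distr) auto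
  also have "\<dots> = - (\<integral>w. \<phi> w \<partial>lborel)" by (simp add: assms)
  finally show ?thesis by simp
qed

lemma set_integral_rotate_power:
  fixes S :: "complex set"
  assumes "S \<in> sets borel" "\<And>a w. norm a = 1 \<Longrightarrow> a * w \<in> S \<longleftrightarrow> w \<in> S" "n > 0"
  shows "(LINT w:S|lborel. w ^ n) = 0" "(LINT w:S|lborel. inverse w ^ n) = 0"
proof -
  define a where "a = cis (pi / n)"
  have a: "norm a = 1" "a ^ n = -1" using assms(3) by (auto simp: a_def Complex.DeMoivre simp flip: cis_pi)
  have ia: "inverse a ^ n = -1" using a by (simp add: power_inverse)
  note assms(1)[measurable]
  show "(LINT w:S|lborel. w ^ n) = 0" "(LINT w:S|lborel. inverse w ^ n) = 0"
    unfolding set_lebesgue_integral_def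
    by (rule integral_rotate_antisym[OF a(1)];
       use assms(2)[OF a(1)] a ia in \<open>auto simp: power_mult_distrib indicator_def\<close>)+
qed

lemma set_integral_series:
  fixes \<phi> :: "nat \<Rightarrow> complex \<Rightarrow> complex"
  assumes S: "S \<in> sets borel" "emeasure lborel S < \<infinity>"
    and m: "\<And>n. \<phi> n \<in> borel_measurable borel"
    and M: "\<And>n w. w \<in> S \<Longrightarrow> norm (\<phi> n w) \<le> M n" "summable M"
    and z: "\<And>n. n > 0 \<Longrightarrow> (LINT w:S|lborel. \<phi> n w) = 0"
  shows "(LINT w:S|lborel. (\<Sum>n. \<phi> n w)) = (LINT w:S|lborel. \<phi> 0 w)"
proof -
  note S(1)[measurable] m[measurable]
  let ?\<psi> = "\<lambda>n w. indicator S w *\<^sub>R \<phi> n w"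
  have J: "integrable lborel (\<lambda>w. M n * indicator S w)" for n
    using S by (intro integrable_mult_right integrable_real_indicator) auto
  have int: "integrable lborel (?\<psi> n)" for n
  proof (rule Bochner_Integration.integrable_bound)
    show "integrable lborel (\<lambda>w. M n * indicator S w)" by (rule J)
    show "AE w in lborel. norm (?\<psi> n w) \<le> norm (M n * indicator S w)"
    proof (intro AE_I2)
      fix w show "norm (?\<psi> n w) \<le> norm (M n * indicator S w)"
        by (cases "w \<in> S") (use M(1)[of w n] in auto)
    qed
  qed auto
  have sn: "summable (\<lambda>n. norm (?\<psi> n w))" for w
    by (cases "w \<in> S") (auto intro!: summable_comparison_test'[OF M(2), of 0] M(1))
  have si: "summable (\<lambda>n. \<integral>w. norm (?\<psi> n w) \<partial>lborel)"
  proof (rule summable_comparison_test')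
    show "summable (\<lambda>n. M n * measure lborel S)" using M(2) by (rule summable_mult2)
    fix n :: nat assume "n \<ge> 0"
    have "(\<integral>w. norm (?\<psi> n w) \<partial>lborel) \<le> (\<integral>w. M n * indicator S w \<partial>lborel)"
    proof (rule integral_mono)
      show "integrable lborel (\<lambda>w. norm (?\<psi> n w))" by (rule integrable_norm[OF int])
      show "integrable lborel (\<lambda>w. M n * indicator S w)" by (rule J)
    qed (use M(1) in \<open>auto simp: indicator_def\<close>)
    then show "norm (\<integral>w. norm (?\<psi> n w) \<partial>lborel) \<le> M n * measure lborel S" by (simp add: integral_nonneg_AE)
  qed
  have "(LINT w:S|lborel. (\<Sum>n. \<phi> n w)) = (\<integral>w. (\<Sum>n. ?\<psi> n w) \<partial>lborel)"
    unfolding set_lebesgue_integral_def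
    by (intro Bochner_Integration.integral_cong) (auto simp: indicator_def)
  also have "\<dots> = (\<Sum>n. \<integral>w. ?\<psi> n w \<partial>lborel)"
    by (rule integral_suminf) (use int sn si in auto)
  also have "\<dots> = (\<Sum>n\<in>{0}. \<integral>w. ?\<psi> n w \<partial>lborel)"
    by (rule suminf_finite) (use z in \<open>auto simp: set_lebesgue_integral_def\<close>)
  finally show ?thesis by (simp add: set_lebesgue_integral_def)
qed

lemma emeasure_ball_complex: "r \<ge> 0 \<Longrightarrow> emeasure lborel (ball (z::complex) r) = ennreal (pi * r\<^sup>2)"
  by (simp add: emeasure_ball unit_ball_vol_2)

lemma measure_ball_complex: "r \<ge> 0 \<Longrightarrow> measure lborel (ball (z::complex) r) = pi * r\<^sup>2"
  by (simp add: measure_def emeasure_ball_complex)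

lemma area_mean_value_0:
  assumes f: "f holomorphic_on ball 0 R" and r: "0 \<le> r" "r < R"
  shows "(LINT w:ball 0 r|lborel. f w) = of_real (pi * r\<^sup>2) * f 0"
proof -
  define a where "a n = (deriv ^^ n) f 0 / fact n" for n
  have sums: "(\<lambda>n. a n * w ^ n) sums f w" if "w \<in> ball 0 R" for w
    using holomorphic_power_series[OF f, of w] that by (simp add: a_def)
  obtain s where s: "r < s" "s < R" using r dense by blast
  have "summable (\<lambda>n. a n * of_real s ^ n)"
    by (rule sums_summable[OF sums]) (use s r in auto)
  then have "summable (\<lambda>n. norm (a n * of_real r ^ n))"
    by (rule powser_insidea) (use s r in auto)
  then have M: "summable (\<lambda>n. norm (a n) * r ^ n)" using r by (simp add: norm_mult norm_power)
  have "(LINT w:ball 0 r|lborel. (\<Sum>n. a n * w ^ n)) = (LINT w:ball 0 r|lborel. a 0 * w ^ 0)"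
  proof (rule set_integral_series[OF _ _ _ _ M])
    show "norm (a n * w ^ n) \<le> norm (a n) * r ^ n" if "w \<in> ball 0 r" for n w
      using that r by (auto simp: norm_mult norm_power intro!: mult_left_mono power_mono)
    show "(LINT w:ball 0 r|lborel. a n * w ^ n) = 0" if "n > 0" for n
      using set_integral_rotate_power(1)[OF _ _ that, of "ball 0 r"] by (simp add: norm_mult)
  qed (use r in \<open>auto simp: emeasure_ball_complex\<close>)
  also have "(LINT w:ball 0 r|lborel. (\<Sum>n. a n * w ^ n)) = (LINT w:ball 0 r|lborel. f w)"
  proof (rule set_lebesgue_integral_cong)
    show "\<forall>w. w \<in> ball 0 r \<longrightarrow> (\<Sum>n. a n * w ^ n) = f w"
      using r by (auto intro!: sums_unique[symmetric] sums)
  qed auto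
  also have "(LINT w:ball 0 r|lborel. a 0 * w ^ 0) = of_real (pi * r\<^sup>2) * f 0"
    using r by (simp add: a_def set_lebesgue_integral_def measure_ball_complex scaleR_conv_of_real)
  finally show ?thesis .
qed

lemma submean_0:
  assumes f: "f holomorphic_on ball 0 R" and r: "0 \<le> r" "r < R"
  shows "ennreal (pi * r\<^sup>2 * (norm (f 0))\<^sup>2) \<le> (\<integral>\<^sup>+w\<in>ball 0 r. ennreal ((norm (f w))\<^sup>2) \<partial>lborel)"
proof -
  have c: "continuous_on (cball 0 r) f"
    using f r by (auto intro!: holomorphic_on_imp_continuous_on elim: holomorphic_on_subset)
  then have i: "integrable lborel (\<lambda>w. indicator (cball 0 r) w *\<^sub>R (norm (f w))\<^sup>2)"
    by (intro borel_integrable_compact continuous_intros) auto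
  have i: "set_integrable lborel (ball 0 r) (\<lambda>w. (norm (f w))\<^sup>2)"
    by (rule set_integrable_subset[where A="cball 0 r"]) (use i in \<open>auto simp: set_integrable_def\<close>)
  have "norm (LINT w:ball 0 r|lborel. (f w)\<^sup>2) = pi * r\<^sup>2 * (norm (f 0))\<^sup>2"
    by (subst area_mean_value_0[OF _ r]) (use f in \<open>auto intro!: holomorphic_intros simp: norm_mult norm_power\<close>)
  then have "pi * r\<^sup>2 * (norm (f 0))\<^sup>2 = norm (LINT w:ball 0 r|lborel. (f w)\<^sup>2)" by simp
  also have "\<dots> \<le> (LINT w:ball 0 r|lborel. (norm (f w))\<^sup>2)"
    unfolding set_lebesgue_integral_def
    by (rule order_trans[OF integral_norm_bound]) (simp add: norm_power)
  also have "ennreal \<dots> = (\<integral>\<^sup>+w. ennreal (indicator (ball 0 r) w *\<^sub>R (norm (f w))\<^sup>2) \<partial>lborel)"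
    unfolding set_lebesgue_integral_def by (rule nn_integral_eq_integral[symmetric]) (use i in \<open>auto simp: set_integrable_def\<close>)
  also have "\<dots> = (\<integral>\<^sup>+w\<in>ball 0 r. ennreal ((norm (f w))\<^sup>2) \<partial>lborel)"
    by (auto intro!: nn_integral_cong simp: indicator_def)
  finally show ?thesis by (simp add: ennreal_leI)
qed

text \<open>The area mean value property of \<open>f\<^sup>2\<close>. It bounds point evaluations by the \<open>L\<^sup>2\<close> norm over a disc.\<close>

lemma submean:
  assumes f: "f holomorphic_on ball z R" and r: "0 \<le> r" "r < R"
  shows "ennreal (pi * r\<^sup>2 * (norm (f z))\<^sup>2) \<le> (\<integral>\<^sup>+w\<in>ball z r. ennreal ((norm (f w))\<^sup>2) \<partial>lborel)"
proof -
  have im: "(+) z ` ball 0 s = ball z s" for s by (simp add: image_add_ball)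
  have h: "(f \<circ> (+) z) holomorphic_on ball 0 R"
    by (intro holomorphic_on_compose holomorphic_intros) (simp add: im f)
  have fm: "(\<lambda>w. indicator (ball z r) w *\<^sub>R f w) \<in> borel_measurable borel"
    using f r by (intro borel_measurable_continuous_on_indicator holomorphic_on_imp_continuous_on) (auto elim: holomorphic_on_subset)
  then have m: "(\<lambda>w. ennreal ((norm (indicator (ball z r) w *\<^sub>R f w))\<^sup>2)) \<in> borel_measurable borel" by measurable
  have "(\<integral>\<^sup>+w\<in>ball z r. ennreal ((norm (f w))\<^sup>2) \<partial>lborel) = (\<integral>\<^sup>+w\<in>(+) z ` ball 0 r. ennreal ((norm (indicator (ball z r) w *\<^sub>R f w))\<^sup>2) \<partial>lborel)"
    unfolding im by (auto intro!: nn_integral_cong simp: indicator_def)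
  also have "\<dots> = (\<integral>\<^sup>+w\<in>ball 0 r. ennreal ((norm (indicator (ball z r) (z + w) *\<^sub>R f (z + w)))\<^sup>2) * ennreal ((norm (deriv ((+) z) w))\<^sup>2) \<partial>lborel)"
    by (rule nn_integral_holomorphic_image[of _ UNIV]) (use m in \<open>auto intro!: holomorphic_intros\<close>)
  also have "\<dots> = (\<integral>\<^sup>+w\<in>ball 0 r. ennreal ((norm ((f \<circ> (+) z) w))\<^sup>2) \<partial>lborel)"
    by (auto intro!: nn_integral_cong simp: indicator_def dist_norm)
  finally show ?thesis using submean_0[OF h r] by simp
qed

lemma null_sphere: "sphere (z::complex) r \<in> null_sets lborel"
  using negligible_sphere[of z r]
  by (auto simp: negligible_iff_null_sets null_sets_def emeasure_completion main_part_sets)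

text \<open>Substituting \<open>w = z - \<zeta>\<^sup>2\<close> with \<open>Re \<zeta> > 0\<close> turns \<open>dA / \<bar>z - w\<bar>\<close> into \<open>4 dA\<close>.\<close>

lemma nn_integral_Cauchy_kernel_ball:
  fixes z :: complex
  assumes "R \<ge> 0"
  shows "(\<integral>\<^sup>+w\<in>ball z R. ennreal (1 / norm (z - w)) \<partial>lborel) \<le> ennreal (4 * pi * R)"
proof -
  define T where "T \<zeta> = z - \<zeta>\<^sup>2" for \<zeta> :: complex
  define S where "S = {\<zeta>. Re \<zeta> > 0}"
  define A where "A = S \<inter> ball 0 (sqrt R)"
  have S: "open S" unfolding S_def by (simp add: open_halfspace_Re_gt)
  have inj: "inj_on T S"
  proof (rule inj_onI)
    fix x y assume *: "x \<in> S" "y \<in> S" "T x = T y"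
    then have "x = y \<or> x = - y" by (simp add: T_def power2_eq_iff)
    then show "x = y" using * by (auto simp: S_def)
  qed
  have der: "deriv T \<zeta> = - 2 * \<zeta>" for \<zeta>
    unfolding T_def by (rule DERIV_imp_deriv) (auto intro!: derivative_eq_intros)
  have hT: "T holomorphic_on S" unfolding T_def by (intro holomorphic_intros)
  have TA: "w \<in> T ` A" if "w \<in> ball z R" "Im (z - w) \<noteq> 0" for w
  proof -
    have "Re (csqrt (z - w)) \<noteq> 0"
    proof
      assume "Re (csqrt (z - w)) = 0"
      then have "Im (csqrt (z - w) * csqrt (z - w)) = 0" by simp
      moreover have "csqrt (z - w) * csqrt (z - w) = z - w" by (metis power2_csqrt power2_eq_square)
      ultimately show False using that(2) by metis
    qed
    then have "csqrt (z - w) \<in> S" using csqrt_principal[of "z - w"] unfolding S_def mem_Collect_eq by blast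
    moreover have "norm (csqrt (z - w)) < sqrt R" using that(1) by (simp add: dist_norm norm_csqrt)
    ultimately show ?thesis by (intro image_eqI[of _ _ "csqrt (z - w)"]) (auto simp: T_def A_def)
  qed
  have nul: "{w. Im (z - w) = 0} \<in> null_sets lborel"
  proof -
    have "{w. Im (z - w) = 0} = {w. \<i> \<bullet> w = Im z}" by (auto simp: inner_complex_def)
    moreover have "negligible {w. \<i> \<bullet> w = Im z}" by (rule negligible_hyperplane) auto
    moreover have "{w. Im (z - w) = 0} \<in> sets borel" by measurable
    ultimately show ?thesis by (auto simp: negligible_iff_null_sets null_sets_def emeasure_completion main_part_sets)
  qed
  have "(\<integral>\<^sup>+w\<in>ball z R. ennreal (1 / norm (z - w)) \<partial>lborel) \<le> (\<integral>\<^sup>+w\<in>T ` A. ennreal (1 / norm (z - w)) \<partial>lborel)"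
  proof (rule nn_integral_mono_AE)
    show "AE w in lborel. ennreal (1 / norm (z - w)) * indicator (ball z R) w \<le> ennreal (1 / norm (z - w)) * indicator (T ` A) w"
      using AE_not_in[OF nul] by eventually_elim (use TA in \<open>auto simp: indicator_def\<close>)
  qed
  also have "\<dots> = (\<integral>\<^sup>+\<zeta>\<in>A. ennreal (1 / norm (z - T \<zeta>)) * ennreal ((norm (deriv T \<zeta>))\<^sup>2) \<partial>lborel)"
    by (rule nn_integral_holomorphic_image[of _ S]) (use inj S hT in \<open>auto simp: A_def\<close>)
  also have "\<dots> \<le> (\<integral>\<^sup>+\<zeta>. 4 * indicator (ball (0::complex) (sqrt R)) \<zeta> \<partial>lborel)"
  proof (rule nn_integral_mono)
    fix \<zeta> :: complex
    show "ennreal (1 / norm (z - T \<zeta>)) * ennreal ((norm (deriv T \<zeta>))\<^sup>2) * indicator A \<zeta> \<le> 4 * indicator (ball 0 (sqrt R)) \<zeta>"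
      by (cases "\<zeta> = 0") (auto simp: der T_def indicator_def norm_mult norm_power power_mult_distrib A_def ennreal_mult[symmetric])
  qed
  also have "\<dots> = 4 * ennreal (pi * R)"
    using assms by (subst nn_integral_cmult_indicator) (auto simp: emeasure_ball_complex)
  also have "\<dots> = ennreal (4 * pi * R)" using assms by (simp add: ennreal_mult mult.assoc)
  finally show ?thesis .
qed

text \<open>The inversion \<open>w \<mapsto> 1 / w\<close> has Jacobian \<open>\<bar>w\<bar>\<^sup>-\<^sup>4\<close>, so the integral is the area of a punctured disc.\<close>

lemma nn_integral_inverse_4:
  assumes "R > 0"
  shows "(\<integral>\<^sup>+w\<in>- cball 0 R. ennreal (1 / norm (w::complex) ^ 4) \<partial>lborel) < \<infinity>"
proof -
  define A where "A = ball (0::complex) (1/R) - {0}"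
  have im: "inverse ` A = - cball 0 R"
  proof
    show "inverse ` A \<subseteq> - cball 0 R" using assms by (auto simp: A_def norm_inverse norm_divide field_simps)
    show "- cball 0 R \<subseteq> inverse ` A"
    proof
      fix w :: complex assume "w \<in> - cball 0 R"
      then have "norm w > R" by auto
      then have "inverse (norm w) < inverse R" using assms by (rule less_imp_inverse_less)
      then have "inverse w \<in> A" "w = inverse (inverse w)"
        using assms \<open>norm w > R\<close> by (auto simp: A_def norm_inverse inverse_eq_divide[of R])
      then show "w \<in> inverse ` A" by blast
    qed
  qed
  have "(\<integral>\<^sup>+w\<in>- cball 0 R. ennreal (1 / norm (w::complex) ^ 4) \<partial>lborel) = (\<integral>\<^sup>+w\<in>A. ennreal (1 / norm (inverse w) ^ 4) * ennreal ((norm (deriv inverse w))\<^sup>2) \<partial>lborel)"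
    unfolding im[symmetric] by (rule nn_integral_holomorphic_image[of _ A]) (auto simp: A_def inj_on_def intro!: holomorphic_intros)
  also have "\<dots> \<le> (\<integral>\<^sup>+w. indicator (ball (0::complex) (1/R)) w \<partial>lborel)"
  proof (rule nn_integral_mono)
    fix w :: complex
    show "ennreal (1 / norm (inverse w) ^ 4) * ennreal ((norm (deriv inverse w))\<^sup>2) * indicator A w \<le> indicator (ball 0 (1/R)) w"
    proof (cases "w \<in> A")
      case True
      then have w: "w \<noteq> 0" by (auto simp: A_def)
      have "deriv inverse w = - (inverse w ^ Suc (Suc 0))" by (rule DERIV_imp_deriv) (rule DERIV_inverse[OF w])
      then have "1 / norm (inverse w) ^ 4 * (norm (deriv inverse w))\<^sup>2 = 1"
        using w by (simp add: norm_mult norm_inverse norm_divide power2_eq_square power4_eq_xxxx field_simps)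
      then show ?thesis using True by (simp add: ennreal_mult[symmetric] A_def)
    qed auto
  qed
  also have "\<dots> < \<infinity>" using assms by (simp add: emeasure_ball_complex)
  finally show ?thesis .
qed

section \<open>Integrals with a holomorphic parameter and Cauchy transforms of discs\<close>

text \<open>Dominated convergence for difference quotients; the Cauchy estimates turn the bound on the integrand
  into a bound on its derivative.\<close>

lemma holomorphic_on_integral_parameter:
  fixes G :: "complex \<Rightarrow> 'b \<Rightarrow> complex"
  assumes U: "open U" and hol: "\<And>w. w \<in> space M \<Longrightarrow> (\<lambda>z. G z w) holomorphic_on U"
    and m: "\<And>z. z \<in> U \<Longrightarrow> G z \<in> borel_measurable M"
    and H: "integrable M H" and bd: "\<And>z w. z \<in> U \<Longrightarrow> w \<in> space M \<Longrightarrow> norm (G z w) \<le> H w"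
  shows "(\<lambda>z. \<integral>w. G z w \<partial>M) holomorphic_on U"
proof (subst holomorphic_on_open[OF U], intro ballI exI)
  fix z0 assume z0: "z0 \<in> U"
  obtain e where e: "e > 0" "ball z0 e \<subseteq> U" using U z0 by (meson openE)
  define r where "r = e / 2"
  have r: "r > 0" using e by (simp add: r_def)
  have sub: "ball z r \<subseteq> U" if "z \<in> ball z0 r" for z
  proof
    fix y assume "y \<in> ball z r"
    with that have "dist z0 y < e" using dist_triangle[of z0 y z] by (auto simp: r_def)
    then show "y \<in> U" using e by auto
  qed
  define d where "d w = deriv (\<lambda>z. G z w) z0" for w
  have G_int: "integrable M (G z)" if "z \<in> U" for z
    by (rule Bochner_Integration.integrable_bound[OF H m[OF that]]) (use bd that in \<open>fastforce intro!: AE_I2\<close>)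
  have lip: "norm (G z w - G z0 w) \<le> H w / r * norm (z - z0)" if "z \<in> ball z0 r" "w \<in> space M" for z w
  proof (rule field_differentiable_bound[where S="ball z0 r" and f="\<lambda>z. G z w" and f'="deriv (\<lambda>z. G z w)"])
    fix y assume y: "y \<in> ball z0 r"
    have yU: "y \<in> U" using sub[OF y] r by auto
    show "((\<lambda>z. G z w) has_field_derivative deriv (\<lambda>z. G z w) y) (at y within ball z0 r)"
      using holomorphic_derivI[OF hol[OF that(2)] U yU] by (rule has_field_derivative_at_within)
    have "norm ((deriv ^^ 1) (\<lambda>z. G z w) y) \<le> fact 1 * H w / r ^ 1"
    proof (rule Cauchy_inequality)
      show "(\<lambda>z. G z w) holomorphic_on ball y r" using holomorphic_on_subset[OF hol[OF that(2)] sub[OF y]] .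
      show "norm (G x w) \<le> H w" if "norm (y - x) = r" for x
      proof -
        have "x \<in> U" using e y that by (intro subsetD[OF e(2)]) (use dist_triangle[of z0 x y] in \<open>auto simp: dist_norm r_def\<close>)
        then show ?thesis using bd \<open>w \<in> space M\<close> by blast
      qed
      have "cball y r \<subseteq> U"
      proof
        fix x assume "x \<in> cball y r"
        then have "x \<in> ball z0 e" using y dist_triangle[of z0 x y] by (auto simp: r_def)
        then show "x \<in> U" using e by blast
      qed
      then show "continuous_on (cball y r) (\<lambda>z. G z w)"
        using holomorphic_on_imp_continuous_on[OF hol[OF that(2)]] continuous_on_subset by blast
    qed (use r in auto)
    then show "norm (deriv (\<lambda>z. G z w) y) \<le> H w / r" by simp
  qed (use that r in auto)
  have lim: "(\<lambda>n. (G (z0 + h n) w - G z0 w) / h n) \<longlonglongrightarrow> d w"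
    if "w \<in> space M" "\<And>n. h n \<noteq> 0" "h \<longlonglongrightarrow> 0" for w h
  proof -
    have "((\<lambda>z. G z w) has_field_derivative d w) (at z0)"
      unfolding d_def by (rule holomorphic_derivI[OF hol[OF that(1)] U z0])
    then have "((\<lambda>k. (G (z0 + k) w - G z0 w) / k) \<longlongrightarrow> d w) (at 0)" by (simp add: DERIV_def)
    then show ?thesis using that by (auto simp: tendsto_at_iff_sequentially o_def)
  qed
  have "((\<lambda>k. ((\<integral>w. G (z0 + k) w \<partial>M) - (\<integral>w. G z0 w \<partial>M)) / k) \<longlongrightarrow> (\<integral>w. d w \<partial>M)) (at 0)"
    unfolding tendsto_at_iff_sequentially
  proof (intro allI impI)
    fix h :: "nat \<Rightarrow> complex" assume h0: "\<forall>n. h n \<in> UNIV - {0}" and "h \<longlonglongrightarrow> 0"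
    then obtain N where N: "\<And>n. n \<ge> N \<Longrightarrow> norm (h n) < r"
      using r LIMSEQ_D[of h 0 r] by auto
    define k where "k n = h (n + N)" for n
    have k: "k n \<noteq> 0" "norm (k n) < r" for n using h0 N by (auto simp: k_def)
    have k0: "k \<longlonglongrightarrow> 0" unfolding k_def using \<open>h \<longlonglongrightarrow> 0\<close> by (rule LIMSEQ_ignore_initial_segment)
    have kb: "z0 + k n \<in> ball z0 r" "z0 + k n \<in> U" for n
      using k(2)[of n] sub[of "z0 + k n"] r by (auto simp: dist_norm)
    have qm: "(\<lambda>w. (G (z0 + k n) w - G z0 w) / k n) \<in> borel_measurable M" for n
      using m[OF z0] m[OF kb(2)] by measurable
    have "(\<lambda>n. \<integral>w. (G (z0 + k n) w - G z0 w) / k n \<partial>M) \<longlonglongrightarrow> (\<integral>w. d w \<partial>M)"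
    proof (rule integral_dominated_convergence)
      show "d \<in> borel_measurable M"
        by (rule borel_measurable_LIMSEQ_metric[OF qm]) (rule lim[OF _ k(1) k0])
      show "integrable M (\<lambda>w. H w / r)" using H by simp
      show "AE w in M. (\<lambda>n. (G (z0 + k n) w - G z0 w) / k n) \<longlonglongrightarrow> d w"
        using lim k k0 by auto
      show "AE w in M. norm ((G (z0 + k n) w - G z0 w) / k n) \<le> H w / r" for n
      proof (rule AE_I2)
        fix w assume "w \<in> space M"
        from lip[OF kb(1) this, of n] show "norm ((G (z0 + k n) w - G z0 w) / k n) \<le> H w / r"
          using k(1)[of n] by (simp add: norm_divide pos_divide_le_eq)
      qed
    qed (rule qm)
    moreover have "(\<integral>w. (G (z0 + k n) w - G z0 w) / k n \<partial>M) = ((\<integral>w. G (z0 + k n) w \<partial>M) - (\<integral>w. G z0 w \<partial>M)) / k n" for n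
      by (simp add: Bochner_Integration.integral_diff[OF G_int[OF kb(2)] G_int[OF z0]])
    ultimately have "(\<lambda>n. ((\<integral>w. G (z0 + k n) w \<partial>M) - (\<integral>w. G z0 w \<partial>M)) / k n) \<longlonglongrightarrow> (\<integral>w. d w \<partial>M)" by (simp only:)
    then show "((\<lambda>k. ((\<integral>w. G (z0 + k) w \<partial>M) - (\<integral>w. G z0 w \<partial>M)) / k) \<circ> h) \<longlonglongrightarrow> (\<integral>w. d w \<partial>M)"
      unfolding k_def o_def by (rule LIMSEQ_offset)
  qed
  then show "((\<lambda>z. \<integral>w. G z w \<partial>M) has_field_derivative (\<integral>w. d w \<partial>M)) (at z0)" by (simp add: DERIV_def)
qed

lemma measurable_Cauchy_kernel [measurable]: "(\<lambda>w. c / (z - w)) \<in> borel_measurable borel" for z :: complex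
  by (intro borel_measurable_divide borel_measurable_diff borel_measurable_const) auto

lemma nn_Cauchy_kernel_le:
  fixes z p :: complex
  assumes "ball p \<rho> \<subseteq> ball z R" "R \<ge> 0"
  shows "(\<integral>\<^sup>+w\<in>ball p \<rho>. ennreal (1 / norm (z - w)) \<partial>lborel) \<le> ennreal (4 * pi * R)"
  by (rule order_trans[OF nn_integral_mono nn_integral_Cauchy_kernel_ball[OF assms(2)]])
    (use assms in \<open>auto simp: indicator_def\<close>)

lemma set_integrable_Cauchy_kernel:
  fixes z p c :: complex
  shows "set_integrable lborel (ball p \<rho>) (\<lambda>w. c / (z - w))"
proof -
  have "(\<integral>\<^sup>+w. ennreal (norm (indicator (ball p \<rho>) w *\<^sub>R (1 / (z - w)))) \<partial>lborel) = (\<integral>\<^sup>+w\<in>ball p \<rho>. ennreal (1 / norm (z - w)) \<partial>lborel)"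
    by (auto intro!: nn_integral_cong simp: indicator_def norm_divide)
  also have "\<dots> \<le> ennreal (4 * pi * (\<bar>\<rho>\<bar> + dist p z))"
    by (rule nn_Cauchy_kernel_le) (auto, smt (verit) dist_commute dist_triangle)
  also have "\<dots> < \<infinity>" by simp
  finally have "integrable lborel (\<lambda>w. indicator (ball p \<rho>) w *\<^sub>R (1 / (z - w)))"
    using measurable_Cauchy_kernel[of 1 z] by (intro integrableI_bounded borel_measurable_scaleR borel_measurable_indicator) auto
  then have "integrable lborel (\<lambda>w. c * (indicator (ball p \<rho>) w *\<^sub>R (1 / (z - w))))" by (rule integrable_mult_right)
  then show ?thesis unfolding set_integrable_def by (simp add: scaleR_conv_of_real mult.commute)
qed

lemma disc_Cauchy_transform_inside:
  fixes z :: complex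
  assumes "0 \<le> s" "s \<le> norm z"
  shows "(LINT w:ball 0 s|lborel. z / (z - w)) = of_real (pi * s\<^sup>2)"
proof (cases "s = 0 \<or> z = 0")
  case True then show ?thesis using assms by (auto simp: set_lebesgue_integral_def)
next
  case False
  then have z: "z \<noteq> 0" and s: "s > 0" using assms by auto
  have *: "(LINT w:ball 0 s'|lborel. z / (z - w)) = of_real (pi * s'\<^sup>2)" if "0 \<le> s'" "s' < norm z" for s'
  proof -
    have "(\<lambda>w. z / (z - w)) holomorphic_on ball 0 (norm z)" by (auto intro!: holomorphic_intros)
    from area_mean_value_0[OF this that] show ?thesis using z by simp
  qed
  define A where "A n = ball (0::complex) (s - s / Suc n)" for n
  have inc: "incseq A" unfolding A_def
    by (intro incseq_SucI subset_ball) (use s in \<open>auto intro!: divide_left_mono\<close>)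
  have un: "(\<Union>n. A n) = ball 0 s"
  proof
    show "(\<Union>n. A n) \<subseteq> ball 0 s" unfolding A_def
      by (intro UN_least subset_ball) (use s in simp)
    show "ball 0 s \<subseteq> (\<Union>n. A n)"
    proof
      fix w :: complex assume "w \<in> ball 0 s"
      then have "0 < (s - norm w) / s" using s by simp
      then obtain n where "inverse (real (Suc n)) < (s - norm w) / s" using reals_Archimedean by blast
      then have "s / Suc n < s - norm w" using s by (simp add: field_simps)
      then show "w \<in> (\<Union>n. A n)" by (auto simp: A_def intro!: exI[of _ n])
    qed
  qed
  have "(\<lambda>n. LINT w:A n|lborel. z / (z - w)) \<longlonglongrightarrow> (LINT w:(\<Union>n. A n)|lborel. z / (z - w))"
    by (rule set_integral_cont_up[OF _ inc]) (unfold un, auto simp: A_def set_integrable_Cauchy_kernel)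
  moreover have "(\<lambda>n. LINT w:A n|lborel. z / (z - w)) = (\<lambda>n. of_real (pi * (s - s / Suc n)\<^sup>2))"
  proof
    fix n
    have "s / Suc n \<le> s" "s / Suc n > 0" using s by (auto simp: divide_le_eq)
    then show "(LINT w:A n|lborel. z / (z - w)) = of_real (pi * (s - s / Suc n)\<^sup>2)"
      unfolding A_def using assms by (intro *) auto
  qed
  moreover have "(\<lambda>n. complex_of_real (pi * (s - s / Suc n)\<^sup>2)) \<longlonglongrightarrow> of_real (pi * (s - 0)\<^sup>2)"
    by (intro tendsto_intros LIMSEQ_Suc[OF lim_const_over_n])
  ultimately show ?thesis unfolding un by (metis LIMSEQ_unique diff_zero)
qed

lemma disc_Cauchy_transform_annulus:
  fixes z :: complex
  assumes "norm z < \<rho>" "z \<noteq> 0"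
  shows "(LINT w:{w. norm z < norm w \<and> norm w < \<rho>}|lborel. z / (z - w)) = 0"
proof -
  define A where "A n = {w::complex. norm z + 1 / Suc n < norm w \<and> norm w < \<rho>}" for n
  have z0: "norm z > 0" using assms by simp
  have A[measurable]: "A n \<in> sets borel" for n unfolding A_def by measurable
  have 0: "(LINT w:A n|lborel. z / (z - w)) = 0" for n
  proof -
    define q where "q = norm z / (norm z + 1 / Suc n)"
    have q: "0 \<le> q" "q < 1" using z0 unfolding q_def by (simp, subst divide_less_eq_1_pos) (auto intro: add_pos_pos)
    have wq: "norm (z * inverse w) \<le> q" if "w \<in> A n" for w
    proof -
      have "norm z * inverse (norm w) \<le> norm z * inverse (norm z + 1 / Suc n)"
        using that z0 by (intro mult_left_mono le_imp_inverse_le) (auto simp: A_def add_pos_pos)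
      then show ?thesis by (simp add: q_def norm_mult norm_inverse divide_inverse)
    qed
    define \<phi> where "\<phi> k w = (if k = 0 then 0 else - ((z * inverse w) ^ k))" for k :: nat and w
    have Ab: "A n \<subseteq> ball 0 \<rho>" by (auto simp: A_def)
    have fin: "emeasure lborel (A n) < \<infinity>"
      using emeasure_mono[OF Ab, of lborel] assms norm_ge_zero[of z] by (auto simp: emeasure_ball_complex less_top[symmetric] top_unique)
    have "(LINT w:A n|lborel. (\<Sum>k. \<phi> k w)) = (LINT w:A n|lborel. \<phi> 0 w)"
    proof (rule set_integral_series[OF _ fin, where M="\<lambda>k. q ^ k"])
      show "summable (\<lambda>k. q ^ k)" using q by (simp add: summable_geometric)
      show "norm (\<phi> k w) \<le> q ^ k" if "w \<in> A n" for k w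
        using power_mono[OF wq[OF that], of k] q by (auto simp: \<phi>_def norm_power)
      show "(LINT w:A n|lborel. \<phi> k w) = 0" if "k > 0" for k
      proof -
        have "\<phi> k = (\<lambda>w. - (z ^ k) * inverse w ^ k)" using that by (auto simp: \<phi>_def power_mult_distrib)
        then obtain c where "\<phi> k = (\<lambda>w. c * inverse w ^ k)" by blast
        then show ?thesis using set_integral_rotate_power(2)[OF A _ that, of n] by (simp add: A_def norm_mult)
      qed
      show "\<phi> k \<in> borel_measurable borel" for k unfolding \<phi>_def by (cases "k = 0") auto
    qed simp
    moreover have "(LINT w:A n|lborel. (\<Sum>k. \<phi> k w)) = (LINT w:A n|lborel. z / (z - w))"
    proof (rule set_lebesgue_integral_cong, simp, intro allI impI)
      fix w assume w: "w \<in> A n"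
      define x where "x = z * inverse w"
      have "norm w > norm z" using w divide_pos_pos[of 1 "real (Suc n)"] unfolding A_def mem_Collect_eq by linarith
      then have w0: "w \<noteq> 0" "w \<noteq> z" by auto
      have x: "norm x < 1" using wq[OF w] q by (simp add: x_def)
      have "(\<lambda>k. x ^ k) sums (1 / (1 - x))" by (rule geometric_sums[OF x])
      then have "(\<lambda>k. (if k = 0 then 1 else 0) - x ^ k) sums (1 - 1 / (1 - x))"
        by (intro sums_diff sums_single[of 0 "\<lambda>_. 1", simplified])
      moreover have "(if k = 0 then 1 else 0) - x ^ k = \<phi> k w" for k by (simp add: \<phi>_def x_def)
      moreover have "1 - 1 / (1 - x) = z / (z - w)"
      proof -
        have "x \<noteq> 1" using x by auto
        have "z = x * w" using w0 by (simp add: x_def)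
        then show ?thesis using w0 \<open>x \<noteq> 1\<close> by (simp add: field_simps)
      qed
      ultimately show "(\<Sum>k. \<phi> k w) = z / (z - w)" by (simp add: sums_iff)
    qed
    ultimately show ?thesis by (simp add: \<phi>_def)
  qed
  have inc: "incseq A" unfolding A_def
    by (intro incseq_SucI Collect_mono conj_mono impI) (auto elim!: order.strict_trans1[rotated] simp: frac_le)
  have un: "(\<Union>n. A n) = {w. norm z < norm w \<and> norm w < \<rho>}"
  proof
    have "norm w > norm z" if "norm z + 1 / real (Suc n) < norm w" for w :: complex and n
      using that divide_pos_pos[of 1 "real (Suc n)"] by linarith
    then show "(\<Union>n. A n) \<subseteq> {w. norm z < norm w \<and> norm w < \<rho>}" unfolding A_def by blast
    show "{w. norm z < norm w \<and> norm w < \<rho>} \<subseteq> (\<Union>n. A n)"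
    proof
      fix w :: complex assume w: "w \<in> {w. norm z < norm w \<and> norm w < \<rho>}"
      then obtain n where "inverse (real (Suc n)) < norm w - norm z" using reals_Archimedean[of "norm w - norm z"] by auto
      then show "w \<in> (\<Union>n. A n)" using w by (auto simp: A_def inverse_eq_divide intro!: exI[of _ n])
    qed
  qed
  have "(\<lambda>n. LINT w:A n|lborel. z / (z - w)) \<longlonglongrightarrow> (LINT w:(\<Union>n. A n)|lborel. z / (z - w))"
  proof (rule set_integral_cont_up[OF _ inc])
    show "set_integrable lborel (\<Union>n. A n) (\<lambda>w. z / (z - w))"
      by (rule set_integrable_subset[OF set_integrable_Cauchy_kernel[of 0 \<rho>]]) (auto simp: un)
  qed auto
  then show ?thesis by (simp add: 0 un LIMSEQ_const_iff)
qed

lemma disc_Cauchy_transform_0: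
  fixes z :: complex
  assumes "\<rho> \<ge> 0"
  shows "(LINT w:ball 0 \<rho>|lborel. z / (z - w)) = of_real (pi * min (\<rho>\<^sup>2) ((norm z)\<^sup>2))"
proof (cases "z = 0 \<or> \<rho> \<le> norm z")
  case True
  then show ?thesis using disc_Cauchy_transform_inside[OF assms] assms
    by (auto simp: min_def dest: power_mono[where n=2])
next
  case False
  then have z: "z \<noteq> 0" and lt: "norm z < \<rho>" by auto
  define B where "B = {w::complex. norm z < norm w \<and> norm w < \<rho>}"
  have [measurable]: "B \<in> sets borel" unfolding B_def by measurable
  have iB: "set_integrable lborel B (\<lambda>w. z / (z - w))"
    by (rule set_integrable_subset[OF set_integrable_Cauchy_kernel[of 0 \<rho>]]) (auto simp: B_def)
  have "(LINT w:ball 0 \<rho>|lborel. z / (z - w)) = (LINT w:ball 0 (norm z) \<union> B|lborel. z / (z - w))"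
  proof (rule set_integral_cong_set)
    show "set_borel_measurable lborel (ball 0 \<rho>) (\<lambda>w. z / (z - w))"
      "set_borel_measurable lborel (ball 0 (norm z) \<union> B) (\<lambda>w. z / (z - w))"
      using measurable_Cauchy_kernel[of z z]
      by (auto simp: set_borel_measurable_def intro!: borel_measurable_scaleR borel_measurable_indicator)
    show "AE w in lborel. w \<in> ball 0 (norm z) \<union> B \<longleftrightarrow> w \<in> ball 0 \<rho>"
      using AE_not_in[OF null_sphere[of 0 "norm z"]] by eventually_elim (use lt in \<open>auto simp: B_def\<close>)
  qed
  also have "\<dots> = (LINT w:ball 0 (norm z)|lborel. z / (z - w)) + (LINT w:B|lborel. z / (z - w))"
    by (rule set_integral_Un) (auto simp: B_def[symmetric] iB set_integrable_Cauchy_kernel, auto simp: B_def)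
  also have "\<dots> = of_real (pi * (norm z)\<^sup>2)"
    using disc_Cauchy_transform_annulus[OF lt z] disc_Cauchy_transform_inside[of "norm z" z] by (simp add: B_def)
  moreover have "min (\<rho>\<^sup>2) ((norm z)\<^sup>2) = (norm z)\<^sup>2" using lt by (intro min_absorb2 power_mono) auto
  ultimately show ?thesis by simp
qed

text \<open>The average of \<open>z / (z - w)\<close> over a circle about \<open>0\<close> is 1 or 0 according to whether \<open>z\<close> lies
  outside or inside that circle.\<close>

lemma disc_Cauchy_transform:
  fixes z p :: complex
  assumes "\<rho> \<ge> 0"
  shows "(LINT w:ball p \<rho>|lborel. (z - p) / (z - w)) = of_real (pi * min (\<rho>\<^sup>2) ((norm (z - p))\<^sup>2))"
proof -
  have "(LINT w:ball p \<rho>|lborel. (z - p) / (z - w)) = (\<integral>w. indicator (ball p \<rho>) w *\<^sub>R ((z - p) / (z - w)) \<partial>distr lborel borel ((+) p))"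
    by (simp add: lborel_distr_plus set_lebesgue_integral_def)
  also have "\<dots> = (\<integral>w. indicator (ball p \<rho>) (p + w) *\<^sub>R ((z - p) / (z - (p + w))) \<partial>lborel)"
    using measurable_Cauchy_kernel[of "z - p" z] by (subst integral_distr) (auto intro!: borel_measurable_scaleR borel_measurable_indicator)
  also have "\<dots> = (LINT w:ball 0 \<rho>|lborel. (z - p) / ((z - p) - w))"
    unfolding set_lebesgue_integral_def
    by (intro Bochner_Integration.integral_cong) (auto simp: indicator_def dist_norm diff_diff_eq)
  finally show ?thesis using disc_Cauchy_transform_0[OF assms, of "z - p"] by simp
qed

text \<open>Schur's test: the kernel \<open>1 / \<bar>z - w\<bar>\<close> has uniformly bounded integrals over discs in either
  variable, so convolution with it is bounded on \<open>L\<^sup>2\<close> of a disc.\<close>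

lemma Cauchy_transform_L2:
  fixes p :: complex and u :: "complex \<Rightarrow> complex"
  assumes u[measurable]: "u \<in> borel_measurable borel" and supp: "\<And>w. w \<notin> ball p \<rho> \<Longrightarrow> u w = 0"
    and "0 \<le> \<rho>" "0 \<le> R"
  shows "(\<integral>\<^sup>+z\<in>ball p R. ennreal ((norm (\<integral>w. u w / (z - w) \<partial>lborel))\<^sup>2) \<partial>lborel)
     \<le> ennreal (4 * pi * (R + \<rho>)) * ennreal (4 * pi * (R + \<rho>)) * (\<integral>\<^sup>+w. ennreal ((norm (u w))\<^sup>2) \<partial>lborel)"
proof -
  let ?A = "ennreal (4 * pi * (R + \<rho>))"
  define k where "k z w = ennreal (1 / norm (z - w))" for z w :: complex
  have bm[measurable]: "ball p R \<in> sets borel" by simp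
  have km[measurable]: "(\<lambda>(z, w). k z w) \<in> borel_measurable (lborel \<Otimes>\<^sub>M lborel)" unfolding k_def split_beta' by measurable
  have pt: "ennreal ((norm (\<integral>w. u w / (z - w) \<partial>lborel))\<^sup>2) \<le> ?A * (\<integral>\<^sup>+w. ennreal ((norm (u w))\<^sup>2) * k z w \<partial>lborel)"
    if z: "z \<in> ball p R" for z
  proof -
    have "ennreal (norm (\<integral>w. u w / (z - w) \<partial>lborel)) \<le> (\<integral>\<^sup>+w. ennreal (norm (u w / (z - w))) \<partial>lborel)"
      by (cases "integrable lborel (\<lambda>w. u w / (z - w))") (auto intro: integral_norm_bound_ennreal simp: not_integrable_integral_eq)
    also have "\<dots> = (\<integral>\<^sup>+w. ennreal (norm (u w) * sqrt (1 / norm (z - w))) * ennreal (indicator (ball p \<rho>) w * sqrt (1 / norm (z - w))) \<partial>lborel)"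
      by (intro nn_integral_cong) (auto simp: indicator_def supp ennreal_mult[symmetric] norm_divide mult.assoc)
    finally have "(ennreal (norm (\<integral>w. u w / (z - w) \<partial>lborel)))\<^sup>2 \<le> (\<integral>\<^sup>+w. ennreal (norm (u w) * sqrt (1 / norm (z - w))) * ennreal (indicator (ball p \<rho>) w * sqrt (1 / norm (z - w))) \<partial>lborel)\<^sup>2"
      by (rule power_mono) simp
    also have "\<dots> \<le> (\<integral>\<^sup>+w. (ennreal (norm (u w) * sqrt (1 / norm (z - w))))\<^sup>2 \<partial>lborel) * (\<integral>\<^sup>+w. (ennreal (indicator (ball p \<rho>) w * sqrt (1 / norm (z - w))))\<^sup>2 \<partial>lborel)"
      by (rule Cauchy_Schwarz_nn_integral) (auto intro!: borel_measurable_times borel_measurable_indicator)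
    also have "\<dots> \<le> (\<integral>\<^sup>+w. (ennreal (norm (u w) * sqrt (1 / norm (z - w))))\<^sup>2 \<partial>lborel) * ?A"
    proof (rule mult_left_mono)
      have "(\<integral>\<^sup>+w. (ennreal (indicator (ball p \<rho>) w * sqrt (1 / norm (z - w))))\<^sup>2 \<partial>lborel) = (\<integral>\<^sup>+w\<in>ball p \<rho>. ennreal (1 / norm (z - w)) \<partial>lborel)"
        by (intro nn_integral_cong) (auto simp: indicator_def ennreal_power)
      also have "\<dots> \<le> ?A"
        by (rule nn_Cauchy_kernel_le) (use z assms in \<open>auto\<close>, smt (verit) dist_commute dist_triangle)
      finally show "(\<integral>\<^sup>+w. (ennreal (indicator (ball p \<rho>) w * sqrt (1 / norm (z - w))))\<^sup>2 \<partial>lborel) \<le> ?A" .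
    qed simp
    also have "(\<integral>\<^sup>+w. (ennreal (norm (u w) * sqrt (1 / norm (z - w))))\<^sup>2 \<partial>lborel) = (\<integral>\<^sup>+w. ennreal ((norm (u w))\<^sup>2) * k z w \<partial>lborel)"
      by (intro nn_integral_cong) (auto simp: k_def ennreal_power power_mult_distrib ennreal_mult)
    finally show ?thesis by (simp add: ennreal_power mult.commute)
  qed
  have 1: "(\<integral>\<^sup>+z\<in>ball p R. ennreal ((norm (\<integral>w. u w / (z - w) \<partial>lborel))\<^sup>2) \<partial>lborel)
      \<le> (\<integral>\<^sup>+z. ?A * (\<integral>\<^sup>+w. ennreal ((norm (u w))\<^sup>2) * k z w * indicator (ball p R) z \<partial>lborel) \<partial>lborel)"
    by (intro nn_integral_mono) (use pt in \<open>auto simp: indicator_def\<close>)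
  have 2: "(\<integral>\<^sup>+z. ?A * (\<integral>\<^sup>+w. ennreal ((norm (u w))\<^sup>2) * k z w * indicator (ball p R) z \<partial>lborel) \<partial>lborel) = ?A * (\<integral>\<^sup>+z. (\<integral>\<^sup>+w. ennreal ((norm (u w))\<^sup>2) * k z w * indicator (ball p R) z \<partial>lborel) \<partial>lborel)"
    by (rule nn_integral_cmult) measurable
  have "(\<integral>\<^sup>+z. (\<integral>\<^sup>+w. ennreal ((norm (u w))\<^sup>2) * k z w * indicator (ball p R) z \<partial>lborel) \<partial>lborel)
      = (\<integral>\<^sup>+w. (\<integral>\<^sup>+z. ennreal ((norm (u w))\<^sup>2) * k z w * indicator (ball p R) z \<partial>lborel) \<partial>lborel)"
    by (rule lborel_pair.Fubini'[symmetric]) measurable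
  also have "\<dots> \<le> (\<integral>\<^sup>+w. ennreal ((norm (u w))\<^sup>2) * ?A \<partial>lborel)"
  proof (rule nn_integral_mono)
    fix w
    have "(\<integral>\<^sup>+z. ennreal ((norm (u w))\<^sup>2) * k z w * indicator (ball p R) z \<partial>lborel) = ennreal ((norm (u w))\<^sup>2) * (\<integral>\<^sup>+z\<in>ball p R. k z w \<partial>lborel)"
      unfolding mult.assoc by (rule nn_integral_cmult) measurable
    also have "\<dots> \<le> ennreal ((norm (u w))\<^sup>2) * ?A"
    proof (cases "w \<in> ball p \<rho>")
      case True
      have "(\<integral>\<^sup>+z\<in>ball p R. ennreal (1 / norm (w - z)) \<partial>lborel) \<le> ?A"
        by (rule nn_Cauchy_kernel_le) (use True assms in \<open>auto\<close>, smt (verit) dist_commute dist_triangle)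
      then show ?thesis by (intro mult_left_mono) (auto simp: k_def norm_minus_commute)
    qed (simp add: supp)
    finally show "(\<integral>\<^sup>+z. ennreal ((norm (u w))\<^sup>2) * k z w * indicator (ball p R) z \<partial>lborel) \<le> ennreal ((norm (u w))\<^sup>2) * ?A" .
  qed
  also have "\<dots> = (\<integral>\<^sup>+w. ennreal ((norm (u w))\<^sup>2) \<partial>lborel) * ?A" by (rule nn_integral_multc) measurable
  finally have 3: "(\<integral>\<^sup>+z. (\<integral>\<^sup>+w. ennreal ((norm (u w))\<^sup>2) * k z w * indicator (ball p R) z \<partial>lborel) \<partial>lborel) \<le> (\<integral>\<^sup>+w. ennreal ((norm (u w))\<^sup>2) \<partial>lborel) * ?A" .
  show ?thesis
    using order_trans[OF 1[unfolded 2] mult_left_mono[OF 3, of ?A]] by (simp add: ac_simps)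
qed

section \<open>Square integrable holomorphic functions on plane domains\<close>

definition L2hol :: "complex set \<Rightarrow> (complex \<Rightarrow> complex) set" where
  "L2hol \<Omega> = {f. f holomorphic_on \<Omega> \<and> (\<integral>\<^sup>+z\<in>\<Omega>. ennreal ((norm (f z))\<^sup>2) \<partial>lborel) < \<infinity>}"

lemma measurable_L2_integrand:
  fixes f :: "complex \<Rightarrow> complex"
  assumes "continuous_on \<Omega> f" and m[measurable]: "\<Omega> \<in> sets borel"
  shows "(\<lambda>z. indicator \<Omega> z *\<^sub>R f z) \<in> borel_measurable borel"
    and "(\<lambda>z. ennreal ((norm (f z))\<^sup>2) * indicator \<Omega> z) \<in> borel_measurable borel"
proof -
  show 1: "(\<lambda>z. indicator \<Omega> z *\<^sub>R f z) \<in> borel_measurable borel"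
    using assms by (intro borel_measurable_continuous_on_indicator)
  have "(\<lambda>z. ennreal ((norm (f z))\<^sup>2) * indicator \<Omega> z) = (\<lambda>z. ennreal ((norm (indicator \<Omega> z *\<^sub>R f z))\<^sup>2))"
    by (auto simp: indicator_def)
  moreover have "(\<lambda>z. ennreal ((norm (indicator \<Omega> z *\<^sub>R f z))\<^sup>2)) \<in> borel_measurable borel"
    using 1 by measurable
  ultimately show "(\<lambda>z. ennreal ((norm (f z))\<^sup>2) * indicator \<Omega> z) \<in> borel_measurable borel"
    by (simp only:)
qed

lemma nn_integral_norm_add_sq:
  assumes "(\<integral>\<^sup>+z\<in>S. ennreal ((norm (f z))\<^sup>2) \<partial>M) < \<infinity>" "(\<integral>\<^sup>+z\<in>S. ennreal ((norm (g z))\<^sup>2) \<partial>M) < \<infinity>"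
    and [measurable]: "(\<lambda>z. ennreal ((norm (f z))\<^sup>2) * indicator S z) \<in> borel_measurable M"
      "(\<lambda>z. ennreal ((norm (g z))\<^sup>2) * indicator S z) \<in> borel_measurable M"
  shows "(\<integral>\<^sup>+z\<in>S. ennreal ((norm (f z + g z))\<^sup>2) \<partial>M) < \<infinity>"
proof -
  have "(\<integral>\<^sup>+z\<in>S. ennreal ((norm (f z + g z))\<^sup>2) \<partial>M)
    \<le> (\<integral>\<^sup>+z. 2 * (ennreal ((norm (f z))\<^sup>2) * indicator S z) + 2 * (ennreal ((norm (g z))\<^sup>2) * indicator S z) \<partial>M)"
  proof (rule nn_integral_mono)
    fix z
    have "(norm (f z + g z))\<^sup>2 \<le> (norm (f z) + norm (g z))\<^sup>2"
      by (intro power_mono norm_triangle_ineq) auto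
    also have "\<dots> \<le> 2 * (norm (f z))\<^sup>2 + 2 * (norm (g z))\<^sup>2"
      using sum_squares_bound[of "norm (f z)" "norm (g z)"] by (simp add: power2_sum)
    finally have "ennreal ((norm (f z + g z))\<^sup>2) \<le> ennreal (2 * (norm (f z))\<^sup>2 + 2 * (norm (g z))\<^sup>2)"
      by (rule ennreal_leI)
    also have "\<dots> = 2 * ennreal ((norm (f z))\<^sup>2) + 2 * ennreal ((norm (g z))\<^sup>2)"
      by (simp add: ennreal_mult)
    finally show "ennreal ((norm (f z + g z))\<^sup>2) * indicator S z \<le> 2 * (ennreal ((norm (f z))\<^sup>2) * indicator S z) + 2 * (ennreal ((norm (g z))\<^sup>2) * indicator S z)"
      by (simp add: indicator_def)
  qed
  also have "\<dots> < \<infinity>"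
    using assms by (subst nn_integral_add; (simp add: nn_integral_cmult ennreal_mult_less_top)?)
  finally show ?thesis .
qed

lemma nn_integral_norm_cmult_sq:
  assumes "(\<integral>\<^sup>+z\<in>S. ennreal ((norm (f z))\<^sup>2) \<partial>M) < \<infinity>" "\<And>z. z \<in> S \<Longrightarrow> norm (g z) \<le> C * norm (f z)"
    and [measurable]: "(\<lambda>z. ennreal ((norm (f z))\<^sup>2) * indicator S z) \<in> borel_measurable M"
  shows "(\<integral>\<^sup>+z\<in>S. ennreal ((norm (g z))\<^sup>2) \<partial>M) < \<infinity>"
proof -
  have "(\<integral>\<^sup>+z\<in>S. ennreal ((norm (g z))\<^sup>2) \<partial>M) \<le> (\<integral>\<^sup>+z. ennreal (C\<^sup>2) * (ennreal ((norm (f z))\<^sup>2) * indicator S z) \<partial>M)"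
    using assms(2) by (intro nn_integral_mono)
      (auto simp: indicator_def ennreal_mult[symmetric] power_mult_distrib[symmetric] intro!: ennreal_leI power_mono)
  also have "\<dots> < \<infinity>" using assms by (simp add: nn_integral_cmult ennreal_mult_less_top)
  finally show ?thesis .
qed

lemma L2hol_bounded_mult:
  assumes "f \<in> L2hol \<Omega>" "g holomorphic_on \<Omega>" "open \<Omega>" "\<And>z. z \<in> \<Omega> \<Longrightarrow> norm (g z) \<le> C"
  shows "(\<lambda>z. g z * f z) \<in> L2hol \<Omega>"
proof -
  have m: "(\<lambda>z. ennreal ((norm (f z))\<^sup>2) * indicator \<Omega> z) \<in> borel_measurable lborel"
    using measurable_L2_integrand(2)[of \<Omega> f] assms
    by (auto simp: L2hol_def holomorphic_on_imp_continuous_on)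
  have "(\<integral>\<^sup>+z\<in>\<Omega>. ennreal ((norm (g z * f z))\<^sup>2) \<partial>lborel) < \<infinity>"
    by (rule nn_integral_norm_cmult_sq[OF _ _ m, where C=C])
      (use assms in \<open>auto simp: L2hol_def norm_mult intro!: mult_right_mono\<close>)
  then show ?thesis using assms by (auto simp: L2hol_def intro!: holomorphic_intros)
qed

text \<open>Finite dimensionality of the Bergman space, phrased without a notion of dimension.\<close>

definition L2hol_finite_dim :: "complex set \<Rightarrow> nat \<Rightarrow> bool" where
  "L2hol_finite_dim \<Omega> N \<longleftrightarrow> (\<forall>F. (\<forall>i<N. F i \<in> L2hol \<Omega>) \<longrightarrow>
     (\<exists>c::nat \<Rightarrow> complex. (\<exists>i<N. c i \<noteq> 0) \<and> (\<forall>z\<in>\<Omega>. (\<Sum>i<N. c i * F i z) = 0)))"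

subsection \<open>Cauchy transforms\<close>

definition cauchy_transform :: "(complex \<Rightarrow> complex) \<Rightarrow> complex \<Rightarrow> complex" where
  "cauchy_transform u z = (\<integral>w. u w / (z - w) \<partial>lborel)"

lemma cauchy_transform_holomorphic:
  assumes u: "integrable lborel u" and K: "closed K" "\<And>w. w \<notin> K \<Longrightarrow> u w = 0"
  shows "cauchy_transform u holomorphic_on (- K)"
proof (subst holomorphic_on_open)
  show "open (- K)" using K by auto
  show "\<forall>z\<in>- K. \<exists>f'. (cauchy_transform u has_field_derivative f') (at z)"
  proof
    fix z0 assume "z0 \<in> - K"
    then obtain e where e: "e > 0" "ball z0 e \<subseteq> - K" using K by (metis openE open_Compl)
    have "(\<lambda>z. \<integral>w. u w / (z - w) \<partial>lborel) holomorphic_on ball z0 (e/2)"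
    proof (rule holomorphic_on_integral_parameter)
      show "integrable lborel (\<lambda>w. norm (u w) * (2 / e))" using u by simp
      fix w :: complex
      have far: "norm (z - w) \<ge> e / 2" if "w \<in> K" "z \<in> ball z0 (e/2)" for z
      proof -
        have "dist z0 w \<ge> e" using e that by (metis ComplD linorder_not_less mem_ball subsetD)
        then show ?thesis using that dist_triangle[of z0 w z] by (auto simp: dist_norm)
      qed
      show "(\<lambda>z. u w / (z - w)) holomorphic_on ball z0 (e/2)"
      proof (cases "w \<in> K")
        case True then show ?thesis using far e by (intro holomorphic_intros) fastforce
      qed (auto simp: K)
      fix z assume z: "z \<in> ball z0 (e/2)"
      show "(\<lambda>w. u w / (z - w)) \<in> borel_measurable lborel"
        using u measurable_Cauchy_kernel[of 1 z] borel_measurable_times[of u lborel "\<lambda>w. 1 / (z - w)"] by (auto dest: borel_measurable_integrable)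
      show "norm (u w / (z - w)) \<le> norm (u w) * (2 / e)"
      proof (cases "w \<in> K")
        case True
        have "norm (u w) / norm (z - w) \<le> norm (u w) / (e / 2)"
          using far[OF True z] e by (intro divide_left_mono mult_pos_pos) auto
        then show ?thesis by (simp add: norm_divide)
      qed (auto simp: K)
    qed auto
    then have "cauchy_transform u holomorphic_on ball z0 (e/2)" unfolding cauchy_transform_def .
    then show "\<exists>f'. (cauchy_transform u has_field_derivative f') (at z0)"
      using e by (metis centre_in_ball half_gt_zero holomorphic_derivI open_ball)
  qed
qed

lemma divided_difference:
  fixes g :: "complex \<Rightarrow> complex"
  assumes "g holomorphic_on S" "open S" "w \<in> S"
  shows "(\<lambda>z. if z = w then deriv g w else (g z - g w) / (z - w)) holomorphic_on S"
proof -
  have "(\<lambda>z. if z = w then deriv g w else g z / (z - w) - g w / (z - w)) holomorphic_on S"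
    by (rule pole_theorem_open[OF assms(1,2)]) auto
  then show ?thesis by (simp add: diff_divide_distrib cong: if_cong)
qed

text \<open>The singularity of the divided difference at \<open>z = w\<close> is removable, and its values are bounded by those of the
  derivative.\<close>

lemma integral_divided_difference_holomorphic:
  assumes g: "g holomorphic_on ball z0 (2 * r)" and r: "r > 0" and A: "A \<in> sets borel" "A \<subseteq> ball z0 r"
  shows "(\<lambda>z. LINT w:A|lborel. (g z - g w) / (z - w)) holomorphic_on ball z0 r"
proof -
  have sub: "cball z0 r \<subseteq> ball z0 (2 * r)" using r by auto
  have "continuous_on (cball z0 r) (deriv g)"
    using holomorphic_deriv[OF g] sub by (meson continuous_on_subset holomorphic_on_imp_continuous_on open_ball)
  then obtain M where M: "\<And>z. z \<in> cball z0 r \<Longrightarrow> norm (deriv g z) \<le> M"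
    using compact_continuous_image[of "cball z0 r" "deriv g"] compact_imp_bounded
    by (metis bounded_iff compact_cball image_eqI)
  have lip: "norm (g z - g w) \<le> M * norm (z - w)" if "z \<in> ball z0 r" "w \<in> ball z0 r" for z w
  proof (rule field_differentiable_bound[where S="ball z0 r" and f'="deriv g"])
    fix y assume "y \<in> ball z0 r"
    then show "(g has_field_derivative deriv g y) (at y within ball z0 r)"
      using holomorphic_derivI[OF g open_ball, of y] r has_field_derivative_at_within by force
    show "norm (deriv g y) \<le> M" using M \<open>y \<in> ball z0 r\<close> by auto
  qed (use that in auto)
  define G where "G z w = (if w \<in> A then (if z = w then deriv g w else (g z - g w) / (z - w)) else 0)" for z w
  have gm: "(\<lambda>w. indicator A w *\<^sub>R g w) \<in> borel_measurable borel"
    by (rule measurable_L2_integrand(1)[OF _ A(1)]) (rule holomorphic_on_imp_continuous_on[OF holomorphic_on_subset[OF g subset_trans[OF A(2) subset_trans[OF ball_subset_cball sub]]]])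
  have cm: "(\<lambda>w. indicator A w *\<^sub>R g z) \<in> borel_measurable borel" for z
    using A(1) by (intro borel_measurable_scaleR borel_measurable_indicator) auto
  have Gm: "G z \<in> borel_measurable borel" for z
  proof -
    have "(\<lambda>w. if w = z then indicator A z *\<^sub>R deriv g z else (indicator A w *\<^sub>R (g z) - indicator A w *\<^sub>R g w) * (1 / (z - w))) \<in> borel_measurable borel"
      by (intro measurable_If borel_measurable_times borel_measurable_diff cm gm measurable_Cauchy_kernel) auto
    moreover have "(\<lambda>w. if w = z then indicator A z *\<^sub>R deriv g z else (indicator A w *\<^sub>R (g z) - indicator A w *\<^sub>R g w) * (1 / (z - w))) = G z"
      by (auto simp: G_def fun_eq_iff indicator_def)
    ultimately show ?thesis by simp
  qed
  have "(\<lambda>z. \<integral>w. G z w \<partial>lborel) holomorphic_on ball z0 r"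
  proof (rule holomorphic_on_integral_parameter)
    show "integrable lborel (\<lambda>w. M * indicator A w)"
    proof (intro integrable_mult_right integrable_real_indicator)
      show "emeasure lborel A < \<infinity>" using emeasure_mono[OF A(2), of lborel] r
        by (auto simp: emeasure_ball_complex less_top[symmetric] top_unique)
    qed (use A in auto)
    fix w :: complex
    show "(\<lambda>z. G z w) holomorphic_on ball z0 r"
    proof (cases "w \<in> A")
      case True
      have "g holomorphic_on ball z0 r" using g sub by (meson ball_subset_cball holomorphic_on_subset)
      then have "(\<lambda>z. if z = w then deriv g w else (g z - g w) / (z - w)) holomorphic_on ball z0 r"
        using True A by (intro divided_difference) auto
      then show ?thesis using True by (simp add: G_def)
    qed (auto simp: G_def)
    fix z assume z: "z \<in> ball z0 r"
    show "norm (G z w) \<le> M * indicator A w"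
    proof (cases "w \<in> A")
      case True
      then have w: "w \<in> ball z0 r" using A by auto
      show ?thesis using lip[OF z w] M[of w] w True by (auto simp: G_def norm_divide divide_le_eq)
    qed (auto simp: G_def)
  qed (use Gm in auto)
  moreover have "(LINT w:A|lborel. (g z - g w) / (z - w)) = (\<integral>w. G z w \<partial>lborel)" for z
  proof -
    have "AE w in lborel. w \<noteq> z" by (rule AE_lborel_singleton)
    then have ae: "AE w in lborel. indicator A w *\<^sub>R ((g z - g w) / (z - w)) = G z w"
      by eventually_elim (auto simp: G_def)
    have m: "(\<lambda>w. indicator A w *\<^sub>R ((g z - g w) / (z - w))) \<in> borel_measurable lborel"
    proof -
      have "(\<lambda>w. (indicator A w *\<^sub>R (g z) - indicator A w *\<^sub>R g w) * (1 / (z - w))) \<in> borel_measurable borel"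
        by (intro borel_measurable_times borel_measurable_diff cm[of z] gm measurable_Cauchy_kernel)
      moreover have "(\<lambda>w. (indicator A w *\<^sub>R (g z) - indicator A w *\<^sub>R g w) * (1 / (z - w))) = (\<lambda>w. indicator A w *\<^sub>R ((g z - g w) / (z - w)))"
        by (auto simp: indicator_def)
      ultimately show ?thesis by simp
    qed
    show ?thesis unfolding set_lebesgue_integral_def
      by (rule integral_cong_AE[OF m _ ae]) (use Gm in auto)
  qed
  ultimately show ?thesis by simp
qed

subsection \<open>Localisation of singularities\<close>

lemma localised_integrable:
  assumes f: "f \<in> L2hol \<Omega>" and \<Omega>: "open \<Omega>"
  shows "integrable lborel (\<lambda>w. indicator (\<Omega> \<inter> ball p \<rho>) w *\<^sub>R (f w * (w - p)))"
    and "(\<integral>\<^sup>+w. ennreal ((norm (indicator (\<Omega> \<inter> ball p \<rho>) w *\<^sub>R (f w * (w - p))))\<^sup>2) \<partial>lborel) < \<infinity>"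
proof -
  have hol: "f holomorphic_on \<Omega>" and fin: "(\<integral>\<^sup>+z\<in>\<Omega>. ennreal ((norm (f z))\<^sup>2) \<partial>lborel) < \<infinity>"
    using f by (auto simp: L2hol_def)
  have c: "continuous_on \<Omega> f" using hol by (rule holomorphic_on_imp_continuous_on)
  have \<Omega>b: "\<Omega> \<inter> ball p \<rho> \<in> sets borel" using \<Omega> by auto
  have m: "(\<lambda>w. indicator (\<Omega> \<inter> ball p \<rho>) w *\<^sub>R (f w * (w - p))) \<in> borel_measurable borel"
    by (rule measurable_L2_integrand(1)[OF _ \<Omega>b]) (auto intro!: continuous_intros continuous_on_subset[OF c])
  have m2: "(\<lambda>z. ennreal ((norm (f z))\<^sup>2) * indicator \<Omega> z) \<in> borel_measurable lborel"
    using measurable_L2_integrand(2)[OF c] \<Omega> by auto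
  have bd: "norm (f w * (w - p)) \<le> \<bar>\<rho>\<bar> * norm (f w)" if "w \<in> ball p \<rho>" for w
    using that by (auto simp: norm_mult dist_norm norm_minus_commute mult.commute[of "norm (f w)"] intro!: mult_right_mono)
  have "(\<integral>\<^sup>+w. ennreal ((norm (indicator (\<Omega> \<inter> ball p \<rho>) w *\<^sub>R (f w * (w - p))))\<^sup>2) \<partial>lborel) \<le> (\<integral>\<^sup>+w\<in>\<Omega>. ennreal ((norm (\<bar>\<rho>\<bar> * norm (f w)))\<^sup>2) \<partial>lborel)"
    by (rule nn_integral_mono) (use bd in \<open>auto simp: indicator_def intro!: ennreal_leI power_mono\<close>)
  also have "\<dots> < \<infinity>"
    using nn_integral_norm_cmult_sq[OF fin _ m2, of "\<lambda>w. \<bar>\<rho>\<bar> * norm (f w)" "\<bar>\<rho>\<bar>"] by simp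
  finally show fin2: "(\<integral>\<^sup>+w. ennreal ((norm (indicator (\<Omega> \<inter> ball p \<rho>) w *\<^sub>R (f w * (w - p))))\<^sup>2) \<partial>lborel) < \<infinity>" .
  let ?u = "\<lambda>w. indicator (\<Omega> \<inter> ball p \<rho>) w *\<^sub>R (f w * (w - p))"
  have m2': "(\<lambda>w. ennreal ((norm (?u w))\<^sup>2)) \<in> borel_measurable borel" using m by measurable
  have le: "norm (?u w) \<le> indicator (ball p \<bar>\<rho>\<bar>) w + (norm (?u w))\<^sup>2" for w
  proof (cases "w \<in> \<Omega> \<inter> ball p \<rho>")
    case True
    then have "w \<in> ball p \<bar>\<rho>\<bar>" by auto
    moreover have "x \<le> 1 + x\<^sup>2" for x :: real using sum_squares_bound[of x 1] by (simp add: power2_eq_square) (smt (verit) zero_le_square)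
    ultimately show ?thesis using True by simp
  qed auto
  have le': "ennreal (norm (?u w)) \<le> indicator (ball p \<bar>\<rho>\<bar>) w + ennreal ((norm (?u w))\<^sup>2)" for w
    using ennreal_leI[OF le[of w]] by (simp add: ennreal_indicator)
  have "(\<integral>\<^sup>+w. ennreal (norm (?u w)) \<partial>lborel) \<le> (\<integral>\<^sup>+w. indicator (ball p \<bar>\<rho>\<bar>) w + ennreal ((norm (?u w))\<^sup>2) \<partial>lborel)"
    by (rule nn_integral_mono[OF le'])
  also have "\<dots> = (\<integral>\<^sup>+w. indicator (ball p \<bar>\<rho>\<bar>) w \<partial>lborel) + (\<integral>\<^sup>+w. ennreal ((norm (?u w))\<^sup>2) \<partial>lborel)"
    by (rule nn_integral_add) (use m2' in \<open>auto intro: borel_measurable_indicator\<close>)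
  also have "\<dots> < \<infinity>" using fin2 by (simp add: emeasure_ball_complex)
  finally show "integrable lborel ?u" using m by (intro integrableI_bounded) auto
qed

text \<open>For \<open>\<chi>(z) = max 0 (\<rho>\<^sup>2 - \<bar>z - p\<bar>\<^sup>2)\<close> the function \<open>\<chi> f\<close> has the \<open>(0,1)\<close>-derivative \<open>- (z - p) f\<close> on the
  disc, and the Cauchy transform corrects it. Because \<open>\<chi>(z) + (z - p) / \<pi>\<close> times the Cauchy transform of
  the disc is the constant \<open>\<rho>\<^sup>2\<close>, the result is holomorphic across the boundary circle as well.\<close>

definition localisation :: "complex set \<Rightarrow> (complex \<Rightarrow> complex) \<Rightarrow> complex \<Rightarrow> real \<Rightarrow> complex \<Rightarrow> complex" where
  "localisation \<Omega> f p \<rho> z = of_real (max 0 (\<rho>\<^sup>2 - (norm (z - p))\<^sup>2)) * f z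
     + cauchy_transform (\<lambda>w. indicator (\<Omega> \<inter> ball p \<rho>) w *\<^sub>R (f w * (w - p))) z / of_real pi"

text \<open>Near a point \<open>z0\<close> of \<open>\<Omega>\<close> only the part of the Cauchy transform coming from a small disc \<open>b\<close> about \<open>z0\<close> is
  singular. There the numerator \<open>g w\<close> is replaced by \<open>g z\<close> minus a difference that is divisible by \<open>z - w\<close>. The
  divided difference contributes a holomorphic function, and \<open>g z\<close> contributes, up to a holomorphic term, a multiple
  of the Cauchy transform of \<open>ball p \<rho>\<close>, which cancels the cut-off term.\<close>

lemma localisation_holomorphic:
  assumes f: "f \<in> L2hol \<Omega>" and \<Omega>: "open \<Omega>" and \<rho>: "\<rho> \<ge> 0"
  shows "localisation \<Omega> f p \<rho> holomorphic_on \<Omega>"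
proof (subst holomorphic_on_open[OF \<Omega>], intro ballI)
  fix z0 assume "z0 \<in> \<Omega>"
  then obtain e where e: "e > 0" "ball z0 e \<subseteq> \<Omega>" using \<Omega> by (metis openE)
  define r where "r = e / 2"
  have r: "r > 0" and r2: "ball z0 (2 * r) \<subseteq> \<Omega>" "ball z0 r \<subseteq> \<Omega>" using e by (auto simp: r_def)
  have hol: "f holomorphic_on \<Omega>" using f by (auto simp: L2hol_def)
  define b where "b = ball z0 r"
  define g where "g w = f w * (w - p)" for w
  have g: "g holomorphic_on ball z0 (2 * r)" unfolding g_def
    using hol r2 by (intro holomorphic_intros) (auto elim: holomorphic_on_subset)
  have gb: "g holomorphic_on b" unfolding b_def by (rule holomorphic_on_subset[OF g]) (use r in auto)
  define A where "A = b \<inter> ball p \<rho>"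
  have A: "A \<in> sets borel" "A \<subseteq> ball z0 r" by (auto simp: A_def b_def)
  define u where "u w = indicator (\<Omega> \<inter> ball p \<rho>) w *\<^sub>R (f w * (w - p))" for w
  have ui: "integrable lborel u" unfolding u_def by (rule localised_integrable[OF f \<Omega>])
  define u1 where "u1 w = indicator (- b) w *\<^sub>R u w" for w
  have u1i: "integrable lborel u1" unfolding u1_def
    by (rule integrable_mult_indicator[OF _ ui]) (auto simp: b_def)
  define u2 :: "complex \<Rightarrow> complex" where "u2 w = indicator (ball p \<rho> - b) w *\<^sub>R 1" for w
  have u2i: "integrable lborel u2"
  proof -
    have s: "ball p \<rho> - b \<in> sets borel" by (auto simp: b_def)
    have "emeasure lborel (ball p \<rho> - b) \<le> emeasure lborel (ball p \<rho>)" by (rule emeasure_mono) auto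
    then have "integrable lborel (\<lambda>w. indicator (ball p \<rho> - b) w :: real)"
      using \<rho> s by (intro integrable_real_indicator) (auto simp: emeasure_ball_complex less_top[symmetric] top_unique)
    then show ?thesis unfolding u2_def by (rule integrable_scaleR_left)
  qed
  have h1: "cauchy_transform u1 holomorphic_on b" 
    using cauchy_transform_holomorphic[OF u1i, of "- b"] by (auto simp: b_def u1_def)
  have h2: "cauchy_transform u2 holomorphic_on b"
    using cauchy_transform_holomorphic[OF u2i, of "- b"] by (auto simp: b_def u2_def)
  define D where "D z = (LINT w:A|lborel. (g z - g w) / (z - w))" for z
  have hD: "D holomorphic_on b" unfolding D_def b_def
    by (rule integral_divided_difference_holomorphic[OF g r A])
  define T where "T z = of_real (\<rho>\<^sup>2) * f z + (cauchy_transform u1 z - g z * cauchy_transform u2 z - D z) / of_real pi" for z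
  have T: "T holomorphic_on b" unfolding T_def
    using h1 h2 hD gb hol r2 by (auto intro!: holomorphic_intros simp: b_def elim: holomorphic_on_subset)
  have eq: "localisation \<Omega> f p \<rho> z = T z" if z: "z \<in> b" for z
  proof -
    have iA: "set_integrable lborel A (\<lambda>w. c / (z - w))" for c
      by (rule set_integrable_subset[OF set_integrable_Cauchy_kernel[of p \<rho>]]) (auto simp: A_def b_def)
    have iB: "set_integrable lborel (ball p \<rho> - b) (\<lambda>w. c / (z - w))" for c
      by (rule set_integrable_subset[OF set_integrable_Cauchy_kernel[of p \<rho>]]) (auto simp: b_def)
    have iu1: "integrable lborel (\<lambda>w. u1 w / (z - w))"
    proof -
      obtain d where d: "d > 0" "ball z d \<subseteq> b" using z by (metis b_def open_ball openE)
      have "integrable lborel (\<lambda>w. (1 / d) *\<^sub>R norm (u1 w))" using u1i by simp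
      then show ?thesis
      proof (rule Bochner_Integration.integrable_bound)
        show "(\<lambda>w. u1 w / (z - w)) \<in> borel_measurable lborel"
          using u1i measurable_Cauchy_kernel[of 1 z] borel_measurable_times[of u1 lborel "\<lambda>w. 1 / (z - w)"] by (auto dest: borel_measurable_integrable)
        show "AE w in lborel. norm (u1 w / (z - w)) \<le> norm ((1 / d) *\<^sub>R norm (u1 w))"
        proof (rule AE_I2)
          fix w
          show "norm (u1 w / (z - w)) \<le> norm ((1 / d) *\<^sub>R norm (u1 w))"
          proof (cases "w \<in> b")
            case False
            then have "norm (z - w) \<ge> d" using d by (metis dist_norm linorder_not_less mem_ball subsetD)
            then have "norm (u1 w) / norm (z - w) \<le> norm (u1 w) / d"
              using d by (intro divide_left_mono mult_pos_pos) auto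
            then show ?thesis using d by (simp add: norm_divide)
          qed (auto simp: u1_def)
        qed
      qed
    qed
    have iD: "set_integrable lborel A (\<lambda>w. (g z - g w) / (z - w))"
    proof -
      have 1: "A \<subseteq> cball z0 r" using A by auto
      have cont: "continuous_on (cball z0 r) (\<lambda>w. if w = z then deriv g z else (g w - g z) / (w - z))"
        by (rule continuous_on_subset[OF holomorphic_on_imp_continuous_on[OF divided_difference[OF g]]])
          (use r z in \<open>auto simp: b_def\<close>)
      have "integrable lborel (\<lambda>w. indicator (cball z0 r) w *\<^sub>R (if w = z then deriv g z else (g w - g z) / (w - z)))"
        by (rule borel_integrable_compact) (use cont in auto)
      then have "set_integrable lborel A (\<lambda>w. if w = z then deriv g z else (g w - g z) / (w - z))"
        using A by (intro set_integrable_subset[OF _ _ 1]) (auto simp: set_integrable_def)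
      moreover have "set_integrable lborel A (\<lambda>w. if w = z then deriv g z else (g w - g z) / (w - z)) \<longleftrightarrow> set_integrable lborel A (\<lambda>w. (g z - g w) / (z - w))"
        unfolding set_integrable_def
      proof (rule integrable_cong_AE)
        have ae: "AE w in lborel. w \<noteq> z" by (rule AE_lborel_singleton)
        have sym: "(g w - g z) / (w - z) = (g z - g w) / (z - w)" for w
          by (metis minus_diff_eq minus_divide_divide)
        show "AE w in lborel. indicator A w *\<^sub>R (if w = z then deriv g z else (g w - g z) / (w - z)) = indicator A w *\<^sub>R ((g z - g w) / (z - w))"
          using ae by eventually_elim (auto simp: sym)
        show "(\<lambda>w. indicator A w *\<^sub>R (if w = z then deriv g z else (g w - g z) / (w - z))) \<in> borel_measurable lborel"
          using measurable_L2_integrand(1)[OF continuous_on_subset[OF cont 1] A(1)] by simp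
        have cm: "(\<lambda>w. indicator A w *\<^sub>R g z) \<in> borel_measurable borel"
          using A(1) by (intro borel_measurable_scaleR borel_measurable_indicator) auto
        have gm: "(\<lambda>w. indicator A w *\<^sub>R g w) \<in> borel_measurable borel"
          by (rule measurable_L2_integrand(1)[OF _ A(1)]) (use gb A in \<open>auto simp: b_def intro: holomorphic_on_imp_continuous_on continuous_on_subset\<close>)
        have "(\<lambda>w. (indicator A w *\<^sub>R (g z) - indicator A w *\<^sub>R g w) * (1 / (z - w))) \<in> borel_measurable borel"
          by (intro borel_measurable_times borel_measurable_diff cm gm measurable_Cauchy_kernel)
        moreover have "(\<lambda>w. (indicator A w *\<^sub>R (g z) - indicator A w *\<^sub>R g w) * (1 / (z - w))) = (\<lambda>w. indicator A w *\<^sub>R ((g z - g w) / (z - w)))"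
          by (auto simp: indicator_def)
        ultimately show "(\<lambda>w. indicator A w *\<^sub>R ((g z - g w) / (z - w))) \<in> borel_measurable lborel" by simp
      qed
      ultimately show ?thesis by simp
    qed
    have "u w / (z - w) = u1 w / (z - w) + (indicator A w *\<^sub>R (g z / (z - w)) - indicator A w *\<^sub>R ((g z - g w) / (z - w)))" for w
      using r2 by (auto simp: u_def u1_def A_def g_def indicator_def b_def diff_divide_distrib)
    then have "cauchy_transform u z = (\<integral>w. u1 w / (z - w) + (indicator A w *\<^sub>R (g z / (z - w)) - indicator A w *\<^sub>R ((g z - g w) / (z - w))) \<partial>lborel)"
      unfolding cauchy_transform_def by simp
    also have "\<dots> = cauchy_transform u1 z + ((LINT w:A|lborel. g z / (z - w)) - D z)"
      unfolding cauchy_transform_def D_def set_lebesgue_integral_def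
      using iu1 iA[of "g z"] iD unfolding set_integrable_def
      by (subst Bochner_Integration.integral_add; (subst Bochner_Integration.integral_diff)?) auto
    also have "(LINT w:A|lborel. g z / (z - w)) = (LINT w:ball p \<rho>|lborel. g z / (z - w)) - (LINT w:ball p \<rho> - b|lborel. g z / (z - w))"
    proof -
      have "(LINT w:A \<union> (ball p \<rho> - b)|lborel. g z / (z - w)) = (LINT w:A|lborel. g z / (z - w)) + (LINT w:ball p \<rho> - b|lborel. g z / (z - w))"
        by (rule set_integral_Un[OF _ iA iB]) (auto simp: A_def)
      moreover have "A \<union> (ball p \<rho> - b) = ball p \<rho>" by (auto simp: A_def)
      ultimately show ?thesis by simp
    qed
    also have "(LINT w:ball p \<rho> - b|lborel. g z / (z - w)) = g z * cauchy_transform u2 z"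
      unfolding cauchy_transform_def set_lebesgue_integral_def Bochner_Integration.integral_mult_right_zero[symmetric]
      by (intro Bochner_Integration.integral_cong) (auto simp: u2_def indicator_def)
    also have "(LINT w:ball p \<rho>|lborel. g z / (z - w)) = f z * (LINT w:ball p \<rho>|lborel. (z - p) / (z - w))"
      unfolding set_lebesgue_integral_def Bochner_Integration.integral_mult_right_zero[symmetric]
      by (intro Bochner_Integration.integral_cong) (auto simp: g_def indicator_def)
    also have "\<dots> = f z * of_real (pi * min (\<rho>\<^sup>2) ((norm (z - p))\<^sup>2))"
      by (simp add: disc_Cauchy_transform[OF \<rho>])
    finally have c: "cauchy_transform u z = cauchy_transform u1 z + (f z * of_real (pi * min (\<rho>\<^sup>2) ((norm (z - p))\<^sup>2)) - g z * cauchy_transform u2 z - D z)" .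
    have "max 0 (\<rho>\<^sup>2 - (norm (z - p))\<^sup>2) + min (\<rho>\<^sup>2) ((norm (z - p))\<^sup>2) = \<rho>\<^sup>2" by (simp add: max_def min_def)
    then have "complex_of_real (\<rho>\<^sup>2) = of_real (max 0 (\<rho>\<^sup>2 - (norm (z - p))\<^sup>2)) + of_real (min (\<rho>\<^sup>2) ((norm (z - p))\<^sup>2))"
      by (metis of_real_add)
    moreover have "cauchy_transform u z / of_real pi = f z * of_real (min (\<rho>\<^sup>2) ((norm (z - p))\<^sup>2)) + (cauchy_transform u1 z - g z * cauchy_transform u2 z - D z) / of_real pi"
      unfolding c by (simp add: field_simps)
    moreover have "localisation \<Omega> f p \<rho> z = of_real (max 0 (\<rho>\<^sup>2 - (norm (z - p))\<^sup>2)) * f z + cauchy_transform u z / of_real pi"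
      by (simp add: localisation_def u_def[abs_def])
    ultimately show ?thesis unfolding T_def by (simp only: distrib_right) (simp only: ac_simps)
  qed
  have "localisation \<Omega> f p \<rho> holomorphic_on b" by (rule holomorphic_transform[OF T]) (use eq in auto)
  then show "\<exists>f'. (localisation \<Omega> f p \<rho> has_field_derivative f') (at z0)"
    unfolding b_def using r by (metis centre_in_ball holomorphic_derivI open_ball)
qed

lemma cauchy_transform_lin:
  assumes "integrable lborel (\<lambda>w. u w / (z - w))" "integrable lborel (\<lambda>w. v w / (z - w))"
  shows "cauchy_transform (\<lambda>w. a * u w + b * v w) z = a * cauchy_transform u z + b * cauchy_transform v z"
proof -
  have "(a * u w + b * v w) / (z - w) = a * (u w / (z - w)) + b * (v w / (z - w))" for w
    by (simp add: add_divide_distrib)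
  then have "cauchy_transform (\<lambda>w. a * u w + b * v w) z = (\<integral>w. a * (u w / (z - w)) + b * (v w / (z - w)) \<partial>lborel)"
    unfolding cauchy_transform_def by (simp only:)
  also have "\<dots> = (\<integral>w. a * (u w / (z - w)) \<partial>lborel) + (\<integral>w. b * (v w / (z - w)) \<partial>lborel)"
    using assms by (intro Bochner_Integration.integral_add integrable_mult_right)
  also have "\<dots> = a * cauchy_transform u z + b * cauchy_transform v z"
    unfolding cauchy_transform_def by (simp only: Bochner_Integration.integral_mult_right_zero)
  finally show ?thesis .
qed

text \<open>The difference of two localisations with the same centre: equal to \<open>f\<close> up to a holomorphic
  function near the centre, holomorphic away from it.\<close>

lemma bump_exists:
  assumes f: "f \<in> L2hol \<Omega>" and \<Omega>: "open \<Omega>" and \<rho>: "\<rho> > 0"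
  obtains \<theta> U where "integrable lborel U" "\<And>w. w \<in> ball p \<rho> \<Longrightarrow> U w = 0" "\<And>w. w \<notin> ball p (2 * \<rho>) \<Longrightarrow> U w = 0"
    "\<And>z. z \<in> ball p \<rho> \<Longrightarrow> \<theta> z = 1" "\<And>z. z \<notin> ball p (2 * \<rho>) \<Longrightarrow> \<theta> z = (0::complex)"
    "(\<lambda>z. \<theta> z * f z + cauchy_transform U z) holomorphic_on \<Omega>"
    "\<And>R. R \<ge> 0 \<Longrightarrow> (\<integral>\<^sup>+z\<in>\<Omega> \<inter> ball p R. ennreal ((norm (\<theta> z * f z + cauchy_transform U z))\<^sup>2) \<partial>lborel) < \<infinity>"
proof -
  define u where "u s w = indicator (\<Omega> \<inter> ball p s) w *\<^sub>R (f w * (w - p))" for s w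
  define k where "k = 3 * \<rho>\<^sup>2"
  have k: "k > 0" using \<rho> by (simp add: k_def)
  define m where "m s z = max 0 (s\<^sup>2 - (norm (z - p))\<^sup>2)" for s z
  define \<theta> :: "complex \<Rightarrow> complex" where "\<theta> z = of_real ((m (2 * \<rho>) z - m \<rho> z) / k)" for z
  define c where "c = complex_of_real (1 / (k * pi))"
  define U where "U w = c * u (2 * \<rho>) w + (- c) * u \<rho> w" for w
  have ui: "integrable lborel (u s)" for s unfolding u_def by (rule localised_integrable[OF f \<Omega>])
  have u2: "(\<integral>\<^sup>+w. ennreal ((norm (u s w))\<^sup>2) \<partial>lborel) < \<infinity>" for s
    unfolding u_def by (rule localised_integrable(2)[OF f \<Omega>])
  have hol: "f holomorphic_on \<Omega>" using f by (auto simp: L2hol_def)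
  have uiz: "integrable lborel (\<lambda>w. u s w / (z - w))" if z: "z \<in> \<Omega>" for s z
  proof -
    obtain d where d: "d > 0" "cball z d \<subseteq> \<Omega>" using \<Omega> z by (meson open_contains_cball)
    have "continuous_on (cball z d) (\<lambda>w. f w * (w - p))"
      using hol d by (intro continuous_intros) (meson continuous_on_subset holomorphic_on_imp_continuous_on)
    then obtain M where M: "\<And>w. w \<in> cball z d \<Longrightarrow> norm (f w * (w - p)) \<le> M"
      using compact_continuous_image[of "cball z d" "\<lambda>w. f w * (w - p)"] compact_imp_bounded
      by (metis (no_types, lifting) bounded_iff compact_cball image_eqI)
    have M0: "M \<ge> 0" using M[of z] d norm_ge_zero order_trans by (metis centre_in_cball less_imp_le)
    have iM: "integrable lborel (\<lambda>w. norm (indicator (ball z d) w *\<^sub>R (1 / (z - w))))"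
      by (rule integrable_norm[OF set_integrable_Cauchy_kernel[of z d 1 z, unfolded set_integrable_def]])
    have "integrable lborel (\<lambda>w. M * norm (indicator (ball z d) w *\<^sub>R (1 / (z - w))) + (1 / d) * norm (u s w))"
      by (intro Bochner_Integration.integrable_add integrable_mult_right iM integrable_norm[OF ui])
    then show ?thesis
    proof (rule Bochner_Integration.integrable_bound)
      show "(\<lambda>w. u s w / (z - w)) \<in> borel_measurable lborel"
        using ui[of s] measurable_Cauchy_kernel[of 1 z] borel_measurable_times[of "u s" lborel "\<lambda>w. 1 / (z - w)"] by (auto dest: borel_measurable_integrable)
      show "AE w in lborel. norm (u s w / (z - w)) \<le> norm (M * norm (indicator (ball z d) w *\<^sub>R (1 / (z - w))) + (1 / d) * norm (u s w))"
      proof (rule AE_I2)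
        fix w
        have "norm (u s w / (z - w)) \<le> M * norm (indicator (ball z d) w *\<^sub>R (1 / (z - w))) + (1 / d) * norm (u s w)"
        proof (cases "w \<in> ball z d")
          case True
          have "norm (u s w) \<le> M" using M[of w] True M0 by (auto simp: u_def indicator_def)
          then have "norm (u s w) / norm (z - w) \<le> M / norm (z - w)" by (rule divide_right_mono) auto
          moreover have "0 \<le> (1 / d) * norm (u s w)" using d by simp
          ultimately show ?thesis using True by (simp add: norm_divide)
        next
          case False
          then have "norm (z - w) \<ge> d" by (auto simp: dist_norm)
          then have "norm (u s w) / norm (z - w) \<le> norm (u s w) / d"
            using d by (intro divide_left_mono mult_pos_pos) auto
          then show ?thesis using False by (simp add: norm_divide)
        qed
        then show "norm (u s w / (z - w)) \<le> norm (M * norm (indicator (ball z d) w *\<^sub>R (1 / (z - w))) + (1 / d) * norm (u s w))"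
          by (smt (verit) real_norm_def)
      qed
    qed
  qed
  have Ui: "integrable lborel U" unfolding U_def by (intro Bochner_Integration.integrable_add integrable_mult_right ui)
  have U0: "U w = 0" if "w \<in> ball p \<rho>" for w
    using that \<rho> by (auto simp: U_def u_def indicator_def)
  have U1: "U w = 0" if "w \<notin> ball p (2 * \<rho>)" for w
    using that \<rho> by (auto simp: U_def u_def indicator_def)
  have c0: "\<theta> z = 1" if "z \<in> ball p \<rho>" for z
  proof -
    have "norm (z - p) \<le> \<rho>" using that by (auto simp: dist_norm norm_minus_commute)
    then have "(norm (z - p))\<^sup>2 \<le> \<rho>\<^sup>2" by (intro power_mono) auto
    moreover have "(norm (z - p))\<^sup>2 \<le> 4 * \<rho>\<^sup>2" using calculation zero_le_power2[of \<rho>] by linarith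
    ultimately have "m (2 * \<rho>) z - m \<rho> z = k" unfolding m_def k_def power_mult_distrib by (simp add: max_def)
    then show ?thesis using k by (simp add: \<theta>_def)
  qed
  have c1: "\<theta> z = 0" if "z \<notin> ball p (2 * \<rho>)" for z
  proof -
    have "norm (z - p) \<ge> 2 * \<rho>" using that by (auto simp: dist_norm norm_minus_commute)
    then have a1: "(norm (z - p))\<^sup>2 \<ge> (2 * \<rho>)\<^sup>2" using \<rho> by (intro power_mono) auto
    have a2: "(2 * \<rho>)\<^sup>2 \<ge> \<rho>\<^sup>2" using \<rho> by (intro power_mono) auto
    have "(2 * \<rho>)\<^sup>2 - (norm (z - p))\<^sup>2 \<le> 0" using a1 by linarith
    moreover have "\<rho>\<^sup>2 - (norm (z - p))\<^sup>2 \<le> 0" using a1 a2 by linarith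
    ultimately have "m (2 * \<rho>) z = 0" "m \<rho> z = 0" unfolding m_def by (simp_all only: max_absorb1)
    then show ?thesis by (simp add: \<theta>_def)
  qed
  have eq: "\<theta> z * f z + cauchy_transform U z = (localisation \<Omega> f p (2 * \<rho>) z - localisation \<Omega> f p \<rho> z) / of_real k"
    if z: "z \<in> \<Omega>" for z
  proof -
    have "cauchy_transform U z = c * cauchy_transform (u (2 * \<rho>)) z + (- c) * cauchy_transform (u \<rho>) z"
      unfolding U_def by (rule cauchy_transform_lin[OF uiz uiz]) (use z in auto)
    moreover have loc: "localisation \<Omega> f p s z = of_real (m s z) * f z + cauchy_transform (u s) z / of_real pi" for s
      by (simp add: localisation_def m_def u_def[abs_def])
    ultimately have "\<theta> z * f z + cauchy_transform U z = of_real ((m (2 * \<rho>) z - m \<rho> z) / k) * f z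
        + (c * cauchy_transform (u (2 * \<rho>)) z + (- c) * cauchy_transform (u \<rho>) z)"
      by (simp only: \<theta>_def)
    also have "\<dots> = ((of_real (m (2 * \<rho>) z) * f z + cauchy_transform (u (2 * \<rho>)) z / of_real pi)
        - (of_real (m \<rho> z) * f z + cauchy_transform (u \<rho>) z / of_real pi)) / of_real k"
      using k by (simp add: c_def field_simps)
    finally show ?thesis by (simp only: loc)
  qed
  have h: "(\<lambda>z. \<theta> z * f z + cauchy_transform U z) holomorphic_on \<Omega>"
  proof (rule holomorphic_transform)
    show "(\<lambda>z. (localisation \<Omega> f p (2 * \<rho>) z - localisation \<Omega> f p \<rho> z) / of_real k) holomorphic_on \<Omega>"
      using k \<rho> by (intro holomorphic_intros localisation_holomorphic[OF f \<Omega>]) auto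
  qed (use eq in auto)
  have fin: "(\<integral>\<^sup>+z\<in>\<Omega> \<inter> ball p R. ennreal ((norm (\<theta> z * f z + cauchy_transform U z))\<^sup>2) \<partial>lborel) < \<infinity>" if R: "R \<ge> 0" for R
  proof -
    have Ub: "U \<in> borel_measurable borel" using Ui by (auto dest: borel_measurable_integrable)
    have hU: "cauchy_transform U = (\<lambda>z. (\<theta> z * f z + cauchy_transform U z) - \<theta> z * f z)" by auto
    have cc: "continuous_on \<Omega> (\<lambda>z. \<theta> z * f z)" unfolding \<theta>_def m_def
      using holomorphic_on_imp_continuous_on[OF hol] k by (intro continuous_intros) auto
    have ch: "continuous_on \<Omega> (cauchy_transform U)"
      by (subst hU) (intro continuous_intros holomorphic_on_imp_continuous_on[OF h] cc)
    have S: "\<Omega> \<inter> ball p R \<in> sets borel" using \<Omega> by auto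
    have nU: "(\<integral>\<^sup>+w. ennreal ((norm (U w))\<^sup>2) \<partial>lborel) < \<infinity>"
    proof -
      have m1: "(\<lambda>w. ennreal ((norm (a * u s w))\<^sup>2)) \<in> borel_measurable lborel" for s a
        using ui[of s] by (auto dest!: borel_measurable_integrable)
      have f1: "(\<integral>\<^sup>+w\<in>UNIV. ennreal ((norm (a * u s w))\<^sup>2) \<partial>lborel) < \<infinity>" for a s
        by (rule nn_integral_norm_cmult_sq[where f="u s" and C="norm a"]) (use u2 m1[of 1] in \<open>auto simp: norm_mult\<close>)
      have "(\<integral>\<^sup>+w\<in>UNIV. ennreal ((norm (c * u (2 * \<rho>) w + (- c) * u \<rho> w))\<^sup>2) \<partial>lborel) < \<infinity>"
        by (rule nn_integral_norm_add_sq[OF f1 f1]) (use m1 in auto)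
      then show ?thesis unfolding U_def by simp
    qed
    have "(\<integral>\<^sup>+z\<in>ball p R. ennreal ((norm (cauchy_transform U z))\<^sup>2) \<partial>lborel) < \<infinity>"
    proof -
      have "(\<integral>\<^sup>+z\<in>ball p R. ennreal ((norm (cauchy_transform U z))\<^sup>2) \<partial>lborel)
         \<le> ennreal (4 * pi * (R + 2 * \<rho>)) * ennreal (4 * pi * (R + 2 * \<rho>)) * (\<integral>\<^sup>+w. ennreal ((norm (U w))\<^sup>2) \<partial>lborel)"
        unfolding cauchy_transform_def by (rule Cauchy_transform_L2[OF Ub U1]) (use \<rho> R in auto)
      also have "\<dots> < \<infinity>" using nU by (simp add: ennreal_mult_less_top)
      finally show ?thesis .
    qed
    moreover have "(\<integral>\<^sup>+z\<in>\<Omega> \<inter> ball p R. ennreal ((norm (cauchy_transform U z))\<^sup>2) \<partial>lborel) \<le> (\<integral>\<^sup>+z\<in>ball p R. ennreal ((norm (cauchy_transform U z))\<^sup>2) \<partial>lborel)"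
      by (rule nn_integral_mono) (auto simp: indicator_def)
    ultimately have 2: "(\<integral>\<^sup>+z\<in>\<Omega> \<inter> ball p R. ennreal ((norm (cauchy_transform U z))\<^sup>2) \<partial>lborel) < \<infinity>" by (rule le_less_trans[rotated])
    have cb: "norm (\<theta> z) \<le> 4 * \<rho>\<^sup>2 / k" for z
    proof -
      have "0 \<le> m (2 * \<rho>) z" "m (2 * \<rho>) z \<le> 4 * \<rho>\<^sup>2" "0 \<le> m \<rho> z" "m \<rho> z \<le> 4 * \<rho>\<^sup>2"
        unfolding m_def using zero_le_power2[of "norm (z - p)"] zero_le_power2[of \<rho>]
        by (simp, intro max.boundedI, simp, simp add: power_mult_distrib, simp, intro max.boundedI, simp, linarith)
      then have "\<bar>m (2 * \<rho>) z - m \<rho> z\<bar> \<le> 4 * \<rho>\<^sup>2" by linarith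
      then have "\<bar>m (2 * \<rho>) z - m \<rho> z\<bar> / k \<le> 4 * \<rho>\<^sup>2 / k" using k by (intro divide_right_mono) auto
      then show ?thesis using k unfolding \<theta>_def norm_of_real by simp
    qed
    have cbf: "norm (\<theta> z * f z) \<le> 4 * \<rho>\<^sup>2 / k * norm (f z)" for z
      unfolding norm_mult by (rule mult_right_mono[OF cb norm_ge_zero])
    have fS: "(\<integral>\<^sup>+z\<in>\<Omega> \<inter> ball p R. ennreal ((norm (f z))\<^sup>2) \<partial>lborel) < \<infinity>"
    proof -
      have "(\<integral>\<^sup>+z\<in>\<Omega> \<inter> ball p R. ennreal ((norm (f z))\<^sup>2) \<partial>lborel) \<le> (\<integral>\<^sup>+z\<in>\<Omega>. ennreal ((norm (f z))\<^sup>2) \<partial>lborel)"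
        by (rule nn_integral_mono) (auto simp: indicator_def)
      also have "\<dots> < \<infinity>" using f by (simp add: L2hol_def)
      finally show ?thesis .
    qed
    have mS: "(\<lambda>z. ennreal ((norm (g z))\<^sup>2) * indicator (\<Omega> \<inter> ball p R) z) \<in> borel_measurable lborel"
      if "continuous_on \<Omega> g" for g :: "complex \<Rightarrow> complex"
      using measurable_L2_integrand(2)[OF continuous_on_subset[OF that Int_lower1] S] by simp
    have 1: "(\<integral>\<^sup>+z\<in>\<Omega> \<inter> ball p R. ennreal ((norm (\<theta> z * f z))\<^sup>2) \<partial>lborel) < \<infinity>"
      by (rule nn_integral_norm_cmult_sq[OF fS cbf mS[OF holomorphic_on_imp_continuous_on[OF hol]]])
    show ?thesis by (rule nn_integral_norm_add_sq[OF 1 2 mS[OF cc] mS[OF ch]])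
  qed
  show ?thesis by (rule that[of U \<theta>]) (use Ui U0 U1 c0 c1 h fin in auto)
qed

text \<open>The leading term at infinity is \<open>1 / z\<close>, which is not square integrable there, while the remainder
  is. One linear condition therefore decides whether such a transform lies in \<open>L\<^sup>2\<close> near infinity.\<close>

lemma cauchy_transform_infinity:
  assumes u: "integrable lborel u" and supp: "\<And>w. w \<notin> cball 0 L \<Longrightarrow> u w = 0" and z: "norm z \<ge> 2 * L" and L: "L > 0"
  shows "norm (cauchy_transform u z - (\<integral>w. u w \<partial>lborel) / z) \<le> 2 * L * (\<integral>w. norm (u w) \<partial>lborel) / (norm z)\<^sup>2"
proof -
  have z0: "z \<noteq> 0" using z L by auto
  have far: "norm (z - w) \<ge> norm z / 2" "norm w \<le> L" if "w \<in> cball 0 L" for w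
    using that z norm_triangle_ineq2[of z w] by auto
  have bd: "norm (u w * (w / (z - w) / z)) \<le> norm (u w) * (2 * L / (norm z)\<^sup>2)" for w
  proof (cases "w \<in> cball 0 L")
    case True
    have "norm w / norm (z - w) \<le> L / (norm z / 2)"
      using far[OF True] z0 L by (intro frac_le) auto
    then have "norm w / norm (z - w) / norm z \<le> L / (norm z / 2) / norm z" by (rule divide_right_mono) auto
    moreover have "L / (norm z / 2) / norm z = 2 * L / (norm z)\<^sup>2" by (simp add: power2_eq_square)
    ultimately have "norm (w / (z - w) / z) \<le> 2 * L / (norm z)\<^sup>2" by (simp only: norm_divide)
    then show ?thesis unfolding norm_mult by (rule mult_left_mono) simp
  qed (auto simp: supp)
  have m: "(\<lambda>w. u w * (w / (z - w) / z)) \<in> borel_measurable lborel"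
  proof -
    have um: "u \<in> borel_measurable borel" using u by (auto dest: borel_measurable_integrable)
    have "(\<lambda>w. u w * (w * (1 / (z - w)) * (1 / z))) \<in> borel_measurable borel"
      using um measurable_Cauchy_kernel[of 1 z] by (intro borel_measurable_times) auto
    then show ?thesis by simp
  qed
  have i1: "integrable lborel (\<lambda>w. u w * (w / (z - w) / z))"
    by (rule Bochner_Integration.integrable_bound[of _ "\<lambda>w. norm (u w) * (2 * L / (norm z)\<^sup>2)"])
      (use u m bd L in \<open>auto simp: norm_mult\<close>)
  have "u w / (z - w) = u w / z + u w * (w / (z - w) / z)" for w
  proof (cases "w \<in> cball 0 L")
    case True
    then have "z - w \<noteq> 0" using far[OF True] z0 by auto
    then show ?thesis using z0 by (simp add: field_simps)
  qed (auto simp: supp)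
  then have "cauchy_transform u z = (\<integral>w. u w / z + u w * (w / (z - w) / z) \<partial>lborel)"
    by (simp add: cauchy_transform_def)
  also have "\<dots> = (\<integral>w. u w \<partial>lborel) / z + (\<integral>w. u w * (w / (z - w) / z) \<partial>lborel)"
    using u i1 by (subst Bochner_Integration.integral_add) auto
  finally have "norm (cauchy_transform u z - (\<integral>w. u w \<partial>lborel) / z) \<le> (\<integral>w. norm (u w * (w / (z - w) / z)) \<partial>lborel)"
    by (simp add: integral_norm_bound)
  also have "\<dots> \<le> (\<integral>w. norm (u w) * (2 * L / (norm z)\<^sup>2) \<partial>lborel)"
    by (rule integral_mono) (use i1 u bd in \<open>auto intro: integrable_norm\<close>)
  finally show ?thesis by (simp add: mult.commute)
qed

subsection \<open>The complement is a null set\<close>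

lemma non_null_ball:
  fixes E :: "complex set"
  assumes "E \<in> sets borel" "E \<notin> null_sets lborel" "\<delta> > 0"
  obtains q where "E \<inter> cball q \<delta> \<notin> null_sets lborel"
proof -
  obtain D :: "complex set" where D: "countable D" "\<And>X. open X \<Longrightarrow> X \<noteq> {} \<Longrightarrow> \<exists>d\<in>D. d \<in> X"
    by (rule countable_dense_setE) blast
  have "E = (\<Union>q\<in>D. E \<inter> cball q \<delta>)"
  proof -
    have "\<exists>q\<in>D. x \<in> cball q \<delta>" for x
    proof -
      obtain d where "d \<in> D" "d \<in> ball x \<delta>" using D(2)[of "ball x \<delta>"] assms(3) by auto
      then show ?thesis by (intro bexI[of _ d]) (auto simp: dist_commute)
    qed
    then show ?thesis by auto
  qed
  moreover have "(\<Union>q\<in>D. E \<inter> cball q \<delta>) \<in> null_sets lborel" if "\<And>q. E \<inter> cball q \<delta> \<in> null_sets lborel"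
    by (rule null_sets_UN'[OF D(1)]) (rule that)
  ultimately show thesis using assms(2) that by metis
qed

text \<open>If the complement had positive area, the Cauchy transform of a piece of it would be a bounded
  nonconstant holomorphic function, and its powers would generate infinitely many dimensions.\<close>

lemma finite_dim_null_complement:
  assumes \<Omega>: "open \<Omega>" "connected \<Omega>" and fd: "L2hol_finite_dim \<Omega> N"
    and f: "f \<in> L2hol \<Omega>" and a: "a \<in> \<Omega>" "f a \<noteq> 0"
  shows "- \<Omega> \<in> null_sets lborel"
proof (rule ccontr)
  assume nn: "- \<Omega> \<notin> null_sets lborel"
  obtain e where e: "e > 0" "ball a e \<subseteq> \<Omega>" using \<Omega> a by (metis openE)
  obtain q where q: "- \<Omega> \<inter> cball q (e / 4) \<notin> null_sets lborel"
    using non_null_ball[of "- \<Omega>" "e / 4"] nn \<Omega> e by auto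
  define E0 where "E0 = - \<Omega> \<inter> cball q (e / 4)"
  have E0c: "closed E0" unfolding E0_def using \<Omega> by auto
  have E0b: "E0 \<in> sets borel" using E0c by auto
  define L where "L = norm q + e"
  have L: "L > 0" using e by (simp add: L_def add_nonneg_pos)
  have EL: "E0 \<subseteq> cball 0 L"
  proof
    fix x assume "x \<in> E0"
    then have "dist q x \<le> e / 4" by (auto simp: E0_def)
    then show "x \<in> cball 0 L" using norm_triangle_ineq[of q "x - q"] e by (auto simp: L_def dist_norm norm_minus_commute)
  qed
  have fin: "emeasure lborel E0 < \<infinity>"
    using emeasure_mono[of E0 "ball 0 (2 * L)" lborel] EL L by (force simp: emeasure_ball_complex less_top[symmetric] top_unique)
  define \<mu> where "\<mu> = measure lborel E0"
  have \<mu>: "\<mu> > 0"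
  proof -
    have "emeasure lborel E0 \<noteq> 0" using q E0b by (auto simp: E0_def null_sets_def)
    then show ?thesis using fin unfolding \<mu>_def by (simp add: measure_def enn2real_positive_iff zero_less_iff_neq_zero)
  qed
  define u :: "complex \<Rightarrow> complex" where "u w = indicator E0 w *\<^sub>R 1" for w
  have ui: "integrable lborel u"
    unfolding u_def using fin E0b by (intro integrable_scaleR_left integrable_real_indicator) auto
  \<comment> \<open>\<open>R\<close> is bounded, so the functions \<open>R^k f\<close> all belong to the space.\<close>
  define R where "R = cauchy_transform u"
  have Rh: "R holomorphic_on - E0" unfolding R_def
    by (rule cauchy_transform_holomorphic[OF ui E0c]) (auto simp: u_def)
  have Rb: "norm (R z) \<le> 4 * pi + \<mu>" for z
  proof -
    have "ennreal (norm (R z)) \<le> (\<integral>\<^sup>+w. ennreal (norm (u w / (z - w))) \<partial>lborel)"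
      unfolding R_def cauchy_transform_def
      by (cases "integrable lborel (\<lambda>w. u w / (z - w))") (auto intro: integral_norm_bound_ennreal simp: not_integrable_integral_eq)
    also have "\<dots> \<le> (\<integral>\<^sup>+w. ennreal (1 / norm (z - w)) * indicator (ball z 1) w + indicator E0 w \<partial>lborel)"
    proof (rule nn_integral_mono)
      fix w
      have "1 / norm (z - w) \<le> 1" if "w \<notin> ball z 1" using that by (auto simp: dist_norm divide_le_eq)
      then show "ennreal (norm (u w / (z - w))) \<le> ennreal (1 / norm (z - w)) * indicator (ball z 1) w + indicator E0 w"
        by (auto simp: u_def indicator_def norm_divide)
    qed
    also have "\<dots> = (\<integral>\<^sup>+w\<in>ball z 1. ennreal (1 / norm (z - w)) \<partial>lborel) + (\<integral>\<^sup>+w. indicator E0 w \<partial>lborel)"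
    proof (rule nn_integral_add)
      have "(\<lambda>w. ennreal (norm (1 / (z - w)))) \<in> borel_measurable lborel"
        using measurable_Cauchy_kernel[of 1 z] by measurable
      then show "(\<lambda>w. ennreal (1 / norm (z - w)) * indicator (ball z 1) w) \<in> borel_measurable lborel"
        by (intro borel_measurable_times_ennreal borel_measurable_indicator) (auto simp: norm_divide)
    qed (use E0b in auto)
    also have "\<dots> \<le> ennreal (4 * pi) + ennreal \<mu>"
      using nn_integral_Cauchy_kernel_ball[of 1 z] E0b fin by (intro add_mono) (auto simp: \<mu>_def emeasure_eq_ennreal_measure less_top)
    also have "\<dots> = ennreal (4 * pi + \<mu>)" using \<mu> by simp
    finally show ?thesis using \<mu> ennreal_le_iff[of "4 * pi + \<mu>" "norm (R z)"] by (simp del: ennreal_plus)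
  qed
  have R\<Omega>: "R holomorphic_on \<Omega>" by (rule holomorphic_on_subset[OF Rh]) (auto simp: E0_def)
  have pw: "(\<lambda>z. R z ^ k * f z) \<in> L2hol \<Omega>" for k
    by (rule L2hol_bounded_mult[OF f _ \<Omega>(1), where C="(4 * pi + \<mu>) ^ k"])
      (use R\<Omega> Rb in \<open>auto intro!: holomorphic_intros power_mono simp: norm_power\<close>)
  obtain c i where c: "i < N" "c i \<noteq> 0" "\<And>z. z \<in> \<Omega> \<Longrightarrow> (\<Sum>i<N. c i * (R z ^ i * f z)) = 0"
    using fd[unfolded L2hol_finite_dim_def, rule_format, of "\<lambda>k z. R z ^ k * f z"] pw by auto
  have fc: "continuous_on \<Omega> f" using f by (auto simp: L2hol_def holomorphic_on_imp_continuous_on)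
  obtain d where d: "d > 0" "ball a d \<subseteq> \<Omega>" "\<And>z. z \<in> ball a d \<Longrightarrow> f z \<noteq> 0"
  proof -
    have "continuous (at a) f" using fc \<Omega> a by (simp add: continuous_on_eq_continuous_at)
    then obtain d where "d > 0" "\<And>z. dist z a < d \<Longrightarrow> f z \<noteq> 0"
      using continuous_at_avoid[of a f 0] a(2) by (metis dist_commute)
    moreover have "ball a (min d e) \<subseteq> \<Omega>" using e by (meson subset_ball min.cobounded2 subset_trans)
    ultimately show thesis using that[of "min d e"] e by (auto simp: dist_commute)
  qed
  obtain M where M: "N = Suc M" using c(1) by (cases N) auto
  \<comment> \<open>The linear relation is a polynomial equation for \<open>R\<close> near \<open>a\<close>, hence \<open>R\<close> is constant there. The disc about
    \<open>q\<close> was taken small compared with \<open>e\<close> so that \<open>\<Omega>\<close> meets the complement of that disc, and the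
    constancy spreads to neighbourhoods of infinity.\<close>
  have "finite (R ` ball a d)"
  proof (rule finite_subset)
    show "R ` ball a d \<subseteq> {x. (\<Sum>i\<le>M. c i * x ^ i) = 0}"
    proof clarify
      fix z assume z: "z \<in> ball a d"
      have "(\<Sum>i\<le>M. c i * R z ^ i) * f z = 0"
        using c(3)[of z] z d unfolding M by (auto simp: sum_distrib_right lessThan_Suc_atMost mult.assoc)
      then show "(\<Sum>i\<le>M. c i * R z ^ i) = 0" using d(3)[OF z] by simp
    qed
    show "finite {x. (\<Sum>i\<le>M. c i * x ^ i) = 0}" using c M Transcendental.polyfun_rootbound[of c i M] by auto
  qed
  moreover have "continuous_on (ball a d) R"
    using R\<Omega> d by (meson continuous_on_subset holomorphic_on_imp_continuous_on)
  ultimately have "R constant_on ball a d" using continuous_finite_range_constant[OF connected_ball] by blast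
  then obtain \<kappa> where \<kappa>: "\<And>z. z \<in> ball a d \<Longrightarrow> R z = \<kappa>" by (auto simp: constant_on_def)
  define W where "W = \<Omega> \<union> - cball q (e / 4)"
  have Wo: "open W" using \<Omega> by (auto simp: W_def)
  have "\<Omega> \<inter> - cball q (e / 4) \<noteq> {}"
  proof
    assume "\<Omega> \<inter> - cball q (e / 4) = {}"
    then have "ball a e \<subseteq> cball q (e / 4)" using e by auto
    then have "a + of_real (3 * e / 4) \<in> cball q (e / 4)" "a \<in> cball q (e / 4)" using e by (auto simp: dist_norm subset_iff)
    then have "dist a (a + of_real (3 * e / 4)) \<le> e / 2" using dist_triangle[of a "a + of_real (3 * e / 4)" q] by (auto simp: dist_commute)
    then show False using e by (simp add: dist_norm norm_mult norm_divide)
  qed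
  then have Wc: "connected W" unfolding W_def
    by (intro connected_Un \<Omega> connected_complement_bounded_convex) auto
  have RW: "R z = \<kappa>" if "z \<in> W" for z
  proof -
    have "R z - \<kappa> = 0"
    proof (rule analytic_continuation[of "\<lambda>z. R z - \<kappa>" W "ball a d" a])
      show "(\<lambda>z. R z - \<kappa>) holomorphic_on W"
        by (intro holomorphic_intros holomorphic_on_subset[OF Rh]) (auto simp: W_def E0_def)
      show "a islimpt ball a d" using d by (simp add: islimpt_ball)
      show "ball a d \<subseteq> W" using d by (auto simp: W_def)
    qed (use that Wo Wc a \<kappa> in \<open>auto simp: W_def\<close>)
    then show ?thesis by simp
  qed
  \<comment> \<open>But \<open>R z\<close> behaves like \<open>\<mu> / z\<close> at infinity; comparing the values at \<open>t\<close> and \<open>- t\<close> gives the contradiction.\<close>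
  have Rinf: "norm (R z * z - of_real \<mu>) \<le> \<mu> / 2" if z: "norm z \<ge> 4 * L" for z
  proof -
    have z0: "z \<noteq> 0" using z L by auto
    have "norm (R z - of_real \<mu> / z) \<le> 2 * L * \<mu> / (norm z)\<^sup>2"
    proof -
      have "u w = 0" if "w \<notin> cball 0 L" for w using that EL by (auto simp: u_def indicator_def)
      moreover have "(\<integral>w. u w \<partial>lborel) = of_real \<mu>" "(\<integral>w. norm (u w) \<partial>lborel) = \<mu>"
        using fin E0b by (simp_all add: u_def \<mu>_def scaleR_conv_of_real)
      ultimately show ?thesis using cauchy_transform_infinity[OF ui _ _ L, of z] z L by (simp add: R_def)
    qed
    then have "norm (R z - of_real \<mu> / z) * norm z \<le> 2 * L * \<mu> / (norm z)\<^sup>2 * norm z" by (rule mult_right_mono) auto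
    also have "norm (R z - of_real \<mu> / z) * norm z = norm (R z * z - of_real \<mu>)"
      using z0 by (simp add: norm_mult[symmetric] left_diff_distrib)
    also have "2 * L * \<mu> / (norm z)\<^sup>2 * norm z = 2 * L * \<mu> / norm z" using z0 by (simp add: power2_eq_square)
    also have "\<dots> \<le> 2 * L * \<mu> / (4 * L)" using z L \<mu> z0 by (intro divide_left_mono) auto
    also have "\<dots> = \<mu> / 2" using L by simp
    finally show ?thesis .
  qed
  define t where "t = complex_of_real (4 * L)"
  have "t \<in> W" "- t \<in> W"
  proof -
    have "z \<notin> cball q (e / 4)" if "norm z = 4 * L" for z
    proof
      assume "z \<in> cball q (e / 4)"
      then have "norm z \<le> norm q + e / 4" using norm_triangle_ineq[of q "z - q"] by (auto simp: dist_norm norm_minus_commute)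
      then show False using that e by (auto simp: L_def) (smt (verit) norm_ge_zero)
    qed
    then show "t \<in> W" "- t \<in> W" using L by (auto simp: W_def t_def norm_mult)
  qed
  then have "norm (\<kappa> * t - of_real \<mu>) \<le> \<mu> / 2" "norm (\<kappa> * (- t) - of_real \<mu>) \<le> \<mu> / 2"
    using Rinf[of t] Rinf[of "- t"] RW L by (auto simp: t_def norm_mult)
  then have "norm ((\<kappa> * t - of_real \<mu>) + (\<kappa> * (- t) - of_real \<mu>)) \<le> \<mu>"
    using norm_triangle_ineq[of "\<kappa> * t - of_real \<mu>" "\<kappa> * (- t) - of_real \<mu>"] by linarith
  also have "(\<kappa> * t - of_real \<mu>) + (\<kappa> * (- t) - of_real \<mu>) = complex_of_real (- 2 * \<mu>)" by simp
  also have "norm \<dots> = 2 * \<mu>" using \<mu> by (simp only: norm_of_real)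
  finally show False using \<mu> by simp
qed

subsection \<open>Extension to an entire function\<close>

text \<open>Points with a neighbourhood disjoint from \<open>\<Omega>\<close> count as points of extension.\<close>

definition extends_at :: "complex set \<Rightarrow> (complex \<Rightarrow> complex) \<Rightarrow> complex \<Rightarrow> bool" where
  "extends_at \<Omega> f p \<longleftrightarrow> (\<exists>r>0. \<exists>g. g holomorphic_on ball p r \<and> (\<forall>z\<in>ball p r \<inter> \<Omega>. g z = f z))"

lemma inverse_square_decay_L2:
  assumes F: "F holomorphic_on \<Omega>" "open \<Omega>" and R: "R > 0"
    and loc: "(\<integral>\<^sup>+z\<in>\<Omega> \<inter> ball 0 (2 * R). ennreal ((norm (F z))\<^sup>2) \<partial>lborel) < \<infinity>"
    and dec: "\<And>z. z \<in> \<Omega> \<Longrightarrow> norm z \<ge> R \<Longrightarrow> norm (F z) \<le> C / (norm z)\<^sup>2"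
  shows "F \<in> L2hol \<Omega>"
proof -
  have c: "continuous_on \<Omega> F" using F by (simp add: holomorphic_on_imp_continuous_on)
  have m1: "(\<lambda>z. ennreal ((norm (F z))\<^sup>2) * indicator (\<Omega> \<inter> ball 0 (2 * R)) z) \<in> borel_measurable lborel"
    using measurable_L2_integrand(2)[OF continuous_on_subset[OF c Int_lower1], of "ball 0 (2 * R)"] F by simp
  have m2: "(\<lambda>z::complex. ennreal (1 / norm z ^ 4) * indicator (- cball 0 R) z) \<in> borel_measurable lborel"
    by (intro borel_measurable_times_ennreal borel_measurable_indicator) auto
  have "(\<integral>\<^sup>+z\<in>\<Omega>. ennreal ((norm (F z))\<^sup>2) \<partial>lborel) \<le>
     (\<integral>\<^sup>+z. ennreal ((norm (F z))\<^sup>2) * indicator (\<Omega> \<inter> ball 0 (2 * R)) z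
        + ennreal (C\<^sup>2) * (ennreal (1 / norm z ^ 4) * indicator (- cball 0 R) z) \<partial>lborel)"
  proof (rule nn_integral_mono)
    fix z
    show "ennreal ((norm (F z))\<^sup>2) * indicator \<Omega> z \<le> ennreal ((norm (F z))\<^sup>2) * indicator (\<Omega> \<inter> ball 0 (2 * R)) z
        + ennreal (C\<^sup>2) * (ennreal (1 / norm z ^ 4) * indicator (- cball 0 R) z)"
    proof (cases "z \<in> \<Omega> \<and> z \<notin> ball 0 (2 * R)")
      case True
      then have z: "z \<in> \<Omega>" "norm z \<ge> 2 * R" by auto
      have "(norm (F z))\<^sup>2 \<le> (C / (norm z)\<^sup>2)\<^sup>2" using dec[of z] z R by (intro power_mono) auto
      also have "\<dots> = C\<^sup>2 * (1 / norm z ^ 4)" by (simp add: power_divide flip: power_mult)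
      finally show ?thesis using True z R by (simp add: ennreal_mult[symmetric] ennreal_leI)
    qed (auto simp: indicator_def)
  qed
  also have "\<dots> < \<infinity>"
    using loc nn_integral_inverse_4[OF R] m1 m2
    by (subst nn_integral_add) (auto simp: nn_integral_cmult ennreal_mult_less_top)
  finally show ?thesis using F by (auto simp: L2hol_def)
qed

text \<open>Cutting \<open>f\<close> down to its singular behaviour near each of \<open>N + 1\<close> singular points gives functions \<open>F i\<close>
  that are \<open>O(1 / z)\<close> at infinity; \<open>N\<close> combinations of them are \<open>O(1 / z\<^sup>2)\<close>, hence square
  integrable. A linear relation between the latter expresses \<open>f\<close> near one of the points by
  functions holomorphic there.\<close>

lemma non_extendable_finite:
  assumes \<Omega>: "open \<Omega>" and fd: "L2hol_finite_dim \<Omega> N" and f: "f \<in> L2hol \<Omega>"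
  shows "finite {p. \<not> extends_at \<Omega> f p}"
proof (rule ccontr)
  assume "infinite {p. \<not> extends_at \<Omega> f p}"
  then obtain T where T: "T \<subseteq> {p. \<not> extends_at \<Omega> f p}" "finite T" "card T = Suc N"
    by (meson infinite_arbitrarily_large)
  obtain p where p: "bij_betw p {..N} T"
    using ex_bij_betw_nat_finite[OF T(2)] T(3) by (metis atLeast0LessThan lessThan_Suc_atMost)
  have pT: "\<not> extends_at \<Omega> f (p i)" if "i \<le> N" for i using p T that by (auto simp: bij_betw_def)
  define S where "S = insert 1 ((\<lambda>(i, j). dist (p i) (p j)) ` {(i, j). i \<le> N \<and> j \<le> N \<and> i \<noteq> j})"
  have Sf: "finite S"
  proof -
    have "{(i, j). i \<le> N \<and> j \<le> N \<and> i \<noteq> j} \<subseteq> {..N} \<times> {..N}" by auto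
    then show ?thesis unfolding S_def by (meson finite.insertI finite_SigmaI finite_atMost finite_imageI finite_subset)
  qed
  have Spos: "x > 0" if "x \<in> S" for x
    using that p by (auto simp: S_def bij_betw_def inj_on_def)
  define \<rho> where "\<rho> = Min S / 4"
  have Sne: "S \<noteq> {}" by (simp add: S_def)
  have \<rho>: "\<rho> > 0" using Spos Min_in[OF Sf Sne] by (simp add: \<rho>_def)
  have sep: "dist (p i) (p j) \<ge> 4 * \<rho>" if "i \<le> N" "j \<le> N" "i \<noteq> j" for i j
  proof -
    have "dist (p i) (p j) \<in> S" unfolding S_def using that by (intro insertI2 image_eqI[of _ _ "(i, j)"]) auto
    then show ?thesis using Min_le[OF Sf] by (simp add: \<rho>_def)
  qed
  define P where "P i U \<theta> \<longleftrightarrow> integrable lborel U \<and> (\<forall>w. w \<in> ball (p i) \<rho> \<longrightarrow> U w = 0) \<and> (\<forall>w. w \<notin> ball (p i) (2 * \<rho>) \<longrightarrow> U w = 0) \<and>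
    (\<forall>z. z \<in> ball (p i) \<rho> \<longrightarrow> \<theta> z = 1) \<and> (\<forall>z. z \<notin> ball (p i) (2 * \<rho>) \<longrightarrow> \<theta> z = (0::complex)) \<and>
    (\<lambda>z. \<theta> z * f z + cauchy_transform U z) holomorphic_on \<Omega> \<and>
    (\<forall>R. R \<ge> 0 \<longrightarrow> (\<integral>\<^sup>+z\<in>\<Omega> \<inter> ball (p i) R. ennreal ((norm (\<theta> z * f z + cauchy_transform U z))\<^sup>2) \<partial>lborel) < \<infinity>)" for i U \<theta>
  have "\<exists>U \<theta>. P i U \<theta>" for i
    unfolding P_def by (rule bump_exists[OF f \<Omega> \<rho>, of "p i"]) blast
  then obtain U \<theta> where P: "\<And>i. P i (U i) (\<theta> i)" by metis
  have Ui: "\<And>i. integrable lborel (U i)" and U0: "\<And>i w. w \<in> ball (p i) \<rho> \<Longrightarrow> U i w = 0"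
    and U1: "\<And>i w. w \<notin> ball (p i) (2 * \<rho>) \<Longrightarrow> U i w = 0"
    and t1: "\<And>i z. z \<in> ball (p i) \<rho> \<Longrightarrow> \<theta> i z = 1" and t0: "\<And>i z. z \<notin> ball (p i) (2 * \<rho>) \<Longrightarrow> \<theta> i z = (0::complex)"
    and hol: "\<And>i. (\<lambda>z. \<theta> i z * f z + cauchy_transform (U i) z) holomorphic_on \<Omega>"
    and fin: "\<And>i R. R \<ge> 0 \<Longrightarrow> (\<integral>\<^sup>+z\<in>\<Omega> \<inter> ball (p i) R. ennreal ((norm (\<theta> i z * f z + cauchy_transform (U i) z))\<^sup>2) \<partial>lborel) < \<infinity>"
    by (use P[unfolded P_def] in blast)+
  define F where "F i z = \<theta> i z * f z + cauchy_transform (U i) z" for i z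
  \<comment> \<open>The coefficients of \<open>1 / z\<close> at infinity are multiples of a single one of them. Subtracting multiples of \<open>F i0\<close>
    from the other \<open>N\<close> functions therefore removes this term; \<open>\<sigma>\<close> enumerates the indices other than \<open>i0\<close>.\<close>
  define \<nu> where "\<nu> i = (\<integral>w. U i w \<partial>lborel)" for i
  have "\<exists>i0\<le>N. \<exists>\<mu>. \<forall>i\<le>N. \<nu> i = \<mu> i * \<nu> i0"
  proof (cases "\<exists>i0\<le>N. \<nu> i0 \<noteq> 0")
    case True
    then obtain i0 where "i0 \<le> N" "\<nu> i0 \<noteq> 0" by auto
    then show ?thesis by (intro exI[of _ i0] conjI exI[of _ "\<lambda>i. \<nu> i / \<nu> i0"]) auto
  next
    case False
    then show ?thesis by (intro exI[of _ 0] conjI exI[of _ "\<lambda>i. 0"]) auto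
  qed
  then obtain i0 \<mu> where i0: "i0 \<le> N" and \<mu>: "\<And>i. i \<le> N \<Longrightarrow> \<nu> i = \<mu> i * \<nu> i0" by blast
  define \<sigma> where "\<sigma> i = (if i < i0 then i else Suc i)" for i
  have \<sigma>: "\<sigma> i \<le> N" "\<sigma> i \<noteq> i0" if "i < N" for i using that i0 by (auto simp: \<sigma>_def)
  have \<sigma>inj: "\<sigma> i \<noteq> \<sigma> j" if "i \<noteq> j" for i j using that by (auto simp: \<sigma>_def split: if_splits)
  define G where "G i z = F (\<sigma> i) z - \<mu> (\<sigma> i) * F i0 z" for i z
  define B where "B = (\<Sum>i\<le>N. norm (p i)) + 2 * \<rho>"
  have B: "B > 0" using \<rho> by (auto simp: B_def intro!: add_nonneg_pos sum_nonneg)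
  have pB: "ball (p i) (2 * \<rho>) \<subseteq> cball 0 B" if "i \<le> N" for i
  proof
    fix x assume "x \<in> ball (p i) (2 * \<rho>)"
    moreover have "norm (p i) \<le> (\<Sum>i\<le>N. norm (p i))" using that by (intro member_le_sum) auto
    ultimately show "x \<in> cball 0 B"
      using norm_triangle_ineq[of "p i" "x - p i"] by (auto simp: B_def dist_norm norm_minus_commute)
  qed
  have finF: "(\<integral>\<^sup>+z\<in>\<Omega> \<inter> ball 0 R. ennreal ((norm (F i z))\<^sup>2) \<partial>lborel) < \<infinity>" if "R \<ge> 0" for i R
  proof -
    have sub: "ball 0 R \<subseteq> ball (p i) (R + norm (p i))"
    proof
      fix x :: complex assume "x \<in> ball 0 R"
      then show "x \<in> ball (p i) (R + norm (p i))" using norm_triangle_ineq4[of "p i" x] by (auto simp: dist_norm)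
    qed
    have "(\<integral>\<^sup>+z\<in>\<Omega> \<inter> ball 0 R. ennreal ((norm (F i z))\<^sup>2) \<partial>lborel) \<le> (\<integral>\<^sup>+z\<in>\<Omega> \<inter> ball (p i) (R + norm (p i)). ennreal ((norm (F i z))\<^sup>2) \<partial>lborel)"
      by (rule nn_integral_mono) (use sub in \<open>auto simp: indicator_def\<close>)
    also have "\<dots> < \<infinity>" unfolding F_def by (rule fin) (use that in simp)
    finally show ?thesis .
  qed
  have hF: "F i holomorphic_on \<Omega>" for i unfolding F_def by (rule hol)
  have GL: "G i \<in> L2hol \<Omega>" if i: "i < N" for i
  proof (rule inverse_square_decay_L2[OF _ \<Omega>, where R="2 * B"])
    show hG: "G i holomorphic_on \<Omega>" unfolding G_def by (intro holomorphic_intros hF)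
    show "2 * B > 0" using B by simp
    let ?S = "\<Omega> \<inter> ball 0 (2 * (2 * B))"
    have m: "(\<lambda>z. ennreal ((norm (h z))\<^sup>2) * indicator ?S z) \<in> borel_measurable lborel" if "h holomorphic_on \<Omega>" for h
      using measurable_L2_integrand(2)[OF continuous_on_subset[OF holomorphic_on_imp_continuous_on[OF that] Int_lower1], of "ball 0 (2 * (2 * B))"] \<Omega> by simp
    have f1: "(\<integral>\<^sup>+z\<in>?S. ennreal ((norm (F j z))\<^sup>2) \<partial>lborel) < \<infinity>" for j by (rule finF) (use B in simp)
    have f2: "(\<integral>\<^sup>+z\<in>?S. ennreal ((norm (- \<mu> (\<sigma> i) * F i0 z))\<^sup>2) \<partial>lborel) < \<infinity>"
      by (rule nn_integral_norm_cmult_sq[OF f1[of i0] _ m[OF hF], where C="norm (\<mu> (\<sigma> i))"]) (simp add: norm_mult)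
    have "(\<integral>\<^sup>+z\<in>?S. ennreal ((norm (F (\<sigma> i) z + - \<mu> (\<sigma> i) * F i0 z))\<^sup>2) \<partial>lborel) < \<infinity>"
      by (rule nn_integral_norm_add_sq[OF f1 f2 m[OF hF] m]) (intro holomorphic_intros hF)
    then show "(\<integral>\<^sup>+z\<in>?S. ennreal ((norm (G i z))\<^sup>2) \<partial>lborel) < \<infinity>" by (simp add: G_def)
    fix z assume z: "z \<in> \<Omega>" "norm z \<ge> 2 * B"
    define K where "K j = 2 * B * (\<integral>w. norm (U j w) \<partial>lborel)" for j
    have est: "norm (F j z - \<nu> j / z) \<le> K j / (norm z)\<^sup>2" if j: "j \<le> N" for j
    proof -
      have "z \<notin> ball (p j) (2 * \<rho>)" using pB[OF j] z B by auto
      then have "F j z = cauchy_transform (U j) z" by (simp add: F_def t0)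
      moreover have "U j w = 0" if "w \<notin> cball 0 B" for w using pB[OF j] that by (intro U1) auto
      ultimately show ?thesis unfolding K_def \<nu>_def using cauchy_transform_infinity[OF Ui _ z(2) B, of j] by simp
    qed
    have "G i z = (F (\<sigma> i) z - \<nu> (\<sigma> i) / z) - \<mu> (\<sigma> i) * (F i0 z - \<nu> i0 / z)"
      using \<mu>[OF \<sigma>(1)[OF i]] by (simp add: G_def algebra_simps)
    then have "norm (G i z) \<le> norm (F (\<sigma> i) z - \<nu> (\<sigma> i) / z) + norm (\<mu> (\<sigma> i)) * norm (F i0 z - \<nu> i0 / z)"
      by (metis norm_mult norm_triangle_ineq4)
    also have "\<dots> \<le> K (\<sigma> i) / (norm z)\<^sup>2 + norm (\<mu> (\<sigma> i)) * (K i0 / (norm z)\<^sup>2)"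
      using est[OF \<sigma>(1)[OF i]] est[OF i0] by (intro add_mono mult_left_mono) auto
    finally show "norm (G i z) \<le> (K (\<sigma> i) + norm (\<mu> (\<sigma> i)) * K i0) / (norm z)\<^sup>2" by (simp add: add_divide_distrib)
  qed
  obtain c i1 where c: "i1 < N" "c i1 \<noteq> 0" "\<And>z. z \<in> \<Omega> \<Longrightarrow> (\<Sum>i<N. c i * G i z) = 0"
    using fd[unfolded L2hol_finite_dim_def, rule_format, of G] GL by blast
  define j where "j = \<sigma> i1"
  have j: "j \<le> N" using \<sigma> c j_def by auto
  have disj: "z \<notin> ball (p i) (2 * \<rho>)" if "z \<in> ball (p j) \<rho>" "i \<le> N" "i \<noteq> j" for z i
    using sep[OF that(2) j that(3)] that(1) dist_triangle[of "p i" "p j" z] \<rho> by (auto simp: dist_commute)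
  have Uh: "cauchy_transform (U i) holomorphic_on ball (p j) \<rho>" if i: "i \<le> N" for i
  proof -
    have "cauchy_transform (U i) holomorphic_on - (- ball (p j) \<rho>)"
    proof (rule cauchy_transform_holomorphic[OF Ui])
      fix w assume "w \<notin> - ball (p j) \<rho>"
      then show "U i w = 0" using U0[of w j] U1[OF disj[OF _ i, of w]] by (cases "i = j") auto
    qed (intro closed_Compl open_ball)
    then show ?thesis by simp
  qed
  \<comment> \<open>Near \<open>p j\<close> the cut-offs are 1 for \<open>j\<close> and 0 for all other indices, so the relation reads \<open>c i1 * f = - H\<close>.\<close>
  define H where "H z = (\<Sum>i<N. c i * (cauchy_transform (U (\<sigma> i)) z - \<mu> (\<sigma> i) * cauchy_transform (U i0) z))" for z
  have "H holomorphic_on ball (p j) \<rho>" unfolding H_def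
    using Uh \<sigma> i0 by (intro holomorphic_intros) auto
  then have "(\<lambda>z. - H z / c i1) holomorphic_on ball (p j) \<rho>" using c by (intro holomorphic_intros) auto
  moreover have "- H z / c i1 = f z" if z: "z \<in> ball (p j) \<rho> \<inter> \<Omega>" for z
  proof -
    have zb: "z \<in> ball (p j) \<rho>" using z by auto
    have "\<theta> i0 z = 0" using disj[OF zb i0] \<sigma>(2)[OF c(1)] by (intro t0) (auto simp: j_def)
    moreover have "\<theta> (\<sigma> i) z = (if i = i1 then 1 else 0)" if "i < N" for i
      using disj[OF zb \<sigma>(1)[OF that]] \<sigma>inj[of i i1] t1[OF zb] t0[of z "\<sigma> i"] by (auto simp: j_def)
    ultimately have "c i * G i z = (if i = i1 then c i1 * f z else 0) + c i * (cauchy_transform (U (\<sigma> i)) z - \<mu> (\<sigma> i) * cauchy_transform (U i0) z)"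
      if "i < N" for i using that by (auto simp: G_def F_def algebra_simps)
    then have "(\<Sum>i<N. c i * G i z) = (\<Sum>i<N. (if i = i1 then c i1 * f z else 0) + c i * (cauchy_transform (U (\<sigma> i)) z - \<mu> (\<sigma> i) * cauchy_transform (U i0) z))"
      by (intro sum.cong) auto
    also have "\<dots> = c i1 * f z + H z"
      using c(1) by (simp add: sum.distrib H_def)
    finally have "c i1 * f z + H z = 0" using c(3)[of z] z by simp
    then have "c i1 * f z = - H z" by (simp add: add_eq_0_iff2)
    then show ?thesis using c(2) by (metis nonzero_mult_div_cancel_left)
  qed
  ultimately have "extends_at \<Omega> f (p j)" unfolding extends_at_def using \<rho>
    by (intro exI[of _ \<rho>] conjI exI[of _ "\<lambda>z. - H z / c i1"]) auto
  then show False using pT[OF j] by simp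
qed

lemma removable_finite:
  assumes "finite Q" "f holomorphic_on - Q" "\<And>q. q \<in> Q \<Longrightarrow> ((\<lambda>z. (z - q) * f z) \<longlongrightarrow> 0) (at q)"
  shows "\<exists>g. g holomorphic_on UNIV \<and> (\<forall>z. z \<notin> Q \<longrightarrow> g z = f z)"
  using assms
proof (induction Q arbitrary: f)
  case empty
  then show ?case by auto
next
  case (insert q Q)
  have o: "open (- Q)" using insert by (simp add: finite_imp_closed open_Compl)
  have int: "q \<in> interior (- Q)" using insert o by (simp add: interior_open)
  have "f holomorphic_on - Q - {q}" using insert.prems(1) by (rule holomorphic_on_subset) auto
  then obtain g where g: "g holomorphic_on - Q" "\<And>z. z \<in> - Q - {q} \<Longrightarrow> g z = f z"
    using holomorphic_on_extend_lim[OF _ int] insert.prems(2) by blast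
  have "((\<lambda>z. (z - q') * g z) \<longlongrightarrow> 0) (at q')" if "q' \<in> Q" for q'
  proof (rule Lim_transform_eventually)
    show "((\<lambda>z. (z - q') * f z) \<longlongrightarrow> 0) (at q')" using insert.prems(2) that by auto
    have "open (- insert q (Q - {q'}))" using insert by (intro open_Compl finite_imp_closed) auto
    moreover have "q' \<in> - insert q (Q - {q'})" using that insert by auto
    ultimately have "\<forall>\<^sub>F z in at q'. z \<in> - insert q (Q - {q'})" by (rule eventually_at_topological[THEN iffD2, OF exI, OF conjI, OF _ conjI]) auto
    moreover have "\<forall>\<^sub>F z in at q'. z \<noteq> q'" by (simp add: eventually_at_filter)
    ultimately show "\<forall>\<^sub>F z in at q'. (z - q') * f z = (z - q') * g z"
      by eventually_elim (use g(2) in auto)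
  qed
  then obtain h where "h holomorphic_on UNIV" "\<And>z. z \<notin> Q \<Longrightarrow> h z = g z" using insert.IH[OF g(1)] by blast
  then show ?case using g(2) by (intro exI[of _ h]) auto
qed

text \<open>By the submean inequality on \<open>ball z (\<bar>z - q\<bar> / 2)\<close>, the square of \<open>\<bar>z - q\<bar> \<bar>f z\<bar>\<close> is at most a constant
  times the mass of \<open>\<bar>f\<bar>\<^sup>2\<close> near \<open>q\<close>, and that mass tends to 0.\<close>

lemma L2_isolated_singularity:
  assumes f: "f holomorphic_on ball q (2 * d) - {q}" and d: "d > 0" and m: "(\<lambda>z. ennreal ((norm (f z))\<^sup>2)) \<in> borel_measurable lborel"
    and fin: "(\<integral>\<^sup>+z. ennreal ((norm (f z))\<^sup>2) \<partial>lborel) < \<infinity>"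
  shows "((\<lambda>z. (z - q) * f z) \<longlongrightarrow> 0) (at q)"
proof (rule tendstoI)
  fix e :: real assume e: "e > 0"
  define M where "M = density lborel (\<lambda>z. ennreal ((norm (f z))\<^sup>2))"
  define A where "A n = ball q (1 / Suc n)" for n
  have eM: "emeasure M S = (\<integral>\<^sup>+z\<in>S. ennreal ((norm (f z))\<^sup>2) \<partial>lborel)" if "S \<in> sets borel" for S
    unfolding M_def using m that by (subst emeasure_density) auto
  have fM: "emeasure M S \<noteq> \<infinity>" if "S \<in> sets borel" for S
  proof -
    have "emeasure M S \<le> (\<integral>\<^sup>+z. ennreal ((norm (f z))\<^sup>2) \<partial>lborel)" unfolding eM[OF that]
      by (rule nn_integral_mono) (auto simp: indicator_def)
    then show ?thesis using fin by auto
  qed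
  have "(\<lambda>n. emeasure M (A n)) \<longlonglongrightarrow> emeasure M (\<Inter>n. A n)"
  proof (rule Lim_emeasure_decseq)
    show "decseq A" unfolding A_def by (intro decseq_SucI subset_ball) (auto simp: frac_le)
  qed (use fM in \<open>auto simp: A_def M_def\<close>)
  moreover have "(\<Inter>n. A n) = {q}"
  proof
    show "{q} \<subseteq> (\<Inter>n. A n)" by (auto simp: A_def)
    show "(\<Inter>n. A n) \<subseteq> {q}"
    proof
      fix z assume z: "z \<in> (\<Inter>n. A n)"
      show "z \<in> {q}"
      proof (rule ccontr)
        assume "z \<notin> {q}"
        then obtain n where "inverse (real (Suc n)) < dist q z" using reals_Archimedean[of "dist q z"] by auto
        moreover have "dist q z < 1 / Suc n" using z by (auto simp: A_def)
        ultimately show False by (simp add: inverse_eq_divide)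
      qed
    qed
  qed
  moreover have "emeasure M {q} = 0"
  proof -
    have "AE z in lborel. ennreal ((norm (f z))\<^sup>2) * indicator {q} z = 0"
      using AE_lborel_singleton[of q] by eventually_elim auto
    then show ?thesis using m by (subst eM) (auto simp: nn_integral_0_iff_AE)
  qed
  ultimately have "(\<lambda>n. emeasure M (A n)) \<longlonglongrightarrow> 0" by simp
  moreover have "ennreal (pi * e\<^sup>2 / 16) > 0" using e by simp
  ultimately have "\<forall>\<^sub>F n in sequentially. emeasure M (A n) < ennreal (pi * e\<^sup>2 / 16)"
    by (rule order_tendstoD(2))
  then obtain n where n: "emeasure M (A n) < ennreal (pi * e\<^sup>2 / 16)" by (auto simp: eventually_sequentially)
  define \<delta> where "\<delta> = min d (1 / (2 * Suc n))"
  have \<delta>: "\<delta> > 0" using d by (simp add: \<delta>_def)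
  have "dist ((z - q) * f z) 0 < e" if z: "z \<noteq> q" "dist z q < \<delta>" for z
  proof -
    define s where "s = dist z q"
    have s: "s > 0" "s < d" "s < 1 / (2 * Suc n)" using z by (auto simp: s_def \<delta>_def)
    have "1 / real (2 * Suc n) = (1 / Suc n) / 2" by (simp add: field_simps)
    then have s2: "2 * s < 1 / Suc n" using s(3) by (simp only: field_sum_of_halves) (simp add: field_simps)
    have sub1: "ball z s \<subseteq> ball q (2 * d) - {q}"
    proof
      fix x assume x: "x \<in> ball z s"
      then have "dist q x < 2 * d" using dist_triangle[of q x z] s by (auto simp: s_def dist_commute)
      moreover have "x \<noteq> q" using x by (auto simp: s_def)
      ultimately show "x \<in> ball q (2 * d) - {q}" by auto
    qed
    have sub2: "ball z (s / 2) \<subseteq> A n"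
    proof
      fix x assume "x \<in> ball z (s / 2)"
      then have "dist z x < s / 2" "dist q z = s" by (auto simp: s_def dist_commute)
      then have a: "dist q x < 2 * s" using dist_triangle[of q x z] s(1) by linarith
      show "x \<in> A n" unfolding A_def mem_ball by (rule less_trans[OF a s2])
    qed
    have "ennreal (pi * (s / 2)\<^sup>2 * (norm (f z))\<^sup>2) \<le> (\<integral>\<^sup>+w\<in>ball z (s / 2). ennreal ((norm (f w))\<^sup>2) \<partial>lborel)"
      by (rule submean[OF holomorphic_on_subset[OF f sub1]]) (use s in auto)
    also have "\<dots> \<le> (\<integral>\<^sup>+w\<in>A n. ennreal ((norm (f w))\<^sup>2) \<partial>lborel)"
      by (rule nn_integral_mono) (use sub2 in \<open>auto simp: indicator_def\<close>)
    also have "\<dots> = emeasure M (A n)" by (rule eM[symmetric]) (simp add: A_def)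
    also have "\<dots> < ennreal (pi * e\<^sup>2 / 16)" by (rule n)
    finally have "pi * (s / 2)\<^sup>2 * (norm (f z))\<^sup>2 < pi * e\<^sup>2 / 16" by (simp add: ennreal_less_iff)
    then have "(s * norm (f z))\<^sup>2 < (e / 2)\<^sup>2" by (simp add: power_mult_distrib power_divide)
    then have "s * norm (f z) < e / 2" by (rule power2_less_imp_less) (use e in simp)
    then show ?thesis using e by (simp add: norm_mult s_def dist_norm)
  qed
  then show "\<forall>\<^sub>F z in at q. dist ((z - q) * f z) 0 < e"
    using \<delta> by (auto simp: eventually_at intro!: exI[of _ \<delta>])
qed

text \<open>The submean inequality on discs of arbitrarily large radius.\<close>

lemma entire_L2_zero:
  assumes g: "g holomorphic_on UNIV" and fin: "(\<integral>\<^sup>+z. ennreal ((norm (g z))\<^sup>2) \<partial>lborel) < \<infinity>"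
  shows "g z = 0"
proof (rule ccontr)
  assume nz: "g z \<noteq> 0"
  define I where "I = enn2real (\<integral>\<^sup>+z. ennreal ((norm (g z))\<^sup>2) \<partial>lborel)"
  have I: "(\<integral>\<^sup>+z. ennreal ((norm (g z))\<^sup>2) \<partial>lborel) = ennreal I" using fin by (simp add: I_def)
  have I0: "I \<ge> 0" by (simp add: I_def)
  have le: "pi * r\<^sup>2 * (norm (g z))\<^sup>2 \<le> I" if "r \<ge> 0" for r
  proof -
    have "ennreal (pi * r\<^sup>2 * (norm (g z))\<^sup>2) \<le> (\<integral>\<^sup>+w\<in>ball z r. ennreal ((norm (g w))\<^sup>2) \<partial>lborel)"
      by (rule submean[of _ _ "r + 1"]) (use that g in \<open>auto elim: holomorphic_on_subset\<close>)
    also have "\<dots> \<le> ennreal I" unfolding I[symmetric] by (rule nn_integral_mono) (auto simp: indicator_def)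
    finally show ?thesis using I0 by (simp add: ennreal_le_iff)
  qed
  define r where "r = sqrt ((I + 1) / (pi * (norm (g z))\<^sup>2))"
  have "pi * r\<^sup>2 * (norm (g z))\<^sup>2 = I + 1"
    using nz I0 unfolding r_def by (subst real_sqrt_pow2) (auto simp: field_simps)
  moreover have "r \<ge> 0" using I0 unfolding r_def by (intro real_sqrt_ge_zero divide_nonneg_nonneg) auto
  ultimately show False using le[of r] by simp
qed

text \<open>In the plane the Bergman space is trivial or infinite dimensional.\<close>

text \<open>Wiegerinck's dichotomy: the Bergman space of a plane domain is trivial or infinite dimensional. If it
  is finite dimensional and \<open>f\<close> is a nonzero member, then \<open>\<Omega>\<close> has full measure and \<open>f\<close> extends across all
  but finitely many points of the complement; as \<open>\<Omega>\<close> is dense, the local extensions fit together.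
  The remaining points are isolated \<open>L\<^sup>2\<close> singularities, so the extension is entire and square
  integrable.\<close>

theorem planar_finite_dim_trivial:
  assumes \<Omega>: "open \<Omega>" "connected \<Omega>" and fd: "L2hol_finite_dim \<Omega> N" and f: "f \<in> L2hol \<Omega>" and a: "a \<in> \<Omega>"
  shows "f a = 0"
proof (rule ccontr)
  assume fa: "f a \<noteq> 0"
  have null: "- \<Omega> \<in> null_sets lborel" by (rule finite_dim_null_complement[OF \<Omega> fd f a fa])
  have ae: "AE z in lborel. z \<in> \<Omega>" using AE_not_in[OF null] by auto
  define Q where "Q = {p. \<not> extends_at \<Omega> f p}"
  have Q: "finite Q" unfolding Q_def by (rule non_extendable_finite[OF \<Omega>(1) fd f])
  have hol: "f holomorphic_on \<Omega>" and ffin: "(\<integral>\<^sup>+z\<in>\<Omega>. ennreal ((norm (f z))\<^sup>2) \<partial>lborel) < \<infinity>" using f by (auto simp: L2hol_def)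
  have dense: "z islimpt \<Omega>" for z
  proof (rule islimptI)
    fix T assume T: "z \<in> T" "open T"
    show "\<exists>y\<in>\<Omega>. y \<in> T \<and> y \<noteq> z"
    proof (rule ccontr)
      assume "\<not> ?thesis"
      then have "T \<subseteq> - \<Omega> \<union> {z}" by auto
      moreover have "- \<Omega> \<union> {z} \<in> null_sets lborel" by (rule null_sets.Un[OF null]) (auto simp: null_sets_def)
      ultimately have "T \<in> null_sets lborel" using T null_sets_subset by (metis borel_open sets_lborel)
      then have "negligible T" by (simp add: negligible_iff_null_sets null_sets_completionI)
      then show False using T open_not_negligible by blast
    qed
  qed
  \<comment> \<open>All local extensions agree with the limit along \<open>\<Omega>\<close>.\<close>
  define h where "h z = (if z \<in> \<Omega> then f z else Lim (at z within \<Omega>) f)" for z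
  have hext: "\<exists>r>0. h holomorphic_on ball p r" if p: "p \<notin> Q" for p
  proof -
    obtain r g where r: "r > 0" "g holomorphic_on ball p r" "\<And>z. z \<in> ball p r \<inter> \<Omega> \<Longrightarrow> g z = f z"
      using p unfolding Q_def extends_at_def by blast
    have "h z = g z" if z: "z \<in> ball p r" for z
    proof (cases "z \<in> \<Omega>")
      case True then show ?thesis using r(3) z by (simp add: h_def)
    next
      case False
      have "(g \<longlongrightarrow> g z) (at z within \<Omega>)"
        using r(2) z holomorphic_on_imp_continuous_on continuous_on_eq_continuous_at[OF open_ball] by (metis Lim_at_imp_Lim_at_within continuous_at)
      moreover have "\<forall>\<^sub>F x in at z within \<Omega>. g x = f x"
        using r(3) z by (auto simp: eventually_at_topological intro!: exI[of _ "ball p r"])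
      ultimately have "(f \<longlongrightarrow> g z) (at z within \<Omega>)" by (rule Lim_transform_eventually)
      then have "Lim (at z within \<Omega>) f = g z"
        using dense[of z] by (intro tendsto_Lim) (auto simp: trivial_limit_within)
      then show ?thesis using False by (simp add: h_def)
    qed
    then have "h holomorphic_on ball p r" by (intro holomorphic_transform[OF r(2)]) auto
    then show ?thesis using r(1) by blast
  qed
  have hQ: "h holomorphic_on - Q"
  proof (subst holomorphic_on_open)
    show "open (- Q)" using Q by (simp add: finite_imp_closed open_Compl)
    show "\<forall>p\<in>- Q. \<exists>f'. (h has_field_derivative f') (at p)"
      using hext by (metis Compl_iff centre_in_ball holomorphic_derivI open_ball)
  qed
  have hf: "h z = f z" if "z \<in> \<Omega>" for z using that by (simp add: h_def)
  have m\<Omega>: "(\<lambda>z. ennreal ((norm (h z))\<^sup>2) * indicator (- Q) z) \<in> borel_measurable lborel"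
    using measurable_L2_integrand(2)[OF holomorphic_on_imp_continuous_on[OF hQ]] Q by (simp add: finite_imp_closed open_Compl)
  define h0 where "h0 z = indicator (- Q) z *\<^sub>R h z" for z
  have h0m: "(\<lambda>z. ennreal ((norm (h0 z))\<^sup>2)) \<in> borel_measurable lborel"
  proof -
    have "h0 \<in> borel_measurable borel"
      using measurable_L2_integrand(1)[OF holomorphic_on_imp_continuous_on[OF hQ]] Q
      unfolding h0_def by (simp add: finite_imp_closed open_Compl)
    then show ?thesis by measurable
  qed
  have Q\<Omega>: "Q \<inter> \<Omega> = {}"
  proof -
    have "extends_at \<Omega> f p" if p: "p \<in> \<Omega>" for p
    proof -
      obtain r where "r > 0" "ball p r \<subseteq> \<Omega>" using \<Omega> p by (metis openE)
      then show ?thesis unfolding extends_at_def using hol by (intro exI[of _ r] conjI exI[of _ f]) (auto elim: holomorphic_on_subset)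
    qed
    then show ?thesis by (auto simp: Q_def)
  qed
  have h0fin: "(\<integral>\<^sup>+z. ennreal ((norm (h0 z))\<^sup>2) \<partial>lborel) < \<infinity>"
  proof -
    have "(\<integral>\<^sup>+z. ennreal ((norm (h0 z))\<^sup>2) \<partial>lborel) = (\<integral>\<^sup>+z\<in>\<Omega>. ennreal ((norm (f z))\<^sup>2) \<partial>lborel)"
      by (rule nn_integral_cong_AE, use ae in eventually_elim) (use Q\<Omega> hf in \<open>auto simp: h0_def indicator_def\<close>)
    then show ?thesis using ffin by simp
  qed
  have hQ0: "h0 holomorphic_on - Q" by (rule holomorphic_transform[OF hQ]) (auto simp: h0_def)
  have lim: "((\<lambda>z. (z - q) * h0 z) \<longlongrightarrow> 0) (at q)" if q: "q \<in> Q" for q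
  proof -
    have "open (- (Q - {q}))" using Q by (intro open_Compl finite_imp_closed) auto
    then obtain d where d: "d > 0" "ball q d \<subseteq> - (Q - {q})" using q by (metis ComplI DiffD2 insertI1 openE)
    have "h0 holomorphic_on ball q (2 * (d / 2)) - {q}"
      by (rule holomorphic_on_subset[OF hQ0]) (use d in auto)
    then show ?thesis by (rule L2_isolated_singularity) (use d h0m h0fin in auto)
  qed
  obtain g where g: "g holomorphic_on UNIV" "\<And>z. z \<notin> Q \<Longrightarrow> g z = h0 z"
    using removable_finite[OF Q hQ0 lim] by blast
  have "(\<integral>\<^sup>+z. ennreal ((norm (g z))\<^sup>2) \<partial>lborel) = (\<integral>\<^sup>+z. ennreal ((norm (h0 z))\<^sup>2) \<partial>lborel)"
  proof (rule nn_integral_cong_AE, use ae in eventually_elim)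
    fix z assume "z \<in> \<Omega>"
    then have "z \<notin> Q" using Q\<Omega> by blast
    then show "ennreal ((norm (g z))\<^sup>2) = ennreal ((norm (h0 z))\<^sup>2)" by (simp add: g(2))
  qed
  then have "g a = 0" by (intro entire_L2_zero[OF g(1)]) (simp only: h0fin)
  moreover have "g a = f a" using g(2)[of a] Q\<Omega> a hf by (auto simp: h0_def indicator_def)
  ultimately show False using fa by simp
qed

section \<open>Holomorphic functions of two variables\<close>

definition hol2 :: "complex set \<Rightarrow> complex set \<Rightarrow> (complex \<Rightarrow> complex \<Rightarrow> complex) \<Rightarrow> bool" where
  "hol2 U W H \<longleftrightarrow> (\<forall>w\<in>W. (\<lambda>z. H z w) holomorphic_on U) \<and> (\<forall>z\<in>U. H z holomorphic_on W) \<and>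
     continuous_on (U \<times> W) (\<lambda>(z, w). H z w)"

definition D1 :: "(complex \<Rightarrow> complex \<Rightarrow> complex) \<Rightarrow> complex \<Rightarrow> complex \<Rightarrow> complex" where
  "D1 H z w = deriv (\<lambda>z. H z w) z"

definition D2 :: "(complex \<Rightarrow> complex \<Rightarrow> complex) \<Rightarrow> complex \<Rightarrow> complex \<Rightarrow> complex" where
  "D2 H z w = deriv (H z) w"

lemma hol2_fst: "hol2 U W H \<Longrightarrow> w \<in> W \<Longrightarrow> (\<lambda>z. H z w) holomorphic_on U"
  and hol2_snd: "hol2 U W H \<Longrightarrow> z \<in> U \<Longrightarrow> H z holomorphic_on W"
  by (auto simp: hol2_def)

lemma hol2_swap: "hol2 U W H \<Longrightarrow> hol2 W U (\<lambda>w z. H z w)"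
proof -
  assume H: "hol2 U W H"
  have "continuous_on (W \<times> U) ((\<lambda>(z, w). H z w) \<circ> prod.swap)"
    using H by (intro continuous_on_compose continuous_on_swap) (auto simp: hol2_def product_swap)
  then show ?thesis using H by (auto simp: hol2_def o_def case_prod_unfold)
qed

lemma hol2_subset: "hol2 U W H \<Longrightarrow> U' \<subseteq> U \<Longrightarrow> W' \<subseteq> W \<Longrightarrow> hol2 U' W' H"
  unfolding hol2_def by (meson Sigma_mono continuous_on_subset holomorphic_on_subset subsetD)

lemma hol2_add: "hol2 U W F \<Longrightarrow> hol2 U W G \<Longrightarrow> hol2 U W (\<lambda>z w. F z w + G z w)"
  and hol2_diff: "hol2 U W F \<Longrightarrow> hol2 U W G \<Longrightarrow> hol2 U W (\<lambda>z w. F z w - G z w)"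
  and hol2_mult: "hol2 U W F \<Longrightarrow> hol2 U W G \<Longrightarrow> hol2 U W (\<lambda>z w. F z w * G z w)"
  by (auto simp: hol2_def case_prod_unfold intro!: holomorphic_intros continuous_intros)

lemma hol2_divide:
  "hol2 U W F \<Longrightarrow> hol2 U W G \<Longrightarrow> (\<And>z w. z \<in> U \<Longrightarrow> w \<in> W \<Longrightarrow> G z w \<noteq> 0) \<Longrightarrow> hol2 U W (\<lambda>z w. F z w / G z w)"
  by (auto simp: hol2_def case_prod_unfold intro!: holomorphic_intros continuous_intros)

lemma hol2_first: "f holomorphic_on U \<Longrightarrow> hol2 U W (\<lambda>z w. f z)"
  unfolding hol2_def case_prod_unfold
  by (auto intro!: holomorphic_intros continuous_on_compose2[OF holomorphic_on_imp_continuous_on[of f U] continuous_on_fst])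

lemma hol2_second: "f holomorphic_on W \<Longrightarrow> hol2 U W (\<lambda>z w. f w)"
  using hol2_swap[OF hol2_first[of f W U]] by simp

lemma hol2_const: "hol2 U W (\<lambda>z w. c)"
  by (rule hol2_first) auto

lemma hol2_compose:
  assumes H: "hol2 U W H" and f: "f holomorphic_on S" and S: "\<And>z w. z \<in> U \<Longrightarrow> w \<in> W \<Longrightarrow> H z w \<in> S"
  shows "hol2 U W (\<lambda>z w. f (H z w))"
proof -
  have "continuous_on (U \<times> W) (\<lambda>p. f ((\<lambda>(z, w). H z w) p))"
    by (rule continuous_on_compose2[OF holomorphic_on_imp_continuous_on[OF f]]) (use H S in \<open>auto simp: hol2_def\<close>)
  moreover have "(\<lambda>z. f (H z w)) holomorphic_on U" if "w \<in> W" for w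
    using holomorphic_on_compose_gen[OF hol2_fst[OF H that] f] S that by (auto simp: o_def)
  moreover have "(\<lambda>w. f (H z w)) holomorphic_on W" if "z \<in> U" for z
    using holomorphic_on_compose_gen[OF hol2_snd[OF H that] f] S that by (auto simp: o_def)
  ultimately show ?thesis by (auto simp: hol2_def case_prod_unfold)
qed

lemma deriv_bound:
  assumes f: "f holomorphic_on ball z r" and r: "r > 0" and M: "\<And>x. x \<in> ball z r \<Longrightarrow> norm (f x) \<le> M"
  shows "norm ((deriv ^^ n) f z) \<le> fact n * M / (r / 2) ^ n"
proof (rule Cauchy_inequality)
  show "f holomorphic_on ball z (r / 2)" by (rule holomorphic_on_subset[OF f]) (use r in auto)
  show "continuous_on (cball z (r / 2)) f"
    by (rule holomorphic_on_imp_continuous_on[OF holomorphic_on_subset[OF f]]) (use r in auto)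
  show "norm (f x) \<le> M" if "norm (z - x) = r / 2" for x
    using that r by (intro M) (auto simp: dist_norm)
qed (use r in auto)

text \<open>A locally bounded separately holomorphic function is continuous by the Cauchy estimates.\<close>

lemma hol2I_bounded:
  assumes o: "open U" "open W" and h1: "\<And>w. w \<in> W \<Longrightarrow> (\<lambda>z. H z w) holomorphic_on U"
    and h2: "\<And>z. z \<in> U \<Longrightarrow> H z holomorphic_on W"
    and bd: "\<And>z0 w0. z0 \<in> U \<Longrightarrow> w0 \<in> W \<Longrightarrow> \<exists>r>0. \<exists>M. \<forall>z\<in>ball z0 r. \<forall>w\<in>ball w0 r. norm (H z w) \<le> M"
  shows "hol2 U W H"
proof -
  have "isCont (\<lambda>(z, w). H z w) (z0, w0)" if z0: "z0 \<in> U" and w0: "w0 \<in> W" for z0 w0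
  proof -
    obtain r M where r: "r > 0" and M: "\<And>z w. z \<in> ball z0 r \<Longrightarrow> w \<in> ball w0 r \<Longrightarrow> norm (H z w) \<le> M"
      using bd[OF z0 w0] by blast
    obtain r1 where r1: "r1 > 0" "ball z0 r1 \<subseteq> U" using o z0 by (metis openE)
    obtain r2 where r2: "r2 > 0" "ball w0 r2 \<subseteq> W" using o w0 by (metis openE)
    define s where "s = min r (min r1 r2)"
    have s: "s > 0" using r r1 r2 by (simp add: s_def)
    have sU: "ball z0 s \<subseteq> U" "ball w0 s \<subseteq> W" using r1 r2 by (auto simp: s_def)
    have sM: "norm (H z w) \<le> M" if "z \<in> ball z0 s" "w \<in> ball w0 s" for z w
      using that by (intro M) (auto simp: s_def)
    have M0: "M \<ge> 0" using sM[of z0 w0] s norm_ge_zero order_trans by (metis centre_in_ball)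
    have lip: "norm (H z w - H z0 w) \<le> 4 * M / s * norm (z - z0)" if z: "z \<in> ball z0 (s / 2)" and w: "w \<in> ball w0 s" for z w
    proof (rule field_differentiable_bound[where S="ball z0 (s/2)" and f="\<lambda>z. H z w" and f'="deriv (\<lambda>z. H z w)"])
      fix y assume y: "y \<in> ball z0 (s / 2)"
      have "w \<in> W" using w sU by blast
      then have hw: "(\<lambda>z. H z w) holomorphic_on ball z0 s" by (rule holomorphic_on_subset[OF h1 sU(1)])
      have sub: "ball y (s / 2) \<subseteq> ball z0 s"
      proof
        fix x assume "x \<in> ball y (s / 2)"
        then show "x \<in> ball z0 s" using y dist_triangle[of z0 x y] by auto
      qed
      have "norm ((deriv ^^ 1) (\<lambda>z. H z w) y) \<le> fact 1 * M / (s / 2 / 2) ^ 1"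
        by (rule deriv_bound[OF holomorphic_on_subset[OF hw sub]]) (use s sM w sub in auto)
      then show "norm (deriv (\<lambda>z. H z w) y) \<le> 4 * M / s" by (simp add: mult.commute)
      have "y \<in> ball z0 s" by (rule subsetD[OF sub]) (use s in simp)
      then have "((\<lambda>z. H z w) has_field_derivative deriv (\<lambda>z. H z w) y) (at y)"
        by (rule holomorphic_derivI[OF hw open_ball])
      then show "((\<lambda>z. H z w) has_field_derivative deriv (\<lambda>z. H z w) y) (at y within ball z0 (s / 2))"
        by (rule has_field_derivative_at_within)
    qed (use z s in auto)
    have c0: "isCont (H z0) w0" using holomorphic_on_imp_continuous_on[OF h2[OF z0]] continuous_on_eq_continuous_at[OF o(2)] w0 by blast
    have ev: "\<forall>\<^sub>F p in at (z0, w0). p \<in> ball z0 (s / 2) \<times> ball w0 s"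
      by (intro eventually_at_in_open' open_Times) (use s in auto)
    have t0: "((\<lambda>p. 4 * M / s * norm (fst p - z0) + norm (H z0 (snd p) - H z0 w0)) \<longlongrightarrow> 4 * M / s * norm (z0 - z0) + norm (H z0 w0 - H z0 w0)) (at (z0, w0))"
    proof -
      have "((\<lambda>p. H z0 (snd p)) \<longlongrightarrow> H z0 w0) (at (z0, w0))"
        by (rule isCont_tendsto_compose[OF c0]) (auto intro!: tendsto_eq_intros)
      moreover have "((\<lambda>p. fst p) \<longlongrightarrow> z0) (at (z0, w0))" by (auto intro!: tendsto_eq_intros)
      ultimately show ?thesis by (intro tendsto_intros)
    qed
    have "((\<lambda>p. (case p of (z, w) \<Rightarrow> H z w) - H z0 w0) \<longlongrightarrow> 0) (at (z0, w0))"
    proof (rule Lim_null_comparison)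
      show "((\<lambda>p. 4 * M / s * norm (fst p - z0) + norm (H z0 (snd p) - H z0 w0)) \<longlongrightarrow> 0) (at (z0, w0))" using t0 by simp
      show "\<forall>\<^sub>F p in at (z0, w0). norm ((case p of (z, w) \<Rightarrow> H z w) - H z0 w0) \<le> 4 * M / s * norm (fst p - z0) + norm (H z0 (snd p) - H z0 w0)"
        using ev
      proof eventually_elim
        case (elim p)
        have "(case p of (z, w) \<Rightarrow> H z w) - H z0 w0 = (H (fst p) (snd p) - H z0 (snd p)) + (H z0 (snd p) - H z0 w0)" by (simp add: case_prod_unfold)
        then show ?case using lip[of "fst p" "snd p"] elim norm_triangle_ineq[of "H (fst p) (snd p) - H z0 (snd p)" "H z0 (snd p) - H z0 w0"] by auto
      qed
    qed
    then show ?thesis unfolding isCont_def by (simp add: LIM_zero_iff)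
  qed
  then have "continuous_on (U \<times> W) (\<lambda>(z, w). H z w)" by (intro continuous_at_imp_continuous_on) auto
  then show ?thesis using h1 h2 by (auto simp: hol2_def)
qed

lemma hol2_locally_bounded:
  assumes "hol2 U W H" "open U" "open W" "z0 \<in> U" "w0 \<in> W"
  obtains r M where "r > 0" "ball z0 r \<subseteq> U" "cball w0 r \<subseteq> W" "\<And>z w. z \<in> ball z0 r \<Longrightarrow> w \<in> cball w0 r \<Longrightarrow> norm (H z w) \<le> M"
proof -
  obtain r1 where r1: "r1 > 0" "cball z0 r1 \<subseteq> U" using assms by (meson open_contains_cball)
  obtain r2 where r2: "r2 > 0" "cball w0 r2 \<subseteq> W" using assms by (meson open_contains_cball)
  define s where "s = min r1 r2"
  have sub: "cball z0 s \<times> cball w0 s \<subseteq> U \<times> W" using r1 r2 by (auto simp: s_def)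
  have "compact ((\<lambda>(z, w). H z w) ` (cball z0 s \<times> cball w0 s))"
    using assms(1) sub by (intro compact_continuous_image compact_Times) (auto simp: hol2_def elim: continuous_on_subset)
  then obtain M where M: "\<And>y. y \<in> (\<lambda>(z, w). H z w) ` (cball z0 s \<times> cball w0 s) \<Longrightarrow> norm y \<le> M"
    using compact_imp_bounded bounded_iff by metis
  show thesis
  proof (rule that[of s M])
    show "norm (H z w) \<le> M" if "z \<in> ball z0 s" "w \<in> cball w0 s" for z w
      using that by (intro M image_eqI[of _ _ "(z, w)"]) auto
  qed (use r1 r2 in \<open>auto simp: s_def\<close>)
qed

text \<open>Uniformity in the second variable makes the limit of the difference quotients holomorphic in that
  variable.\<close>

lemma D1_uniform_quotient:
  assumes H: "hol2 U W H" "open U" "open W" and z0: "z0 \<in> U" and w0: "w0 \<in> W"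
  obtains r where "r > 0" "cball w0 r \<subseteq> W"
    "uniform_limit (cball w0 r) (\<lambda>h w. (H (z0 + h) w - H z0 w) / h) (D1 H z0) (at 0)"
    "\<forall>\<^sub>F h in at 0. z0 + h \<in> U"
proof -
  obtain r M where r: "r > 0" "ball z0 r \<subseteq> U" "cball w0 r \<subseteq> W" and M: "\<And>z w. z \<in> ball z0 r \<Longrightarrow> w \<in> cball w0 r \<Longrightarrow> norm (H z w) \<le> M"
    using hol2_locally_bounded[OF H z0 w0] by metis
  define C where "C = 2 * M / (r / 4) ^ 2"
  have M0: "M \<ge> 0" using M[of z0 w0] r norm_ge_zero order_trans by (metis centre_in_ball centre_in_cball less_imp_le)
  have C0: "C \<ge> 0" using M0 by (simp add: C_def)
  have est: "norm ((H (z0 + h) w - H z0 w) / h - D1 H z0 w) \<le> C * norm h" if h: "h \<noteq> 0" "norm h < r / 2" and w: "w \<in> cball w0 r" for h w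
  proof -
    define f where "f = (\<lambda>z. H z w)"
    have fh: "f holomorphic_on ball z0 r" unfolding f_def
      by (rule holomorphic_on_subset[OF hol2_fst[OF H(1)] r(2)]) (use w r in blast)
    have "norm ((deriv ^^ 0) f (z0 + h) - (\<Sum>i\<le>1. (deriv ^^ i) f z0 * ((z0 + h) - z0) ^ i / fact i)) \<le> C * norm ((z0 + h) - z0) ^ Suc 1 / fact 1"
    proof (rule complex_Taylor[where S="ball z0 (r / 2)"])
      fix i and x assume x: "x \<in> ball z0 (r / 2)"
      have xr: "x \<in> ball z0 r" using x r subset_ball[of "r / 2" r z0] by auto
      have "((deriv ^^ i) f has_field_derivative deriv ((deriv ^^ i) f) x) (at x)"
        by (rule holomorphic_derivI[OF holomorphic_higher_deriv[OF fh open_ball] open_ball xr])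
      then show "((deriv ^^ i) f has_field_derivative (deriv ^^ Suc i) f x) (at x within ball z0 (r / 2))"
        by (simp add: has_field_derivative_at_within)
    next
      fix x assume x: "x \<in> ball z0 (r / 2)"
      have sub: "ball x (r / 2) \<subseteq> ball z0 r"
      proof
        fix y assume "y \<in> ball x (r / 2)"
        then show "y \<in> ball z0 r" using x dist_triangle[of z0 y x] by auto
      qed
      have "norm ((deriv ^^ 2) f x) \<le> fact 2 * M / (r / 2 / 2) ^ 2"
        by (rule deriv_bound[OF holomorphic_on_subset[OF fh sub]]) (use r M w sub in \<open>auto simp: f_def\<close>)
      then show "norm ((deriv ^^ Suc 1) f x) \<le> C" by (simp add: C_def numeral_2_eq_2)
    qed (use h r in \<open>auto simp: dist_norm\<close>)
    then have "norm (f (z0 + h) - f z0 - deriv f z0 * h) \<le> C * (norm h * norm h)" by (simp add: algebra_simps)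
    then have "norm (f (z0 + h) - f z0 - deriv f z0 * h) / norm h \<le> C * norm h"
      using h by (simp add: pos_divide_le_eq mult.assoc)
    moreover have "(f (z0 + h) - f z0 - deriv f z0 * h) / h = (H (z0 + h) w - H z0 w) / h - D1 H z0 w"
      using h by (simp add: f_def D1_def diff_divide_distrib)
    ultimately show ?thesis by (metis norm_divide)
  qed
  have "uniform_limit (cball w0 r) (\<lambda>h w. (H (z0 + h) w - H z0 w) / h) (D1 H z0) (at 0)"
  proof (rule uniform_limitI)
    fix e :: real assume e: "e > 0"
    define \<delta> where "\<delta> = min (r / 2) (e / (C + 1))"
    have \<delta>: "\<delta> > 0" using r e C0 by (simp add: \<delta>_def)
    have "dist ((H (z0 + h) w - H z0 w) / h) (D1 H z0 w) < e" if h: "h \<noteq> 0" "norm h < \<delta>" and w: "w \<in> cball w0 r" for h w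
    proof -
      have "norm ((H (z0 + h) w - H z0 w) / h - D1 H z0 w) \<le> C * norm h" by (rule est) (use h w in \<open>auto simp: \<delta>_def\<close>)
      also have "\<dots> \<le> (C + 1) * norm h" by (simp add: mult_right_mono)
      also have "\<dots> < (C + 1) * (e / (C + 1))" using h C0 by (intro mult_strict_left_mono) (auto simp: \<delta>_def)
      also have "\<dots> = e" using C0 by simp
      finally show ?thesis by (simp add: dist_norm)
    qed
    then show "\<forall>\<^sub>F h in at 0. \<forall>w\<in>cball w0 r. dist ((H (z0 + h) w - H z0 w) / h) (D1 H z0 w) < e"
      using \<delta> by (auto simp: eventually_at intro!: exI[of _ \<delta>])
  qed
  moreover have "\<forall>\<^sub>F h in at 0. z0 + h \<in> U"
    using r by (auto simp: eventually_at dist_norm subset_iff intro!: exI[of _ r])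
  ultimately show thesis using that r by blast
qed

lemma D1_second:
  assumes H: "hol2 U W H" "open U" "open W" and z0: "z0 \<in> U" and w0: "w0 \<in> W"
  shows "\<exists>d. (D1 H z0 has_field_derivative d) (at w0) \<and>
    ((\<lambda>h. (D2 H (z0 + h) w0 - D2 H z0 w0) / h) \<longlongrightarrow> d) (at 0)"
proof -
  obtain r where r: "r > 0" "cball w0 r \<subseteq> W"
    and ul: "uniform_limit (cball w0 r) (\<lambda>h w. (H (z0 + h) w - H z0 w) / h) (D1 H z0) (at 0)"
    and ev: "\<forall>\<^sub>F h in at 0. z0 + h \<in> U"
    by (rule D1_uniform_quotient[OF assms]) blast
  have ev': "\<forall>\<^sub>F h in at 0. continuous_on (cball w0 r) (\<lambda>w. (H (z0 + h) w - H z0 w) / h) \<and>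
     (\<forall>w\<in>ball w0 r. ((\<lambda>w. (H (z0 + h) w - H z0 w) / h) has_field_derivative (D2 H (z0 + h) w - D2 H z0 w) / h) (at w))"
    using ev
  proof eventually_elim
    case (elim h)
    have hh: "H (z0 + h) holomorphic_on W" "H z0 holomorphic_on W" using hol2_snd[OF H(1)] elim z0 by auto
    have "continuous_on (cball w0 r) (\<lambda>w. (H (z0 + h) w - H z0 w) * inverse h)"
      using hh r by (intro continuous_intros) (auto intro: holomorphic_on_imp_continuous_on holomorphic_on_subset)
    moreover have "((\<lambda>w. (H (z0 + h) w - H z0 w) * inverse h) has_field_derivative (D2 H (z0 + h) w - D2 H z0 w) * inverse h) (at w)"
      if w: "w \<in> ball w0 r" for w
    proof -
      have "w \<in> W" using r w by auto
      then have "(H (z0 + h) has_field_derivative D2 H (z0 + h) w) (at w)" "(H z0 has_field_derivative D2 H z0 w) (at w)"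
        using hh H(3) by (auto simp: D2_def holomorphic_derivI)
      then show ?thesis by (intro DERIV_cmult_right DERIV_diff)
    qed
    ultimately show ?case unfolding divide_inverse by blast
  qed
  obtain g' where "\<And>w. w \<in> ball w0 r \<Longrightarrow> (D1 H z0 has_field_derivative g' w) (at w) \<and> ((\<lambda>h. (D2 H (z0 + h) w - D2 H z0 w) / h) \<longlongrightarrow> g' w) (at 0)"
    by (rule has_complex_derivative_uniform_limit[OF ev' ul _ r(1)]) auto
  then show ?thesis using r(1) by (intro exI[of _ "g' w0"]) auto
qed

lemma hol2_D1:
  assumes H: "hol2 U W H" "open U" "open W"
  shows "hol2 U W (D1 H)"
proof (rule hol2I_bounded[OF H(2,3)])
  show "(\<lambda>z. D1 H z w) holomorphic_on U" if "w \<in> W" for w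
    unfolding D1_def using hol2_fst[OF H(1) that] H by (intro holomorphic_deriv) auto
  show "D1 H z holomorphic_on W" if "z \<in> U" for z
    using D1_second[OF H that] H by (subst holomorphic_on_open) blast+
  fix z0 w0 assume "z0 \<in> U" "w0 \<in> W"
  then obtain r M where r: "r > 0" "ball z0 r \<subseteq> U" "cball w0 r \<subseteq> W" and M: "\<And>z w. z \<in> ball z0 r \<Longrightarrow> w \<in> cball w0 r \<Longrightarrow> norm (H z w) \<le> M"
    using hol2_locally_bounded[OF H] by metis
  have "norm (D1 H z w) \<le> M / (r / 4)" if z: "z \<in> ball z0 (r / 2)" and w: "w \<in> ball w0 (r / 2)" for z w
  proof -
    have wr: "w \<in> cball w0 r" using w r by auto
    have sub: "ball z (r / 2) \<subseteq> ball z0 r"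
    proof
      fix y assume "y \<in> ball z (r / 2)"
      then show "y \<in> ball z0 r" using z dist_triangle[of z0 y z] by auto
    qed
    have "norm ((deriv ^^ 1) (\<lambda>z. H z w) z) \<le> fact 1 * M / (r / 2 / 2) ^ 1"
    proof (rule deriv_bound)
      have "w \<in> W" using wr r by blast
      then show "(\<lambda>z. H z w) holomorphic_on ball z (r / 2)"
        by (rule holomorphic_on_subset[OF hol2_fst[OF H(1)] subset_trans[OF sub r(2)]])
    qed (use r M wr sub in auto)
    then show ?thesis by (simp add: D1_def)
  qed
  then have "\<forall>z\<in>ball z0 (r / 2). \<forall>w\<in>ball w0 (r / 2). norm (D1 H z w) \<le> M / (r / 4)" by blast
  then show "\<exists>r>0. \<exists>M. \<forall>z\<in>ball z0 r. \<forall>w\<in>ball w0 r. norm (D1 H z w) \<le> M"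
    using r(1) half_gt_zero by blast
qed

lemma D2_swap: "D2 H z w = D1 (\<lambda>w z. H z w) w z"
  by (simp add: D1_def D2_def)

lemma hol2_D2:
  assumes H: "hol2 U W H" "open U" "open W"
  shows "hol2 U W (D2 H)"
  using hol2_swap[OF hol2_D1[OF hol2_swap[OF H(1)] H(3,2)]] by (simp add: D2_swap[abs_def])

lemma D1_D2_commute:
  assumes H: "hol2 U W H" "open U" "open W" and z: "z \<in> U" and w: "w \<in> W"
  shows "D2 (D1 H) z w = D1 (D2 H) z w"
proof -
  obtain d where d: "(D1 H z has_field_derivative d) (at w)" "((\<lambda>h. (D2 H (z + h) w - D2 H z w) / h) \<longlongrightarrow> d) (at 0)"
    using D1_second[OF H z w] by blast
  have "((\<lambda>z. D2 H z w) has_field_derivative D1 (D2 H) z w) (at z)"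
    unfolding D1_def[of "D2 H"] using hol2_fst[OF hol2_D2[OF H] w] H z by (intro holomorphic_derivI) auto
  then have "((\<lambda>h. (D2 H (z + h) w - D2 H z w) / h) \<longlongrightarrow> D1 (D2 H) z w) (at 0)" by (simp add: DERIV_def)
  then have "D1 (D2 H) z w = d" using d(2) tendsto_unique trivial_limit_at by blast
  then show ?thesis using d(1) by (simp add: D2_def[of "D1 H"] DERIV_imp_deriv)
qed

lemma hol2_D1_at:
  assumes "hol2 U W H" "open U" "open W" "z \<in> U" "w \<in> W"
  shows "((\<lambda>z. H z w) has_field_derivative D1 H z w) (at z)"
  unfolding D1_def using hol2_fst assms by (intro holomorphic_derivI) auto

lemma hol2_D2_at:
  assumes "hol2 U W H" "open U" "open W" "z \<in> U" "w \<in> W"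
  shows "(H z has_field_derivative D2 H z w) (at w)"
  unfolding D2_def using hol2_snd assms by (intro holomorphic_derivI) auto

lemma D1_unique: "((\<lambda>z. H z w) has_field_derivative d) (at z) \<Longrightarrow> D1 H z w = d"
  and D2_unique: "(H z has_field_derivative d) (at w) \<Longrightarrow> D2 H z w = d"
  by (auto simp: D1_def D2_def DERIV_imp_deriv)

subsection \<open>Restriction to the conjugate diagonal\<close>

lemma hol2_has_derivative_diagonal:
  assumes H: "hol2 U W H" "open U" "open W" and z: "z \<in> U" "cnj z \<in> W"
  shows "((\<lambda>z. H z (cnj z)) has_derivative (\<lambda>h. D1 H z (cnj z) * h + D2 H z (cnj z) * cnj h)) (at z)"
proof -
  obtain r where r: "r > 0" "ball (cnj z) r \<subseteq> W" using H z by (metis openE)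
  let ?Y = "ball (cnj z) r"
  have "((\<lambda>(z, w). H z w) has_derivative (\<lambda>(tx, ty). D1 H z (cnj z) * tx + blinfun_apply (blinfun_mult_right (D2 H z (cnj z))) ty)) (at (z, cnj z) within U \<times> ?Y)"
  proof (rule has_derivative_partialsI[where fy="\<lambda>z w. blinfun_mult_right (D2 H z w)"])
    show "((\<lambda>x. H x (cnj z)) has_derivative (*) (D1 H z (cnj z))) (at z within U)"
      using hol2_D1_at[OF H z] by (simp add: has_field_derivative_def has_derivative_at_withinI)
    show "(H x has_derivative blinfun_apply (blinfun_mult_right (D2 H x y))) (at y within ?Y)" if "x \<in> U" "y \<in> ?Y" for x y
      using hol2_D2_at[OF H that(1), of y] that r
      by (auto simp: has_field_derivative_def has_derivative_at_withinI blinfun_mult_right.rep_eq)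
    have "continuous_on (U \<times> ?Y) (\<lambda>(z, w). D2 H z w)"
      using hol2_D2[OF H] r by (auto simp: hol2_def elim!: continuous_on_subset)
    then have "continuous_on (U \<times> ?Y) (\<lambda>p. blinfun_mult_right ((\<lambda>(z, w). D2 H z w) p))"
      by (intro bounded_linear.continuous_on[OF bounded_linear_blinfun_mult_right])
    then show "continuous (at (z, cnj z) within U \<times> ?Y) (\<lambda>(z, w). blinfun_mult_right (D2 H z w))"
      using z r by (auto simp: continuous_on_eq_continuous_within case_prod_unfold)
  qed (use r in auto)
  then have d: "((\<lambda>(z, w). H z w) has_derivative (\<lambda>(tx, ty). D1 H z (cnj z) * tx + D2 H z (cnj z) * ty)) (at (z, cnj z))"
    using H z r by (subst (asm) at_within_open) (auto simp: blinfun_mult_right.rep_eq intro: open_Times)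
  have "((\<lambda>z. (z, cnj z)) has_derivative (\<lambda>h. (h, cnj h))) (at z)"
    by (intro has_derivative_Pair has_derivative_ident bounded_linear_imp_has_derivative bounded_linear_cnj)
  from has_derivative_compose[OF this d] show ?thesis by (simp add: case_prod_unfold)
qed

text \<open>If \<open>F z = H z (cnj z)\<close> with \<open>H\<close> holomorphic in both variables, then the Wirtinger derivatives of \<open>F\<close>
  are the partial derivatives of \<open>H\<close>. This replaces real calculus on the metric by
  complex calculus on its polarization.\<close>

lemma wirtinger_diagonal:
  assumes H: "hol2 U W H" "open U" "open W" and S: "open S" "S \<subseteq> U" "cnj ` S \<subseteq> W"
    and F: "\<And>x. x \<in> S \<Longrightarrow> F x = H x (cnj x)" and z: "z \<in> S"
  shows "wirtinger F z = D1 H z (cnj z)" and "wirtinger_bar F z = D2 H z (cnj z)"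
proof -
  have zz: "z \<in> U" "cnj z \<in> W" using S z by auto
  have "(F has_derivative (\<lambda>h. D1 H z (cnj z) * h + D2 H z (cnj z) * cnj h)) (at z)"
    by (rule has_derivative_transform_within_open[OF hol2_has_derivative_diagonal[OF H zz] S(1) z]) (simp add: F)
  then have fd: "frechet_derivative F (at z) = (\<lambda>h. D1 H z (cnj z) * h + D2 H z (cnj z) * cnj h)"
    by (rule frechet_derivative_at[symmetric])
  show "wirtinger F z = D1 H z (cnj z)" "wirtinger_bar F z = D2 H z (cnj z)"
    unfolding wirtinger_def wirtinger_bar_def fd by (simp_all add: algebra_simps)
qed

text \<open>Polarization: a holomorphic function of two variables is determined on the conjugate diagonal,
  because both partial derivatives are determined there and so, inductively, all of them.\<close>

lemma hol2_diagonal_zero_step: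
  assumes H: "hol2 U W H" "open U" "open W" and W: "W = cnj ` U" and 0: "\<And>z. z \<in> U \<Longrightarrow> H z (cnj z) = 0" and z: "z \<in> U"
  shows "D1 H z (cnj z) = 0" "D2 H z (cnj z) = 0"
proof -
  let ?L = "\<lambda>h. D1 H z (cnj z) * h + D2 H z (cnj z) * cnj h"
  have "((\<lambda>z. H z (cnj z)) has_derivative ?L) (at z)"
    by (rule hol2_has_derivative_diagonal[OF H]) (use W z in auto)
  moreover have "((\<lambda>z. H z (cnj z)) has_derivative (\<lambda>h. 0)) (at z)"
    by (rule has_derivative_transform_within_open[OF has_derivative_const H(2) z]) (simp add: 0)
  ultimately have "?L = (\<lambda>h. 0)" by (rule has_derivative_unique)
  then have "?L 1 = 0" "?L \<i> = 0" by metis+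
  then have "D1 H z (cnj z) + D2 H z (cnj z) = 0" "\<i> * (D1 H z (cnj z) - D2 H z (cnj z)) = 0" by (simp_all add: algebra_simps)
  then show "D1 H z (cnj z) = 0" "D2 H z (cnj z) = 0" by (auto simp: add_eq_0_iff2)
qed

lemma hol2_polarization:
  assumes H: "hol2 (ball a r) (ball (cnj a) r) H" and 0: "\<And>z. z \<in> ball a r \<Longrightarrow> H z (cnj z) = 0"
    and z: "z \<in> ball a r" and w: "w \<in> ball (cnj a) r"
  shows "H z w = 0"
proof -
  let ?U = "ball a r" and ?W = "ball (cnj a) r"
  have r: "r > 0" using z by (metis ball_empty empty_iff linorder_not_less)
  have W: "?W = cnj ` ?U"
  proof -
    have d: "dist (cnj a) (cnj x) = dist a x" for x by (metis complex_cnj_diff complex_mod_cnj dist_norm)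
    have "x \<in> cnj ` ?U" if "x \<in> ?W" for x
      using that d[of "cnj x"] by (intro image_eqI[of _ _ "cnj x"]) auto
    then show ?thesis using d by auto
  qed
  have iter: "hol2 ?U ?W ((D1 ^^ i) ((D2 ^^ j) H)) \<and> (\<forall>z\<in>?U. (D1 ^^ i) ((D2 ^^ j) H) z (cnj z) = 0)" for i j
  proof (induction i)
    case 0
    show ?case
    proof (induction j)
      case 0 then show ?case using H assms(2) by simp
    next
      case (Suc j)
      have h: "hol2 ?U ?W ((D2 ^^ j) H)" and 0: "\<And>z. z \<in> ?U \<Longrightarrow> (D2 ^^ j) H z (cnj z) = 0" using Suc by auto
      show ?case using hol2_D2[OF h open_ball open_ball] hol2_diagonal_zero_step(2)[OF h open_ball open_ball W 0] by simp
    qed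
  next
    case (Suc i)
    have h: "hol2 ?U ?W ((D1 ^^ i) ((D2 ^^ j) H))" and 0: "\<And>z. z \<in> ?U \<Longrightarrow> (D1 ^^ i) ((D2 ^^ j) H) z (cnj z) = 0" using Suc by auto
    show ?case using hol2_D1[OF h open_ball open_ball] hol2_diagonal_zero_step(1)[OF h open_ball open_ball W 0] by simp
  qed
  have d1: "(deriv ^^ i) (\<lambda>z. G z w) z = (D1 ^^ i) G z w" for i G z w
  proof (induction i arbitrary: z)
    case (Suc i)
    then have "(\<lambda>z. (D1 ^^ i) G z w) = (deriv ^^ i) (\<lambda>z. G z w)" by auto
    then show ?case by (simp add: D1_def[of "(D1 ^^ i) G"])
  qed simp
  have d2: "(deriv ^^ j) (H z) w = (D2 ^^ j) H z w" for j z w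
  proof (induction j arbitrary: w)
    case (Suc j)
    then have "(D2 ^^ j) H z = (deriv ^^ j) (H z)" by auto
    then show ?case by (simp add: D2_def[of "(D2 ^^ j) H"])
  qed simp
  have g0: "(D2 ^^ j) H z (cnj a) = 0" for j
  proof (rule holomorphic_fun_eq_0_on_ball[of "\<lambda>z. (D2 ^^ j) H z (cnj a)" a r z])
    show "(\<lambda>z. (D2 ^^ j) H z (cnj a)) holomorphic_on ?U" using iter[of 0 j] r hol2_fst by fastforce
    show "(deriv ^^ n) (\<lambda>z. (D2 ^^ j) H z (cnj a)) a = 0" for n
      unfolding d1 using iter[of n j] r by auto
  qed (use z in auto)
  show ?thesis
    by (rule holomorphic_fun_eq_0_on_ball[of "H z" "cnj a" r w]) (use hol2_snd[OF H z] w d2 g0 in auto)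
qed

lemma hol2_near:
  assumes H: "hol2 U W H" "open U" "open W" and a: "a \<in> U" "b \<in> W" and S: "open S" "H a b \<in> S"
  obtains s where "s > 0" "ball a s \<subseteq> U" "ball b s \<subseteq> W" "\<And>z w. z \<in> ball a s \<Longrightarrow> w \<in> ball b s \<Longrightarrow> H z w \<in> S"
proof -
  have "continuous_on (U \<times> W) (\<lambda>(z, w). H z w)" "open (U \<times> W)" using H by (auto simp: hol2_def open_Times)
  then have "open ((\<lambda>(z, w). H z w) -` S \<inter> (U \<times> W))" using S(1) by (simp add: continuous_open_preimage Int_commute)
  moreover have "(a, b) \<in> (\<lambda>(z, w). H z w) -` S \<inter> (U \<times> W)" using a S by auto
  ultimately obtain A B where AB: "open A" "open B" "(a, b) \<in> A \<times> B" "A \<times> B \<subseteq> (\<lambda>(z, w). H z w) -` S \<inter> (U \<times> W)"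
    by (rule open_prod_elim) blast
  obtain s1 where s1: "s1 > 0" "ball a s1 \<subseteq> A" using AB by (metis SigmaD1 openE)
  obtain s2 where s2: "s2 > 0" "ball b s2 \<subseteq> B" using AB by (metis SigmaD2 openE)
  have sub: "ball a (min s1 s2) \<times> ball b (min s1 s2) \<subseteq> (\<lambda>(z, w). H z w) -` S \<inter> (U \<times> W)"
    using s1 s2 AB(4) by (intro subset_trans[OF _ AB(4)] Sigma_mono) auto
  show thesis
  proof (rule that[of "min s1 s2"])
    have "a \<in> ball a (min s1 s2)" "b \<in> ball b (min s1 s2)" using s1 s2 by auto
    then show "ball a (min s1 s2) \<subseteq> U" "ball b (min s1 s2) \<subseteq> W" using sub by blast+
    show "H z w \<in> S" if "z \<in> ball a (min s1 s2)" "w \<in> ball b (min s1 s2)" for z w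
      using subsetD[OF sub, of "(z, w)"] that by auto
  qed (use s1 s2 in auto)
qed

lemma D1_cong:
  assumes "open U" "z \<in> U" "\<And>x. x \<in> U \<Longrightarrow> F x w = G x w"
  shows "D1 F z w = D1 G z w"
  unfolding D1_def by (intro deriv_cong_ev eventually_mono[OF eventually_nhds_in_open[OF assms(1,2)]]) (auto simp: assms(3))

lemma D2_cong:
  assumes "open W" "w \<in> W" "\<And>x. x \<in> W \<Longrightarrow> F z x = G z x"
  shows "D2 F z w = D2 G z w"
  unfolding D2_def by (intro deriv_cong_ev eventually_mono[OF eventually_nhds_in_open[OF assms(1,2)]]) (auto simp: assms(3))

lemma deriv_zero_const:
  assumes "convex S" "open S" "\<And>x. x \<in> S \<Longrightarrow> (f has_field_derivative 0) (at x)" "x \<in> S" "y \<in> S"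
  shows "f x = (f y :: complex)"
  using has_field_derivative_zero_constant[of S f] assms has_field_derivative_at_within by metis

section \<open>Metrics of constant curvature with a potential\<close>

text \<open>Let \<open>\<gamma>\<close> be the polarized metric. Constant curvature says that the mixed second derivative of \<open>Ln \<gamma>\<close> is
  \<open>- \<kappa> \<gamma>\<close>. Two integrations in the second variable give a Riccati equation for the
  first derivative \<open>y\<close> of the potential \<open>ell\<close>, normalised to vanish on both axes through the base
  point. The substitution \<open>v = exp ((\<kappa> / 2) ell)\<close> linearises it: \<open>v\<close> satisfies \<open>v'' = p v'\<close> in the first
  variable, so \<open>v = 1 + \<psi> z * b w\<close>, and the Hermitian symmetry of the kernel forces \<open>b\<close> to be a real multiple
  of the conjugate of \<open>\<psi>\<close>.\<close>

lemma liouville_potential: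
  fixes k :: "complex \<Rightarrow> complex \<Rightarrow> complex" and \<kappa> :: real
  assumes r: "r > 0" and k: "hol2 (ball a r) (ball (cnj a) r) k"
    and herm: "\<And>z x. z \<in> ball a r \<Longrightarrow> x \<in> ball a r \<Longrightarrow> k z (cnj x) = cnj (k x (cnj z))"
    and pos: "\<And>z w. z \<in> ball a r \<Longrightarrow> w \<in> ball (cnj a) r \<Longrightarrow> Re (k z w) > 0"
    and \<kappa>: "\<kappa> \<noteq> 0"
    and F: "\<And>z. z \<in> ball a r \<Longrightarrow> F z = k z (cnj z)"
    and curv: "\<And>z. z \<in> ball a r \<Longrightarrow> hol_sectional_curvature (wirtinger (wirtinger_bar (\<lambda>z. ln (F z)))) z = of_real \<kappa>"
  obtains s h \<psi> c where "0 < s" "s \<le> r" "h holomorphic_on ball a s" "\<psi> holomorphic_on ball a s"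
    "\<And>z. z \<in> ball a s \<Longrightarrow> h z \<noteq> 0" "\<psi> a = 0" "deriv \<psi> a = 1" "c \<noteq> (0::real)"
    "\<And>z x. z \<in> ball a s \<Longrightarrow> x \<in> ball a s \<Longrightarrow> norm (of_real c * \<psi> z * cnj (\<psi> x)) < 1"
    "\<And>z x. z \<in> ball a s \<Longrightarrow> x \<in> ball a s \<Longrightarrow>
       k z (cnj x) = h z * cnj (h x) * (1 + of_real c * \<psi> z * cnj (\<psi> x)) powr of_real (2 / \<kappa>)"
proof -
  define U W w0 where "U = ball a r" and "W = ball (cnj a) r" and "w0 = cnj a"
  have o: "open U" "open W" by (auto simp: U_def W_def)
  have dc: "dist (cnj a) (cnj x) = dist a x" for x by (metis complex_cnj_diff complex_mod_cnj dist_norm)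
  have cW: "cnj x \<in> W" if "x \<in> U" for x using that dc by (auto simp: U_def W_def)
  have aU: "a \<in> U" and w0: "w0 \<in> W" using r by (auto simp: U_def W_def w0_def)
  have k: "hol2 U W k" using k by (simp add: U_def W_def)
  have kpos: "k z w \<in> {x. Re x > 0}" if "z \<in> U" "w \<in> W" for z w using pos that by (auto simp: U_def W_def)
  have knz: "k z w \<noteq> 0" if "z \<in> U" "w \<in> W" for z w using kpos[OF that] by auto
  define L where "L z w = Ln (k z w)" for z w
  have "Ln holomorphic_on {x. Re x > 0}" by (intro holomorphic_on_Ln) (auto simp: complex_nonpos_Reals_iff)
  then have L: "hol2 U W L" unfolding L_def by (rule hol2_compose[OF k]) (use kpos in auto)
  have eL: "exp (L z w) = k z w" if "z \<in> U" "w \<in> W" for z w using knz[OF that] by (simp add: L_def)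
  have Lh: "L z (cnj x) = cnj (L x (cnj z))" if "z \<in> U" "x \<in> U" for z x
  proof -
    have "k x (cnj z) \<notin> \<real>\<^sub>\<le>\<^sub>0" using kpos[OF that(2) cW[OF that(1)]] by (auto simp: complex_nonpos_Reals_iff)
    then show ?thesis using herm[of z x] that by (simp add: L_def U_def cnj_Ln)
  qed
  define \<gamma> where "\<gamma> = D2 (D1 L)"
  have hL1: "hol2 U W (D1 L)" and hL2: "hol2 U W (D2 L)" using hol2_D1[OF L o] hol2_D2[OF L o] .
  have h\<gamma>: "hol2 U W \<gamma>" unfolding \<gamma>_def by (rule hol2_D2[OF hL1 o])
  have h\<gamma>1: "hol2 U W (D1 \<gamma>)" and h\<gamma>2: "hol2 U W (D2 \<gamma>)" using hol2_D1[OF h\<gamma> o] hol2_D2[OF h\<gamma> o] .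
  have h\<gamma>12: "hol2 U W (D1 (D2 \<gamma>))" by (rule hol2_D1[OF h\<gamma>2 o])
  have cU: "cnj ` U \<subseteq> W" using cW by auto
  define g where "g = wirtinger (wirtinger_bar (\<lambda>z. ln (F z)))"
  have gb: "wirtinger_bar (\<lambda>z. ln (F z)) z = D2 L z (cnj z)" if "z \<in> U" for z
    by (rule wirtinger_diagonal(2)[OF L o o(1) order_refl cU _ that]) (simp add: L_def F U_def)
  have g: "g z = \<gamma> z (cnj z)" if z: "z \<in> U" for z
  proof -
    have "g z = D1 (D2 L) z (cnj z)" unfolding g_def
      by (rule wirtinger_diagonal(1)[OF hL2 o o(1) order_refl cU gb z])
    then show ?thesis using D1_D2_commute[OF L o z cW[OF z]] by (simp add: \<gamma>_def)
  qed
  have g1: "wirtinger g z = D1 \<gamma> z (cnj z)" and g2: "wirtinger_bar g z = D2 \<gamma> z (cnj z)" if z: "z \<in> U" for z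
    using wirtinger_diagonal[OF h\<gamma> o o(1) order_refl cU g z] by auto
  have g12: "wirtinger (wirtinger_bar g) z = D1 (D2 \<gamma>) z (cnj z)" if z: "z \<in> U" for z
    by (rule wirtinger_diagonal(1)[OF h\<gamma>2 o o(1) order_refl cU g2 z])
  have cv: "(- D1 (D2 \<gamma>) z (cnj z) + D1 \<gamma> z (cnj z) * D2 \<gamma> z (cnj z) / \<gamma> z (cnj z)) / (\<gamma> z (cnj z))\<^sup>2 = of_real \<kappa>" if z: "z \<in> U" for z
    using curv[of z] z g[OF z] g1[OF z] g2[OF z] g12[OF z] unfolding hol_sectional_curvature_def g_def[symmetric] by (simp add: U_def)
  have nz: "\<gamma> z (cnj z) \<noteq> 0" if z: "z \<in> U" for z using cv[OF z] \<kappa> by auto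
  \<comment> \<open>The cleared curvature equation holds on the conjugate diagonal, hence for independent variables.\<close>
  define E where "E z w = (D1 \<gamma> z w * D2 \<gamma> z w - D1 (D2 \<gamma>) z w * \<gamma> z w) - of_real \<kappa> * (\<gamma> z w * \<gamma> z w * \<gamma> z w)" for z w
  have hE: "hol2 U W E" unfolding E_def by (intro hol2_diff hol2_mult hol2_const h\<gamma>1 h\<gamma>2 h\<gamma>12 h\<gamma>)
  have Ed: "E z (cnj z) = 0" if z: "z \<in> U" for z
  proof -
    have id: "(- d12 + d1 * d2 / g) / g\<^sup>2 = c \<Longrightarrow> g \<noteq> 0 \<Longrightarrow> (d1 * d2 - d12 * g) - c * (g * g * g) = 0"
      for d12 d1 d2 g c :: complex
      by (simp add: field_simps power2_eq_square)
    show ?thesis unfolding E_def by (rule id[OF cv[OF z] nz[OF z]])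
  qed
  have E0: "E z w = 0" if "z \<in> U" "w \<in> W" for z w
    using hol2_polarization[of a r E z w] hE Ed that by (simp add: U_def W_def)
  obtain s where s: "s > 0" "ball a s \<subseteq> U" "ball w0 s \<subseteq> W" and \<gamma>nz: "\<And>z w. z \<in> ball a s \<Longrightarrow> w \<in> ball w0 s \<Longrightarrow> \<gamma> z w \<in> - {0}"
    by (rule hol2_near[OF h\<gamma> o aU w0, of "- {0}"]) (use nz[OF aU] in \<open>auto simp: w0_def\<close>)
  define V Y where "V = ball a s" and "Y = ball w0 s"
  have oV: "open V" "open Y" "convex V" "convex Y" and aV: "a \<in> V" and wY: "w0 \<in> Y" using s by (auto simp: V_def Y_def)
  have VU: "V \<subseteq> U" and YW: "Y \<subseteq> W" using s by (auto simp: V_def Y_def)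
  have cY: "cnj x \<in> Y" if "x \<in> V" for x using that dc by (auto simp: V_def Y_def w0_def)
  note mono = hol2_subset[OF _ VU YW]
  \<comment> \<open>Subtracting functions of one variable alone changes neither the metric nor, up to factors, the kernel.\<close>
  define ell where "ell z w = L z w - L z w0 - L a w + L a w0" for z w
  define y where "y z w = D1 L z w - D1 L z w0" for z w
  have hell: "hol2 U W ell" unfolding ell_def
    by (intro hol2_add hol2_diff hol2_const L hol2_first hol2_second hol2_fst[OF L w0] hol2_snd[OF L aU])
  have hy: "hol2 U W y" unfolding y_def
    by (intro hol2_diff hL1 hol2_first hol2_fst[OF hL1 w0])
  have D1ell: "D1 ell z w = y z w" if "z \<in> U" "w \<in> W" for z w
  proof (rule D1_unique)
    have "((\<lambda>z. L z w - L z w0 - L a w + L a w0) has_field_derivative D1 L z w - D1 L z w0 - 0 + 0) (at z)"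
      by (intro DERIV_add DERIV_diff DERIV_const hol2_D1_at[OF L o that(1)] that w0)
    then show "((\<lambda>z. ell z w) has_field_derivative y z w) (at z)" by (simp add: ell_def y_def)
  qed
  have D2y: "D2 y z w = \<gamma> z w" if "z \<in> U" "w \<in> W" for z w
  proof (rule D2_unique)
    have "((\<lambda>w. D1 L z w - D1 L z w0) has_field_derivative D2 (D1 L) z w - 0) (at w)"
      by (intro DERIV_diff DERIV_const hol2_D2_at[OF hL1 o that])
    then show "(y z has_field_derivative \<gamma> z w) (at w)" by (simp add: y_def[abs_def] \<gamma>_def)
  qed
  have yw0: "y z w0 = 0" for z by (simp add: y_def)
  have ellw0: "ell z w0 = 0" and ella: "ell a w = 0" for z w by (simp_all add: ell_def)
  have \<gamma>0: "\<gamma> z w \<noteq> 0" if "z \<in> V" "w \<in> Y" for z w using \<gamma>nz that by (auto simp: V_def Y_def)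
  \<comment> \<open>The curvature equation says that the derivative of the following function in the second variable vanishes.\<close>
  define q where "q z w = D1 \<gamma> z w / \<gamma> z w + of_real \<kappa> * y z w" for z w
  define p where "p z = q z w0" for z
  have hq: "hol2 V Y q" unfolding q_def
    by (intro hol2_add hol2_mult hol2_const hol2_divide mono[OF h\<gamma>1] mono[OF h\<gamma>] mono[OF hy]) (use \<gamma>0 in auto)
  have hp: "p holomorphic_on V" unfolding p_def by (rule hol2_fst[OF hq wY])
  have qp: "q z w = p z" if z: "z \<in> V" and w: "w \<in> Y" for z w
    unfolding p_def
  proof (rule deriv_zero_const[OF oV(4,2) _ w wY])
    fix x assume x: "x \<in> Y"
    have zx: "z \<in> U" "x \<in> W" using z x VU YW by auto
    have "((\<lambda>w. D1 \<gamma> z w / \<gamma> z w + of_real \<kappa> * y z w) has_field_derivative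
       (D2 (D1 \<gamma>) z x * \<gamma> z x - D1 \<gamma> z x * D2 \<gamma> z x) / (\<gamma> z x * \<gamma> z x) + of_real \<kappa> * D2 y z x) (at x)"
      by (intro DERIV_add DERIV_divide DERIV_cmult hol2_D2_at[OF h\<gamma>1 o zx] hol2_D2_at[OF h\<gamma> o zx] hol2_D2_at[OF hy o zx] \<gamma>0 z x)
    moreover have "(D2 (D1 \<gamma>) z x * \<gamma> z x - D1 \<gamma> z x * D2 \<gamma> z x) / (\<gamma> z x * \<gamma> z x) + of_real \<kappa> * D2 y z x = 0"
    proof -
      have "D2 (D1 \<gamma>) z x * \<gamma> z x - D1 \<gamma> z x * D2 \<gamma> z x = - of_real \<kappa> * \<gamma> z x * (\<gamma> z x * \<gamma> z x)"
        using E0[OF zx] D1_D2_commute[OF h\<gamma> o zx] by (simp add: E_def algebra_simps)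
      then show ?thesis using \<gamma>0[OF z x] D2y[OF zx] by simp
    qed
    ultimately show "(q z has_field_derivative 0) (at x)" by (simp add: q_def[abs_def])
  qed
  have \<gamma>1: "D1 \<gamma> z w = \<gamma> z w * (p z - of_real \<kappa> * y z w)" if "z \<in> V" "w \<in> Y" for z w
    using qp[OF that] \<gamma>0[OF that] by (simp add: q_def field_simps)
  \<comment> \<open>Integrating once more in the second variable gives a Riccati equation in the first.\<close>
  have ric: "D1 y z w = p z * y z w - of_real (\<kappa> / 2) * y z w * y z w" if z: "z \<in> V" and w: "w \<in> Y" for z w
  proof -
    define R where "R w = D1 y z w - p z * y z w + of_real (\<kappa> / 2) * (y z w * y z w)" for w
    have zU: "z \<in> U" using z VU by auto
    have "R w = R w0"
    proof (rule deriv_zero_const[OF oV(4,2) _ w wY])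
      fix x assume x: "x \<in> Y"
      have zx: "z \<in> U" "x \<in> W" using z x VU YW by auto
      have "(R has_field_derivative D2 (D1 y) z x - p z * D2 y z x + of_real (\<kappa> / 2) * (D2 y z x * y z x + D2 y z x * y z x)) (at x)"
        unfolding R_def
        by (intro DERIV_add DERIV_diff DERIV_cmult DERIV_mult hol2_D2_at[OF hol2_D1[OF hy o] o zx] hol2_D2_at[OF hy o zx])
      moreover have "D2 (D1 y) z x = D1 \<gamma> z x"
      proof -
        have "D1 (D2 y) z x = D1 \<gamma> z x" by (rule D1_cong[OF o(1) zx(1)]) (use D2y zx in auto)
        then show ?thesis using D1_D2_commute[OF hy o zx] by simp
      qed
      moreover have "D1 \<gamma> z x - p z * D2 y z x + of_real (\<kappa> / 2) * (D2 y z x * y z x + D2 y z x * y z x) = 0"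
        unfolding D2y[OF zx] \<gamma>1[OF z x] by (simp add: algebra_simps)
      ultimately show "(R has_field_derivative 0) (at x)" by simp
    qed
    moreover have "R w0 = 0"
    proof -
      have "D1 y z w0 = 0" by (rule D1_unique) (simp add: yw0)
      then show ?thesis by (simp add: R_def yw0)
    qed
    ultimately have "D1 y z w - p z * y z w + of_real (\<kappa> / 2) * (y z w * y z w) = 0" by (simp only: R_def)
    moreover have "A - B + K * (X * X) = 0 \<Longrightarrow> A = B - K * X * X" for A B K X :: complex
      by (simp add: algebra_simps)
    ultimately show ?thesis by blast
  qed
  define v where "v z w = exp (of_real (\<kappa> / 2) * ell z w)" for z w
  define v1 where "v1 z w = of_real (\<kappa> / 2) * y z w * v z w" for z w
  have dv: "((\<lambda>z. v z w) has_field_derivative v1 z w) (at z)" if "z \<in> U" "w \<in> W" for z w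
  proof -
    have "((\<lambda>z. ell z w) has_field_derivative y z w) (at z)" using hol2_D1_at[OF hell o that] D1ell[OF that] by simp
    then have "((\<lambda>z. exp (of_real (\<kappa> / 2) * ell z w)) has_field_derivative exp (of_real (\<kappa> / 2) * ell z w) * (of_real (\<kappa> / 2) * y z w)) (at z)"
      by (intro DERIV_fun_exp DERIV_cmult)
    then show ?thesis by (simp add: v_def v1_def mult.commute)
  qed
  have dv1: "((\<lambda>z. v1 z w) has_field_derivative p z * v1 z w) (at z)" if z: "z \<in> V" and w: "w \<in> Y" for z w
  proof -
    have zw: "z \<in> U" "w \<in> W" using z w VU YW by auto
    have "((\<lambda>z. of_real (\<kappa> / 2) * y z w * v z w) has_field_derivative (of_real (\<kappa> / 2) * D1 y z w) * v z w + v1 z w * (of_real (\<kappa> / 2) * y z w)) (at z)"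
      by (intro DERIV_mult DERIV_cmult hol2_D1_at[OF hy o zw] dv[OF zw])
    moreover have "(of_real (\<kappa> / 2) * D1 y z w) * v z w + v1 z w * (of_real (\<kappa> / 2) * y z w) = p z * v1 z w"
      unfolding ric[OF z w] v1_def by (simp add: algebra_simps)
    ultimately have "((\<lambda>z. of_real (\<kappa> / 2) * y z w * v z w) has_field_derivative p z * v1 z w) (at z)" by (simp only:)
    then show ?thesis unfolding v1_def .
  qed
  obtain P where P: "\<And>x. x \<in> V \<Longrightarrow> (P has_field_derivative p x) (at x)"
    using holomorphic_convex_primitive'[OF oV(3,1) hp] by (metis at_within_open oV(1))
  define e where "e z = exp (P z - P a)" for z
  have de: "(e has_field_derivative e z * p z) (at z)" if "z \<in> V" for z
  proof -
    have "((\<lambda>z. exp (P z - P a)) has_field_derivative exp (P z - P a) * (p z - 0)) (at z)"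
      by (intro DERIV_fun_exp DERIV_diff DERIV_const P that)
    then show ?thesis by (simp add: e_def[abs_def])
  qed
  have he: "e holomorphic_on V" using de oV by (subst holomorphic_on_open) auto
  obtain \<psi>0 where \<psi>0: "\<And>x. x \<in> V \<Longrightarrow> (\<psi>0 has_field_derivative e x) (at x)"
    using holomorphic_convex_primitive'[OF oV(3,1) he] by (metis at_within_open oV(1))
  define \<psi> where "\<psi> z = \<psi>0 z - \<psi>0 a" for z
  have d\<psi>: "(\<psi> has_field_derivative e x) (at x)" if "x \<in> V" for x
    unfolding \<psi>_def using DERIV_diff[OF \<psi>0[OF that] DERIV_const] by simp
  define b where "b w = v1 a w" for w
  have v1e: "v1 z w = e z * b w" if z: "z \<in> V" and w: "w \<in> Y" for z w
  proof -
    have "v1 z w / e z = v1 a w / e a"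
    proof (rule deriv_zero_const[OF oV(3,1) _ z aV])
      fix x assume x: "x \<in> V"
      have "((\<lambda>x. v1 x w / e x) has_field_derivative (p x * v1 x w * e x - v1 x w * (e x * p x)) / (e x * e x)) (at x)"
        by (intro DERIV_divide dv1 de x w) (simp add: e_def)
      then show "((\<lambda>x. v1 x w / e x) has_field_derivative 0) (at x)" by (simp add: mult.commute mult.left_commute)
    qed
    then show ?thesis by (simp add: b_def e_def divide_eq_eq mult.commute)
  qed
  have v\<psi>: "v z w = 1 + \<psi> z * b w" if z: "z \<in> V" and w: "w \<in> Y" for z w
  proof -
    have "v z w - \<psi> z * b w = v a w - \<psi> a * b w"
    proof (rule deriv_zero_const[OF oV(3,1) _ z aV])
      fix x assume x: "x \<in> V"
      have xw: "x \<in> U" "w \<in> W" using x w VU YW by auto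
      have "((\<lambda>x. v x w - \<psi> x * b w) has_field_derivative v1 x w - e x * b w) (at x)"
        by (intro DERIV_diff DERIV_cmult_right dv xw d\<psi> x)
      then show "((\<lambda>x. v x w - \<psi> x * b w) has_field_derivative 0) (at x)" by (simp add: v1e[OF x w])
    qed
    then show ?thesis by (simp add: v_def ella \<psi>_def algebra_simps)
  qed
  have ellh: "ell z (cnj x) = cnj (ell x (cnj z))" if "z \<in> U" "x \<in> U" for z x
    using Lh[OF that] Lh[OF that(1) aU] Lh[OF aU that(2)] Lh[OF aU aU] by (simp add: ell_def w0_def)
  have vh: "v z (cnj x) = cnj (v x (cnj z))" if "z \<in> V" "x \<in> V" for z x
  proof -
    have "z \<in> U" "x \<in> U" using that VU by auto
    from ellh[OF this] show ?thesis by (simp add: v_def exp_cnj)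
  qed
  have bh: "\<psi> z * b (cnj x) = cnj (\<psi> x) * cnj (b (cnj z))" if "z \<in> V" "x \<in> V" for z x
    using vh[OF that] v\<psi>[OF that(1) cY[OF that(2)]] v\<psi>[OF that(2) cY[OF that(1)]] by simp
  obtain x1 where x1: "x1 \<in> V" "\<psi> x1 \<noteq> 0"
  proof -
    have "\<exists>x1\<in>V. \<psi> x1 \<noteq> 0"
    proof (rule ccontr)
      assume n: "\<not> ?thesis"
      have "(\<psi> has_field_derivative 0) (at a)"
        by (rule has_field_derivative_transform_within_open[OF DERIV_const[of 0] oV(1) aV]) (use n in auto)
      then have "e a = 0" using DERIV_unique[OF d\<psi>[OF aV]] by simp
      then show False by (simp add: e_def)
    qed
    then show thesis using that by blast
  qed
  define C where "C = cnj (b (cnj x1)) / \<psi> x1"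
  have bC: "b (cnj x) = C * cnj (\<psi> x)" if "x \<in> V" for x
    using bh[OF x1(1) that] x1(2) by (simp add: C_def field_simps)
  have "C * (\<psi> x1 * cnj (\<psi> x1)) = cnj C * (\<psi> x1 * cnj (\<psi> x1))"
    using bh[OF x1(1) x1(1)] bC[OF x1(1)] by (simp add: mult_ac)
  then have "C = cnj C" using x1(2) by simp
  then have "C \<in> \<real>" by (metis Reals_cnj_iff)
  then obtain c where c: "C = of_real c" by (auto elim: Reals_cases)
  have c0: "c \<noteq> 0"
  proof
    assume "c = 0"
    then have b0: "b (cnj x) = 0" if "x \<in> V" for x using bC[OF that] c by simp
    have y0: "y a w = 0" if "w \<in> Y" for w
    proof -
      have "cnj w \<in> V" using that dc[of "cnj w"] by (auto simp: V_def Y_def w0_def)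
      then have "b w = 0" using b0[of "cnj w"] by simp
      then show ?thesis using \<kappa> by (simp add: b_def v1_def v_def)
    qed
    have "D2 y a w0 = D2 (\<lambda>z w. 0) a w0" by (rule D2_cong[OF oV(2) wY]) (rule y0)
    then show False using D2y[OF aU w0] \<gamma>0[OF aV wY] by (simp add: D2_def)
  qed
  \<comment> \<open>For arguments in \<open>S\<close> the principal logarithm inverts the exponential defining \<open>v\<close>, and \<open>v\<close> stays within
    distance 1 of 1.\<close>
  define S where "S = {x::complex. norm (of_real (\<kappa> / 2) * x) < 1 \<and> norm (exp (of_real (\<kappa> / 2) * x) - 1) < 1}"
  have oS: "open S" unfolding S_def by (intro open_Collect_conj open_Collect_less continuous_intros)
  obtain t where t: "t > 0" "ball a t \<subseteq> V" "ball w0 t \<subseteq> Y" and tS: "\<And>z w. z \<in> ball a t \<Longrightarrow> w \<in> ball w0 t \<Longrightarrow> ell z w \<in> S"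
    by (rule hol2_near[OF mono[OF hell] oV(1,2) aV wY oS]) (auto simp: S_def ellw0)
  define s' where "s' = min t r"
  have s': "0 < s'" "s' \<le> r" and sV: "ball a s' \<subseteq> V" using t r by (auto simp: s'_def)
  have st: "cnj x \<in> ball w0 t" "x \<in> ball a t" if "x \<in> ball a s'" for x
    using that dc[of x] by (auto simp: s'_def w0_def)
  have ellS: "ell z (cnj x) \<in> S" if "z \<in> ball a s'" "x \<in> ball a s'" for z x using tS st that by blast
  have vc: "v z (cnj x) = 1 + of_real c * \<psi> z * cnj (\<psi> x)" if "z \<in> ball a s'" "x \<in> ball a s'" for z x
  proof -
    have "z \<in> V" "x \<in> V" using that sV by blast+
    then show ?thesis using v\<psi>[OF _ cY] bC c by (simp add: mult_ac)
  qed
  define \<sigma> where "\<sigma> = sqrt (Re (k a w0))"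
  have ka: "k a w0 = of_real (\<sigma>\<^sup>2)" and \<sigma>0: "\<sigma> > 0"
  proof -
    have "k a w0 = cnj (k a w0)" using herm[of a a] r by (simp add: w0_def)
    then have "Im (k a w0) = 0" by (metis Reals_cnj_iff complex_is_Real_iff)
    moreover have "Re (k a w0) > 0" using kpos[OF aU w0] by simp
    ultimately show "k a w0 = of_real (\<sigma>\<^sup>2)" "\<sigma> > 0" by (auto simp: \<sigma>_def complex_eq_iff)
  qed
  \<comment> \<open>Dividing by the square root of \<open>k a w0\<close> distributes this constant evenly between \<open>h\<close> and its conjugate.\<close>
  define h where "h z = k z w0 / of_real \<sigma>" for z
  show thesis
  proof (rule that[OF s'])
    show "h z \<noteq> 0" if "z \<in> ball a s'" for z
    proof -
      have "z \<in> U" using that sV VU by blast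
      then show ?thesis using knz[OF _ w0] \<sigma>0 by (auto simp: h_def)
    qed
    have "h holomorphic_on U" unfolding h_def using \<sigma>0 by (intro holomorphic_intros hol2_fst[OF k w0]) auto
    then show "h holomorphic_on ball a s'" by (rule holomorphic_on_subset) (use sV VU in auto)
    have "\<psi> holomorphic_on V" using d\<psi> oV by (subst holomorphic_on_open) auto
    then show "\<psi> holomorphic_on ball a s'" by (rule holomorphic_on_subset[OF _ sV])
    show "\<psi> a = 0" by (simp add: \<psi>_def)
    show "deriv \<psi> a = 1" using DERIV_imp_deriv[OF d\<psi>[OF aV]] by (simp add: e_def)
    show "c \<noteq> 0" by (rule c0)
    fix z x assume zx: "z \<in> ball a s'" "x \<in> ball a s'"
    have inS: "ell z (cnj x) \<in> S" by (rule ellS[OF zx])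
    then show "norm (of_real c * \<psi> z * cnj (\<psi> x)) < 1" using vc[OF zx] by (simp add: S_def v_def)
    have zU: "z \<in> U" "x \<in> U" "cnj x \<in> W" using zx sV VU cW by blast+
    have "\<bar>Im (of_real (\<kappa> / 2) * ell z (cnj x))\<bar> < 1"
      using inS abs_Im_le_cmod[of "of_real (\<kappa> / 2) * ell z (cnj x)"] unfolding S_def by simp
    then have Lnv: "Ln (v z (cnj x)) = of_real (\<kappa> / 2) * ell z (cnj x)" unfolding v_def using pi_gt3 by (intro Ln_exp) auto
    have "v z (cnj x) powr of_real (2 / \<kappa>) = exp (of_real (2 / \<kappa>) * Ln (v z (cnj x)))"
      by (simp add: powr_def v_def)
    also have "\<dots> = exp (ell z (cnj x))" unfolding Lnv using \<kappa> by simp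
    also have "\<dots> = k z (cnj x) * k a w0 / (k z w0 * k a (cnj x))"
      unfolding ell_def using eL[OF zU(1,3)] eL[OF zU(1) w0] eL[OF aU zU(3)] eL[OF aU w0] by (simp add: exp_diff exp_add)
    finally have "v z (cnj x) powr of_real (2 / \<kappa>) = k z (cnj x) * k a w0 / (k z w0 * k a (cnj x))" .
    moreover have "cnj (h x) = k a (cnj x) / of_real \<sigma>"
      using herm[of a x] r zU by (simp add: h_def w0_def U_def)
    ultimately have "h z * cnj (h x) * v z (cnj x) powr of_real (2 / \<kappa>) = k z (cnj x)"
      unfolding h_def ka using \<sigma>0 knz[OF zU(1) w0] knz[OF aU zU(3)] by (simp add: power2_eq_square)
    then show "k z (cnj x) = h z * cnj (h x) * (1 + of_real c * \<psi> z * cnj (\<psi> x)) powr of_real (2 / \<kappa>)"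
      using vc[OF zx] by simp
  qed
qed

section \<open>Square summable families of holomorphic functions\<close>

text \<open>A bound for all finite sums of squares; the index set may be uncountable, as for a maximal orthonormal
  set.\<close>

definition bessel_family :: "'b set \<Rightarrow> ('b \<Rightarrow> complex \<Rightarrow> complex) \<Rightarrow> complex set \<Rightarrow> real \<Rightarrow> bool" where
  "bessel_family B f U C \<longleftrightarrow> (\<forall>b\<in>B. f b holomorphic_on U) \<and>
     (\<forall>z\<in>U. \<forall>F. finite F \<and> F \<subseteq> B \<longrightarrow> (\<Sum>b\<in>F. (norm (f b z))\<^sup>2) \<le> C)"

lemma bessel_family_subset: "bessel_family B f U C \<Longrightarrow> V \<subseteq> U \<Longrightarrow> bessel_family B f V C"
  unfolding bessel_family_def by (blast intro: holomorphic_on_subset)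

lemma bessel_nonneg: "bessel_family B f U C \<Longrightarrow> z \<in> U \<Longrightarrow> C \<ge> 0"
  unfolding bessel_family_def by (metis empty_subsetI finite.emptyI sum.empty)

lemma bessel_summable:
  assumes "bessel_family B f U C" "z \<in> U"
  shows "(\<lambda>b. (norm (f b z))\<^sup>2) summable_on B" "(\<Sum>\<^sub>\<infinity>b\<in>B. (norm (f b z))\<^sup>2) \<le> C"
proof -
  show s: "(\<lambda>b. (norm (f b z))\<^sup>2) summable_on B"
    by (rule nonneg_bdd_above_summable_on) (use assms in \<open>auto simp: bessel_family_def intro!: bdd_aboveI[of _ C]\<close>)
  show "(\<Sum>\<^sub>\<infinity>b\<in>B. (norm (f b z))\<^sup>2) \<le> C"
    by (rule infsum_le_finite_sums[OF s]) (use assms in \<open>auto simp: bessel_family_def\<close>)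
qed

lemma l2_product_summable:
  fixes c d :: "'b \<Rightarrow> complex"
  assumes "(\<lambda>b. (norm (c b))\<^sup>2) summable_on B" "(\<lambda>b. (norm (d b))\<^sup>2) summable_on B"
  shows "(\<lambda>b. norm (c b * d b)) summable_on B" "(\<lambda>b. c b * d b) summable_on B"
proof -
  show "(\<lambda>b. norm (c b * d b)) summable_on B"
  proof (rule Infinite_Sum.abs_summable_on_comparison_test')
    show "(\<lambda>b. (norm (c b))\<^sup>2 + (norm (d b))\<^sup>2) summable_on B" using assms by (rule summable_on_add)
    fix b
    have "norm (c b) * norm (d b) \<le> (norm (c b))\<^sup>2 + (norm (d b))\<^sup>2"
    proof -
      have "2 * (norm (c b) * norm (d b)) \<le> (norm (c b))\<^sup>2 + (norm (d b))\<^sup>2"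
        using sum_squares_bound[of "norm (c b)" "norm (d b)"] by (simp add: mult.assoc)
      moreover have "0 \<le> norm (c b) * norm (d b)" by simp
      ultimately show ?thesis by linarith
    qed
    then show "norm (c b * d b) \<le> (norm (c b))\<^sup>2 + (norm (d b))\<^sup>2" by (simp add: norm_mult)
  qed
  then show "(\<lambda>b. c b * d b) summable_on B" by (rule abs_summable_summable)
qed

lemma bessel_sum_derivative:
  assumes f: "bessel_family B f (ball a r) C" and c: "(\<lambda>b. (norm (c b))\<^sup>2) summable_on B" and z: "z \<in> ball a r"
  shows "((\<lambda>z. \<Sum>\<^sub>\<infinity>b\<in>B. f b z * c b) has_field_derivative (\<Sum>\<^sub>\<infinity>b\<in>B. deriv (f b) z * c b)) (at z)"
proof -
  have C: "C \<ge> 0" using bessel_nonneg[OF f z] .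
  obtain d where d: "d > 0" "cball z d \<subseteq> ball a r" using z by (metis open_ball open_contains_cball)
  define G where "G x = (\<Sum>\<^sub>\<infinity>b\<in>B. f b x * c b)" for x
  have sm: "(\<lambda>b. f b x * c b) summable_on B" "(\<lambda>b. norm (f b x * c b)) summable_on B" if "x \<in> ball a r" for x
    using l2_product_summable[OF bessel_summable(1)[OF f that] c] by auto
  have ul: "uniform_limit (cball z d) (\<lambda>F x. \<Sum>b\<in>F. f b x * c b) G (finite_subsets_at_top B)"
  proof (rule uniform_limitI)
    fix e :: real assume e: "e > 0"
    define t where "t = e / (2 * (C + 1))"
    have t: "t > 0" using e C by (simp add: t_def)
    define S where "S = (\<Sum>\<^sub>\<infinity>b\<in>B. (norm (c b))\<^sup>2)"
    have "((\<lambda>F. \<Sum>b\<in>F. (norm (c b))\<^sup>2) \<longlongrightarrow> S) (finite_subsets_at_top B)"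
      using c has_sum_infsum unfolding S_def has_sum_def by blast
    then have "\<forall>\<^sub>F F in finite_subsets_at_top B. (\<Sum>b\<in>F. (norm (c b))\<^sup>2) > S - t * e / 2"
      by (rule order_tendstoD) (use t e in simp)
    moreover have "\<forall>\<^sub>F F in finite_subsets_at_top B. finite F \<and> F \<subseteq> B" by (rule eventually_finite_subsets_at_top_weakI) auto
    ultimately show "\<forall>\<^sub>F F in finite_subsets_at_top B. \<forall>x\<in>cball z d. dist (\<Sum>b\<in>F. f b x * c b) (G x) < e"
    proof eventually_elim
      case (elim F)
      show ?case
      proof
        fix x assume "x \<in> cball z d"
        then have x: "x \<in> ball a r" using d by auto
        have FB: "F \<subseteq> B" and fF: "finite F" using elim by auto
        note sF = summable_on_finite[OF fF]
        have s1: "(\<lambda>b. (norm (f b x))\<^sup>2) summable_on (B - F)" "(\<lambda>b. (norm (c b))\<^sup>2) summable_on (B - F)"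
          using bessel_summable(1)[OF f x] c summable_on_subset_banach by blast+
        have s2: "(\<lambda>b. norm (f b x * c b)) summable_on (B - F)" using sm(2)[OF x] summable_on_subset_banach by blast
        have "G x - (\<Sum>b\<in>F. f b x * c b) = (\<Sum>\<^sub>\<infinity>b\<in>B - F. f b x * c b)"
          unfolding G_def using infsum_Diff[OF sm(1)[OF x] sF FB] fF by simp
        then have "norm (G x - (\<Sum>b\<in>F. f b x * c b)) \<le> (\<Sum>\<^sub>\<infinity>b\<in>B - F. norm (f b x * c b))"
          using norm_infsum_bound[OF s2] by simp
        also have "\<dots> \<le> (\<Sum>\<^sub>\<infinity>b\<in>B - F. t / 2 * (norm (f b x))\<^sup>2 + 1 / (2 * t) * (norm (c b))\<^sup>2)"
        proof (rule infsum_mono[OF s2])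
          show "(\<lambda>b. t / 2 * (norm (f b x))\<^sup>2 + 1 / (2 * t) * (norm (c b))\<^sup>2) summable_on (B - F)"
            by (intro summable_on_add summable_on_cmult_right s1)
          fix b
          have "0 \<le> (t * norm (f b x) - norm (c b))\<^sup>2 / (2 * t)" using t by simp
          then show "norm (f b x * c b) \<le> t / 2 * (norm (f b x))\<^sup>2 + 1 / (2 * t) * (norm (c b))\<^sup>2"
            using t by (simp add: norm_mult power2_eq_square field_simps)
        qed
        also have "\<dots> = t / 2 * (\<Sum>\<^sub>\<infinity>b\<in>B - F. (norm (f b x))\<^sup>2) + 1 / (2 * t) * (\<Sum>\<^sub>\<infinity>b\<in>B - F. (norm (c b))\<^sup>2)"
          by (simp only: infsum_add[OF summable_on_cmult_right[OF s1(1)] summable_on_cmult_right[OF s1(2)]] infsum_cmult_right[OF s1(1)] infsum_cmult_right[OF s1(2)])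
        also have "\<dots> < e"
        proof -
          have "(\<Sum>\<^sub>\<infinity>b\<in>B - F. (norm (f b x))\<^sup>2) \<le> C"
          proof (rule infsum_le_finite_sums[OF s1(1)])
            fix H assume "finite H" "H \<subseteq> B - F"
            then show "(\<Sum>b\<in>H. (norm (f b x))\<^sup>2) \<le> C" using f x unfolding bessel_family_def by blast
          qed
          then have "t / 2 * (\<Sum>\<^sub>\<infinity>b\<in>B - F. (norm (f b x))\<^sup>2) \<le> t / 2 * (C + 1)" using t by (intro mult_left_mono) auto
          also have "\<dots> = e / 4" using C by (simp add: t_def field_simps)
          finally have 1: "t / 2 * (\<Sum>\<^sub>\<infinity>b\<in>B - F. (norm (f b x))\<^sup>2) \<le> e / 4" .
          have "(\<Sum>\<^sub>\<infinity>b\<in>B - F. (norm (c b))\<^sup>2) = S - (\<Sum>b\<in>F. (norm (c b))\<^sup>2)"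
            unfolding S_def using infsum_Diff[OF c sF FB] fF by simp
          then have "(\<Sum>\<^sub>\<infinity>b\<in>B - F. (norm (c b))\<^sup>2) < t * e / 2" using elim by simp
          then have "1 / (2 * t) * (\<Sum>\<^sub>\<infinity>b\<in>B - F. (norm (c b))\<^sup>2) < 1 / (2 * t) * (t * e / 2)" using t by (intro mult_strict_left_mono) auto
          also have "\<dots> = e / 4" using t by simp
          finally show ?thesis using 1 e by linarith
        qed
        finally show "dist (\<Sum>b\<in>F. f b x * c b) (G x) < e" by (simp add: dist_norm norm_minus_commute)
      qed
    qed
  qed
  have ev: "\<forall>\<^sub>F F in finite_subsets_at_top B. continuous_on (cball z d) (\<lambda>x. \<Sum>b\<in>F. f b x * c b) \<and>
      (\<forall>x\<in>ball z d. ((\<lambda>x. \<Sum>b\<in>F. f b x * c b) has_field_derivative (\<Sum>b\<in>F. deriv (f b) x * c b)) (at x))"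
  proof (rule eventually_finite_subsets_at_top_weakI, intro conjI ballI)
    fix F assume F: "finite F" "F \<subseteq> B"
    have h: "f b holomorphic_on ball a r" if "b \<in> F" for b using f F that by (auto simp: bessel_family_def)
    show "continuous_on (cball z d) (\<lambda>x. \<Sum>b\<in>F. f b x * c b)"
      using h d by (intro continuous_intros) (meson continuous_on_subset holomorphic_on_imp_continuous_on)
    fix x assume "x \<in> ball z d"
    then have x: "x \<in> ball a r" using d ball_subset_cball by blast
    show "((\<lambda>x. \<Sum>b\<in>F. f b x * c b) has_field_derivative (\<Sum>b\<in>F. deriv (f b) x * c b)) (at x)"
      by (intro DERIV_sum DERIV_cmult_right holomorphic_derivI[OF h open_ball x])
  qed
  obtain g' where g': "\<And>w. w \<in> ball z d \<Longrightarrow> (G has_field_derivative g' w) (at w) \<and> ((\<lambda>F. \<Sum>b\<in>F. deriv (f b) w * c b) \<longlongrightarrow> g' w) (finite_subsets_at_top B)"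
    by (rule has_complex_derivative_uniform_limit[OF ev ul _ d(1)]) auto
  have zz: "z \<in> ball z d" using d by simp
  have "((\<lambda>b. deriv (f b) z * c b) has_sum g' z) B" using g'[OF zz] by (simp add: has_sum_def)
  then have "(\<Sum>\<^sub>\<infinity>b\<in>B. deriv (f b) z * c b) = g' z" by (rule infsumI)
  then show ?thesis using g'[OF zz] by (simp add: G_def[abs_def])
qed

text \<open>For finitely many members, pair \<open>f b\<close> with the conjugate of its derivative at a fixed point. The
  resulting function is bounded by the Cauchy-Schwarz inequality, and its derivative at the
  point, estimated by Cauchy, is the sum in question.\<close>

lemma bessel_deriv:
  assumes f: "bessel_family B f (ball a r) C" and s: "s < r"
  shows "bessel_family B (\<lambda>b. deriv (f b)) (ball a s) (4 * C / (r - s)\<^sup>2)"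
  unfolding bessel_family_def
proof (intro conjI ballI allI impI)
  fix b assume "b \<in> B"
  then have "deriv (f b) holomorphic_on ball a r" using f by (auto simp: bessel_family_def intro: holomorphic_deriv)
  then show "deriv (f b) holomorphic_on ball a s" by (rule holomorphic_on_subset) (use s in auto)
next
  fix z F assume z: "z \<in> ball a s" and F: "finite F \<and> F \<subseteq> B"
  define S where "S = (\<Sum>b\<in>F. (norm (deriv (f b) z))\<^sup>2)"
  have S0: "S \<ge> 0" by (simp add: S_def sum_nonneg)
  have zr: "z \<in> ball a r" using z s by auto
  have C: "C \<ge> 0" using bessel_nonneg[OF f zr] .
  have h: "f b holomorphic_on ball a r" if "b \<in> F" for b using f F that by (auto simp: bessel_family_def)
  define \<phi> where "\<phi> x = (\<Sum>b\<in>F. f b x * cnj (deriv (f b) z))" for x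
  have h\<phi>: "\<phi> holomorphic_on ball a r" unfolding \<phi>_def using h by (intro holomorphic_intros) auto
  have sub: "ball z (r - s) \<subseteq> ball a r"
  proof
    fix x assume "x \<in> ball z (r - s)"
    then show "x \<in> ball a r" using z dist_triangle[of a x z] by auto
  qed
  have bd: "norm (\<phi> x) \<le> sqrt (C * S)" if "x \<in> ball z (r - s)" for x
  proof -
    have x: "x \<in> ball a r" using that sub by blast
    have "norm (\<phi> x) \<le> (\<Sum>b\<in>F. norm (f b x) * norm (deriv (f b) z))"
      unfolding \<phi>_def by (rule order_trans[OF norm_sum]) (simp add: norm_mult)
    then have "(norm (\<phi> x))\<^sup>2 \<le> (\<Sum>b\<in>F. norm (f b x) * norm (deriv (f b) z))\<^sup>2" by (rule power_mono) simp
    also have "\<dots> \<le> (\<Sum>b\<in>F. (norm (f b x))\<^sup>2) * S" unfolding S_def by (rule Cauchy_Schwarz_ineq_sum)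
    also have "\<dots> \<le> C * S" using f x F S0 by (intro mult_right_mono) (auto simp: bessel_family_def)
    finally show ?thesis by (rule real_le_rsqrt)
  qed
  have "norm ((deriv ^^ 1) \<phi> z) \<le> fact 1 * sqrt (C * S) / ((r - s) / 2) ^ 1"
    by (rule deriv_bound[OF holomorphic_on_subset[OF h\<phi> sub]]) (use s bd in auto)
  moreover have "deriv \<phi> z = (\<Sum>b\<in>F. deriv (f b) z * cnj (deriv (f b) z))"
    unfolding \<phi>_def by (intro DERIV_imp_deriv DERIV_sum DERIV_cmult_right holomorphic_derivI[OF h open_ball zr])
  moreover have "\<dots> = of_real S" by (simp add: S_def complex_norm_square[symmetric])
  ultimately have "S \<le> sqrt (C * S) / ((r - s) / 2)" using S0 by simp
  then have "S\<^sup>2 \<le> (sqrt (C * S) / ((r - s) / 2))\<^sup>2" using S0 by (intro power_mono) auto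
  also have "\<dots> = 4 * C / (r - s)\<^sup>2 * S" using C S0 by (simp add: power_divide power_mult_distrib)
  finally have "S * S \<le> 4 * C / (r - s)\<^sup>2 * S" by (simp add: power2_eq_square)
  then have "S \<le> 4 * C / (r - s)\<^sup>2" if "S \<noteq> 0" using S0 that mult_right_le_imp_le by (metis order_le_less)
  then have "S \<le> 4 * C / (r - s)\<^sup>2" using C by (cases "S = 0") auto
  then show "(\<Sum>b\<in>F. (norm (deriv (f b) z))\<^sup>2) \<le> 4 * C / (r - s)\<^sup>2" by (simp add: S_def)
qed

lemma bessel_higher_deriv:
  assumes f: "bessel_family B f (ball a r) C" and s: "s < r"
  shows "\<exists>C'. bessel_family B (\<lambda>b. (deriv ^^ n) (f b)) (ball a s) C'"
  using s
proof (induction n arbitrary: s)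
  case 0
  then show ?case using bessel_family_subset[OF f subset_ball[OF less_imp_le]] by auto
next
  case (Suc n)
  obtain t where t: "s < t" "t < r" using Suc.prems dense by blast
  then obtain C' where "bessel_family B (\<lambda>b. (deriv ^^ n) (f b)) (ball a t) C'" using Suc.IH by blast
  from bessel_deriv[OF this t(1)] show ?case by auto
qed

lemma bessel_sum_higher_deriv:
  assumes f: "bessel_family B f (ball a r) C" and c: "(\<lambda>b. (norm (c b))\<^sup>2) summable_on B" and z: "z \<in> ball a r"
  shows "(deriv ^^ n) (\<lambda>z. \<Sum>\<^sub>\<infinity>b\<in>B. f b z * c b) z = (\<Sum>\<^sub>\<infinity>b\<in>B. (deriv ^^ n) (f b) z * c b)"
  using z
proof (induction n arbitrary: z)
  case (Suc n)
  obtain s where s: "dist a z < s" "s < r" using Suc.prems dense by auto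
  obtain C' where C': "bessel_family B (\<lambda>b. (deriv ^^ n) (f b)) (ball a s) C'" using bessel_higher_deriv[OF f s(2)] by blast
  have zs: "z \<in> ball a s" using s by simp
  have "((\<lambda>z. \<Sum>\<^sub>\<infinity>b\<in>B. (deriv ^^ n) (f b) z * c b) has_field_derivative (\<Sum>\<^sub>\<infinity>b\<in>B. deriv ((deriv ^^ n) (f b)) z * c b)) (at z)"
    by (rule bessel_sum_derivative[OF C' c zs])
  then have "((deriv ^^ n) (\<lambda>z. \<Sum>\<^sub>\<infinity>b\<in>B. f b z * c b) has_field_derivative (\<Sum>\<^sub>\<infinity>b\<in>B. deriv ((deriv ^^ n) (f b)) z * c b)) (at z)"
    by (rule has_field_derivative_transform_within_open[OF _ open_ball Suc.prems]) (simp add: Suc.IH)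
  then show ?case by (simp add: DERIV_imp_deriv)
qed simp

subsection \<open>Positivity of the Taylor coefficients\<close>

lemma higher_deriv_binomial:
  fixes u :: complex
  assumes r: "r > 0" and u: "\<And>t. t \<in> ball 0 r \<Longrightarrow> norm (u * t) < 1" and t: "t \<in> ball 0 r"
  shows "(deriv ^^ n) (\<lambda>t. (1 + u * t) powr of_real \<nu>) t
     = of_real (\<Prod>i<n. \<nu> - real i) * u ^ n * (1 + u * t) powr (of_real \<nu> - of_nat n)"
  using t
proof (induction n arbitrary: t)
  case (Suc n)
  have nn: "1 + u * t \<notin> \<real>\<^sub>\<le>\<^sub>0"
  proof -
    have "Re (- (u * t)) \<le> norm (u * t)" by (metis complex_Re_le_cmod norm_minus_cancel)
    then have "Re (1 + u * t) > 0" using u[OF Suc.prems] by simp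
    then show ?thesis by (auto simp: complex_nonpos_Reals_iff)
  qed
  let ?s = "of_real \<nu> - of_nat n :: complex"
  have "((\<lambda>t. 1 + u * t) has_field_derivative u) (at t)" by (auto intro!: derivative_eq_intros)
  then have "((\<lambda>t. (1 + u * t) powr ?s) has_field_derivative (?s * (1 + u * t) powr (?s - 1)) * u) (at t)"
    using DERIV_chain2[where g="\<lambda>t. 1 + u * t" and x=t, OF has_field_derivative_powr[OF nn, of ?s]] by blast
  then have "((\<lambda>t. of_real (\<Prod>i<n. \<nu> - real i) * u ^ n * (1 + u * t) powr ?s) has_field_derivative
      of_real (\<Prod>i<n. \<nu> - real i) * u ^ n * ((?s * (1 + u * t) powr (?s - 1)) * u)) (at t)"
    by (rule DERIV_cmult)
  then have "((deriv ^^ n) (\<lambda>t. (1 + u * t) powr of_real \<nu>) has_field_derivative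
      of_real (\<Prod>i<n. \<nu> - real i) * u ^ n * ((?s * (1 + u * t) powr (?s - 1)) * u)) (at t)"
    by (rule has_field_derivative_transform_within_open[OF _ open_ball Suc.prems]) (simp add: Suc.IH)
  then have "(deriv ^^ Suc n) (\<lambda>t. (1 + u * t) powr of_real \<nu>) t = of_real (\<Prod>i<n. \<nu> - real i) * u ^ n * ((?s * (1 + u * t) powr (?s - 1)) * u)"
    by (simp add: DERIV_imp_deriv)
  also have "?s - 1 = of_real \<nu> - of_nat (Suc n)" by simp
  finally show ?case by (simp add: mult_ac)
qed simp

lemma higher_deriv_power_0:
  "(deriv ^^ j) (\<lambda>s. K * s ^ n) 0 = (if j = n then K * fact n else (0::complex))"
proof -
  have h: "(\<lambda>s::complex. s ^ n) holomorphic_on UNIV" by (intro holomorphic_intros)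
  have "(deriv ^^ j) (\<lambda>s. K * s ^ n) 0 = K * (deriv ^^ j) (\<lambda>s. s ^ n) 0"
    using higher_deriv_cmult[OF h, of 0 j K] by simp
  also have "(deriv ^^ j) (\<lambda>s. (s - 0) ^ n) (0::complex) = pochhammer (of_nat (Suc n - j)) j * (0 - 0) ^ (n - j)"
    by (rule higher_deriv_power)
  then have "(deriv ^^ j) (\<lambda>s. s ^ n) (0::complex) = (if j = n then fact n else 0)"
    by (cases j n rule: linorder_cases) (auto simp: pochhammer_fact pochhammer_0_left)
  finally show ?thesis by simp
qed

text \<open>Calabi's observation: the coefficients of \<open>(1 + c x)\<^sup>\<nu>\<close> must be nonnegative, which for \<open>\<nu> > 0\<close> is only
  possible if \<open>\<nu>\<close> is a natural number; then the expansion breaks off.\<close>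

lemma bessel_binomial:
  assumes r: "r > 0" and f: "bessel_family B f (ball 0 r) C" and c: "c \<noteq> 0" and \<nu>: "\<nu> > 0"
    and c1: "\<And>t s. t \<in> ball 0 r \<Longrightarrow> s \<in> ball 0 r \<Longrightarrow> norm (of_real c * t * cnj s) < 1"
    and K: "\<And>t s. t \<in> ball 0 r \<Longrightarrow> s \<in> ball 0 r \<Longrightarrow>
       (\<Sum>\<^sub>\<infinity>b\<in>B. f b t * cnj (f b s)) = (1 + of_real c * t * cnj s) powr of_real \<nu>"
  obtains m :: nat and \<beta> :: "nat \<Rightarrow> real" where "\<nu> = real m"
    "\<And>b n. b \<in> B \<Longrightarrow> n > m \<Longrightarrow> (deriv ^^ n) (f b) 0 = 0"
    "\<And>n. n \<le> m \<Longrightarrow> \<beta> n > 0"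
    "\<And>i j. (\<Sum>\<^sub>\<infinity>b\<in>B. (deriv ^^ j) (f b) 0 * cnj ((deriv ^^ i) (f b) 0)) = (if i = j then of_real (\<beta> i) else 0)"
proof -
  define Q where "Q n = (\<Prod>i<n. \<nu> - real i)" for n
  define \<beta> where "\<beta> n = fact n * Q n * c ^ n" for n
  have 0: "0 \<in> ball (0::complex) r" using r by simp
  have "\<exists>C'. bessel_family B (\<lambda>b. (deriv ^^ n) (f b)) (ball 0 (r / 2)) C'" for n
    by (rule bessel_higher_deriv[OF f]) (use r in simp)
  then obtain C1 where C1: "bessel_family B (\<lambda>b. (deriv ^^ n) (f b)) (ball 0 (r / 2)) (C1 n)" for n
    by metis
  have dl2: "(\<lambda>b. (norm ((deriv ^^ n) (f b) 0))\<^sup>2) summable_on B" for n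
    using bessel_summable(1)[OF C1, of 0] r by simp
  have cl2: "(\<lambda>b. (norm (cnj (d b)))\<^sup>2) summable_on B" if "(\<lambda>b. (norm (d b))\<^sup>2) summable_on B" for d using that by simp
  have step1: "(\<Sum>\<^sub>\<infinity>b\<in>B. (deriv ^^ n) (f b) 0 * cnj (f b s)) = of_real (Q n) * (of_real c * cnj s) ^ n" if s: "s \<in> ball 0 r" for n s
  proof -
    have "(\<Sum>\<^sub>\<infinity>b\<in>B. (deriv ^^ n) (f b) 0 * cnj (f b s)) = (deriv ^^ n) (\<lambda>z. \<Sum>\<^sub>\<infinity>b\<in>B. f b z * cnj (f b s)) 0"
      by (rule bessel_sum_higher_deriv[OF f cl2[OF bessel_summable(1)[OF f s]] 0, symmetric])
    also have "\<dots> = (deriv ^^ n) (\<lambda>t. (1 + (of_real c * cnj s) * t) powr of_real \<nu>) 0"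
    proof (rule higher_deriv_cong_ev)
      show "\<forall>\<^sub>F x in nhds 0. (\<Sum>\<^sub>\<infinity>b\<in>B. f b x * cnj (f b s)) = (1 + of_real c * cnj s * x) powr of_real \<nu>"
        by (rule eventually_mono[OF eventually_nhds_in_open[OF open_ball 0]]) (simp add: K[OF _ s] mult_ac)
    qed simp
    also have "\<dots> = of_real (Q n) * (of_real c * cnj s) ^ n"
      by (subst higher_deriv_binomial[OF r _ 0]) (use c1[OF _ s] in \<open>auto simp: Q_def mult_ac\<close>)
    finally show ?thesis .
  qed
  have step2: "(\<Sum>\<^sub>\<infinity>b\<in>B. (deriv ^^ j) (f b) 0 * cnj ((deriv ^^ n) (f b) 0)) = (if n = j then of_real (\<beta> n) else 0)" for n j
  proof -
    have "(\<Sum>\<^sub>\<infinity>b\<in>B. f b s * cnj ((deriv ^^ n) (f b) 0)) = of_real (Q n * c ^ n) * s ^ n" if s: "s \<in> ball 0 r" for s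
    proof -
      have "(\<Sum>\<^sub>\<infinity>b\<in>B. f b s * cnj ((deriv ^^ n) (f b) 0)) = (\<Sum>\<^sub>\<infinity>b\<in>B. cnj ((deriv ^^ n) (f b) 0 * cnj (f b s)))"
        by (simp add: mult.commute)
      also have "\<dots> = cnj (of_real (Q n) * (of_real c * cnj s) ^ n)" by (simp only: infsum_cnj step1[OF s])
      finally show ?thesis by (simp add: power_mult_distrib)
    qed
    note e = this
    have "(\<Sum>\<^sub>\<infinity>b\<in>B. (deriv ^^ j) (f b) 0 * cnj ((deriv ^^ n) (f b) 0)) = (deriv ^^ j) (\<lambda>s. \<Sum>\<^sub>\<infinity>b\<in>B. f b s * cnj ((deriv ^^ n) (f b) 0)) 0"
      by (rule bessel_sum_higher_deriv[OF f cl2[OF dl2] 0, symmetric])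
    also have "\<dots> = (deriv ^^ j) (\<lambda>s. of_real (Q n * c ^ n) * s ^ n) 0"
      by (intro higher_deriv_cong_ev eventually_mono[OF eventually_nhds_in_open[OF open_ball 0]] e) auto
    also have "\<dots> = (if n = j then of_real (\<beta> n) else 0)" unfolding higher_deriv_power_0 by (auto simp: \<beta>_def)
    finally show ?thesis .
  qed
  have sq: "(\<Sum>\<^sub>\<infinity>b\<in>B. (norm ((deriv ^^ n) (f b) 0))\<^sup>2) = \<beta> n" for n
  proof -
    have "((\<lambda>b. (deriv ^^ n) (f b) 0 * cnj ((deriv ^^ n) (f b) 0)) has_sum of_real (\<beta> n)) B"
      using has_sum_infsum[OF l2_product_summable(2)[OF dl2 cl2[OF dl2]], of n n] step2[of n n] by simp
    from has_sum_Re[OF this] have "((\<lambda>b. (norm ((deriv ^^ n) (f b) 0))\<^sup>2) has_sum \<beta> n) B"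
      by (simp add: cmod_power2 flip: power2_eq_square)
    then show ?thesis by (rule infsumI)
  qed
  have \<beta>0: "\<beta> n \<ge> 0" for n unfolding sq[symmetric] by (rule infsum_nonneg) simp
  have "\<nu> * c \<ge> 0" using \<beta>0[of 1] by (simp add: \<beta>_def Q_def)
  then have cp: "c > 0" using \<nu> c by (simp add: zero_le_mult_iff) 
  have Q0: "Q n \<ge> 0" for n
  proof (rule ccontr)
    assume "\<not> Q n \<ge> 0"
    then have "(fact n * c ^ n) * Q n < 0" using cp by (intro mult_pos_neg mult_pos_pos) auto
    then show False using \<beta>0[of n] by (simp add: \<beta>_def mult_ac)
  qed
  \<comment> \<open>If \<open>\<nu>\<close> were not an integer, then the first factor \<open>\<nu> - m\<close> below 0 would make the next coefficient negative.\<close>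
  define m where "m = nat \<lceil>\<nu>\<rceil>"
  have m1: "\<nu> \<le> real m" "real m < \<nu> + 1" using \<nu> by (auto simp: m_def) linarith+
  have Qm: "Q n > 0" if "n \<le> m" for n
    unfolding Q_def using that m1 by (intro prod_pos) auto
  have "\<nu> = real m"
  proof (rule ccontr)
    assume "\<nu> \<noteq> real m"
    then have "\<nu> - real m < 0" using m1 by simp
    then have "Q (Suc m) < 0" using Qm[of m] by (simp add: Q_def mult_pos_neg)
    then show False using Q0[of "Suc m"] by simp
  qed
  moreover have "(deriv ^^ n) (f b) 0 = 0" if b: "b \<in> B" and n: "n > m" for b n
  proof -
    have "Q n = 0" unfolding Q_def using n \<open>\<nu> = real m\<close> by (intro prod_zero) auto
    then have "(\<Sum>\<^sub>\<infinity>b\<in>B. (norm ((deriv ^^ n) (f b) 0))\<^sup>2) = 0" using sq[of n] by (simp add: \<beta>_def)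
    then have "(norm ((deriv ^^ n) (f b) 0))\<^sup>2 \<le> 0"
      using finite_sum_le_infsum[OF dl2[of n], of "{b}"] b by simp
    then show ?thesis by simp
  qed
  moreover have "\<beta> n > 0" if "n \<le> m" for n using Qm[OF that] cp by (simp add: \<beta>_def)
  ultimately show thesis using that[of m \<beta>] step2 by blast
qed

section \<open>Local form of a kernel of constant positive curvature\<close>

text \<open>The form of the kernel found above is read in the coordinate \<open>t = \<psi> z\<close>, after division by \<open>h\<close>. There
  the members of the family are polynomials of degree at most \<open>m\<close>, where \<open>m = 2 / \<kappa>\<close>, and the sums
  of products of their coefficients are those of \<open>(1 + c t)^m\<close>.\<close>

lemma constant_curvature_local_form:
  fixes B :: "'b set" and f :: "'b \<Rightarrow> complex \<Rightarrow> complex" and \<kappa> :: real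
  assumes r0: "r0 > 0" and bes: "bessel_family B f (ball a r0) C" and nz: "b0 \<in> B" "f b0 a \<noteq> 0" and \<kappa>: "\<kappa> > 0"
    and curv: "\<And>z. z \<in> ball a r0 \<Longrightarrow>
      hol_sectional_curvature (wirtinger (wirtinger_bar (\<lambda>z. ln (\<Sum>\<^sub>\<infinity>b\<in>B. f b z * cnj (f b z))))) z = of_real \<kappa>"
  obtains s and m :: nat and h \<psi> \<phi> and \<beta> :: "nat \<Rightarrow> real" where "0 < s" "s \<le> r0" "m \<ge> 1"
    "h holomorphic_on ball a s" "\<psi> holomorphic_on ball a s" "\<And>z. z \<in> ball a s \<Longrightarrow> h z \<noteq> 0"
    "\<And>b z. b \<in> B \<Longrightarrow> z \<in> ball a s \<Longrightarrow> f b z = h z * (\<Sum>j\<le>m. \<phi> b j * \<psi> z ^ j)"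
    "\<And>i j. i \<le> m \<Longrightarrow> j \<le> m \<Longrightarrow> (\<Sum>\<^sub>\<infinity>b\<in>B. \<phi> b j * cnj (\<phi> b i)) = (if i = j then of_real (\<beta> i) else 0)"
    "\<And>j. j \<le> m \<Longrightarrow> \<beta> j > 0"
proof -
  define U where "U = ball a r0"
  have aU: "a \<in> U" using r0 by (simp add: U_def)
  have dc: "dist (cnj a) (cnj x) = dist a x" for x by (metis complex_cnj_diff complex_mod_cnj dist_norm)
  have cU: "cnj w \<in> U" if "w \<in> ball (cnj a) r0" for w using that dc[of "cnj w"] by (simp add: U_def)
  have l2: "(\<lambda>b. (norm (f b z))\<^sup>2) summable_on B" if "z \<in> U" for z using bessel_summable(1)[OF bes] that by (simp add: U_def)
  have l2c: "(\<lambda>b. (norm (cnj (f b z)))\<^sup>2) summable_on B" if "z \<in> U" for z using l2[OF that] by simp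
  have sm: "(\<lambda>b. f b z * cnj (f b x)) summable_on B" "(\<lambda>b. norm (f b z * cnj (f b x))) summable_on B" if "z \<in> U" "x \<in> U" for z x
    using l2_product_summable[OF l2[OF that(1)] l2c[OF that(2)]] by auto
  define k where "k z w = (\<Sum>\<^sub>\<infinity>b\<in>B. f b z * cnj (f b (cnj w)))" for z w
  have herm: "k z (cnj x) = cnj (k x (cnj z))" for z x
    unfolding k_def infsum_cnj[symmetric] by (simp add: mult.commute)
  have C0: "C \<ge> 0" using bessel_nonneg[OF bes, of a] r0 by simp
  have k1: "(\<lambda>z. \<Sum>\<^sub>\<infinity>b\<in>B. f b z * cnj (f b x)) holomorphic_on U" if "x \<in> U" for x
    using bessel_sum_derivative[OF bes l2c[OF that]] unfolding U_def by (subst holomorphic_on_open) blast+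
  have hk: "hol2 (ball a r0) (ball (cnj a) r0) k"
  proof (rule hol2I_bounded[OF open_ball open_ball])
    show "(\<lambda>z. k z w) holomorphic_on ball a r0" if "w \<in> ball (cnj a) r0" for w
      using k1[OF cU[OF that]] by (simp add: k_def U_def)
    show "k z holomorphic_on ball (cnj a) r0" if z: "z \<in> ball a r0" for z
    proof (subst holomorphic_on_open[OF open_ball], intro ballI)
      fix w assume w: "w \<in> ball (cnj a) r0"
      define g where "g x = (\<Sum>\<^sub>\<infinity>b\<in>B. f b x * cnj (f b z))" for x
      have zU: "z \<in> U" using z by (simp add: U_def)
      have "(g has_field_derivative deriv g (cnj w)) (at (cnj w))"
        using k1[OF zU] cU[OF w] unfolding g_def U_def by (intro holomorphic_derivI) auto
      then have "((cnj \<circ> g \<circ> cnj) has_field_derivative cnj (deriv g (cnj w))) (at w)"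
        by (rule has_field_derivative_cnj_cnj)
      moreover have "cnj \<circ> g \<circ> cnj = k z"
        by (rule ext) (simp add: k_def g_def mult.commute flip: infsum_cnj)
      ultimately show "\<exists>f'. (k z has_field_derivative f') (at w)" by auto
    qed
    fix z0 w0 assume "z0 \<in> ball a r0" "w0 \<in> ball (cnj a) r0"
    have bd: "norm (k z w) \<le> C" if z: "z \<in> ball a r0" and w: "w \<in> ball (cnj a) r0" for z w
    proof -
      have zU: "z \<in> U" and wU: "cnj w \<in> U" using z cU[OF w] by (auto simp: U_def)
      have "norm (k z w) \<le> (\<Sum>\<^sub>\<infinity>b\<in>B. norm (f b z * cnj (f b (cnj w))))"
        unfolding k_def by (rule norm_infsum_bound[OF sm(2)[OF zU wU]])
      also have "\<dots> \<le> (\<Sum>\<^sub>\<infinity>b\<in>B. 1 / 2 * (norm (f b z))\<^sup>2 + 1 / 2 * (norm (f b (cnj w)))\<^sup>2)"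
      proof (rule infsum_mono[OF sm(2)[OF zU wU]])
        show "(\<lambda>b. 1 / 2 * (norm (f b z))\<^sup>2 + 1 / 2 * (norm (f b (cnj w)))\<^sup>2) summable_on B"
          by (intro summable_on_add summable_on_cmult_right l2 zU wU)
        show "norm (f b z * cnj (f b (cnj w))) \<le> 1 / 2 * (norm (f b z))\<^sup>2 + 1 / 2 * (norm (f b (cnj w)))\<^sup>2" for b
          using sum_squares_bound[of "norm (f b z)" "norm (f b (cnj w))"] by (simp add: norm_mult)
      qed
      also have "\<dots> = 1 / 2 * (\<Sum>\<^sub>\<infinity>b\<in>B. (norm (f b z))\<^sup>2) + 1 / 2 * (\<Sum>\<^sub>\<infinity>b\<in>B. (norm (f b (cnj w)))\<^sup>2)"
        by (simp only: infsum_add[OF summable_on_cmult_right[OF l2[OF zU]] summable_on_cmult_right[OF l2[OF wU]]] infsum_cmult_right[OF l2[OF zU]] infsum_cmult_right[OF l2[OF wU]])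
      also have "\<dots> \<le> 1 / 2 * C + 1 / 2 * C"
        using bessel_summable(2)[OF bes, of z] bessel_summable(2)[OF bes, of "cnj w"] zU wU unfolding U_def by (intro add_mono mult_left_mono) auto
      finally show ?thesis by simp
    qed
    obtain r1 where r1: "r1 > 0" "ball z0 r1 \<subseteq> ball a r0" using \<open>z0 \<in> ball a r0\<close> by (metis open_ball openE)
    obtain r2 where r2: "r2 > 0" "ball w0 r2 \<subseteq> ball (cnj a) r0" using \<open>w0 \<in> ball (cnj a) r0\<close> by (metis open_ball openE)
    have "ball z0 (min r1 r2) \<subseteq> ball a r0" "ball w0 (min r1 r2) \<subseteq> ball (cnj a) r0" using r1 r2 by auto
    then have "\<forall>z\<in>ball z0 (min r1 r2). \<forall>w\<in>ball w0 (min r1 r2). norm (k z w) \<le> C" using bd by blast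
    moreover have "min r1 r2 > 0" using r1 r2 by simp
    ultimately show "\<exists>r>0. \<exists>M. \<forall>z\<in>ball z0 r. \<forall>w\<in>ball w0 r. norm (k z w) \<le> M" by blast
  qed
  have pos0: "Re (k a (cnj a)) > 0"
  proof -
    have "((\<lambda>b. Re (f b a * cnj (f b a))) has_sum Re (k a (cnj a))) B"
      unfolding k_def by (rule has_sum_Re) (use has_sum_infsum[OF sm(1)[OF aU aU]] in simp)
    then have "((\<lambda>b. (norm (f b a))\<^sup>2) has_sum Re (k a (cnj a))) B" by (simp add: cmod_power2 flip: power2_eq_square)
    then have "(\<Sum>\<^sub>\<infinity>b\<in>B. (norm (f b a))\<^sup>2) = Re (k a (cnj a))" by (rule infsumI)
    moreover have "(norm (f b0 a))\<^sup>2 \<le> (\<Sum>\<^sub>\<infinity>b\<in>B. (norm (f b a))\<^sup>2)"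
      using finite_sum_le_infsum[OF l2[OF aU], of "{b0}"] nz by simp
    moreover have "(norm (f b0 a))\<^sup>2 > 0" using nz by simp
    ultimately show ?thesis by linarith
  qed
  obtain r where r: "r > 0" "ball a r \<subseteq> ball a r0" "ball (cnj a) r \<subseteq> ball (cnj a) r0"
    and pos: "\<And>z w. z \<in> ball a r \<Longrightarrow> w \<in> ball (cnj a) r \<Longrightarrow> k z w \<in> {x. Re x > 0}"
  proof (rule hol2_near[OF hk open_ball open_ball, of a "cnj a" "{x. Re x > 0}"])
    show "a \<in> ball a r0" "cnj a \<in> ball (cnj a) r0" using r0 by auto
    show "open {x::complex. Re x > 0}" by (rule open_halfspace_Re_gt)
    show "k a (cnj a) \<in> {x. Re x > 0}" using pos0 by simp
  qed (rule that)
  obtain s h \<psi> c where s: "0 < s" "s \<le> r" and h: "h holomorphic_on ball a s" and \<psi>: "\<psi> holomorphic_on ball a s"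
    and hnz: "\<And>z. z \<in> ball a s \<Longrightarrow> h z \<noteq> 0" and \<psi>a: "\<psi> a = 0" "deriv \<psi> a = 1" and c: "c \<noteq> (0::real)"
    and c1: "\<And>z x. z \<in> ball a s \<Longrightarrow> x \<in> ball a s \<Longrightarrow> norm (of_real c * \<psi> z * cnj (\<psi> x)) < 1"
    and kf: "\<And>z x. z \<in> ball a s \<Longrightarrow> x \<in> ball a s \<Longrightarrow>
       k z (cnj x) = h z * cnj (h x) * (1 + of_real c * \<psi> z * cnj (\<psi> x)) powr of_real (2 / \<kappa>)"
  proof (rule liouville_potential[OF r(1), where k=k and \<kappa>=\<kappa> and F="\<lambda>z. \<Sum>\<^sub>\<infinity>b\<in>B. f b z * cnj (f b z)"])
    show "hol2 (ball a r) (ball (cnj a) r) k" by (rule hol2_subset[OF hk r(2,3)])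
    show "(\<Sum>\<^sub>\<infinity>b\<in>B. f b z * cnj (f b z)) = k z (cnj z)" for z by (simp add: k_def)
    show "k z (cnj x) = cnj (k x (cnj z))" for z x by (rule herm)
    show "hol_sectional_curvature (wirtinger (wirtinger_bar (\<lambda>z. ln (\<Sum>\<^sub>\<infinity>b\<in>B. f b z * cnj (f b z))))) z = of_real \<kappa>" if "z \<in> ball a r" for z
      using curv r(2) that by blast
    show "Re (k z w) > 0" if "z \<in> ball a r" "w \<in> ball (cnj a) r" for z w using pos[OF that] by simp
    show "\<kappa> \<noteq> 0" using \<kappa> by simp
  qed (rule that)
  have sr0: "ball a s \<subseteq> ball a r0" using s r subset_ball[of s r a] by blast
  obtain s1 where s1: "s1 > 0" "ball a s1 \<subseteq> ball a s" and inj: "inj_on \<psi> (ball a s1)"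
    by (rule has_complex_derivative_locally_injective[OF \<psi>, of a]) (use s \<psi>a in auto)
  have "isCont h a" using holomorphic_on_imp_continuous_on[OF h] continuous_on_eq_continuous_at[OF open_ball] s(1) by (metis centre_in_ball)
  moreover have ha: "h a \<noteq> 0" using hnz s by simp
  ultimately obtain d where d: "d > 0" "\<And>x. dist x a < d \<Longrightarrow> dist (h x) (h a) < norm (h a) / 2"
    unfolding continuous_at_eps_delta by (metis half_gt_zero zero_less_norm_iff)
  define s2 where "s2 = min s1 d"
  have s2: "s2 > 0" "ball a s2 \<subseteq> ball a s" "ball a s2 \<subseteq> ball a s1" using s1 d by (auto simp: s2_def)
  have hlow: "norm (h x) \<ge> norm (h a) / 2" if "x \<in> ball a s2" for x
  proof -
    have "dist x a < d" using that by (simp add: s2_def dist_commute)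
    then have "norm (h x - h a) < norm (h a) / 2" using d(2) by (simp add: dist_norm)
    then show ?thesis using norm_triangle_ineq2[of "h a" "h x"] by (simp add: norm_minus_commute)
  qed
  have \<psi>2: "\<psi> holomorphic_on ball a s2" using \<psi> s2(2) by (rule holomorphic_on_subset)
  have inj2: "inj_on \<psi> (ball a s2)" using inj s2(3) by (rule inj_on_subset)
  obtain \<omega> where \<omega>: "\<omega> holomorphic_on \<psi> ` ball a s2" "\<And>z. z \<in> ball a s2 \<Longrightarrow> \<omega> (\<psi> z) = z"
    using holomorphic_has_inverse[OF \<psi>2 open_ball inj2] by metis
  have op: "open (\<psi> ` ball a s2)" by (rule open_mapping_thm3[OF \<psi>2 open_ball inj2])
  have "0 \<in> \<psi> ` ball a s2" using \<psi>a s2(1) by (metis centre_in_ball image_eqI)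
  then obtain \<rho> where \<rho>: "\<rho> > 0" "ball 0 \<rho> \<subseteq> \<psi> ` ball a s2" using op by (metis openE)
  have \<omega>in: "\<omega> t \<in> ball a s2" "\<psi> (\<omega> t) = t" if "t \<in> ball 0 \<rho>" for t
  proof -
    have "t \<in> \<psi> ` ball a s2" using that by (rule subsetD[OF \<rho>(2)])
    then obtain z where "z \<in> ball a s2" "t = \<psi> z" by auto
    then show "\<omega> t \<in> ball a s2" "\<psi> (\<omega> t) = t" using \<omega>(2) by auto
  qed
  define F where "F b t = f b (\<omega> t) / h (\<omega> t)" for b t
  have h\<omega>: "\<omega> holomorphic_on ball 0 \<rho>" by (rule holomorphic_on_subset[OF \<omega>(1) \<rho>(2)])
  have \<omega>s: "\<omega> t \<in> ball a s" "\<omega> t \<in> ball a r0" if "t \<in> ball 0 \<rho>" for t using \<omega>in(1)[OF that] s2 sr0 by blast+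
  have im: "\<omega> ` ball 0 \<rho> \<subseteq> ball a s" "\<omega> ` ball 0 \<rho> \<subseteq> ball a r0" using \<omega>s by blast+
  have bF: "bessel_family B F (ball 0 \<rho>) (C / (norm (h a) / 2)\<^sup>2)"
    unfolding bessel_family_def
  proof (intro conjI ballI allI impI)
    fix b assume b: "b \<in> B"
    have fb: "f b holomorphic_on ball a r0" using bes b by (simp add: bessel_family_def)
    have "(\<lambda>t. f b (\<omega> t)) holomorphic_on ball 0 \<rho>"
      using holomorphic_on_compose_gen[OF h\<omega> fb im(2)] by (simp add: o_def)
    moreover have "(\<lambda>t. h (\<omega> t)) holomorphic_on ball 0 \<rho>"
      using holomorphic_on_compose_gen[OF h\<omega> h im(1)] by (simp add: o_def)
    ultimately show "F b holomorphic_on ball 0 \<rho>" unfolding F_def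
      by (intro holomorphic_on_divide) (use hnz \<omega>s in auto)
  next
    fix t :: complex and G assume t: "t \<in> ball 0 \<rho>" and G: "finite G \<and> G \<subseteq> B"
    have "(\<Sum>b\<in>G. (norm (F b t))\<^sup>2) = (\<Sum>b\<in>G. (norm (f b (\<omega> t)))\<^sup>2) / (norm (h (\<omega> t)))\<^sup>2"
      by (simp add: F_def norm_divide power_divide sum_divide_distrib)
    also have "\<dots> \<le> C / (norm (h a) / 2)\<^sup>2"
    proof (rule frac_le)
      show "(\<Sum>b\<in>G. (norm (f b (\<omega> t)))\<^sup>2) \<le> C" using bes G \<omega>s(2)[OF t] by (auto simp: bessel_family_def)
      show "(norm (h a) / 2)\<^sup>2 \<le> (norm (h (\<omega> t)))\<^sup>2" using hlow[OF \<omega>in(1)[OF t]] by (intro power_mono) auto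
    qed (use ha C0 in auto)
    finally show "(\<Sum>b\<in>G. (norm (F b t))\<^sup>2) \<le> C / (norm (h a) / 2)\<^sup>2" .
  qed
  have KF: "(\<Sum>\<^sub>\<infinity>b\<in>B. F b t * cnj (F b x)) = (1 + of_real c * t * cnj x) powr of_real (2 / \<kappa>)"
    if t: "t \<in> ball 0 \<rho>" and x: "x \<in> ball 0 \<rho>" for t x
  proof -
    let ?H = "h (\<omega> t) * cnj (h (\<omega> x))"
    have H: "?H \<noteq> 0" using hnz \<omega>s(1)[OF t] \<omega>s(1)[OF x] by auto
    have "(\<Sum>\<^sub>\<infinity>b\<in>B. F b t * cnj (F b x)) = (\<Sum>\<^sub>\<infinity>b\<in>B. inverse ?H * (f b (\<omega> t) * cnj (f b (\<omega> x))))"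
      by (intro infsum_cong) (simp add: F_def field_simps)
    also have "\<dots> = inverse ?H * k (\<omega> t) (cnj (\<omega> x))" unfolding k_def by (simp only: infsum_cmult_right' complex_cnj_cnj)
    also have "\<dots> = (1 + of_real c * t * cnj x) powr of_real (2 / \<kappa>)"
    proof -
      have id: "inverse H * (H * X) = X" if "H \<noteq> 0" for H X :: complex using that by simp
      show ?thesis unfolding kf[OF \<omega>s(1)[OF t] \<omega>s(1)[OF x]] \<omega>in(2)[OF t] \<omega>in(2)[OF x] by (rule id[OF H])
    qed
    finally show ?thesis .
  qed
  have c1': "norm (of_real c * t * cnj x) < 1" if t: "t \<in> ball 0 \<rho>" and x: "x \<in> ball 0 \<rho>" for t x
    using c1[OF \<omega>s(1)[OF t] \<omega>s(1)[OF x]] \<omega>in(2)[OF t] \<omega>in(2)[OF x] by simp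
  obtain m \<beta> where m: "2 / \<kappa> = real m" and z: "\<And>b n. b \<in> B \<Longrightarrow> n > m \<Longrightarrow> (deriv ^^ n) (F b) 0 = 0"
    and \<beta>: "\<And>n. n \<le> m \<Longrightarrow> \<beta> n > (0::real)"
    and ort: "\<And>i j. (\<Sum>\<^sub>\<infinity>b\<in>B. (deriv ^^ j) (F b) 0 * cnj ((deriv ^^ i) (F b) 0)) = (if i = j then of_real (\<beta> i) else 0)"
    by (rule bessel_binomial[OF \<rho>(1) bF c _ c1' KF]) (use \<kappa> in auto)
  have m1: "m \<ge> 1" using m \<kappa> by (cases m) auto
  define \<phi> where "\<phi> b j = (deriv ^^ j) (F b) 0 / fact j" for b j
  have Fp: "F b t = (\<Sum>j\<le>m. \<phi> b j * t ^ j)" if b: "b \<in> B" and t: "t \<in> ball 0 \<rho>" for b t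
  proof -
    have "F b holomorphic_on ball 0 \<rho>" using bF b by (simp add: bessel_family_def)
    then have "(\<lambda>n. (deriv ^^ n) (F b) 0 / fact n * (t - 0) ^ n) sums F b t" using t by (rule holomorphic_power_series)
    then have "(\<lambda>n. \<phi> b n * t ^ n) sums F b t" by (simp add: \<phi>_def)
    moreover have "(\<lambda>n. \<phi> b n * t ^ n) sums (\<Sum>j\<le>m. \<phi> b j * t ^ j)"
      by (rule sums_finite) (use z[OF b] in \<open>auto simp: \<phi>_def\<close>)
    ultimately show ?thesis by (rule sums_unique2)
  qed
  have "isCont \<psi> a" using holomorphic_on_imp_continuous_on[OF \<psi>] continuous_on_eq_continuous_at[OF open_ball] s(1) by (metis centre_in_ball)
  then obtain d' where d': "d' > 0" "\<And>x. dist x a < d' \<Longrightarrow> dist (\<psi> x) (\<psi> a) < \<rho>"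
    unfolding continuous_at_eps_delta using \<rho>(1) by metis
  define s3 where "s3 = min s2 (min d' s)"
  have s3: "s3 > 0" "s3 \<le> s" "ball a s3 \<subseteq> ball a s2" using s2 d' s by (auto simp: s3_def)
  have \<psi>in: "\<psi> x \<in> ball 0 \<rho>" if "x \<in> ball a s3" for x
    using d'(2)[of x] that \<psi>a by (auto simp: s3_def dist_commute)
  show thesis
  proof (rule that[of s3 m h \<psi> \<phi> "\<lambda>i. \<beta> i / (fact i)\<^sup>2"])
    show "s3 \<le> r0"
    proof -
      have "ball a s3 \<subseteq> ball a r0" using s3(3) s2(2) sr0 by blast
      then show ?thesis using s3(1) by (auto simp: ball_subset_ball_iff)
    qed
    show "h holomorphic_on ball a s3" "\<psi> holomorphic_on ball a s3"
      using h \<psi> s3(2) by (auto elim!: holomorphic_on_subset)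
    show "h z \<noteq> 0" if "z \<in> ball a s3" for z using that s3(2) by (intro hnz) auto
    show "f b z = h z * (\<Sum>j\<le>m. \<phi> b j * \<psi> z ^ j)" if b: "b \<in> B" and zz: "z \<in> ball a s3" for b z
    proof -
      have "z \<in> ball a s2" using zz s3 by blast
      then have "F b (\<psi> z) = f b z / h z" by (simp add: F_def \<omega>(2))
      moreover have "h z \<noteq> 0" using zz s3(2) by (intro hnz) auto
      ultimately show ?thesis using Fp[OF b \<psi>in[OF zz]] by (simp add: field_simps)
    qed
    show "(\<Sum>\<^sub>\<infinity>b\<in>B. \<phi> b j * cnj (\<phi> b i)) = (if i = j then of_real (\<beta> i / (fact i)\<^sup>2) else 0)" if "i \<le> m" "j \<le> m" for i j
    proof -
      have "(\<Sum>\<^sub>\<infinity>b\<in>B. \<phi> b j * cnj (\<phi> b i)) = (\<Sum>\<^sub>\<infinity>b\<in>B. 1 / (fact j * fact i) * ((deriv ^^ j) (F b) 0 * cnj ((deriv ^^ i) (F b) 0)))"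
        by (intro infsum_cong) (simp add: \<phi>_def)
      also have "\<dots> = 1 / (fact j * fact i) * (if i = j then of_real (\<beta> i) else 0)"
        by (simp only: infsum_cmult_right' ort)
      finally show ?thesis by (auto simp: power2_eq_square)
    qed
    show "\<beta> j / (fact j)\<^sup>2 > 0" if "j \<le> m" for j using \<beta>[OF that] by simp
  qed (use s3 m1 in auto)
qed

section \<open>Forms on a Riemann surface\<close>

locale surface =
  fixes X :: "'a topology" and A :: "'a chart set"
  assumes rs: "riemann_surface X A"
begin

lemma openin_dom: "c \<in> A \<Longrightarrow> openin X (chart_dom c)"
  and open_image: "c \<in> A \<Longrightarrow> open (chart_image c)"
  and homeo: "c \<in> A \<Longrightarrow> homeomorphic_map (subtopology X (chart_dom c)) (top_of_set (chart_image c)) (coord c)"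
  using rs by (auto simp: riemann_surface_def chart_on_def)

lemma dom_topspace: "c \<in> A \<Longrightarrow> chart_dom c \<subseteq> topspace X"
  using openin_dom openin_subset by blast

lemma cover: "(\<Union>c\<in>A. chart_dom c) = topspace X"
  and transition_hol: "c \<in> A \<Longrightarrow> d \<in> A \<Longrightarrow> transition c d holomorphic_on overlap c d"
  and nonempty: "topspace X \<noteq> {}"
  using rs by (auto simp: riemann_surface_def)

lemma inj_coord: "c \<in> A \<Longrightarrow> inj_on (coord c) (chart_dom c)"
  using homeomorphic_imp_injective_map[OF homeo] dom_topspace by (metis topspace_subtopology_subset)

lemma transition_coord:
  "c \<in> A \<Longrightarrow> p \<in> chart_dom c \<Longrightarrow> transition c d (coord c p) = coord d p"
  by (simp add: transition_def inj_coord)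

lemma coord_image: "p \<in> chart_dom c \<Longrightarrow> coord c p \<in> chart_image c"
  by (simp add: chart_image_def)

lemma open_coord_image:
  assumes c: "c \<in> A" and V: "openin X V" "V \<subseteq> chart_dom c"
  shows "open (coord c ` V)"
proof -
  have "openin (subtopology X (chart_dom c)) V" using V by (metis inf.absorb_iff2 openin_subtopology_Int2 inf_commute)
  then have "openin (top_of_set (chart_image c)) (coord c ` V)"
    using homeomorphic_imp_open_map[OF homeo[OF c]] by (auto simp: open_map_def)
  then show ?thesis using open_image[OF c] by (simp add: openin_open_eq)
qed

lemma open_overlap: "c \<in> A \<Longrightarrow> d \<in> A \<Longrightarrow> open (overlap c d)"
  unfolding overlap_def by (intro open_coord_image openin_Int openin_dom) auto

lemma openin_coord_preimage:
  assumes c: "c \<in> A" and O: "open O'"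
  shows "openin X {p \<in> chart_dom c. coord c p \<in> O'}"
proof -
  have "continuous_map (subtopology X (chart_dom c)) (top_of_set (chart_image c)) (coord c)"
    by (rule homeomorphic_imp_continuous_map[OF homeo[OF c]])
  moreover have "openin (top_of_set (chart_image c)) (chart_image c \<inter> O')" using O by auto
  ultimately have "openin (subtopology X (chart_dom c)) {p \<in> topspace (subtopology X (chart_dom c)). coord c p \<in> chart_image c \<inter> O'}"
    by (rule openin_continuous_map_preimage)
  moreover have "{p \<in> topspace (subtopology X (chart_dom c)). coord c p \<in> chart_image c \<inter> O'} = {p \<in> chart_dom c. coord c p \<in> O'}"
    using dom_topspace[OF c] by (auto simp: chart_image_def)
  ultimately have "openin (subtopology X (chart_dom c)) {p \<in> chart_dom c. coord c p \<in> O'}" by simp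
  then show ?thesis using openin_dom[OF c] by (rule openin_trans_full)
qed

text \<open>The identity theorem for families of local coefficients whose zeros do not depend on the chart:
  forms, and homogeneous polynomials in forms.\<close>

lemma identity_theorem:
  assumes hol: "\<And>c. c \<in> A \<Longrightarrow> \<phi> c holomorphic_on chart_image c"
    and compat: "\<And>c d p. c \<in> A \<Longrightarrow> d \<in> A \<Longrightarrow> p \<in> chart_dom c \<inter> chart_dom d \<Longrightarrow> \<phi> d (coord d p) = 0 \<Longrightarrow> \<phi> c (coord c p) = 0"
    and c0: "c0 \<in> A" and W: "open W" "W \<noteq> {}" "W \<subseteq> chart_image c0" "\<And>z. z \<in> W \<Longrightarrow> \<phi> c0 z = 0"
    and c: "c \<in> A" and z: "z \<in> chart_image c"
  shows "\<phi> c z = 0"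
proof -
  define Z where "Z = {p \<in> topspace X. \<exists>c\<in>A. p \<in> chart_dom c \<and> (\<exists>T. open T \<and> coord c p \<in> T \<and> (\<forall>q\<in>chart_dom c. coord c q \<in> T \<longrightarrow> \<phi> c (coord c q) = 0))}"
  have "openin X Z"
  proof (subst openin_subopen, intro ballI)
    fix p assume "p \<in> Z"
    then obtain c T where c: "c \<in> A" "p \<in> chart_dom c" "open T" "coord c p \<in> T" "\<forall>q\<in>chart_dom c. coord c q \<in> T \<longrightarrow> \<phi> c (coord c q) = 0"
      unfolding Z_def by blast
    have "{q \<in> chart_dom c. coord c q \<in> T} \<subseteq> Z" using c dom_topspace[OF c(1)] unfolding Z_def by blast
    then show "\<exists>T. openin X T \<and> p \<in> T \<and> T \<subseteq> Z" using openin_coord_preimage[OF c(1,3)] c by blast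
  qed
  moreover have "openin X (topspace X - Z)"
  proof (subst openin_subopen, intro ballI)
    fix p assume p: "p \<in> topspace X - Z"
    then obtain d where d: "d \<in> A" "p \<in> chart_dom d" using cover by blast
    obtain e where e: "e > 0" "ball (coord d p) e \<subseteq> chart_image d"
      using open_image[OF d(1)] coord_image[OF d(2)] by (metis openE)
    define O' where "O' = ball (coord d p) e"
    have "q \<notin> Z" if q: "q \<in> chart_dom d" "coord d q \<in> O'" for q
    proof
      assume "q \<in> Z"
      then obtain c T where c: "c \<in> A" "q \<in> chart_dom c" "open T" "coord c q \<in> T" "\<forall>q\<in>chart_dom c. coord c q \<in> T \<longrightarrow> \<phi> c (coord c q) = 0"
        unfolding Z_def by blast
      define V where "V = {q \<in> chart_dom c. coord c q \<in> T} \<inter> {q \<in> chart_dom d. coord d q \<in> O'}"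
      have "openin X V" unfolding V_def
        by (intro openin_Int openin_coord_preimage[OF c(1,3)] openin_coord_preimage[OF d(1)]) (simp add: O'_def)
      then have op: "open (coord d ` V)" by (rule open_coord_image[OF d(1)]) (auto simp: V_def)
      have van: "\<phi> d x = 0" if "x \<in> coord d ` V" for x
        using that c compat[OF d(1) c(1)] by (auto simp: V_def)
      have "\<phi> d x = 0" if "x \<in> O'" for x
      proof (rule analytic_continuation_open[of "coord d ` V" O' "\<phi> d" "\<lambda>_. 0" x])
        show "coord d ` V \<noteq> {}" using c q by (auto simp: V_def)
        show "coord d ` V \<subseteq> O'" by (auto simp: V_def)
        show "\<phi> d holomorphic_on O'" using hol[OF d(1)] e by (auto simp: O'_def elim: holomorphic_on_subset)
      qed (use op van that in \<open>auto simp: O'_def\<close>)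
      then have "p \<in> Z" unfolding Z_def using d e p by (auto simp: O'_def intro!: bexI[of _ d] exI[of _ O'])
      then show False using p by blast
    qed
    then have "{q \<in> chart_dom d. coord d q \<in> O'} \<subseteq> topspace X - Z" using dom_topspace[OF d(1)] by blast
    moreover have "p \<in> {q \<in> chart_dom d. coord d q \<in> O'}" using d e by (auto simp: O'_def)
    moreover have "openin X {q \<in> chart_dom d. coord d q \<in> O'}" by (rule openin_coord_preimage[OF d(1)]) (simp add: O'_def)
    ultimately show "\<exists>T. openin X T \<and> p \<in> T \<and> T \<subseteq> topspace X - Z" by blast
  qed
  then have "closedin X Z" by (auto simp: closedin_def Z_def)
  moreover have "Z \<noteq> {}"
  proof -
    obtain w where w: "w \<in> W" using W by blast
    then obtain p where p: "p \<in> chart_dom c0" "coord c0 p = w" using W by (auto simp: chart_image_def)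
    have "p \<in> Z" unfolding Z_def using p w W c0 dom_topspace[OF c0] by blast
    then show ?thesis by blast
  qed
  ultimately have ZX: "Z = topspace X" using rs by (auto simp: riemann_surface_def connected_space_clopen_in)
  obtain p where p: "p \<in> chart_dom c" "coord c p = z" using z by (auto simp: chart_image_def)
  then have "p \<in> Z" using ZX dom_topspace[OF c] by blast
  then obtain d where "d \<in> A" "p \<in> chart_dom d" "\<phi> d (coord d p) = 0" unfolding Z_def by blast
  then show ?thesis using compat[OF c, of d p] p by auto
qed

lemma form_hol: "f \<in> holomorphic_forms A \<Longrightarrow> c \<in> A \<Longrightarrow> f c holomorphic_on chart_image c"
  by (auto simp: holomorphic_forms_def)

lemma form_transform:
  assumes "f \<in> holomorphic_forms A" "c \<in> A" "d \<in> A" "p \<in> chart_dom c \<inter> chart_dom d"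
  shows "f c (coord c p) = f d (coord d p) * deriv (transition c d) (coord c p)"
proof -
  have "coord c p \<in> overlap c d" using assms by (auto simp: overlap_def)
  then have "f c (coord c p) = f d (transition c d (coord c p)) * deriv (transition c d) (coord c p)"
    using assms(1-3) unfolding holomorphic_forms_def by blast
  then show ?thesis using transition_coord[of c p d] assms by simp
qed

lemma form_outside: "f \<in> holomorphic_forms A \<Longrightarrow> c \<notin> A \<or> z \<notin> chart_image c \<Longrightarrow> f c z = 0"
  unfolding holomorphic_forms_def by blast

lemma form_zero:
  assumes f: "f \<in> holomorphic_forms A" and c0: "c0 \<in> A" and W: "open W" "W \<noteq> {}" "W \<subseteq> chart_image c0" "\<And>z. z \<in> W \<Longrightarrow> f c0 z = 0"
  shows "f = (\<lambda>c z. 0)"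
proof (intro ext)
  fix c z
  show "f c z = 0"
  proof (cases "c \<in> A \<and> z \<in> chart_image c")
    case True
    have cp: "f c (coord c p) = 0" if "c \<in> A" "d \<in> A" "p \<in> chart_dom c \<inter> chart_dom d" "f d (coord d p) = 0" for c d p
      using form_transform[OF f that(1-3)] that(4) by simp
    from True show ?thesis
      by (intro identity_theorem[of f c0 W c z, OF form_hol[OF f] cp c0 W]) (assumption | simp)+
  qed (use form_outside[OF f] in blast)
qed

lemma forms_lin:
  assumes f: "f \<in> holomorphic_forms A" and g: "g \<in> holomorphic_forms A"
  shows "(\<lambda>c z. \<alpha> * f c z + g c z) \<in> holomorphic_forms A"
  unfolding holomorphic_forms_def
proof (intro CollectI conjI ballI allI impI)
  fix c assume "c \<in> A"
  then show "(\<lambda>z. \<alpha> * f c z + g c z) holomorphic_on chart_image c"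
    using form_hol[OF f] form_hol[OF g] by (intro holomorphic_intros) auto
next
  fix c d z assume cd: "c \<in> A" "d \<in> A" "z \<in> overlap c d"
  have "f c z = f d (transition c d z) * deriv (transition c d) z" "g c z = g d (transition c d z) * deriv (transition c d) z"
    using f g cd unfolding holomorphic_forms_def by blast+
  then show "\<alpha> * f c z + g c z = (\<alpha> * f d (transition c d z) + g d (transition c d z)) * deriv (transition c d) z"
    by (simp only: ring_distribs mult.assoc)
next
  fix c z assume "c \<notin> A \<or> z \<notin> chart_image c"
  then show "\<alpha> * f c z + g c z = 0" using form_outside[OF f] form_outside[OF g] by simp
qed

lemma zero_form: "(\<lambda>c z. 0) \<in> holomorphic_forms A"
  by (auto simp: holomorphic_forms_def)

subsection \<open>The chosen countable cover\<close>

abbreviation "cc \<equiv> chart_cover A"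

lemma cc: "cc n \<in> A" "(\<Union>n. chart_dom (cc n)) = topspace X"
proof -
  have "Lindelof_space X" using rs second_countable_imp_Lindelof_space by (auto simp: riemann_surface_def)
  then obtain \<V> where \<V>: "countable \<V>" "\<V> \<subseteq> chart_dom ` A" "\<Union>\<V> = topspace X"
    unfolding Lindelof_space_def using cover openin_dom by (metis (no_types, lifting) imageE)
  then have ne: "\<V> \<noteq> {}" using \<V>(3) nonempty by (metis Union_empty)
  have "\<forall>n. \<exists>c\<in>A. chart_dom c = from_nat_into \<V> n" using from_nat_into[OF ne] \<V>(2) by (metis (no_types, lifting) imageE subsetD)
  then obtain c where c: "\<And>n. c n \<in> A" "\<And>n. chart_dom (c n) = from_nat_into \<V> n" by metis
  have "(\<Union>n. chart_dom (c n)) = \<Union>\<V>" unfolding c(2) range_from_nat_into[OF ne \<V>(1)] ..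
  then have "(\<Union>n. chart_dom (c n)) = (\<Union>d\<in>A. chart_dom d)" unfolding \<V>(3) cover .
  then have "range c \<subseteq> A \<and> (\<Union>n. chart_dom (c n)) = (\<Union>d\<in>A. chart_dom d)" using c(1) by blast
  then have "range cc \<subseteq> A \<and> (\<Union>n. chart_dom (cc n)) = (\<Union>d\<in>A. chart_dom d)"
    unfolding chart_cover_def by (rule someI[of "\<lambda>c. range c \<subseteq> A \<and> (\<Union>n. chart_dom (c n)) = (\<Union>d\<in>A. chart_dom d)" c])
  then show "cc n \<in> A" "(\<Union>n. chart_dom (cc n)) = topspace X" unfolding cover by blast+
qed

abbreviation "disjoint_dom \<equiv> disjointed (\<lambda>k. chart_dom (cc k))"

lemma disjoint_dom_sub: "disjoint_dom n \<subseteq> chart_dom (cc n)" by (auto simp: disjointed_def)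

lemma piece_sub: "piece A n \<subseteq> chart_image (cc n)"
  unfolding piece_def chart_image_def using disjoint_dom_sub by blast

lemma piece_borel [measurable]: "piece A n \<in> sets borel"
proof -
  define V where "V = (\<Union>k<n. chart_dom (cc k)) \<inter> chart_dom (cc n)"
  have "openin X V" unfolding V_def using openin_dom[OF cc(1)] by (intro openin_Int openin_Union) auto
  then have "open (coord (cc n) ` V)" by (rule open_coord_image[OF cc(1)]) (auto simp: V_def)
  moreover have "piece A n = chart_image (cc n) - coord (cc n) ` V"
  proof -
    have "disjoint_dom n = chart_dom (cc n) - V" by (auto simp: disjointed_def V_def)
    then show ?thesis unfolding piece_def chart_image_def
      using inj_on_image_set_diff[OF inj_coord[OF cc(1), of n], of "chart_dom (cc n)" V] by (auto simp: V_def)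
  qed
  ultimately show ?thesis using open_image[OF cc(1)] by auto
qed

text \<open>The first chart of the cover with nonempty domain is not diminished by the preceding ones.\<close>

lemma full_piece: obtains n0 where "piece A n0 = chart_image (cc n0)" "chart_image (cc n0) \<noteq> {}"
proof -
  have ex: "\<exists>n. chart_dom (cc n) \<noteq> {}"
  proof (rule ccontr)
    assume "\<nexists>n. chart_dom (cc n) \<noteq> {}"
    then have "(\<Union>n. chart_dom (cc n)) = {}" by simp
    then show False using cc(2) nonempty by metis
  qed
  define n0 where "n0 = (LEAST n. chart_dom (cc n) \<noteq> {})"
  have n0: "chart_dom (cc n0) \<noteq> {}" "\<And>k. k < n0 \<Longrightarrow> chart_dom (cc k) = {}"
    unfolding n0_def using LeastI_ex[OF ex] not_less_Least by blast+
  then have "disjoint_dom n0 = chart_dom (cc n0)" by (auto simp: disjointed_def)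
  then show thesis using that[of n0] n0 by (auto simp: piece_def chart_image_def)
qed

subsection \<open>The Hermitian inner product\<close>

text \<open>The square of the norm over one piece. Values in \<open>ennreal\<close> spare integrability conditions.\<close>

definition piece_sq :: "('a chart \<Rightarrow> complex \<Rightarrow> complex) \<Rightarrow> nat \<Rightarrow> ennreal" where
  "piece_sq f n = (\<integral>\<^sup>+z\<in>piece A n. ennreal ((norm (f (cc n) z))\<^sup>2) \<partial>lborel)"

lemma form_measurable:
  assumes f: "f \<in> holomorphic_forms A"
  shows "(\<lambda>z. indicator (piece A n) z *\<^sub>R f (cc n) z) \<in> borel_measurable borel"
    and "(\<lambda>z. ennreal ((norm (f (cc n) z))\<^sup>2) * indicator (piece A n) z) \<in> borel_measurable lborel"
proof -
  have "continuous_on (piece A n) (f (cc n))"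
    using form_hol[OF f cc(1)] piece_sub by (meson continuous_on_subset holomorphic_on_imp_continuous_on)
  then show "(\<lambda>z. indicator (piece A n) z *\<^sub>R f (cc n) z) \<in> borel_measurable borel"
    "(\<lambda>z. ennreal ((norm (f (cc n) z))\<^sup>2) * indicator (piece A n) z) \<in> borel_measurable lborel"
    using measurable_L2_integrand[OF _ piece_borel] by auto
qed

lemma product_measurable:
  assumes f: "f \<in> holomorphic_forms A" and g: "g \<in> holomorphic_forms A"
  shows "(\<lambda>z. indicator (piece A n) z *\<^sub>R (f (cc n) z * cnj (g (cc n) z))) \<in> borel_measurable lborel"
proof -
  have "(\<lambda>z. (indicator (piece A n) z *\<^sub>R f (cc n) z) * cnj (indicator (piece A n) z *\<^sub>R g (cc n) z)) \<in> borel_measurable lborel"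
    using form_measurable(1)[OF f, of n]
      measurable_compose[OF form_measurable(1)[OF g, of n] borel_measurable_continuous_onI[OF continuous_on_cnj[OF continuous_on_id]]]
    by (intro borel_measurable_times) (simp_all add: measurable_lborel1)
  moreover have "(\<lambda>z. (indicator (piece A n) z *\<^sub>R f (cc n) z) * cnj (indicator (piece A n) z *\<^sub>R g (cc n) z)) = (\<lambda>z. indicator (piece A n) z *\<^sub>R (f (cc n) z * cnj (g (cc n) z)))"
    by (auto simp: indicator_def)
  ultimately show ?thesis by simp
qed

lemma sq_integral:
  assumes f: "f \<in> holomorphic_forms A" and fin: "piece_sq f n < \<infinity>"
  shows "set_integrable lborel (piece A n) (\<lambda>z. (norm (f (cc n) z))\<^sup>2)"
    and "piece_sq f n = ennreal (LINT z:piece A n|lborel. (norm (f (cc n) z))\<^sup>2)"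
proof -
  have e: "(\<lambda>z. ennreal (indicator (piece A n) z *\<^sub>R (norm (f (cc n) z))\<^sup>2)) = (\<lambda>z. ennreal ((norm (f (cc n) z))\<^sup>2) * indicator (piece A n) z)"
    by (auto simp: indicator_def)
  have m: "(\<lambda>z. indicator (piece A n) z *\<^sub>R (norm (f (cc n) z))\<^sup>2) \<in> borel_measurable lborel"
  proof -
    have "(\<lambda>z. (norm (indicator (piece A n) z *\<^sub>R f (cc n) z))\<^sup>2) \<in> borel_measurable lborel"
      using borel_measurable_power[OF measurable_compose[OF form_measurable(1)[OF f, of n] borel_measurable_continuous_onI[OF continuous_on_norm[OF continuous_on_id]]], of 2] by (simp add: measurable_lborel1)
    moreover have "(\<lambda>z. (norm (indicator (piece A n) z *\<^sub>R f (cc n) z))\<^sup>2) = (\<lambda>z. indicator (piece A n) z *\<^sub>R (norm (f (cc n) z))\<^sup>2)"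
      by (auto simp: indicator_def)
    ultimately show ?thesis by simp
  qed
  have "integrable lborel (\<lambda>z. indicator (piece A n) z *\<^sub>R (norm (f (cc n) z))\<^sup>2)"
    by (rule integrableI_nonneg[OF m]) (use fin e in \<open>auto simp: piece_sq_def\<close>)
  then show "set_integrable lborel (piece A n) (\<lambda>z. (norm (f (cc n) z))\<^sup>2)" by (simp add: set_integrable_def)
  then show "piece_sq f n = ennreal (LINT z:piece A n|lborel. (norm (f (cc n) z))\<^sup>2)"
    unfolding piece_sq_def set_lebesgue_integral_def e[symmetric] set_integrable_def
    by (intro nn_integral_eq_integral) auto
qed

lemma bergman_space_iff:
  "f \<in> bergman_space A \<longleftrightarrow> f \<in> holomorphic_forms A \<and> (\<Sum>n. piece_sq f n) < \<infinity>"
proof (cases "f \<in> holomorphic_forms A")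
  case f: True
  have nw: "norm (wedge_cnj f f c z) = (norm (f c z))\<^sup>2" for c z
    by (simp add: wedge_cnj_def norm_mult power2_eq_square)
  have "form_integrable A (wedge_cnj f f) \<longleftrightarrow> (\<Sum>n. piece_sq f n) < \<infinity>"
  proof
    assume fi: "form_integrable A (wedge_cnj f f)"
    have fin: "piece_sq f n < \<infinity>" for n
    proof -
      have "set_integrable lborel (piece A n) (wedge_cnj f f (cc n))" using fi by (simp add: form_integrable_def)
      then have "(\<integral>\<^sup>+z. ennreal (norm (indicator (piece A n) z *\<^sub>R wedge_cnj f f (cc n) z)) \<partial>lborel) < \<infinity>"
        by (simp add: set_integrable_def integrable_iff_bounded)
      moreover have "ennreal (norm (indicator (piece A n) z *\<^sub>R wedge_cnj f f (cc n) z)) = ennreal ((norm (f (cc n) z))\<^sup>2) * indicator (piece A n) z" for z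
        by (simp add: nw indicator_def)
      ultimately show ?thesis by (simp add: piece_sq_def)
    qed
    have "summable (\<lambda>n. LINT z:piece A n|lborel. (norm (f (cc n) z))\<^sup>2)" using fi by (simp add: form_integrable_def nw)
    then have "(\<Sum>n. ennreal (LINT z:piece A n|lborel. (norm (f (cc n) z))\<^sup>2)) \<noteq> top"
      by (rule ennreal_suminf_neq_top) (auto simp: set_lebesgue_integral_def intro!: integral_nonneg_AE)
    then show "(\<Sum>n. piece_sq f n) < \<infinity>" by (simp add: sq_integral(2)[OF f fin] less_top)
  next
    assume s: "(\<Sum>n. piece_sq f n) < \<infinity>"
    have fin: "piece_sq f n < \<infinity>" for n
      using sum_le_suminf[of "piece_sq f" "{n}"] s by (auto intro: le_less_trans)
    have "set_integrable lborel (piece A n) (wedge_cnj f f (cc n))" for n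
    proof -
      have "set_integrable lborel (piece A n) (\<lambda>z. complex_of_real ((norm (f (cc n) z))\<^sup>2))"
        using integrable_of_real[OF sq_integral(1)[OF f fin, of n, unfolded set_integrable_def], where 'a = complex]
        unfolding set_integrable_def by (simp add: scaleR_conv_of_real)
      then show ?thesis by (simp only: wedge_cnj_def[abs_def] complex_norm_square)
    qed
    moreover have "summable (\<lambda>n. LINT z:piece A n|lborel. (norm (f (cc n) z))\<^sup>2)"
    proof (rule summable_suminf_not_top)
      show "0 \<le> (LINT z:piece A n|lborel. (norm (f (cc n) z))\<^sup>2)" for n
        by (auto simp: set_lebesgue_integral_def intro!: integral_nonneg_AE)
      show "(\<Sum>n. ennreal (LINT z:piece A n|lborel. (norm (f (cc n) z))\<^sup>2)) \<noteq> top"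
        using s by (simp add: sq_integral(2)[OF f fin, symmetric] less_top)
    qed
    ultimately show "form_integrable A (wedge_cnj f f)" by (simp add: form_integrable_def nw)
  qed
  then show ?thesis using f by (simp add: bergman_space_def)
qed (auto simp: bergman_space_def)

lemma bergman_form: "f \<in> bergman_space A \<Longrightarrow> f \<in> holomorphic_forms A"
  and piece_sq_finite: "f \<in> bergman_space A \<Longrightarrow> piece_sq f n < \<infinity>"
  using sum_le_suminf[of "piece_sq f" "{n}"] by (auto simp: bergman_space_iff intro: le_less_trans)

lemma sq_summable:
  assumes f: "f \<in> bergman_space A"
  shows "summable (\<lambda>n. LINT z:piece A n|lborel. (norm (f (cc n) z))\<^sup>2)"
proof (rule summable_suminf_not_top)
  show "0 \<le> (LINT z:piece A n|lborel. (norm (f (cc n) z))\<^sup>2)" for n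
    by (auto simp: set_lebesgue_integral_def intro!: integral_nonneg_AE)
  show "(\<Sum>n. ennreal (LINT z:piece A n|lborel. (norm (f (cc n) z))\<^sup>2)) \<noteq> top"
    using f sq_integral(2)[OF bergman_form[OF f] piece_sq_finite[OF f]] by (simp add: bergman_space_iff less_top)
qed

lemma bergman_lin:
  assumes f: "f \<in> bergman_space A" and g: "g \<in> bergman_space A"
  shows "(\<lambda>c z. \<alpha> * f c z + g c z) \<in> bergman_space A"
proof -
  note ff = bergman_form[OF f] and gf = bergman_form[OF g]
  have le: "piece_sq (\<lambda>c z. \<alpha> * f c z + g c z) n \<le> ennreal (2 * (norm \<alpha>)\<^sup>2) * piece_sq f n + 2 * piece_sq g n" for n
  proof -
    have "piece_sq (\<lambda>c z. \<alpha> * f c z + g c z) n \<le> (\<integral>\<^sup>+z. ennreal (2 * (norm \<alpha>)\<^sup>2) * (ennreal ((norm (f (cc n) z))\<^sup>2) * indicator (piece A n) z) + 2 * (ennreal ((norm (g (cc n) z))\<^sup>2) * indicator (piece A n) z) \<partial>lborel)"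
      unfolding piece_sq_def
    proof (rule nn_integral_mono)
      fix z
      let ?x = "\<alpha> * f (cc n) z" and ?y = "g (cc n) z"
      have "(norm (?x + ?y))\<^sup>2 \<le> (norm ?x + norm ?y)\<^sup>2" by (intro power_mono norm_triangle_ineq) auto
      also have "\<dots> \<le> 2 * (norm ?x)\<^sup>2 + 2 * (norm ?y)\<^sup>2"
        using sum_squares_bound[of "norm ?x" "norm ?y"] by (simp add: power2_sum)
      also have "\<dots> = 2 * (norm \<alpha>)\<^sup>2 * (norm (f (cc n) z))\<^sup>2 + 2 * (norm ?y)\<^sup>2" by (simp add: norm_mult power_mult_distrib)
      finally have "ennreal ((norm (?x + ?y))\<^sup>2) \<le> ennreal (2 * (norm \<alpha>)\<^sup>2 * (norm (f (cc n) z))\<^sup>2 + 2 * (norm ?y)\<^sup>2)" by (rule ennreal_leI)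
      also have "\<dots> = ennreal (2 * (norm \<alpha>)\<^sup>2) * ennreal ((norm (f (cc n) z))\<^sup>2) + 2 * ennreal ((norm ?y)\<^sup>2)" by (simp add: ennreal_mult)
      finally show "ennreal ((norm (?x + ?y))\<^sup>2) * indicator (piece A n) z \<le> ennreal (2 * (norm \<alpha>)\<^sup>2) * (ennreal ((norm (f (cc n) z))\<^sup>2) * indicator (piece A n) z) + 2 * (ennreal ((norm ?y)\<^sup>2) * indicator (piece A n) z)"
        by (simp add: indicator_def)
    qed
    also have "\<dots> = ennreal (2 * (norm \<alpha>)\<^sup>2) * piece_sq f n + 2 * piece_sq g n"
      unfolding piece_sq_def using form_measurable(2)[OF ff, of n] form_measurable(2)[OF gf, of n]
      by (subst nn_integral_add; (simp add: nn_integral_cmult)?)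
    finally show ?thesis .
  qed
  have "(\<Sum>n. piece_sq (\<lambda>c z. \<alpha> * f c z + g c z) n) \<le> (\<Sum>n. ennreal (2 * (norm \<alpha>)\<^sup>2) * piece_sq f n + 2 * piece_sq g n)"
    by (rule suminf_le[OF le]) auto
  also have "\<dots> = ennreal (2 * (norm \<alpha>)\<^sup>2) * (\<Sum>n. piece_sq f n) + 2 * (\<Sum>n. piece_sq g n)"
    by (simp add: suminf_add[symmetric])
  also have "\<dots> < \<infinity>" using f g by (simp add: bergman_space_iff ennreal_mult_less_top)
  finally show ?thesis using forms_lin[OF ff gf] by (simp add: bergman_space_iff)
qed

lemma bergman_zero: "(\<lambda>c z. 0) \<in> bergman_space A"
  using zero_form by (simp add: bergman_space_iff piece_sq_def)

lemma bergman_sum: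
  "finite F \<Longrightarrow> (\<And>b. b \<in> F \<Longrightarrow> g b \<in> bergman_space A) \<Longrightarrow> (\<lambda>c z. \<Sum>b\<in>F. \<alpha> b * g b c z) \<in> bergman_space A"
proof (induction F rule: finite_induct)
  case (insert x F)
  then show ?case using bergman_lin[of "g x" "\<lambda>c z. \<Sum>b\<in>F. \<alpha> b * g b c z" "\<alpha> x"] by simp
qed (simp add: bergman_zero)

definition piece_inner :: "('a chart \<Rightarrow> complex \<Rightarrow> complex) \<Rightarrow> ('a chart \<Rightarrow> complex \<Rightarrow> complex) \<Rightarrow> nat \<Rightarrow> complex" where
  "piece_inner f g n = (LINT z:piece A n|lborel. f (cc n) z * cnj (g (cc n) z))"

lemma product_integrable:
  assumes f: "f \<in> bergman_space A" and g: "g \<in> bergman_space A"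
  shows "set_integrable lborel (piece A n) (\<lambda>z. f (cc n) z * cnj (g (cc n) z))"
    and "norm (piece_inner f g n) \<le> (LINT z:piece A n|lborel. (norm (f (cc n) z))\<^sup>2) + (LINT z:piece A n|lborel. (norm (g (cc n) z))\<^sup>2)"
proof -
  note ff = bergman_form[OF f] and gf = bergman_form[OF g]
  let ?F = "\<lambda>z. indicator (piece A n) z *\<^sub>R (norm (f (cc n) z))\<^sup>2" and ?G = "\<lambda>z. indicator (piece A n) z *\<^sub>R (norm (g (cc n) z))\<^sup>2"
  let ?P = "\<lambda>z. indicator (piece A n) z *\<^sub>R (f (cc n) z * cnj (g (cc n) z))"
  have i: "integrable lborel ?F" "integrable lborel ?G"
    using sq_integral(1)[OF ff piece_sq_finite[OF f]] sq_integral(1)[OF gf piece_sq_finite[OF g]] by (auto simp: set_integrable_def)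
  have le: "norm (?P z) \<le> ?F z + ?G z" for z
  proof -
    have "2 * (norm (f (cc n) z) * norm (g (cc n) z)) \<le> (norm (f (cc n) z))\<^sup>2 + (norm (g (cc n) z))\<^sup>2"
      using sum_squares_bound[of "norm (f (cc n) z)" "norm (g (cc n) z)"] by (simp add: mult.assoc)
    moreover have "0 \<le> norm (f (cc n) z) * norm (g (cc n) z)" by simp
    ultimately have "norm (f (cc n) z) * norm (g (cc n) z) \<le> (norm (f (cc n) z))\<^sup>2 + (norm (g (cc n) z))\<^sup>2" by linarith
    then show ?thesis by (simp add: norm_mult indicator_def)
  qed
  have iP: "integrable lborel ?P"
    by (rule Bochner_Integration.integrable_bound[OF Bochner_Integration.integrable_add[OF i] product_measurable[OF ff gf]])
      (use le in \<open>auto intro!: AE_I2 order_trans[OF _ abs_ge_self]\<close>)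
  then show "set_integrable lborel (piece A n) (\<lambda>z. f (cc n) z * cnj (g (cc n) z))" by (simp add: set_integrable_def)
  have "norm (piece_inner f g n) \<le> (\<integral>z. norm (?P z) \<partial>lborel)" unfolding piece_inner_def set_lebesgue_integral_def by (rule integral_norm_bound)
  also have "\<dots> \<le> (\<integral>z. ?F z + ?G z \<partial>lborel)"
    by (rule integral_mono[OF integrable_norm[OF iP] Bochner_Integration.integrable_add[OF i] le])
  also have "\<dots> = (\<integral>z. ?F z \<partial>lborel) + (\<integral>z. ?G z \<partial>lborel)" by (rule Bochner_Integration.integral_add[OF i])
  finally show "norm (piece_inner f g n) \<le> (LINT z:piece A n|lborel. (norm (f (cc n) z))\<^sup>2) + (LINT z:piece A n|lborel. (norm (g (cc n) z))\<^sup>2)"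
    by (simp add: set_lebesgue_integral_def)
qed

lemma piece_inner_summable:
  assumes "f \<in> bergman_space A" "g \<in> bergman_space A"
  shows "summable (piece_inner f g)"
  by (rule summable_comparison_test'[OF summable_add[OF sq_summable[OF assms(1)] sq_summable[OF assms(2)]], of 0])
    (use product_integrable(2)[OF assms] in auto)

abbreviation "ip \<equiv> bergman_inner A"

lemma ip_piece_inner: 
  assumes "f \<in> bergman_space A" "g \<in> bergman_space A"
  shows "ip f g = 2 * (\<Sum>n. piece_inner f g n)"
proof -
  have "(LINT z:piece A n|lborel. wedge_cnj f g (cc n) z * (- 2 * \<i>)) = piece_inner f g n * (- 2 * \<i>)" for n
    unfolding wedge_cnj_def piece_inner_def by (rule set_integral_mult_left)
  then have "form_integral A (wedge_cnj f g) = (\<Sum>n. piece_inner f g n * (- 2 * \<i>))" by (simp only: form_integral_def)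
  also have "\<dots> = (\<Sum>n. piece_inner f g n) * (- 2 * \<i>)" by (rule suminf_mult2[OF piece_inner_summable[OF assms], symmetric])
  finally have "ip f g = \<i> * ((\<Sum>n. piece_inner f g n) * (- 2 * \<i>))" by (simp only: bergman_inner_def)
  then show ?thesis by (simp add: algebra_simps)
qed

lemma ip_lin:
  assumes f: "f \<in> bergman_space A" and g: "g \<in> bergman_space A" and h: "h \<in> bergman_space A"
  shows "ip (\<lambda>c z. \<alpha> * f c z + g c z) h = \<alpha> * ip f h + ip g h"
proof -
  have "piece_inner (\<lambda>c z. \<alpha> * f c z + g c z) h n = \<alpha> * piece_inner f h n + piece_inner g h n" for n
  proof -
    have "piece_inner (\<lambda>c z. \<alpha> * f c z + g c z) h n = (LINT z:piece A n|lborel. \<alpha> * (f (cc n) z * cnj (h (cc n) z)) + g (cc n) z * cnj (h (cc n) z))"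
      unfolding piece_inner_def by (simp add: algebra_simps)
    also have "\<dots> = (LINT z:piece A n|lborel. \<alpha> * (f (cc n) z * cnj (h (cc n) z))) + piece_inner g h n"
      unfolding piece_inner_def by (rule set_integral_add(2)) (use product_integrable(1)[OF f h] product_integrable(1)[OF g h] in \<open>auto intro: set_integrable_mult_right\<close>)
    finally show ?thesis by (simp add: piece_inner_def)
  qed
  then have "(\<Sum>n. piece_inner (\<lambda>c z. \<alpha> * f c z + g c z) h n) = \<alpha> * (\<Sum>n. piece_inner f h n) + (\<Sum>n. piece_inner g h n)"
    using suminf_add[OF summable_mult[OF piece_inner_summable[OF f h], of \<alpha>] piece_inner_summable[OF g h]] suminf_mult[OF piece_inner_summable[OF f h], of \<alpha>] by simp
  then show ?thesis using ip_piece_inner[OF bergman_lin[OF f g] h] ip_piece_inner[OF f h] ip_piece_inner[OF g h] by (simp add: algebra_simps)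
qed

lemma ip_zero: "h \<in> bergman_space A \<Longrightarrow> ip (\<lambda>c z. 0) h = 0"
  using ip_piece_inner[OF bergman_zero, of h] by (simp add: piece_inner_def)

lemma ip_sum:
  assumes "finite F" "\<And>b. b \<in> F \<Longrightarrow> g b \<in> bergman_space A" "h \<in> bergman_space A"
  shows "ip (\<lambda>c z. \<Sum>b\<in>F. \<alpha> b * g b c z) h = (\<Sum>b\<in>F. \<alpha> b * ip (g b) h)"
  using assms
proof (induction F rule: finite_induct)
  case (insert x F)
  then show ?case using ip_lin[of "g x" "\<lambda>c z. \<Sum>b\<in>F. \<alpha> b * g b c z" h "\<alpha> x"] bergman_sum[of F g \<alpha>] by simp
qed (simp add: ip_zero)

lemma ip_herm:
  assumes f: "f \<in> bergman_space A" and g: "g \<in> bergman_space A"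
  shows "ip g f = cnj (ip f g)"
proof -
  have "piece_inner g f n = cnj (piece_inner f g n)" for n
  proof -
    have e: "(\<lambda>z. indicator (piece A n) z *\<^sub>R (g (cc n) z * cnj (f (cc n) z))) = (\<lambda>z. cnj (indicator (piece A n) z *\<^sub>R (f (cc n) z * cnj (g (cc n) z))))"
      by (simp add: fun_eq_iff mult.commute)
    show ?thesis unfolding piece_inner_def set_lebesgue_integral_def e by (rule Bochner_Integration.integral_cnj)
  qed
  then have "(\<Sum>n. piece_inner g f n) = (\<Sum>n. cnj (piece_inner f g n))" by presburger
  also have "\<dots> = cnj (\<Sum>n. piece_inner f g n)"
    by (rule bounded_linear.suminf[OF bounded_linear_cnj piece_inner_summable[OF f g], symmetric])
  finally show ?thesis using ip_piece_inner[OF f g] ip_piece_inner[OF g f] by simp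
qed

text \<open>Half the norm square, because \<open>\<i> dz \<and> d(cnj z)\<close> is twice the area form.\<close>

definition total_sq :: "('a chart \<Rightarrow> complex \<Rightarrow> complex) \<Rightarrow> real" where
  "total_sq f = (\<Sum>n. LINT z:piece A n|lborel. (norm (f (cc n) z))\<^sup>2)"

lemma ip_self: assumes f: "f \<in> bergman_space A" shows "ip f f = of_real (2 * total_sq f)"
proof -
  have "piece_inner f f n = of_real (LINT z:piece A n|lborel. (norm (f (cc n) z))\<^sup>2)" for n
    unfolding piece_inner_def set_lebesgue_integral_def integral_complex_of_real[symmetric]
    by (intro Bochner_Integration.integral_cong) (auto simp: indicator_def complex_norm_square[symmetric])
  then have "(\<Sum>n. piece_inner f f n) = of_real (total_sq f)"
    unfolding total_sq_def using suminf_of_real[OF sq_summable[OF f], where 'a = complex] by simp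
  then show ?thesis using ip_piece_inner[OF f f] by simp
qed

lemma piece_le_total_sq:
  assumes f: "f \<in> bergman_space A"
  shows "piece_sq f n \<le> ennreal (total_sq f)" and "total_sq f \<ge> 0"
proof -
  have nn: "0 \<le> (LINT z:piece A n|lborel. (norm (f (cc n) z))\<^sup>2)" for n
    by (auto simp: set_lebesgue_integral_def intro!: integral_nonneg_AE)
  show "total_sq f \<ge> 0" unfolding total_sq_def by (rule suminf_nonneg[OF sq_summable[OF f]]) (rule nn)
  have "(LINT z:piece A n|lborel. (norm (f (cc n) z))\<^sup>2) \<le> total_sq f"
    unfolding total_sq_def using sum_le_suminf[OF sq_summable[OF f], of "{n}"] nn by auto
  then show "piece_sq f n \<le> ennreal (total_sq f)" using sq_integral(2)[OF bergman_form[OF f] piece_sq_finite[OF f]] by (simp add: ennreal_leI)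
qed

text \<open>Point evaluations are bounded in the chart whose image is one full piece of the cover: there the
  norm contains the integral over a whole disc.\<close>

lemma point_evaluation:
  assumes f: "f \<in> bergman_space A" and n0: "piece A n = chart_image (cc n)" and z: "ball z \<rho> \<subseteq> chart_image (cc n)" and \<rho>: "\<rho> > 0"
  shows "pi * (\<rho> / 2)\<^sup>2 * (norm (f (cc n) z))\<^sup>2 \<le> total_sq f"
proof -
  have "f (cc n) holomorphic_on ball z \<rho>" using form_hol[OF bergman_form[OF f] cc(1)] z by (rule holomorphic_on_subset)
  then have "ennreal (pi * (\<rho> / 2)\<^sup>2 * (norm (f (cc n) z))\<^sup>2) \<le> (\<integral>\<^sup>+w\<in>ball z (\<rho> / 2). ennreal ((norm (f (cc n) w))\<^sup>2) \<partial>lborel)"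
    by (rule submean) (use \<rho> in auto)
  also have "\<dots> \<le> piece_sq f n"
  proof -
    have "ball z (\<rho> / 2) \<subseteq> piece A n" using z n0 \<rho> subset_ball[of "\<rho> / 2" \<rho> z] by auto
    then show ?thesis unfolding piece_sq_def by (intro nn_integral_mono) (auto simp: indicator_def)
  qed
  also have "\<dots> \<le> ennreal (total_sq f)" by (rule piece_le_total_sq[OF f])
  finally show ?thesis using piece_le_total_sq(2)[OF f] by (simp add: ennreal_le_iff)
qed

lemma total_sq_zero:
  assumes f: "f \<in> bergman_space A" and 0: "total_sq f = 0"
  shows "f = (\<lambda>c z. 0)"
proof -
  obtain n where n: "piece A n = chart_image (cc n)" "chart_image (cc n) \<noteq> {}" by (rule full_piece) blast
  have "f (cc n) z = 0" if z: "z \<in> chart_image (cc n)" for z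
  proof -
    obtain \<rho> where \<rho>: "\<rho> > 0" "ball z \<rho> \<subseteq> chart_image (cc n)" using open_image[OF cc(1)] z by (metis openE)
    have "pi * (\<rho> / 2)\<^sup>2 * (norm (f (cc n) z))\<^sup>2 \<le> 0" using point_evaluation[OF f n(1) \<rho>(2,1)] 0 by simp
    moreover have "pi * (\<rho> / 2)\<^sup>2 > 0" using \<rho> by simp
    ultimately have "(norm (f (cc n) z))\<^sup>2 \<le> 0" by (metis mult_le_0_iff not_less)
    then show ?thesis by simp
  qed
  then show ?thesis using form_zero[OF bergman_form[OF f] cc(1) open_image[OF cc(1)] n(2)] by auto
qed

text \<open>A maximal orthonormal set; a form orthogonal to it could be normalised and added.\<close>

lemma basis_exists: "\<exists>B. bergman_basis A B"
proof -
  define \<C> where "\<C> = {B. B \<subseteq> bergman_space A \<and> (\<forall>f\<in>B. \<forall>g\<in>B. ip f g = (if f = g then 1 else 0))}"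
  have "\<exists>M\<in>\<C>. \<forall>X\<in>\<C>. M \<subseteq> X \<longrightarrow> X = M"
  proof (rule subset_Zorn_nonempty)
    show "\<C> \<noteq> {}" by (auto simp: \<C>_def)
    fix \<D> assume "\<D> \<noteq> {}" and chain: "subset.chain \<C> \<D>"
    show "\<Union>\<D> \<in> \<C>"
      unfolding \<C>_def
    proof (intro CollectI conjI ballI)
      show "\<Union>\<D> \<subseteq> bergman_space A" using chain by (auto simp: \<C>_def subset_chain_def)
      fix f g assume "f \<in> \<Union>\<D>" "g \<in> \<Union>\<D>"
      then obtain D where "D \<in> \<D>" "f \<in> D" "g \<in> D" using chain by (auto simp: subset_chain_def) blast
      moreover have "D \<in> \<C>" using chain \<open>D \<in> \<D>\<close> by (auto simp: subset_chain_def)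
      ultimately show "ip f g = (if f = g then 1 else 0)" unfolding \<C>_def by blast
    qed
  qed
  then obtain B where B: "B \<in> \<C>" "\<And>X. X \<in> \<C> \<Longrightarrow> B \<subseteq> X \<Longrightarrow> X = B" by blast
  have Bs: "B \<subseteq> bergman_space A" and Bo: "\<And>f g. f \<in> B \<Longrightarrow> g \<in> B \<Longrightarrow> ip f g = (if f = g then 1 else 0)" using B(1) by (auto simp: \<C>_def)
  have "f = (\<lambda>c z. 0)" if f: "f \<in> bergman_space A" and ort: "\<And>g. g \<in> B \<Longrightarrow> ip f g = 0" for f
  proof (rule ccontr)
    assume nz: "f \<noteq> (\<lambda>c z. 0)"
    then have pos: "total_sq f > 0" using total_sq_zero[OF f] piece_le_total_sq(2)[OF f] by fastforce
    define t where "t = complex_of_real (1 / sqrt (2 * total_sq f))"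
    define u where "u c z = t * f c z + 0" for c z
    have u: "u \<in> bergman_space A" unfolding u_def by (rule bergman_lin[OF f bergman_zero])
    have iu: "ip u h = t * ip f h" if "h \<in> bergman_space A" for h
      unfolding u_def using ip_lin[OF f bergman_zero that, of t] ip_zero[OF that] by simp
    have uB: "ip u g = 0" "ip g u = 0" if "g \<in> B" for g
    proof -
      have "g \<in> bergman_space A" using Bs that by blast
      then show "ip u g = 0" "ip g u = 0" using iu[of g] ort[OF that] ip_herm[OF u, of g] by auto
    qed
    have "ip u u = 1"
    proof -
      have "ip u u = t * cnj (ip u f)" using iu[OF u] ip_herm[OF u f] by simp
      also have "\<dots> = t * cnj (t * of_real (2 * total_sq f))" by (simp only: iu[OF f] ip_self[OF f])
      also have "\<dots> = of_real ((1 / sqrt (2 * total_sq f))\<^sup>2 * (2 * total_sq f))"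
        unfolding t_def power2_eq_square complex_cnj_mult complex_cnj_complex_of_real of_real_mult by (simp only: mult.assoc)
      also have "(1 / sqrt (2 * total_sq f))\<^sup>2 * (2 * total_sq f) = 1" using pos by (simp add: power_divide)
      finally show ?thesis by simp
    qed
    then have uu: "ip u u = 1" and unB: "u \<notin> B" using uB(1) zero_neq_one by metis+
    have "insert u B \<in> \<C>" unfolding \<C>_def
    proof (intro CollectI conjI ballI)
      show "insert u B \<subseteq> bergman_space A" using Bs u by blast
      fix f g assume "f \<in> insert u B" "g \<in> insert u B"
      then consider "f = u" "g = u" | "f = u" "g \<in> B" | "f \<in> B" "g = u" | "f \<in> B" "g \<in> B" by blast
      then show "ip f g = (if f = g then 1 else 0)"
        by cases (use uu unB uB Bo in \<open>metis\<close>)+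
    qed
    then show False using B(2)[of "insert u B"] unB by blast
  qed
  then have "bergman_basis A B" using Bs Bo unfolding bergman_basis_def by blast
  then show ?thesis by blast
qed

text \<open>The usual argument for the reproducing kernel, with finite sums: the combination
  \<open>\<phi> = (\<Sum>b\<in>F. cnj (b z) * b)\<close> has both norm square and value at \<open>z\<close> equal to the sum \<open>S\<close>, so bounded point
  evaluation gives \<open>S\<^sup>2 \<le> const * S\<close>.\<close>

lemma basis_bessel:
  assumes B: "bergman_basis A B" and n0: "piece A n = chart_image (cc n)" and a: "ball a (2 * \<rho>) \<subseteq> chart_image (cc n)" and \<rho>: "\<rho> > 0"
  shows "bessel_family B (\<lambda>b. b (cc n)) (ball a \<rho>) (1 / (2 * (pi * (\<rho> / 2)\<^sup>2)))"
  unfolding bessel_family_def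
proof (intro conjI ballI allI impI)
  have Bs: "B \<subseteq> bergman_space A" and Bo: "\<And>f g. f \<in> B \<Longrightarrow> g \<in> B \<Longrightarrow> ip f g = (if f = g then 1 else 0)" using B by (auto simp: bergman_basis_def)
  {
    fix b assume "b \<in> B"
    then have "b (cc n) holomorphic_on chart_image (cc n)" using Bs form_hol[OF bergman_form cc(1)] by blast
    then show "b (cc n) holomorphic_on ball a \<rho>" by (rule holomorphic_on_subset) (use a \<rho> subset_ball[of \<rho> "2 * \<rho>" a] in auto)
  next
    fix z F assume z: "z \<in> ball a \<rho>" and F: "finite F \<and> F \<subseteq> B"
    define S where "S = (\<Sum>b\<in>F. (norm (b (cc n) z))\<^sup>2)"
    have S0: "S \<ge> 0" by (simp add: S_def sum_nonneg)
    have FV: "b \<in> bergman_space A" if "b \<in> F" for b using F Bs that by blast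
    define \<phi> where "\<phi> c w = (\<Sum>b\<in>F. cnj (b (cc n) z) * b c w)" for c w
    have \<phi>: "\<phi> \<in> bergman_space A" unfolding \<phi>_def using F FV by (intro bergman_sum) auto
    have ipb: "ip b \<phi> = b (cc n) z" if b: "b \<in> F" for b
    proof -
      have "ip \<phi> b = (\<Sum>b'\<in>F. cnj (b' (cc n) z) * ip b' b)" unfolding \<phi>_def using F FV b by (intro ip_sum) auto
      also have "\<dots> = (\<Sum>b'\<in>F. if b' = b then cnj (b (cc n) z) else 0)" using F b by (intro sum.cong) (auto simp: Bo subset_iff)
      also have "\<dots> = cnj (b (cc n) z)" using F b by simp
      finally show ?thesis using ip_herm[OF \<phi> FV[OF b]] by simp
    qed
    have "ip \<phi> \<phi> = (\<Sum>b\<in>F. cnj (b (cc n) z) * ip b \<phi>)" unfolding \<phi>_def[abs_def]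
      by (rule ip_sum) (use F FV \<phi> in \<open>auto simp: \<phi>_def[abs_def]\<close>)
    also have "\<dots> = of_real S" unfolding S_def of_real_sum by (intro sum.cong) (auto simp: ipb mult.commute complex_norm_square[symmetric] simp del: of_real_power)
    finally have nS: "2 * total_sq \<phi> = S" using ip_self[OF \<phi>] by (simp only: of_real_eq_iff)
    have \<phi>z: "\<phi> (cc n) z = of_real S" unfolding S_def of_real_sum \<phi>_def by (intro sum.cong) (simp_all only: complex_norm_square mult.commute)
    have "ball z \<rho> \<subseteq> ball a (2 * \<rho>)"
    proof
      fix x assume "x \<in> ball z \<rho>"
      then show "x \<in> ball a (2 * \<rho>)" using z dist_triangle[of a x z] by auto
    qed
    then have "pi * (\<rho> / 2)\<^sup>2 * (norm (\<phi> (cc n) z))\<^sup>2 \<le> total_sq \<phi>" using a by (intro point_evaluation[OF \<phi> n0 _ \<rho>]) auto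
    then have "pi * (\<rho> / 2)\<^sup>2 * S\<^sup>2 \<le> S / 2" using nS S0 by (simp add: \<phi>z)
    moreover have "(2 * K * S) * S \<le> 1 * S" if "K * S\<^sup>2 \<le> S / 2" for K :: real
      using that by (simp add: power2_eq_square mult.assoc)
    ultimately have *: "(2 * (pi * (\<rho> / 2)\<^sup>2) * S) * S \<le> 1 * S" by blast
    have "2 * (pi * (\<rho> / 2)\<^sup>2) * S \<le> 1"
    proof (cases "S = 0")
      case False
      then have "S > 0" using S0 by simp
      with * show ?thesis by (rule mult_right_le_imp_le)
    qed simp
    moreover have "2 * (pi * (\<rho> / 2)\<^sup>2) > 0" using \<rho> by simp
    ultimately show "(\<Sum>b\<in>F. (norm (b (cc n) z))\<^sup>2) \<le> 1 / (2 * (pi * (\<rho> / 2)\<^sup>2))"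
      unfolding S_def[symmetric] by (simp add: pos_le_divide_eq mult.commute)
  }
qed

end

section \<open>Finite dimensionality of the Bergman space\<close>

text \<open>Gaussian elimination: more vectors than coordinates. The vectors are the rows of \<open>M\<close>.\<close>

lemma linear_dependence:
  fixes M :: "'b \<Rightarrow> 'j \<Rightarrow> complex"
  assumes "finite J" "finite F" "card J < card F"
  shows "\<exists>c. (\<exists>b\<in>F. c b \<noteq> 0) \<and> (\<forall>j\<in>J. (\<Sum>b\<in>F. c b * M b j) = 0)"
  using assms
proof (induction J arbitrary: F M rule: finite_induct)
  case empty
  then have "F \<noteq> {}" by auto
  then show ?case by (intro exI[of _ "\<lambda>_. 1"]) auto
next
  case (insert j J)
  show ?case
  proof (cases "\<forall>b\<in>F. M b j = 0")
    case True
    have "card J < card F" using insert by simp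
    then obtain c where "\<exists>b\<in>F. c b \<noteq> 0" "\<forall>i\<in>J. (\<Sum>b\<in>F. c b * M b i) = 0"
      using insert.IH[OF insert.prems(1)] by blast
    then show ?thesis using True by (intro exI[of _ c]) auto
  next
    case False
    then obtain b0 where b0: "b0 \<in> F" "M b0 j \<noteq> 0" by blast
    have "card J < card (F - {b0})" using insert b0 by simp
    then obtain c where c: "\<exists>b\<in>F - {b0}. c b \<noteq> 0" "\<forall>i\<in>J. (\<Sum>b\<in>F - {b0}. c b * (M b i - M b j / M b0 j * M b0 i)) = 0"
      using insert.IH[of "F - {b0}" "\<lambda>b i. M b i - M b j / M b0 j * M b0 i"] insert.prems(1) by blast
    define t where "t = - (\<Sum>b\<in>F - {b0}. c b * M b j) / M b0 j"
    define c' where "c' b = (if b = b0 then t else c b)" for b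
    have split: "(\<Sum>b\<in>F. c' b * M b i) = t * M b0 i + (\<Sum>b\<in>F - {b0}. c b * M b i)" for i
    proof -
      have "(\<Sum>b\<in>F. c' b * M b i) = c' b0 * M b0 i + (\<Sum>b\<in>F - {b0}. c' b * M b i)" by (rule sum.remove[OF insert.prems(1) b0(1)])
      also have "(\<Sum>b\<in>F - {b0}. c' b * M b i) = (\<Sum>b\<in>F - {b0}. c b * M b i)" by (rule sum.cong) (auto simp: c'_def)
      finally show ?thesis by (simp add: c'_def)
    qed
    have "(\<Sum>b\<in>F. c' b * M b i) = 0" if "i \<in> J" for i
    proof -
      have "0 = (\<Sum>b\<in>F - {b0}. c b * M b i - c b * M b j * (M b0 i / M b0 j))"
        using c(2) that by (simp add: algebra_simps)
      also have "\<dots> = (\<Sum>b\<in>F - {b0}. c b * M b i) - (\<Sum>b\<in>F - {b0}. c b * M b j) * (M b0 i / M b0 j)"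
        by (simp only: sum_subtractf sum_distrib_right)
      finally show ?thesis unfolding split t_def by (simp add: algebra_simps)
    qed
    moreover have "(\<Sum>b\<in>F. c' b * M b j) = 0" unfolding split t_def using b0 by simp
    moreover have "\<exists>b\<in>F. c' b \<noteq> 0"
    proof -
      obtain b where "b \<in> F - {b0}" "c b \<noteq> 0" using c(1) by blast
      then show ?thesis by (intro bexI[of _ b]) (auto simp: c'_def)
    qed
    ultimately show ?thesis by (intro exI[of _ c']) auto
  qed
qed

context surface
begin

lemma nonzero_somewhere:
  assumes f: "f \<in> holomorphic_forms A" and nz: "f \<noteq> (\<lambda>c z. 0)" and c: "c \<in> A" "chart_image c \<noteq> {}"
  obtains z where "z \<in> chart_image c" "f c z \<noteq> 0"
proof -
  have "\<exists>z\<in>chart_image c. f c z \<noteq> 0"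
  proof (rule ccontr)
    assume *: "\<not> (\<exists>z\<in>chart_image c. f c z \<noteq> 0)"
    have "f = (\<lambda>c z. 0)" by (rule form_zero[OF f c(1) open_image[OF c(1)] c(2) order_refl]) (use * in blast)
    then show False using nz by blast
  qed
  then show thesis using that by blast
qed

text \<open>A member of the basis is determined by its \<open>m + 1\<close> coefficients near one point, so the basis is
  finite. The coefficient vectors are orthogonal in the sense of the local form, and inverting
  this gives forms \<open>e j\<close> equal to \<open>h \<psi>^j\<close> near the point. Expansions of forms and quadratic relations
  between them propagate from there by the identity theorem.\<close>

lemma constant_curvature_span:
  assumes bpf: "base_point_free A" and \<kappa>: "\<kappa> > 0" and curv: "bergman_constant_curvature A \<kappa>"
  obtains m :: nat and e where "m \<ge> 1" "\<And>j. j \<le> m \<Longrightarrow> e j \<in> bergman_space A"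
    "\<And>f. f \<in> bergman_space A \<Longrightarrow> \<exists>\<alpha>. f = (\<lambda>c z. \<Sum>j\<le>m. \<alpha> j * e j c z)"
    "\<And>i j c z. i < m \<Longrightarrow> j < m \<Longrightarrow> e i c z * e (Suc j) c z = e (Suc i) c z * e j c z"
proof -
  obtain n0 where n0: "piece A n0 = chart_image (cc n0)" "chart_image (cc n0) \<noteq> {}" by (rule full_piece) blast
  define B where "B = (SOME B. bergman_basis A B)"
  have B: "bergman_basis A B" unfolding B_def by (rule someI_ex[OF basis_exists])
  have Bs: "B \<subseteq> bergman_space A" and Bo: "\<And>f g. f \<in> B \<Longrightarrow> g \<in> B \<Longrightarrow> ip f g = (if f = g then 1 else 0)"
    and Bm: "\<And>f. f \<in> bergman_space A \<Longrightarrow> (\<And>g. g \<in> B \<Longrightarrow> ip f g = 0) \<Longrightarrow> f = (\<lambda>c z. 0)"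
    using B unfolding bergman_basis_def by blast+
  obtain w where w: "w \<in> chart_image (cc n0)" using n0 by blast
  have "B \<noteq> {}"
  proof
    assume "B = {}"
    obtain p where p: "p \<in> chart_dom (cc n0)" "coord (cc n0) p = w" using w by (auto simp: chart_image_def)
    obtain f where "f \<in> bergman_space A" "f (cc n0) (coord (cc n0) p) \<noteq> 0" using bpf cc(1) p(1) unfolding base_point_free_def by blast
    then show False using Bm[of f] \<open>B = {}\<close> by auto
  qed
  then obtain b0 where b0: "b0 \<in> B" by blast
  have "b0 \<noteq> (\<lambda>c z. 0)"
  proof
    assume "b0 = (\<lambda>c z. 0)"
    then have "ip b0 b0 = 0" using ip_zero[of b0] b0 Bs by auto
    then show False using Bo[OF b0 b0] by simp
  qed
  then obtain a where a: "a \<in> chart_image (cc n0)" "b0 (cc n0) a \<noteq> 0"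
    using nonzero_somewhere[OF bergman_form _ cc(1) n0(2), of b0] b0 Bs by blast
  obtain R where R: "R > 0" "ball a R \<subseteq> chart_image (cc n0)" using open_image[OF cc(1)] a(1) by (metis openE)
  have bes: "bessel_family B (\<lambda>b. b (cc n0)) (ball a (R / 2)) (1 / (2 * (pi * ((R / 2) / 2)\<^sup>2)))"
    by (rule basis_bessel[OF B n0(1)]) (use R in auto)
  have cv: "hol_sectional_curvature (wirtinger (wirtinger_bar (\<lambda>z. ln (\<Sum>\<^sub>\<infinity>b\<in>B. b (cc n0) z * cnj (b (cc n0) z))))) z = of_real \<kappa>"
    if "z \<in> ball a (R / 2)" for z
  proof -
    have "z \<in> chart_image (cc n0)" using that R by (auto simp: subset_iff)
    then have "hol_sectional_curvature (bergman_metric A (cc n0)) z = of_real \<kappa>" using curv cc(1) unfolding bergman_constant_curvature_def by blast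
    then show ?thesis unfolding bergman_metric_def bergman_kernel_def B_def .
  qed
  obtain s and m :: nat and h \<psi> \<phi> and \<beta> :: "nat \<Rightarrow> real" where s: "0 < s" "s \<le> R / 2" and m: "m \<ge> 1"
    and hol: "h holomorphic_on ball a s" "\<psi> holomorphic_on ball a s" "\<And>z. z \<in> ball a s \<Longrightarrow> h z \<noteq> 0"
    and form: "\<And>b z. b \<in> B \<Longrightarrow> z \<in> ball a s \<Longrightarrow> b (cc n0) z = h z * (\<Sum>j\<le>m. \<phi> b j * \<psi> z ^ j)"
    and orth: "\<And>i j. i \<le> m \<Longrightarrow> j \<le> m \<Longrightarrow> (\<Sum>\<^sub>\<infinity>b\<in>B. \<phi> b j * cnj (\<phi> b i)) = (if i = j then of_real (\<beta> i) else 0)"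
    and \<beta>: "\<And>j. j \<le> m \<Longrightarrow> \<beta> j > 0"
  proof (rule constant_curvature_local_form[where f = "\<lambda>b. b (cc n0)" and B = B, OF half_gt_zero[OF R(1)] bes b0 a(2) \<kappa>], goal_cases)
    case (1 z)
    show ?case by (rule cv[OF 1(2)])
  next
    case 2
    show ?case by (rule 2(1)[OF 2(2-)])
  qed
  have ballsub: "ball a s \<subseteq> chart_image (cc n0)" using R s by (auto simp: subset_iff)
  have unique: "f = (\<lambda>c z. 0)" if "f \<in> bergman_space A" "\<And>z. z \<in> ball a s \<Longrightarrow> f (cc n0) z = 0" for f
    by (rule form_zero[OF bergman_form[OF that(1)] cc(1) open_ball _ ballsub that(2)]) (use s in auto)
  have comb: "(\<Sum>b\<in>F. x b * b (cc n0) z) = h z * (\<Sum>j\<le>m. (\<Sum>b\<in>F. x b * \<phi> b j) * \<psi> z ^ j)"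
    if "F \<subseteq> B" "z \<in> ball a s" for F x z
  proof -
    have "(\<Sum>b\<in>F. x b * b (cc n0) z) = (\<Sum>b\<in>F. \<Sum>j\<le>m. h z * (x b * \<phi> b j * \<psi> z ^ j))"
    proof (rule sum.cong)
      fix b assume "b \<in> F"
      then have "b (cc n0) z = h z * (\<Sum>j\<le>m. \<phi> b j * \<psi> z ^ j)" using form that by blast
      then show "x b * b (cc n0) z = (\<Sum>j\<le>m. h z * (x b * \<phi> b j * \<psi> z ^ j))" by (simp add: sum_distrib_left algebra_simps)
    qed simp
    also have "\<dots> = (\<Sum>j\<le>m. \<Sum>b\<in>F. h z * (x b * \<phi> b j * \<psi> z ^ j))" by (rule sum.swap)
    also have "\<dots> = h z * (\<Sum>j\<le>m. (\<Sum>b\<in>F. x b * \<phi> b j) * \<psi> z ^ j)" by (simp only: sum_distrib_left sum_distrib_right)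
    finally show ?thesis .
  qed
  have fin: "finite B"
  proof (rule ccontr)
    assume "infinite B"
    then obtain F where F: "finite F" "card F = m + 2" "F \<subseteq> B" by (meson infinite_arbitrarily_large)
    have "card {..m} < card F" using F(2) by simp
    from linear_dependence[OF finite_atMost F(1) this, of \<phi>]
    obtain x where x: "\<exists>b\<in>F. x b \<noteq> 0" "\<forall>j\<in>{..m}. (\<Sum>b\<in>F. x b * \<phi> b j) = 0" by (elim exE conjE) (rule that)
    have "(\<lambda>c z. \<Sum>b\<in>F. x b * b c z) = (\<lambda>c z. 0)"
    proof (rule unique)
      show "(\<lambda>c z. \<Sum>b\<in>F. x b * b c z) \<in> bergman_space A" by (rule bergman_sum) (use F Bs in auto)
      show "(\<Sum>b\<in>F. x b * b (cc n0) z) = 0" if "z \<in> ball a s" for z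
        unfolding comb[OF F(3) that] using x(2) by simp
    qed
    then have 0: "(\<Sum>b\<in>F. x b * ip b g) = 0" if "g \<in> B" for g
      using ip_sum[of F "\<lambda>b. b" g x] F Bs that ip_zero[of g] by auto
    have "x g = 0" if g: "g \<in> F" for g
    proof -
      have "(\<Sum>b\<in>F. x b * ip b g) = (\<Sum>b\<in>F. if b = g then x g else 0)" by (rule sum.cong) (use g F Bo in \<open>auto simp: subset_iff\<close>)
      then show ?thesis using 0[of g] g F by auto
    qed
    then show False using x(1) by blast
  qed
  \<comment> \<open>The functionals dual to the coefficients.\<close>
  define y where "y j b = cnj (\<phi> b j) / of_real (\<beta> j)" for j b
  define e where "e j c z = (\<Sum>b\<in>B. y j b * b c z)" for j c z
  have eV: "e j \<in> bergman_space A" for j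
    unfolding e_def[abs_def] by (rule bergman_sum[OF fin]) (use Bs in auto)
  have eloc: "e j (cc n0) z = h z * \<psi> z ^ j" if j: "j \<le> m" and z: "z \<in> ball a s" for j z
  proof -
    have co: "(\<Sum>b\<in>B. y j b * \<phi> b i) = (if i = j then 1 else 0)" if "i \<le> m" for i
    proof -
      have "(\<Sum>b\<in>B. y j b * \<phi> b i) = (\<Sum>b\<in>B. \<phi> b i * cnj (\<phi> b j)) / of_real (\<beta> j)"
        unfolding sum_divide_distrib by (rule sum.cong) (auto simp: y_def)
      also have "(\<Sum>b\<in>B. \<phi> b i * cnj (\<phi> b j)) = (if j = i then of_real (\<beta> j) else 0)" using orth[OF j that] fin by simp
      finally show ?thesis using \<beta>[OF j] by auto
    qed
    have "(\<Sum>i\<le>m. (\<Sum>b\<in>B. y j b * \<phi> b i) * \<psi> z ^ i) = (\<Sum>i\<le>m. if i = j then \<psi> z ^ j else 0)"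
      by (rule sum.cong) (auto simp: co)
    then show ?thesis unfolding e_def comb[OF order_refl z] using j by simp
  qed
  have span: "\<exists>\<alpha>. f = (\<lambda>c z. \<Sum>j\<le>m. \<alpha> j * e j c z)" if f: "f \<in> bergman_space A" for f
  proof -
    define g where "g c z = (\<Sum>b\<in>B. ip f b * b c z)" for c z
    have gV: "g \<in> bergman_space A" unfolding g_def[abs_def] by (rule bergman_sum[OF fin]) (use Bs in auto)
    have "(\<lambda>c z. - 1 * g c z + f c z) = (\<lambda>c z. 0)"
    proof (rule Bm[OF bergman_lin[OF gV f]])
      fix b assume b: "b \<in> B"
      then have bV: "b \<in> bergman_space A" using Bs by blast
      have "ip g b = (\<Sum>b'\<in>B. ip f b' * ip b' b)" unfolding g_def[abs_def] by (rule ip_sum[OF fin]) (use Bs bV in auto)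
      also have "\<dots> = (\<Sum>b'\<in>B. if b' = b then ip f b else 0)" by (rule sum.cong) (use b Bo in auto)
      also have "\<dots> = ip f b" using fin b by simp
      finally show "ip (\<lambda>c z. - 1 * g c z + f c z) b = 0" unfolding ip_lin[OF gV f bV] by simp
    qed
    note eq = this
    have fg: "f c z = g c z" for c z using fun_cong[OF fun_cong[OF eq, of c], of z] by simp
    define \<alpha> where "\<alpha> j = (\<Sum>b\<in>B. ip f b * \<phi> b j)" for j
    define k where "k c z = (\<Sum>j\<in>{..m}. \<alpha> j * e j c z)" for c z
    have kV: "k \<in> bergman_space A" unfolding k_def[abs_def] by (rule bergman_sum) (use eV in auto)
    have "(\<lambda>c z. - 1 * k c z + f c z) = (\<lambda>c z. 0)"
    proof (rule unique[OF bergman_lin[OF kV f]])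
      fix z assume z: "z \<in> ball a s"
      have "f (cc n0) z = g (cc n0) z" by (rule fg)
      also have "\<dots> = (\<Sum>b\<in>B. ip f b * b (cc n0) z)" by (simp only: g_def)
      also have "\<dots> = h z * (\<Sum>j\<le>m. (\<Sum>b\<in>B. ip f b * \<phi> b j) * \<psi> z ^ j)" by (rule comb[OF order_refl z])
      also have "\<dots> = h z * (\<Sum>j\<le>m. \<alpha> j * \<psi> z ^ j)" by (simp only: \<alpha>_def)
      also have "\<dots> = (\<Sum>j\<in>{..m}. \<alpha> j * (h z * \<psi> z ^ j))" by (simp only: sum_distrib_left mult.left_commute)
      also have "\<dots> = k (cc n0) z" unfolding k_def
      proof (rule sum.cong[OF refl])
        fix j assume "j \<in> {..m}"
        then show "\<alpha> j * (h z * \<psi> z ^ j) = \<alpha> j * e j (cc n0) z" using eloc[OF _ z, of j] by simp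
      qed
      finally have "f (cc n0) z = k (cc n0) z" .
      then show "- 1 * k (cc n0) z + f (cc n0) z = 0" by simp
    qed
    note eq = this
    have "f c z = k c z" for c z using fun_cong[OF fun_cong[OF eq, of c], of z] by simp
    then show ?thesis unfolding k_def by blast
  qed
  have rel: "e i c z * e (Suc j) c z = e (Suc i) c z * e j c z" if ij: "i < m" "j < m" for i j c z
  proof (cases "c \<in> A \<and> z \<in> chart_image c")
    case True
    define q where "q c z = e i c z * e (Suc j) c z - e (Suc i) c z * e j c z" for c z
    note ef = bergman_form[OF eV]
    have "q c z = 0"
    proof (rule identity_theorem[of q "cc n0" "ball a s"])
      show "q d holomorphic_on chart_image d" if "d \<in> A" for d
        unfolding q_def by (intro holomorphic_on_diff holomorphic_on_mult form_hol[OF ef that])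
      show "q c (coord c p) = 0" if "c \<in> A" "d \<in> A" "p \<in> chart_dom c \<inter> chart_dom d" "q d (coord d p) = 0" for c d p
      proof -
        let ?D = "deriv (transition c d) (coord c p)"
        have "q c (coord c p) = q d (coord d p) * ?D\<^sup>2"
          unfolding q_def form_transform[OF ef that(1-3)] by (simp add: power2_eq_square algebra_simps)
        then show ?thesis using that(4) by simp
      qed
      show "q (cc n0) z = 0" if "z \<in> ball a s" for z
        using ij eloc[OF _ that] by (simp add: q_def algebra_simps)
    qed (use True s ballsub cc(1) in auto)
    then show ?thesis by (simp add: q_def)
  qed (use form_outside[OF bergman_form[OF eV]] in auto)
  show thesis by (rule that[OF m _ span rel]) (use eV in auto)
qed

text \<open>Elimination turns a spanning family with \<open>m + 1\<close> members into linear dependence of any \<open>m + 2\<close>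
  forms.\<close>

lemma span_dependent:
  fixes m :: nat
  assumes span: "\<And>f. f \<in> V \<Longrightarrow> \<exists>\<alpha>. f = (\<lambda>c z. \<Sum>j\<le>m. \<alpha> j * e j c z)"
    and G: "\<And>i. i < m + 2 \<Longrightarrow> G i \<in> V"
  shows "\<exists>x. (\<exists>i<m + 2. x i \<noteq> (0::complex)) \<and> (\<forall>c z. (\<Sum>i<m + 2. x i * G i c z) = 0)"
proof -
  define \<alpha> where "\<alpha> i = (SOME \<alpha>. G i = (\<lambda>c z. \<Sum>j\<le>m. \<alpha> j * e j c z))" for i
  have \<alpha>: "G i = (\<lambda>c z. \<Sum>j\<le>m. \<alpha> i j * e j c z)" if "i < m + 2" for i
    unfolding \<alpha>_def by (rule someI_ex[OF span[OF G[OF that]]])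
  have "card {..m} < card {..<m + 2}" by simp
  from linear_dependence[OF finite_atMost finite_lessThan this, of \<alpha>]
  obtain x where x: "\<exists>i\<in>{..<m + 2}. x i \<noteq> 0" "\<forall>j\<in>{..m}. (\<Sum>i<m + 2. x i * \<alpha> i j) = 0" by (elim exE conjE) (rule that)
  have "(\<Sum>i<m + 2. x i * G i c z) = 0" for c z
  proof -
    have "(\<Sum>i<m + 2. x i * G i c z) = (\<Sum>i<m + 2. \<Sum>j\<le>m. x i * \<alpha> i j * e j c z)"
      by (rule sum.cong) (simp_all add: \<alpha> sum_distrib_left mult.assoc)
    also have "\<dots> = (\<Sum>j\<le>m. \<Sum>i<m + 2. x i * \<alpha> i j * e j c z)" by (rule sum.swap)
    also have "\<dots> = (\<Sum>j\<le>m. (\<Sum>i<m + 2. x i * \<alpha> i j) * e j c z)" by (simp only: sum_distrib_right)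
    finally show ?thesis using x(2) by simp
  qed
  then show ?thesis using x(1) by (meson lessThan_iff)
qed

end

section \<open>Injective quotients of forms as global coordinates\<close>

context surface
begin

definition nonzero_set :: "('a chart \<Rightarrow> complex \<Rightarrow> complex) \<Rightarrow> 'a set" where
  "nonzero_set g = {p \<in> topspace X. \<exists>c\<in>A. p \<in> chart_dom c \<and> g c (coord c p) \<noteq> 0}"

lemma form_vanish_chart:
  assumes "g \<in> holomorphic_forms A" "c \<in> A" "d \<in> A" "p \<in> chart_dom c" "p \<in> chart_dom d" "g c (coord c p) = 0"
  shows "g d (coord d p) = 0"
  using form_transform[OF assms(1,3,2), of p] assms by simp

lemma nonzero_set_iff:
  assumes "g \<in> holomorphic_forms A" "c \<in> A" "p \<in> chart_dom c"
  shows "p \<in> nonzero_set g \<longleftrightarrow> g c (coord c p) \<noteq> 0"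
  using form_vanish_chart[OF assms(1)] assms dom_topspace[OF assms(2)] unfolding nonzero_set_def by blast

text \<open>The chart is immaterial, because both coefficients change by the same factor.\<close>

definition form_ratio :: "('a chart \<Rightarrow> complex \<Rightarrow> complex) \<Rightarrow> ('a chart \<Rightarrow> complex \<Rightarrow> complex) \<Rightarrow> 'a \<Rightarrow> complex" where
  "form_ratio f g p = (let c = (SOME c. c \<in> A \<and> p \<in> chart_dom c) in f c (coord c p) / g c (coord c p))"

lemma form_ratio_chart:
  assumes f: "f \<in> holomorphic_forms A" and g: "g \<in> holomorphic_forms A" and c: "c \<in> A" "p \<in> chart_dom c"
  shows "form_ratio f g p = f c (coord c p) / g c (coord c p)"
proof -
  define d where "d = (SOME c. c \<in> A \<and> p \<in> chart_dom c)"
  have d: "d \<in> A" "p \<in> chart_dom d" using someI[of "\<lambda>c. c \<in> A \<and> p \<in> chart_dom c" c] c unfolding d_def by blast+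
  have p: "p \<in> chart_dom d \<inter> chart_dom c" using c d by blast
  have "f d (coord d p) / g d (coord d p) = f c (coord c p) / g c (coord c p)"
  proof (cases "g d (coord d p) = 0")
    case True
    then show ?thesis using form_vanish_chart[OF g d(1) c(1) d(2) c(2)] by simp
  next
    case False
    then show ?thesis
      using form_transform[OF f d(1) c(1) p] form_transform[OF g d(1) c(1) p] by auto
  qed
  then show ?thesis unfolding form_ratio_def Let_def d_def[symmetric] .
qed

end

locale global_coordinate = surface +
  fixes f g
  assumes ff: "f \<in> holomorphic_forms A" and gf: "g \<in> holomorphic_forms A"
    and inj: "inj_on (form_ratio f g) (nonzero_set g)"
begin

abbreviation "\<Psi> \<equiv> form_ratio f g"
abbreviation "\<Omega> \<equiv> \<Psi> ` nonzero_set g"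
text \<open>The map \<open>\<Psi>\<close> in the chart \<open>c\<close>, and the open set on which it is finite.\<close>

definition "T c z = f c z / g c z"
definition "D c = {z \<in> chart_image c. g c z \<noteq> 0}"

lemma T_coord: "c \<in> A \<Longrightarrow> p \<in> chart_dom c \<Longrightarrow> T c (coord c p) = \<Psi> p"
  by (simp add: T_def form_ratio_chart[OF ff gf])

lemma D_coord: "c \<in> A \<Longrightarrow> p \<in> chart_dom c \<Longrightarrow> coord c p \<in> D c \<longleftrightarrow> p \<in> nonzero_set g"
  by (simp add: D_def coord_image nonzero_set_iff[OF gf])

lemma D_obtain:
  assumes "c \<in> A" "z \<in> D c"
  obtains p where "p \<in> chart_dom c" "p \<in> nonzero_set g" "z = coord c p" "T c z = \<Psi> p"
proof -
  obtain p where p: "p \<in> chart_dom c" "z = coord c p" using assms by (auto simp: D_def chart_image_def)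
  then show thesis using that[of p] D_coord[OF assms(1) p(1)] T_coord[OF assms(1) p(1)] assms by simp
qed

lemma open_D: assumes c: "c \<in> A" shows "open (D c)"
proof -
  have "open (chart_image c \<inter> g c -` (- {0}))"
    by (rule continuous_open_preimage[OF holomorphic_on_imp_continuous_on[OF form_hol[OF gf c]] open_image[OF c]]) (auto intro: open_Compl)
  moreover have "chart_image c \<inter> g c -` (- {0}) = D c" by (auto simp: D_def)
  ultimately show ?thesis by simp
qed

lemma T_hol: assumes c: "c \<in> A" shows "T c holomorphic_on D c"
proof -
  have "f c holomorphic_on D c" "g c holomorphic_on D c"
    using form_hol[OF ff c] form_hol[OF gf c] by (auto simp: D_def elim: holomorphic_on_subset)
  then show ?thesis unfolding T_def[abs_def] by (intro holomorphic_on_divide) (auto simp: D_def)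
qed

lemma T_inj: assumes c: "c \<in> A" shows "inj_on (T c) (D c)"
proof (rule inj_onI)
  fix z z' assume z: "z \<in> D c" "z' \<in> D c" "T c z = T c z'"
  obtain p where p: "p \<in> nonzero_set g" "z = coord c p" "T c z = \<Psi> p" using D_obtain[OF c z(1)] by metis
  obtain p' where p': "p' \<in> nonzero_set g" "z' = coord c p'" "T c z' = \<Psi> p'" using D_obtain[OF c z(2)] by metis
  have "p = p'" using inj_onD[OF inj, of p p'] p p' z(3) by simp
  then show "z = z'" using p p' by simp
qed

lemma T_deriv: "c \<in> A \<Longrightarrow> z \<in> D c \<Longrightarrow> deriv (T c) z \<noteq> 0"
  by (rule holomorphic_injective_imp_regular[OF T_hol open_D T_inj])

lemma \<Omega>_charts: "\<Omega> = (\<Union>c\<in>A. T c ` D c)"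
proof
  show "\<Omega> \<subseteq> (\<Union>c\<in>A. T c ` D c)"
  proof
    fix w assume "w \<in> \<Omega>"
    then obtain p where p: "p \<in> nonzero_set g" "w = \<Psi> p" by blast
    then obtain c where c: "c \<in> A" "p \<in> chart_dom c" unfolding nonzero_set_def by blast
    then have "coord c p \<in> D c" "w = T c (coord c p)" using p by (simp_all add: D_coord T_coord)
    then show "w \<in> (\<Union>c\<in>A. T c ` D c)" using c by blast
  qed
  show "(\<Union>c\<in>A. T c ` D c) \<subseteq> \<Omega>"
  proof
    fix w assume "w \<in> (\<Union>c\<in>A. T c ` D c)"
    then obtain c z where c: "c \<in> A" "z \<in> D c" "w = T c z" by blast
    then show "w \<in> \<Omega>" using D_obtain[OF c(1,2)] by (metis imageI)
  qed
qed

lemma open_T: "c \<in> A \<Longrightarrow> open (T c ` D c)"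
  by (rule open_mapping_thm3[OF T_hol open_D T_inj])

lemma open_\<Omega>: "open \<Omega>"
  unfolding \<Omega>_charts using open_T by blast

lemma T_in_\<Omega>: "c \<in> A \<Longrightarrow> z \<in> D c \<Longrightarrow> T c z \<in> \<Omega>"
  unfolding \<Omega>_charts by blast

lemma connected_\<Omega>:
  assumes all: "nonzero_set g = topspace X"
  shows "connected \<Omega>"
proof -
  have "continuous_map X euclidean \<Psi>"
    unfolding continuous_map_def
  proof (intro conjI allI impI)
    fix U :: "complex set" assume "openin euclidean U"
    then have U: "open U" by simp
    have "{p \<in> topspace X. \<Psi> p \<in> U} = (\<Union>c\<in>A. {p \<in> chart_dom c. coord c p \<in> D c \<inter> T c -` U})"
    proof
      show "{p \<in> topspace X. \<Psi> p \<in> U} \<subseteq> (\<Union>c\<in>A. {p \<in> chart_dom c. coord c p \<in> D c \<inter> T c -` U})"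
      proof
        fix p assume p: "p \<in> {p \<in> topspace X. \<Psi> p \<in> U}"
        then obtain c where c: "c \<in> A" "p \<in> chart_dom c" using cover by blast
        then show "p \<in> (\<Union>c\<in>A. {p \<in> chart_dom c. coord c p \<in> D c \<inter> T c -` U})"
          using p all by (auto simp: D_coord T_coord intro!: bexI[of _ c])
      qed
      show "(\<Union>c\<in>A. {p \<in> chart_dom c. coord c p \<in> D c \<inter> T c -` U}) \<subseteq> {p \<in> topspace X. \<Psi> p \<in> U}"
        using dom_topspace by (auto simp: T_coord)
    qed
    moreover have "openin X {p \<in> chart_dom c. coord c p \<in> D c \<inter> T c -` U}" if "c \<in> A" for c
      by (rule openin_coord_preimage[OF that continuous_open_preimage[OF holomorphic_on_imp_continuous_on[OF T_hol] open_D U]]) (rule that)+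
    ultimately show "openin X {p \<in> topspace X. \<Psi> p \<in> U}" by auto
  qed auto
  then have "connectedin euclidean (\<Psi> ` topspace X)"
    using rs by (intro connectedin_continuous_map_image) (auto simp: connectedin_topspace riemann_surface_def)
  then show ?thesis by (simp add: all)
qed

lemma T_transition:
  assumes c: "c \<in> A" and d: "d \<in> A" and p: "p \<in> chart_dom c \<inter> chart_dom d" "p \<in> nonzero_set g"
  shows "deriv (T c) (coord c p) = deriv (T d) (coord d p) * deriv (transition c d) (coord c p)"
proof -
  define W where "W = overlap c d \<inter> D c"
  have z: "coord c p \<in> overlap c d" "coord c p \<in> W" using p c by (auto simp: overlap_def W_def D_coord)
  have oW: "open W" unfolding W_def using open_overlap[OF c d] open_D[OF c] by blast
  have dD: "coord d p \<in> D d" using p d by (simp add: D_coord)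
  have 1: "(transition c d has_field_derivative deriv (transition c d) (coord c p)) (at (coord c p))"
    by (rule holomorphic_derivI[OF transition_hol[OF c d] open_overlap[OF c d] z(1)])
  have 2: "(T d has_field_derivative deriv (T d) (coord d p)) (at (transition c d (coord c p)))"
    using holomorphic_derivI[OF T_hol[OF d] open_D[OF d] dD] transition_coord[OF c, of p d] p by simp
  have "((\<lambda>x. T d (transition c d x)) has_field_derivative deriv (T d) (coord d p) * deriv (transition c d) (coord c p)) (at (coord c p))"
    by (rule DERIV_chain2[OF 2 1])
  then have "(T c has_field_derivative deriv (T d) (coord d p) * deriv (transition c d) (coord c p)) (at (coord c p))"
  proof (rule has_field_derivative_transform_within_open[OF _ oW z(2)])
    fix x assume "x \<in> W"
    then obtain q where q: "q \<in> chart_dom c" "q \<in> chart_dom d" "x = coord c q" by (auto simp: W_def overlap_def)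
    then show "T d (transition c d x) = T c x" using c d by (simp add: transition_coord T_coord)
  qed
  then show ?thesis by (rule DERIV_imp_deriv)
qed

text \<open>On the image, \<open>F\<close> is the quotient of the form by the differential of \<open>\<Psi>\<close>.\<close>

lemma push_forward:
  assumes u: "u \<in> holomorphic_forms A"
  obtains F where "F holomorphic_on \<Omega>" "\<forall>c\<in>A. \<forall>z\<in>D c. u c z = F (T c z) * deriv (T c) z"
proof -
  define ch where "ch p = (SOME c. c \<in> A \<and> p \<in> chart_dom c)" for p
  define F where "F w = (let p = inv_into (nonzero_set g) \<Psi> w in u (ch p) (coord (ch p) p) / deriv (T (ch p)) (coord (ch p) p))" for w
  have F: "F (\<Psi> p) = u c (coord c p) / deriv (T c) (coord c p)" if p: "p \<in> nonzero_set g" and c: "c \<in> A" "p \<in> chart_dom c" for p c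
  proof -
    have d: "ch p \<in> A" "p \<in> chart_dom (ch p)" unfolding ch_def using someI[of "\<lambda>c. c \<in> A \<and> p \<in> chart_dom c" c] c by blast+
    have pp: "p \<in> chart_dom (ch p) \<inter> chart_dom c" using c d by blast
    have "deriv (T (ch p)) (coord (ch p) p) \<noteq> 0" by (rule T_deriv[OF d(1)]) (use p d D_coord in blast)
    then have "u (ch p) (coord (ch p) p) / deriv (T (ch p)) (coord (ch p) p) = u c (coord c p) / deriv (T c) (coord c p)"
      unfolding form_transform[OF u d(1) c(1) pp] T_transition[OF d(1) c(1) pp p] by auto
    then show ?thesis by (simp add: F_def Let_def inv_into_f_f[OF inj p])
  qed
  have FT: "F (T c z) = u c z / deriv (T c) z" if c: "c \<in> A" and z: "z \<in> D c" for c z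
  proof -
    obtain p where p: "p \<in> chart_dom c" "p \<in> nonzero_set g" "z = coord c p" "T c z = \<Psi> p" by (rule D_obtain[OF c z]) blast
    then show ?thesis using F[OF p(2) c p(1)] by simp
  qed
  show thesis
  proof (rule that)
    show "F holomorphic_on \<Omega>" unfolding \<Omega>_charts
    proof (rule holomorphic_on_UN_open)
      fix c assume c: "c \<in> A"
      obtain k where k: "k holomorphic_on T c ` D c" "\<And>z. z \<in> D c \<Longrightarrow> k (T c z) = z"
        using holomorphic_has_inverse[OF T_hol[OF c] open_D[OF c] T_inj[OF c]] by metis
      have "(\<lambda>z. u c z / deriv (T c) z) holomorphic_on D c"
      proof (rule holomorphic_on_divide)
        show "u c holomorphic_on D c" using form_hol[OF u c] by (auto simp: D_def elim: holomorphic_on_subset)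
        show "deriv (T c) holomorphic_on D c" by (rule holomorphic_deriv[OF T_hol[OF c] open_D[OF c]])
      qed (use T_deriv[OF c] in blast)
      then have "((\<lambda>z. u c z / deriv (T c) z) \<circ> k) holomorphic_on T c ` D c"
        using k by (intro holomorphic_on_compose_gen[of k _ _ "D c"]) auto
      then show "F holomorphic_on T c ` D c"
        by (rule holomorphic_transform) (auto simp: FT[OF c] k(2))
    qed (rule open_T)
    show "\<forall>c\<in>A. \<forall>z\<in>D c. u c z = F (T c z) * deriv (T c) z" using T_deriv by (simp add: FT)
  qed
qed

text \<open>The images of the disjoint pieces of the surface are disjoint and exhaust \<open>\<Omega>\<close>; on each of them the
  change of variables formula applies. The zeros of \<open>g\<close> are left out on the right.\<close>

lemma norm_transport:
  assumes F: "F holomorphic_on \<Omega>" and u: "\<forall>c\<in>A. \<forall>z\<in>D c. u c z = F (T c z) * deriv (T c) z"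
  shows "(\<integral>\<^sup>+w\<in>\<Omega>. ennreal ((norm (F w))\<^sup>2) \<partial>lborel) = (\<Sum>n. \<integral>\<^sup>+z\<in>piece A n \<inter> D (cc n). ennreal ((norm (u (cc n) z))\<^sup>2) \<partial>lborel)"
proof -
  let ?\<phi> = "\<lambda>w. ennreal ((norm (F w))\<^sup>2) * indicator \<Omega> w"
  define P where "P n = piece A n \<inter> D (cc n)" for n
  have m: "?\<phi> \<in> borel_measurable borel"
    by (rule measurable_L2_integrand(2)[OF holomorphic_on_imp_continuous_on[OF F]]) (use open_\<Omega> in simp)
  have Pb: "P n \<in> sets borel" "P n \<subseteq> D (cc n)" for n using piece_borel open_D[OF cc(1)] by (auto simp: P_def)
  define B where "B n = T (cc n) ` P n" for n
  have B: "B n = \<Psi> ` (disjoint_dom n \<inter> nonzero_set g)" for n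
  proof
    show "B n \<subseteq> \<Psi> ` (disjoint_dom n \<inter> nonzero_set g)"
    proof
      fix w assume "w \<in> B n"
      then obtain z where z: "z \<in> piece A n" "z \<in> D (cc n)" "w = T (cc n) z" by (auto simp: B_def P_def)
      then obtain p where p: "p \<in> disjoint_dom n" "z = coord (cc n) p" by (auto simp: piece_def)
      then have pc: "p \<in> chart_dom (cc n)" using disjoint_dom_sub by blast
      show "w \<in> \<Psi> ` (disjoint_dom n \<inter> nonzero_set g)" using z p T_coord[OF cc(1) pc] D_coord[OF cc(1) pc] by auto
    qed
    show "\<Psi> ` (disjoint_dom n \<inter> nonzero_set g) \<subseteq> B n"
    proof
      fix w assume "w \<in> \<Psi> ` (disjoint_dom n \<inter> nonzero_set g)"
      then obtain p where p: "p \<in> disjoint_dom n" "p \<in> nonzero_set g" "w = \<Psi> p" by blast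
      then have pc: "p \<in> chart_dom (cc n)" using disjoint_dom_sub by blast
      have "coord (cc n) p \<in> P n" using p D_coord[OF cc(1) pc] by (auto simp: P_def piece_def)
      then show "w \<in> B n" using p T_coord[OF cc(1) pc] unfolding B_def by (metis imageI)
    qed
  qed
  have "(\<Union>n. disjoint_dom n) = topspace X" unfolding UN_disjointed_eq by (rule cc(2))
  then have un: "(\<Union>n. B n) = \<Omega>" 
  proof -
    have "nonzero_set g \<subseteq> (\<Union>n. disjoint_dom n)" unfolding \<open>(\<Union>n. disjoint_dom n) = topspace X\<close> by (auto simp: nonzero_set_def)
    then show ?thesis unfolding B by blast
  qed
  have dis: "disjoint_family B"
    unfolding disjoint_family_on_def
  proof (intro ballI impI)
    fix i j :: nat assume "i \<noteq> j"
    then have "disjoint_dom i \<inter> disjoint_dom j = {}" using disjoint_family_disjointed[of "\<lambda>k. chart_dom (cc k)"] unfolding disjoint_family_on_def by blast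
    then show "B i \<inter> B j = {}" unfolding B using inj_on_image_Int[OF inj, of "disjoint_dom i \<inter> nonzero_set g" "disjoint_dom j \<inter> nonzero_set g"] by blast
  qed
  have Bb: "B n \<in> sets lborel" for n
    unfolding B_def using borel_holomorphic_image[OF T_hol[OF cc(1)] open_D[OF cc(1)] T_inj[OF cc(1)] Pb] by simp
  have "(\<integral>\<^sup>+w\<in>\<Omega>. ennreal ((norm (F w))\<^sup>2) \<partial>lborel) = (\<integral>\<^sup>+w\<in>(\<Union>n. B n). ?\<phi> w \<partial>lborel)"
    unfolding un by (intro nn_integral_cong) (auto simp: indicator_def)
  also have "\<dots> = (\<Sum>n. \<integral>\<^sup>+w\<in>B n. ?\<phi> w \<partial>lborel)"
    by (rule nn_integral_disjoint_family[OF _ Bb dis]) (use m in \<open>simp add: measurable_lborel1\<close>)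
  also have "\<dots> = (\<Sum>n. \<integral>\<^sup>+z\<in>P n. ennreal ((norm (u (cc n) z))\<^sup>2) \<partial>lborel)"
  proof (rule suminf_cong)
    fix n
    have "(\<integral>\<^sup>+w\<in>B n. ?\<phi> w \<partial>lborel) = (\<integral>\<^sup>+z\<in>P n. ?\<phi> (T (cc n) z) * ennreal ((norm (deriv (T (cc n)) z))\<^sup>2) \<partial>lborel)"
      unfolding B_def by (rule nn_integral_holomorphic_image[OF T_hol[OF cc(1)] open_D[OF cc(1)] T_inj[OF cc(1)] Pb m])
    also have "\<dots> = (\<integral>\<^sup>+z\<in>P n. ennreal ((norm (u (cc n) z))\<^sup>2) \<partial>lborel)"
    proof (rule nn_integral_cong)
      fix z
      have "?\<phi> (T (cc n) z) * ennreal ((norm (deriv (T (cc n)) z))\<^sup>2) = ennreal ((norm (u (cc n) z))\<^sup>2)" if "z \<in> P n"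
      proof -
        have z: "z \<in> D (cc n)" using that Pb(2) by blast
        have "?\<phi> (T (cc n) z) = ennreal ((norm (F (T (cc n) z)))\<^sup>2)" using T_in_\<Omega>[OF cc(1) z] by simp
        moreover have "u (cc n) z = F (T (cc n) z) * deriv (T (cc n)) z" using u cc(1) z by blast
        ultimately show ?thesis by (simp add: norm_mult power_mult_distrib ennreal_mult)
      qed
      then show "?\<phi> (T (cc n) z) * ennreal ((norm (deriv (T (cc n)) z))\<^sup>2) * indicator (P n) z = ennreal ((norm (u (cc n) z))\<^sup>2) * indicator (P n) z"
        by (auto simp: indicator_def)
    qed
    finally show "(\<integral>\<^sup>+w\<in>B n. ?\<phi> w \<partial>lborel) = (\<integral>\<^sup>+z\<in>P n. ennreal ((norm (u (cc n) z))\<^sup>2) \<partial>lborel)" .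
  qed
  finally show ?thesis unfolding P_def .
qed

lemma push_forward_L2:
  assumes u: "u \<in> bergman_space A"
  obtains F where "F \<in> L2hol \<Omega>" "\<forall>c\<in>A. \<forall>z\<in>D c. u c z = F (T c z) * deriv (T c) z"
proof -
  obtain F where F: "F holomorphic_on \<Omega>" "\<forall>c\<in>A. \<forall>z\<in>D c. u c z = F (T c z) * deriv (T c) z"
    by (rule push_forward[OF bergman_form[OF u]]) blast
  have "(\<integral>\<^sup>+w\<in>\<Omega>. ennreal ((norm (F w))\<^sup>2) \<partial>lborel) \<le> (\<Sum>n. piece_sq u n)"
    unfolding norm_transport[OF F] piece_sq_def
    by (intro suminf_le nn_integral_mono) (auto simp: indicator_def)
  also have "\<dots> < \<infinity>" using u by (simp add: bergman_space_iff)
  finally show thesis using that F by (simp add: L2hol_def)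
qed

text \<open>\<open>F dw\<close> pulled back along \<open>\<Psi>\<close>; the value 0 elsewhere is the convention for forms.\<close>

definition pull_back :: "(complex \<Rightarrow> complex) \<Rightarrow> 'a chart \<Rightarrow> complex \<Rightarrow> complex" where
  "pull_back F c z = (if c \<in> A \<and> z \<in> chart_image c then F (T c z) * deriv (T c) z else 0)"

lemma pull_back_bergman:
  assumes all: "nonzero_set g = topspace X" and F: "F \<in> L2hol \<Omega>"
  shows "pull_back F \<in> bergman_space A"
proof -
  have D: "D c = chart_image c" if c: "c \<in> A" for c
  proof -
    have "z \<in> D c" if "z \<in> chart_image c" for z
    proof -
      obtain p where p: "p \<in> chart_dom c" "z = coord c p" using \<open>z \<in> chart_image c\<close> by (auto simp: chart_image_def)
      then show ?thesis using D_coord[OF c p(1)] all dom_topspace[OF c] by blast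
    qed
    then show ?thesis by (auto simp: D_def)
  qed
  have hol: "F holomorphic_on \<Omega>" using F by (simp add: L2hol_def)
  have pf: "pull_back F \<in> holomorphic_forms A"
    unfolding holomorphic_forms_def
  proof (intro CollectI conjI ballI allI impI)
    fix c assume c: "c \<in> A"
    have "(\<lambda>z. F (T c z) * deriv (T c) z) holomorphic_on D c"
    proof (intro holomorphic_on_mult)
      show "(\<lambda>z. F (T c z)) holomorphic_on D c"
        using holomorphic_on_compose_gen[OF T_hol[OF c] hol] T_in_\<Omega>[OF c] by (auto simp: o_def)
      show "deriv (T c) holomorphic_on D c" by (rule holomorphic_deriv[OF T_hol[OF c] open_D[OF c]])
    qed
    then show "pull_back F c holomorphic_on chart_image c"
      unfolding D[OF c] by (rule holomorphic_transform) (simp add: pull_back_def c)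
  next
    fix c d z assume c: "c \<in> A" and d: "d \<in> A" and "z \<in> overlap c d"
    then obtain p where p: "p \<in> chart_dom c \<inter> chart_dom d" "z = coord c p" by (auto simp: overlap_def)
    have pn: "p \<in> nonzero_set g" using p dom_topspace[OF c] all by blast
    show "pull_back F c z = pull_back F d (transition c d z) * deriv (transition c d) z"
      using T_transition[OF c d p(1) pn] p c d by (simp add: pull_back_def transition_coord coord_image T_coord)
  next
    fix c z assume "c \<notin> A \<or> z \<notin> chart_image c"
    then show "pull_back F c z = 0" by (auto simp: pull_back_def)
  qed
  have u: "\<forall>c\<in>A. \<forall>z\<in>D c. pull_back F c z = F (T c z) * deriv (T c) z"
    by (auto simp: pull_back_def D_def)
  have "(\<Sum>n. piece_sq (pull_back F) n) = (\<integral>\<^sup>+w\<in>\<Omega>. ennreal ((norm (F w))\<^sup>2) \<partial>lborel)"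
  proof -
    have "piece A n \<inter> D (cc n) = piece A n" for n using D[OF cc(1)] piece_sub by blast
    then show ?thesis unfolding norm_transport[OF hol u] piece_sq_def by simp
  qed
  also have "\<dots> < \<infinity>" using F by (simp add: L2hol_def)
  finally show ?thesis using pf by (simp add: bergman_space_iff)
qed

text \<open>A coordinate defined on the whole surface identifies it with a plane domain with isomorphic
  Bergman space, which is trivial as soon as it is finite dimensional.\<close>

lemma no_global_coordinate:
  fixes m :: nat
  assumes all: "nonzero_set g = topspace X" and u: "u \<in> bergman_space A"
    and span: "\<And>f. f \<in> bergman_space A \<Longrightarrow> \<exists>\<alpha>. f = (\<lambda>c z. \<Sum>j\<le>m. \<alpha> j * e j c z)"
    and c: "c \<in> A" and z: "z \<in> D c"
  shows "u c z = 0"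
proof -
  have "L2hol_finite_dim \<Omega> (m + 2)"
    unfolding L2hol_finite_dim_def
  proof (intro allI impI)
    fix F :: "nat \<Rightarrow> complex \<Rightarrow> complex" assume F: "\<forall>i<m + 2. F i \<in> L2hol \<Omega>"
    have pb: "pull_back (F i) \<in> bergman_space A" if "i < m + 2" for i using pull_back_bergman[OF all] F that by blast
    have "\<exists>x. (\<exists>i<m + 2. x i \<noteq> (0::complex)) \<and> (\<forall>c z. (\<Sum>i<m + 2. x i * pull_back (F i) c z) = 0)"
      by (rule span_dependent) (erule span, erule pb)
    then obtain x where xx: "(\<exists>i<m + 2. x i \<noteq> 0) \<and> (\<forall>c z. (\<Sum>i<m + 2. x i * pull_back (F i) c z) = 0)" by (rule exE)
    note x = conjunct1[OF xx] conjunct2[OF xx]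
    have "(\<Sum>i<m + 2. x i * F i w) = 0" if "w \<in> \<Omega>" for w
    proof -
      obtain c z where c: "c \<in> A" "z \<in> D c" "w = T c z" using \<open>w \<in> \<Omega>\<close> unfolding \<Omega>_charts by blast
      then have zi: "z \<in> chart_image c" by (simp add: D_def)
      have "(\<Sum>i<m + 2. x i * F i w) * deriv (T c) z = (\<Sum>i<m + 2. x i * pull_back (F i) c z)"
        unfolding sum_distrib_right by (rule sum.cong) (simp_all add: pull_back_def c zi)
      also have "\<dots> = 0" using x(2) by blast
      finally show ?thesis using T_deriv[OF c(1,2)] by simp
    qed
    then show "\<exists>c. (\<exists>i<m + 2. c i \<noteq> 0) \<and> (\<forall>z\<in>\<Omega>. (\<Sum>i<m + 2. c i * F i z) = 0)" using x(1) by blast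
  qed
  note fd = this
  obtain F where F: "F \<in> L2hol \<Omega>" "\<forall>c\<in>A. \<forall>z\<in>D c. u c z = F (T c z) * deriv (T c) z"
    by (rule push_forward_L2[OF u]) blast
  have "F (T c z) = 0" by (rule planar_finite_dim_trivial[OF open_\<Omega> connected_\<Omega>[OF all] fd F(1) T_in_\<Omega>[OF c z]])
  then show ?thesis using F(2) c z by simp
qed

text \<open>The zeros of \<open>g\<close>, where the coordinate has no finite value, do not disturb the argument:
  integrability over the complement of the zeros suffices to obtain an entire function in \<open>L\<^sup>2\<close>.\<close>

lemma plane_image_zero:
  assumes \<Omega>: "\<Omega> = UNIV" and u: "u \<in> bergman_space A" and c: "c \<in> A" and z: "z \<in> D c"
  shows "u c z = 0"
proof -
  obtain F where F: "F \<in> L2hol \<Omega>" "\<forall>c\<in>A. \<forall>z\<in>D c. u c z = F (T c z) * deriv (T c) z"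
    by (rule push_forward_L2[OF u]) blast
  have "F (T c z) = 0" by (rule entire_L2_zero[of F]) (use F(1) in \<open>simp_all add: L2hol_def \<Omega>\<close>)
  then show ?thesis using F(2) c z by simp
qed

end

section \<open>The two exclusions\<close>

text \<open>The relations say that the vector \<open>(x 0, \<dots>, x m)\<close> lies on the cone over the rational normal curve: either
  it is a geometric progression, or only its last entry can be nonzero.\<close>

lemma geometric_relations:
  fixes x :: "nat \<Rightarrow> complex"
  assumes rel: "\<And>i j. i < m \<Longrightarrow> j < m \<Longrightarrow> x i * x (Suc j) = x (Suc i) * x j"
  shows "x 0 \<noteq> 0 \<Longrightarrow> j \<le> m \<Longrightarrow> x j = x 0 * (x 1 / x 0) ^ j"
    and "x 0 = 0 \<Longrightarrow> j < m \<Longrightarrow> x j = 0"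
proof -
  show "x j = x 0 * (x 1 / x 0) ^ j" if x0: "x 0 \<noteq> 0" and j: "j \<le> m"
    using j
  proof (induction j)
    case (Suc j)
    have "x 0 * x (Suc j) = x 1 * x j" using rel[of 0 j] Suc.prems by simp
    then have "x (Suc j) = x 1 / x 0 * x j" using x0 by (simp add: field_simps)
    also have "x j = x 0 * (x 1 / x 0) ^ j" using Suc by simp
    finally show ?case by (simp add: mult_ac)
  qed simp
  show "x j = 0" if x0: "x 0 = 0" and j: "j < m"
    using j
  proof (induction j)
    case (Suc j)
    then have "x j * x (Suc (Suc j)) = x (Suc j) * x (Suc j)" using rel[of j "Suc j"] by simp
    then show ?case using Suc by simp
  qed (use x0 in simp)
qed

text \<open>The point \<open>[e 0 : \<dots> : e m]\<close> runs on the rational normal curve, hence the surface is mapped to the Riemann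
  sphere by \<open>\<psi> = e 1 / e 0\<close>, with value \<open>\<infinity>\<close> at the zeros of \<open>e 0\<close>. Separation of points makes the map
  injective. If it omits \<open>\<infinity>\<close>, then \<open>\<psi>\<close> is a global coordinate; if it omits \<open>\<alpha>\<close>, then
  \<open>1 / (\<alpha> - \<psi>)\<close> is one; and if it is onto, then off one point the surface is the plane.\<close>

lemma nondegenerate_surface_impossible:
  assumes rs: "riemann_surface X A" and nd: "bergman_nondegenerate A" and \<kappa>: "\<kappa> > 0" and curv: "bergman_constant_curvature A \<kappa>"
  shows False
proof -
  interpret surface X A by unfold_locales (rule rs)
  have chart_at: "\<exists>c. c \<in> A \<and> p \<in> chart_dom c" if "p \<in> topspace X" for p
  proof -
    have "p \<in> (\<Union>c\<in>A. chart_dom c)" unfolding cover by (rule that)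
    then show ?thesis by (rule UN_E) blast
  qed
  have bpf: "base_point_free A" and sep: "separates_points A" using nd by (auto simp: bergman_nondegenerate_def)
  obtain m :: nat and e where m: "m \<ge> 1" and eV: "\<And>j. j \<le> m \<Longrightarrow> e j \<in> bergman_space A"
    and span: "\<And>f. f \<in> bergman_space A \<Longrightarrow> \<exists>\<alpha>. f = (\<lambda>c z. \<Sum>j\<le>m. \<alpha> j * e j c z)"
    and rel: "\<And>i j c z. i < m \<Longrightarrow> j < m \<Longrightarrow> e i c z * e (Suc j) c z = e (Suc i) c z * e j c z"
    by (rule constant_curvature_span[OF bpf \<kappa> curv]) blast
  have e0: "e 0 \<in> holomorphic_forms A" and e1: "e 1 \<in> holomorphic_forms A" using eV m bergman_form by auto
  define \<psi> where "\<psi> = form_ratio (e 1) (e 0)"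
  have val: "e j c (coord c p) = e 0 c (coord c p) * \<psi> p ^ j"
    if "c \<in> A" "p \<in> chart_dom c" "p \<in> nonzero_set (e 0)" "j \<le> m" for c p j
  proof -
    have "e 0 c (coord c p) \<noteq> 0" using nonzero_set_iff[OF e0 that(1,2)] that(3) by blast
    then show ?thesis unfolding \<psi>_def form_ratio_chart[OF e1 e0 that(1,2)]
      using geometric_relations(1)[of m "\<lambda>i. e i c (coord c p)" j] rel that(4) by blast
  qed
  have val0: "e j c (coord c p) = 0" if "c \<in> A" "p \<in> chart_dom c" "p \<notin> nonzero_set (e 0)" "j < m" for c p j
  proof -
    have "e 0 c (coord c p) = 0" using nonzero_set_iff[OF e0 that(1,2)] that(3) by blast
    then show ?thesis using geometric_relations(2)[of m "\<lambda>i. e i c (coord c p)" j] rel that(4) by blast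
  qed
  have valm: "e m c (coord c p) \<noteq> 0" if c: "c \<in> A" "p \<in> chart_dom c" and p: "p \<notin> nonzero_set (e 0)" for c p
  proof
    assume 0: "e m c (coord c p) = 0"
    obtain f where f: "f \<in> bergman_space A" "f c (coord c p) \<noteq> 0" using bpf c unfolding base_point_free_def by blast
    obtain \<alpha> where "f = (\<lambda>c z. \<Sum>j\<le>m. \<alpha> j * e j c z)" using span[OF f(1)] by blast
    moreover have "e j c (coord c p) = 0" if "j \<le> m" for j using val0[OF c p, of j] 0 that by (cases "j = m") auto
    ultimately show False using f(2) by simp
  qed
  \<comment> \<open>Two points with proportional values of the forms cannot be separated.\<close>
  have noprop: False
    if c: "c \<in> A" "p \<in> chart_dom c" and d: "d \<in> A" "q \<in> chart_dom d" and pq: "p \<noteq> q"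
      and t: "t \<noteq> 0" "\<And>j. j \<le> m \<Longrightarrow> e j d (coord d q) = t * e j c (coord c p)" for c d p q t
  proof -
    obtain f where f: "f \<in> bergman_space A" "f c (coord c p) = 0" "f d (coord d q) \<noteq> 0"
      using sep c d pq unfolding separates_points_def by blast
    obtain \<alpha> where \<alpha>: "f = (\<lambda>c z. \<Sum>j\<le>m. \<alpha> j * e j c z)" using span[OF f(1)] by blast
    have "f d (coord d q) = t * f c (coord c p)" unfolding \<alpha> sum_distrib_left by (rule sum.cong) (simp_all add: t(2))
    then show False using f by simp
  qed
  have inj: "inj_on \<psi> (nonzero_set (e 0))"
  proof (rule inj_onI, rule ccontr)
    fix p q assume p: "p \<in> nonzero_set (e 0)" and q: "q \<in> nonzero_set (e 0)" and eq: "\<psi> p = \<psi> q" and ne: "p \<noteq> q"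
    obtain c d where c: "c \<in> A" "p \<in> chart_dom c" and d: "d \<in> A" "q \<in> chart_dom d" using p q unfolding nonzero_set_def by blast
    have nz: "e 0 c (coord c p) \<noteq> 0" "e 0 d (coord d q) \<noteq> 0" using nonzero_set_iff[OF e0] c d p q by blast+
    show False
    proof (rule noprop[OF c d ne])
      show "e 0 d (coord d q) / e 0 c (coord c p) \<noteq> 0" using nz by simp
      show "e j d (coord d q) = e 0 d (coord d q) / e 0 c (coord c p) * e j c (coord c p)" if "j \<le> m" for j
        unfolding val[OF c p that] val[OF d q that] eq using nz by simp
    qed
  qed
  show False
  proof (cases "nonzero_set (e 0) = topspace X")
    case True
    interpret global_coordinate X A "e 1" "e 0" by unfold_locales (use e0 e1 inj in \<open>auto simp: \<psi>_def\<close>)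
    obtain p where "p \<in> nonzero_set (e 0)" using True nonempty by (metis all_not_in_conv)
    then obtain c where c: "c \<in> A" "p \<in> chart_dom c" and nz: "e 0 c (coord c p) \<noteq> 0" unfolding nonzero_set_def by blast
    have "coord c p \<in> D c" using \<open>p \<in> nonzero_set (e 0)\<close> c D_coord by blast
    then have "e 0 c (coord c p) = 0" by (intro no_global_coordinate[OF True eV span c(1)]) auto
    then show False using nz by simp
  next
    case False
    then obtain p0 where p0: "p0 \<in> topspace X" "p0 \<notin> nonzero_set (e 0)" using e0 by (auto simp: nonzero_set_def)
    have uni: "q = p0" if qX: "q \<in> topspace X" and q: "q \<notin> nonzero_set (e 0)" for q
    proof (rule ccontr)
      assume ne: "q \<noteq> p0"
      obtain c d where c: "c \<in> A" "q \<in> chart_dom c" and d: "d \<in> A" "p0 \<in> chart_dom d" using chart_at[OF qX] chart_at[OF p0(1)] by blast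
      note nz = valm[OF c q] valm[OF d p0(2)]
      show False
      proof (rule noprop[OF c d ne])
        show "e m d (coord d p0) / e m c (coord c q) \<noteq> 0" using nz by simp
        show "e j d (coord d p0) = e m d (coord d p0) / e m c (coord c q) * e j c (coord c q)" if "j \<le> m" for j
          
        proof (cases "j = m")
          case True
          then show ?thesis using nz by simp
        next
          case False
          then have "j < m" using \<open>j \<le> m\<close> by simp
          then show ?thesis by (simp only: val0[OF c q] val0[OF d p0(2)] mult_zero_right)
        qed
      qed
    qed
    show False
    proof (cases "\<psi> ` nonzero_set (e 0) = UNIV")
      case True
      interpret global_coordinate X A "e 1" "e 0" by unfold_locales (use e0 e1 inj in \<open>auto simp: \<psi>_def\<close>)
      obtain p where p: "p \<in> nonzero_set (e 0)" using True by auto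
      then obtain c where c: "c \<in> A" "p \<in> chart_dom c" and nz: "e 0 c (coord c p) \<noteq> 0" unfolding nonzero_set_def by blast
      have "coord c p \<in> D c" using p c D_coord by blast
      then have "e 0 c (coord c p) = 0" using True by (intro plane_image_zero[OF _ eV c(1)]) (auto simp: \<psi>_def)
      then show False using nz by simp
    next
      case False
      then obtain \<alpha> where "\<alpha> \<notin> \<psi> ` nonzero_set (e 0)" by auto
      then have \<alpha>: "\<psi> p \<noteq> \<alpha>" if "p \<in> nonzero_set (e 0)" for p using that by blast
      \<comment> \<open>The combination that equals \<open>e 0 * (\<alpha> - \<psi>)^n\<close> off \<open>p0\<close>. The case \<open>n = m\<close> has no zeros, and its quotient with the
        case \<open>n = m - 1\<close> is \<open>1 / (\<alpha> - \<psi>)\<close>, extended by 0 to \<open>p0\<close>.\<close>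
      define L where "L n c z = (\<Sum>i\<in>{..n}. (of_nat (n choose i) * (- 1) ^ i * \<alpha> ^ (n - i)) * e i c z)" for n c z
      have LV: "L n \<in> bergman_space A" if "n \<le> m" for n
        unfolding L_def[abs_def] by (rule bergman_sum) (use that eV in auto)
      have Lval: "L n c (coord c p) = e 0 c (coord c p) * (\<alpha> - \<psi> p) ^ n"
        if "c \<in> A" "p \<in> chart_dom c" "p \<in> nonzero_set (e 0)" "n \<le> m" for n c p
      proof -
        have "(\<alpha> - \<psi> p) ^ n = (- \<psi> p + \<alpha>) ^ n" by simp
        also have "\<dots> = (\<Sum>k\<le>n. of_nat (n choose k) * (- \<psi> p) ^ k * \<alpha> ^ (n - k))" by (rule binomial_ring)
        finally have b: "(\<alpha> - \<psi> p) ^ n = (\<Sum>k\<le>n. of_nat (n choose k) * (- \<psi> p) ^ k * \<alpha> ^ (n - k))" .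
        show ?thesis unfolding L_def b sum_distrib_left
        proof (rule sum.cong[OF refl])
          fix i assume "i \<in> {..n}"
          then have i: "i \<le> m" using that(4) by simp
          have "(- \<psi> p) ^ i = (- 1) ^ i * \<psi> p ^ i" by (rule power_minus)
          then show "of_nat (n choose i) * (- 1) ^ i * \<alpha> ^ (n - i) * e i c (coord c p) = e 0 c (coord c p) * (of_nat (n choose i) * (- \<psi> p) ^ i * \<alpha> ^ (n - i))"
            by (simp only: val[OF that(1-3) i] mult_ac)
        qed
      qed
      have Lm: "L m c (coord c p) \<noteq> 0" and Lr: "L (m - 1) c (coord c p) / L m c (coord c p) = (if p \<in> nonzero_set (e 0) then 1 / (\<alpha> - \<psi> p) else 0)"
        if c: "c \<in> A" "p \<in> chart_dom c" for c p
      proof -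
        have "L m c (coord c p) \<noteq> 0 \<and> L (m - 1) c (coord c p) / L m c (coord c p) = (if p \<in> nonzero_set (e 0) then 1 / (\<alpha> - \<psi> p) else 0)"
        proof (cases "p \<in> nonzero_set (e 0)")
          case True
          have nz: "e 0 c (coord c p) \<noteq> 0" using nonzero_set_iff[OF e0 c] True by blast
          have nz': "\<alpha> - \<psi> p \<noteq> 0" using \<alpha>[OF True] by auto
          have pw: "(\<alpha> - \<psi> p) ^ m = (\<alpha> - \<psi> p) * (\<alpha> - \<psi> p) ^ (m - 1)" using m by (metis power_eq_if not_one_le_zero)
          show ?thesis using nz nz' True by (simp add: Lval[OF c True] pw)
        next
          case False
          have 1: "L (m - 1) c (coord c p) = 0" unfolding L_def using val0[OF c False] m by (intro sum.neutral) auto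
          have "L m c (coord c p) = (\<Sum>i\<in>{m}. (of_nat (m choose i) * (- 1) ^ i * \<alpha> ^ (m - i)) * e i c (coord c p))"
            unfolding L_def by (rule sum.mono_neutral_right) (use val0[OF c False] in auto)
          then show ?thesis using 1 False valm[OF c False] by simp
        qed
        then show "L m c (coord c p) \<noteq> 0" "L (m - 1) c (coord c p) / L m c (coord c p) = (if p \<in> nonzero_set (e 0) then 1 / (\<alpha> - \<psi> p) else 0)" by blast+
      qed
      have Lf: "L m \<in> holomorphic_forms A" "L (m - 1) \<in> holomorphic_forms A" using LV bergman_form by auto
      have all: "nonzero_set (L m) = topspace X" using Lm cover unfolding nonzero_set_def by blast
      have ratio: "form_ratio (L (m - 1)) (L m) p = (if p \<in> nonzero_set (e 0) then 1 / (\<alpha> - \<psi> p) else 0)" if pX: "p \<in> topspace X" for p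
      proof -
        obtain c where c: "c \<in> A" "p \<in> chart_dom c" using chart_at[OF pX] by blast
        show ?thesis unfolding form_ratio_chart[OF Lf(2,1) c] by (rule Lr[OF c])
      qed
      have Linj: "inj_on (form_ratio (L (m - 1)) (L m)) (nonzero_set (L m))"
      proof (rule inj_onI)
        fix p q assume "p \<in> nonzero_set (L m)" "q \<in> nonzero_set (L m)"
        then have pX: "p \<in> topspace X" "q \<in> topspace X" using all by auto
        assume eq: "form_ratio (L (m - 1)) (L m) p = form_ratio (L (m - 1)) (L m) q"
        have nz: "1 / (\<alpha> - \<psi> r) \<noteq> 0" if "r \<in> nonzero_set (e 0)" for r using \<alpha>[OF that] by auto
        consider "p \<in> nonzero_set (e 0)" "q \<in> nonzero_set (e 0)" | "p \<notin> nonzero_set (e 0)" "q \<notin> nonzero_set (e 0)"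
          using eq nz[of p] nz[of q] unfolding ratio[OF pX(1)] ratio[OF pX(2)] by (metis)
        then show "p = q"
        proof cases
          case 1
          then have "1 / (\<alpha> - \<psi> p) = 1 / (\<alpha> - \<psi> q)" using eq unfolding ratio[OF pX(1)] ratio[OF pX(2)] by simp
          then have "\<psi> p = \<psi> q" by simp
          then show ?thesis using inj_onD[OF inj] 1 by blast
        next
          case 2
          then show ?thesis using uni pX by metis
        qed
      qed
      interpret global_coordinate X A "L (m - 1)" "L m" by unfold_locales (use Lf Linj in auto)
      obtain c where c: "c \<in> A" "p0 \<in> chart_dom c" using chart_at[OF p0(1)] by blast
      have "coord c p0 \<in> D c" using D_coord[OF c] all p0(1) by blast
      then have "L m c (coord c p0) = 0" by (intro no_global_coordinate[OF all LV span c(1)]) auto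
      then show False using Lm[OF c] by simp
    qed
  qed
qed

lemma plane_domain_impossible:
  assumes \<Omega>: "open \<Omega>" "connected \<Omega>" "\<Omega> \<noteq> {}" and bpf: "base_point_free (plane_atlas \<Omega>)"
    and \<kappa>: "\<kappa> > 0" and curv: "bergman_constant_curvature (plane_atlas \<Omega>) \<kappa>"
  shows False
proof -
  let ?A = "plane_atlas \<Omega>" and ?c = "(\<Omega>, id) :: complex chart"
  interpret surface "top_of_set \<Omega>" ?A by unfold_locales (rule riemann_surface_plane[OF \<Omega>])
  have simps: "chart_dom ?c = \<Omega>" "chart_image ?c = \<Omega>" "coord ?c = id" "overlap ?c ?c = \<Omega>"
    by (auto simp: chart_dom_def chart_image_def coord_def overlap_def)
  have tr: "transition ?c ?c z = z" if "z \<in> \<Omega>" for z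
    using that by (simp add: transition_def simps inv_into_f_f)
  have dtr: "deriv (transition ?c ?c) z = 1" if "z \<in> \<Omega>" for z
  proof (rule DERIV_imp_deriv)
    show "(transition ?c ?c has_field_derivative 1) (at z)"
      by (rule has_field_derivative_transform_within_open[OF DERIV_ident \<Omega>(1) that]) (simp add: tr)
  qed
  have piece_sq: "(\<Sum>n. piece_sq f n) = (\<integral>\<^sup>+z\<in>\<Omega>. ennreal ((norm (f ?c z))\<^sup>2) \<partial>lborel)" for f
  proof -
    have "(\<Sum>n. piece_sq f n) = (\<Sum>n\<in>{0}. piece_sq f n)"
      by (rule suminf_finite) (auto simp: piece_sq_def piece_plane)
    then show ?thesis by (simp add: piece_sq_def piece_plane chart_cover_plane)
  qed
  obtain m :: nat and e where span: "\<And>f. f \<in> bergman_space ?A \<Longrightarrow> \<exists>\<alpha>. f = (\<lambda>c z. \<Sum>j\<le>m. \<alpha> j * e j c z)"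
    by (rule constant_curvature_span[OF bpf \<kappa> curv]) blast
  define up where "up F c z = (if c = ?c \<and> z \<in> \<Omega> then F z else (0::complex))" for F and c :: "complex chart" and z
  have up: "up F \<in> bergman_space ?A" if F: "F \<in> L2hol \<Omega>" for F
  proof -
    have "up F \<in> holomorphic_forms ?A"
      unfolding holomorphic_forms_def
    proof (intro CollectI conjI ballI allI impI)
      fix c assume "c \<in> ?A"
      then have c: "c = ?c" by (simp add: plane_atlas_def)
      have "F holomorphic_on \<Omega>" using F by (simp add: L2hol_def)
      then show "up F c holomorphic_on chart_image c" unfolding c simps by (rule holomorphic_transform) (simp add: up_def)
    next
      fix c d z assume "c \<in> ?A" "d \<in> ?A" and z: "z \<in> overlap c d"
      then have c: "c = ?c" "d = ?c" by (simp_all add: plane_atlas_def)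
      then show "up F c z = up F d (transition c d z) * deriv (transition c d) z" using z by (simp add: simps tr dtr)
    next
      fix c z assume "c \<notin> ?A \<or> z \<notin> chart_image c"
      then show "up F c z = 0" by (auto simp: up_def simps plane_atlas_def)
    qed
    moreover have "(\<integral>\<^sup>+z\<in>\<Omega>. ennreal ((norm (up F ?c z))\<^sup>2) \<partial>lborel) = (\<integral>\<^sup>+z\<in>\<Omega>. ennreal ((norm (F z))\<^sup>2) \<partial>lborel)"
      by (intro nn_integral_cong) (auto simp: up_def indicator_def)
    ultimately show ?thesis using F by (simp add: bergman_space_iff piece_sq L2hol_def)
  qed
  have fd: "L2hol_finite_dim \<Omega> (m + 2)"
    unfolding L2hol_finite_dim_def
  proof (intro allI impI)
    fix F :: "nat \<Rightarrow> complex \<Rightarrow> complex" assume F: "\<forall>i<m + 2. F i \<in> L2hol \<Omega>"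
    have pb: "up (F i) \<in> bergman_space ?A" if "i < m + 2" for i using up F that by blast
    have "\<exists>x. (\<exists>i<m + 2. x i \<noteq> (0::complex)) \<and> (\<forall>c z. (\<Sum>i<m + 2. x i * up (F i) c z) = 0)"
      by (rule span_dependent) (erule span, erule pb)
    then obtain x where xx: "(\<exists>i<m + 2. x i \<noteq> 0) \<and> (\<forall>c z. (\<Sum>i<m + 2. x i * up (F i) c z) = 0)" by (rule exE)
    note x = conjunct1[OF xx] conjunct2[OF xx]
    have "(\<Sum>i<m + 2. x i * F i z) = 0" if "z \<in> \<Omega>" for z
    proof -
      have "(\<Sum>i<m + 2. x i * F i z) = (\<Sum>i<m + 2. x i * up (F i) ?c z)" by (rule sum.cong) (use that in \<open>simp_all add: up_def\<close>)
      then show ?thesis using x(2) by simp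
    qed
    then show "\<exists>c. (\<exists>i<m + 2. c i \<noteq> 0) \<and> (\<forall>z\<in>\<Omega>. (\<Sum>i<m + 2. c i * F i z) = 0)" using x(1) by blast
  qed
  obtain a where a: "a \<in> \<Omega>" using \<Omega>(3) by blast
  have "?c \<in> ?A" by (simp add: plane_atlas_def)
  then obtain f where f: "f \<in> bergman_space ?A" "f ?c (coord ?c a) \<noteq> 0"
    using bpf a unfolding base_point_free_def by (metis simps(1))
  have "f ?c \<in> L2hol \<Omega>"
    using f(1) form_hol[OF bergman_form[OF f(1)] \<open>?c \<in> ?A\<close>] by (simp add: bergman_space_iff piece_sq L2hol_def simps)
  then have "f ?c a = 0" by (rule planar_finite_dim_trivial[OF \<Omega>(1,2) fd _ a])
  then show False using f(2) by (simp add: simps)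
qed

theorem mainTheorem5:
  shows "(\<nexists>\<Omega> :: complex set.
            open \<Omega> \<and> connected \<Omega> \<and> \<Omega> \<noteq> {} \<and>
            admits_bergman_metric (plane_atlas \<Omega>) \<and>
            (\<exists>\<kappa>>0. bergman_constant_curvature (plane_atlas \<Omega>) \<kappa>)) \<and>
         (\<nexists>(X :: 'a topology) A.
            riemann_surface X A \<and> bergman_nondegenerate A \<and>
            (\<exists>\<kappa>>0. bergman_constant_curvature A \<kappa>))"
  using plane_domain_impossible nondegenerate_surface_impossible
  unfolding admits_bergman_metric_def by metis

end
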